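(* Let $M$ be a connected smooth $7$-dimensional Riemannian manifold. The assignment sending a $G_2$-structure, viewed as a definite $3$-form $\varphi$ on $M$, to the octonion algebra $C_\varphi$ over $C^\infty(M)$, and sending a morphism $f:\varphi\to\varphi'$ to $\mathrm{id}_{C^\infty(M)}\oplus f$, is an isomorphism of categories $$\mathbf{G2str}(M)\overset{\sim}{\longrightarrow}\mathbf{octbun}_{C^\infty(M)}.$$
   Context: Notation: $\Gamma$ denotes global smooth sections, $\Lambda^0=M\times\mathbb R$ is the trivial line bundle, so $\Gamma(\Lambda^0\oplus TM)=C^\infty(M)\oplus\Gamma(TM)$. Definite 3-forms. On $\mathbb R^7$ with standard basis $e_1,\dots,e_7$, dual basis $e^1,\dots,e^7$ and $e^{ijk}=e^i\wedge e^j\wedge e^k$, put $\varphi_0=e^{123}+e^{145}+e^{167}+e^{246}-e^{257}-e^{347}-e^{356}$; $G_2\subset \mathrm{GL}_7(\mathbb R)$ is the stabilizer of $\varphi_0$ (it is contained in $\mathrm{SO}_7(\mathbb R)$). A definite (or positive) $3$-form on $M$ is a smooth $3$-form $\varphi$ such that for each $p\in M$ there is a linear isomorphism $u:\mathbb R^7\to T_pM$ with $u^*\varphi_p=\varphi_0$. Definite $3$-forms correspond bijectively to $G_2$-structures (reductions of the frame bundle $F(TM)$ to $G_2$) via $\varphi\mapsto F_\varphi$, $(F_\varphi)_p=\{u\in\mathrm{Isom}(\mathbb R^7,T_pM): u^*\varphi_p=\varphi_0\}$. The associated metric $g_\varphi$ is the Riemannian metric for which every such $u$ is an isometry from the standard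 Euclidean $\mathbb R^7$. Category $\mathbf{G2str}(M)$ (described via definite 3-forms): objects are all definite $3$-forms on $M$ (equivalently all $G_2$-structures; the associated metric is not fixed); a morphism $\varphi\to\varphi'$ is a $C^\infty(M)$-linear automorphism $f$ of $\Gamma(TM)$ with $\varphi'=f_*\varphi:=\varphi\circ(f^{-1}\otimes f^{-1}\otimes f^{-1})$. Octonion algebras. An octonion algebra over a commutative ring $R\ni\frac12$ is $(C,m,e,b)$ with $C$ a finitely generated projective $R$-module of rank $8$, $m$ an $R$-bilinear (not necessarily commutative or associative) multiplication with two-sided identity $e$, and $b$ a symmetric bilinear form with $C\to C^\vee$, $x\mapsto b(x,-)$, an isomorphism, such that $q(x)=\frac12 b(x,x)$ satisfies $q(xy)=q(x)q(y)$. A morphism $(C,m,e,b)\to(C',m',e',b')$ is an $R$-module isomorphism $f$ with $m'(x,y)=f(m(f^{-1}x,f^{-1}y))$, $e'=f(e)$, $b'(x,y)=b(f^{-1}x,f^{-1}y)$. Octonion bundles. For a Riemannian metric $g$ on $M$ let $b_g(a+\alpha,d+\delta)=2ad+2g(\alpha,\delta)$ for $a,d\in C^\infty(M)$, $\alpha,\delta\in\Gamma(TM)$. $\mathbf{octbun}_{C^\infty(M)}$ is the full subcategory of the category of octonion algebras over $C^\infty(M)$ on the objects $(C^\infty(M)\oplus\Gamma(TM),m,e,b_g)$ with $e=(1,0)$, $g$ any Riemannian metric on $M$, and $m$ such that at each $p\in M$ the induced real octonion algebra on $\mathbb R\oplus T_pM$ is non-split (has no zero divisors). The algebra $C_\varphi$: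 for a definite $3$-form $\varphi$ with metric $g=g_\varphi$, $C_\varphi=(C^\infty(M)\oplus\Gamma(TM),m_\varphi,(1,0),b_g)$, where $m_\varphi(a+\alpha,b+\beta)=ab-g(\alpha,\beta)+a\beta+b\alpha+\alpha\times_\varphi\beta$ and $\alpha\times_\varphi\beta\in\Gamma(TM)$ is determined by $g(\alpha\times_\varphi\beta,\gamma)=\varphi(\alpha,\beta,\gamma)$ for all $\gamma\in\Gamma(TM)$. *)

theory Defs
  imports "HOL-Analysis.Analysis" "HOL-Algebra.Module" "HOL-Algebra.Ideal"
begin

section \<open>Categories\<close>

text \<open>Hom-sets may overlap, so composition and the arrow part of a functor take the objects as
  arguments: \<open>Cmp C a b c g f\<close> is the composite of \<open>f : a \<rightarrow> b\<close> and \<open>g : b \<rightarrow> c\<close>.\<close>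

record ('o, 'm) cat =
  Obj :: "'o set"
  Hom :: "'o \<Rightarrow> 'o \<Rightarrow> 'm set"
  Ide :: "'o \<Rightarrow> 'm"
  Cmp :: "'o \<Rightarrow> 'o \<Rightarrow> 'o \<Rightarrow> 'm \<Rightarrow> 'm \<Rightarrow> 'm"

definition is_category :: "('o, 'm) cat \<Rightarrow> bool" where
  "is_category C \<longleftrightarrow>
     (\<forall>a\<in>Obj C. Ide C a \<in> Hom C a a) \<and>
     (\<forall>a\<in>Obj C. \<forall>b\<in>Obj C. \<forall>c\<in>Obj C. \<forall>f\<in>Hom C a b. \<forall>g\<in>Hom C b c.
        Cmp C a b c g f \<in> Hom C a c) \<and>
     (\<forall>a\<in>Obj C. \<forall>b\<in>Obj C. \<forall>f\<in>Hom C a b.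
        Cmp C a a b f (Ide C a) = f \<and> Cmp C a b b (Ide C b) f = f) \<and>
     (\<forall>a\<in>Obj C. \<forall>b\<in>Obj C. \<forall>c\<in>Obj C. \<forall>d\<in>Obj C.
        \<forall>f\<in>Hom C a b. \<forall>g\<in>Hom C b c. \<forall>h\<in>Hom C c d.
        Cmp C a b d (Cmp C b c d h g) f = Cmp C a c d h (Cmp C a b c g f))"

definition is_functor ::
  "('o, 'm) cat \<Rightarrow> ('p, 'k) cat \<Rightarrow> ('o \<Rightarrow> 'p) \<Rightarrow> ('o \<Rightarrow> 'o \<Rightarrow> 'm \<Rightarrow> 'k) \<Rightarrow> bool" where
  "is_functor C D Fo Fm \<longleftrightarrow>
     is_category C \<and> is_category D \<and>
     (\<forall>a\<in>Obj C. Fo a \<in> Obj D) \<and>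
     (\<forall>a\<in>Obj C. \<forall>b\<in>Obj C. \<forall>f\<in>Hom C a b. Fm a b f \<in> Hom D (Fo a) (Fo b)) \<and>
     (\<forall>a\<in>Obj C. Fm a a (Ide C a) = Ide D (Fo a)) \<and>
     (\<forall>a\<in>Obj C. \<forall>b\<in>Obj C. \<forall>c\<in>Obj C. \<forall>f\<in>Hom C a b. \<forall>g\<in>Hom C b c.
        Fm a c (Cmp C a b c g f) = Cmp D (Fo a) (Fo b) (Fo c) (Fm b c g) (Fm a b f))"

definition isomorphism_of_categories ::
  "('o, 'm) cat \<Rightarrow> ('p, 'k) cat \<Rightarrow> ('o \<Rightarrow> 'p) \<Rightarrow> ('o \<Rightarrow> 'o \<Rightarrow> 'm \<Rightarrow> 'k) \<Rightarrow> bool" where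
  "isomorphism_of_categories C D Fo Fm \<longleftrightarrow>
     is_functor C D Fo Fm \<and>
     (\<exists>Go Gm. is_functor D C Go Gm \<and>
        (\<forall>a\<in>Obj C. Go (Fo a) = a) \<and>
        (\<forall>a\<in>Obj D. Fo (Go a) = a) \<and>
        (\<forall>a\<in>Obj C. \<forall>b\<in>Obj C. \<forall>f\<in>Hom C a b. Gm (Fo a) (Fo b) (Fm a b f) = f) \<and>
        (\<forall>a\<in>Obj D. \<forall>b\<in>Obj D. \<forall>f\<in>Hom D a b. Fm (Go a) (Go b) (Gm a b f) = f))"

definition full_subcategory :: "('o, 'm) cat \<Rightarrow> 'o set \<Rightarrow> ('o, 'm) cat" where
  "full_subcategory C S = C \<lparr>Obj := Obj C \<inter> S\<rparr>"


section \<open>Modules\<close>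

text \<open>\<open>Module.module\<close> constrains only the additive structure and \<open>smult\<close>; the \<open>mult\<close> and
  \<open>one\<close> fields of a module record are free. Linear and bilinear maps are extensional functions,
  so that equality of such maps is equality on the carrier.\<close>

definition linear_maps ::
  "('r, 'c) ring_scheme \<Rightarrow> ('r, 'm, 'd) module_scheme \<Rightarrow> ('r, 'n, 'e) module_scheme \<Rightarrow> ('m \<Rightarrow> 'n) set"
  where
  "linear_maps R M N = {f \<in> carrier M \<rightarrow>\<^sub>E carrier N.
     (\<forall>x\<in>carrier M. \<forall>y\<in>carrier M. f (x \<oplus>\<^bsub>M\<^esub> y) = f x \<oplus>\<^bsub>N\<^esub> f y) \<and>
     (\<forall>r\<in>carrier R. \<forall>x\<in>carrier M. f (r \<odot>\<^bsub>M\<^esub> x) = r \<odot>\<^bsub>N\<^esub> f x)}"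

definition linear_isos ::
  "('r, 'c) ring_scheme \<Rightarrow> ('r, 'm, 'd) module_scheme \<Rightarrow> ('r, 'n, 'e) module_scheme \<Rightarrow> ('m \<Rightarrow> 'n) set"
  where
  "linear_isos R M N = {f \<in> linear_maps R M N. bij_betw f (carrier M) (carrier N)}"

definition bilinear_maps ::
  "('r, 'c) ring_scheme \<Rightarrow> ('r, 'm, 'd) module_scheme \<Rightarrow> ('r, 'n, 'e) module_scheme
    \<Rightarrow> ('m \<Rightarrow> 'm \<Rightarrow> 'n) set"
  where
  "bilinear_maps R M N = {B \<in> extensional (carrier M).
     (\<forall>x\<in>carrier M. B x \<in> linear_maps R M N) \<and>
     (\<forall>y\<in>carrier M. (\<lambda>x\<in>carrier M. B x y) \<in> linear_maps R M N)}"

definition self_module :: "('r, 'c) ring_scheme \<Rightarrow> ('r, 'r) module" where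
  "self_module R = \<lparr>carrier = carrier R, mult = mult R, one = \<one>\<^bsub>R\<^esub>, zero = \<zero>\<^bsub>R\<^esub>,
     add = add R, smult = mult R\<rparr>"

definition free_module :: "('r, 'c) ring_scheme \<Rightarrow> nat \<Rightarrow> ('r, nat \<Rightarrow> 'r) module" where
  "free_module R n = \<lparr>carrier = {..<n} \<rightarrow>\<^sub>E carrier R, mult = undefined, one = undefined,
     zero = (\<lambda>i\<in>{..<n}. \<zero>\<^bsub>R\<^esub>),
     add = (\<lambda>x y. \<lambda>i\<in>{..<n}. x i \<oplus>\<^bsub>R\<^esub> y i),
     smult = (\<lambda>r x. \<lambda>i\<in>{..<n}. r \<otimes>\<^bsub>R\<^esub> x i)\<rparr>"

text \<open>Finitely generated projective means: a direct summand of some \<open>R\<close>-module \<open>R\<^sup>n\<close>.\<close>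

definition fin_gen_projective ::
  "('r, 'c) ring_scheme \<Rightarrow> ('r, 'm, 'd) module_scheme \<Rightarrow> bool" where
  "fin_gen_projective R M \<longleftrightarrow>
     (\<exists>n. \<exists>i\<in>linear_maps R M (free_module R n). \<exists>r\<in>linear_maps R (free_module R n) M.
        \<forall>x\<in>carrier M. r (i x) = x)"

text \<open>Localisation of a module, and of the ring itself, at a multiplicative set \<open>S\<close>;
  \<open>frac R S M x s\<close> is the class of \<open>x / s\<close>.\<close>

definition frac_rel ::
  "('r, 'c) ring_scheme \<Rightarrow> 'r set \<Rightarrow> ('r, 'm, 'd) module_scheme \<Rightarrow> (('m \<times> 'r) \<times> ('m \<times> 'r)) set"
  where
  "frac_rel R S M = {((x, s), (y, t)). x \<in> carrier M \<and> y \<in> carrier M \<and> s \<in> S \<and> t \<in> S \<and>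
     (\<exists>u\<in>S. u \<odot>\<^bsub>M\<^esub> (t \<odot>\<^bsub>M\<^esub> x) = u \<odot>\<^bsub>M\<^esub> (s \<odot>\<^bsub>M\<^esub> y))}"

definition frac ::
  "('r, 'c) ring_scheme \<Rightarrow> 'r set \<Rightarrow> ('r, 'm, 'd) module_scheme \<Rightarrow> 'm \<Rightarrow> 'r \<Rightarrow> ('m \<times> 'r) set"
  where
  "frac R S M x s = frac_rel R S M `` {(x, s)}"

definition loc_module ::
  "('r, 'c) ring_scheme \<Rightarrow> 'r set \<Rightarrow> ('r, 'm, 'd) module_scheme
    \<Rightarrow> (('r \<times> 'r) set, ('m \<times> 'r) set) module"
  where
  "loc_module R S M = \<lparr>carrier = {frac R S M x s | x s. x \<in> carrier M \<and> s \<in> S},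
     mult = undefined, one = undefined,
     zero = frac R S M \<zero>\<^bsub>M\<^esub> \<one>\<^bsub>R\<^esub>,
     add = (\<lambda>X Y. \<Union>(x, s)\<in>X. \<Union>(y, t)\<in>Y.
              frac R S M (t \<odot>\<^bsub>M\<^esub> x \<oplus>\<^bsub>M\<^esub> s \<odot>\<^bsub>M\<^esub> y) (s \<otimes>\<^bsub>R\<^esub> t)),
     smult = (\<lambda>Q X. \<Union>(r, s)\<in>Q. \<Union>(x, t)\<in>X. frac R S M (r \<odot>\<^bsub>M\<^esub> x) (s \<otimes>\<^bsub>R\<^esub> t))\<rparr>"

definition loc_ring :: "('r, 'c) ring_scheme \<Rightarrow> 'r set \<Rightarrow> ('r \<times> 'r) set ring" where
  "loc_ring R S = (let L = loc_module R S (self_module R) in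
     \<lparr>carrier = carrier L, mult = smult L, one = frac R S (self_module R) \<one>\<^bsub>R\<^esub> \<one>\<^bsub>R\<^esub>,
      zero = zero L, add = add L\<rparr>)"

definition has_rank ::
  "('r, 'c) ring_scheme \<Rightarrow> ('r, 'm, 'd) module_scheme \<Rightarrow> nat \<Rightarrow> bool" where
  "has_rank R M n \<longleftrightarrow>
     (\<forall>P. primeideal P R \<longrightarrow>
        linear_isos (loc_ring R (carrier R - P))
          (free_module (loc_ring R (carrier R - P)) n)
          (loc_module R (carrier R - P) M) \<noteq> {})"


section \<open>Octonion algebras over a commutative ring\<close>

text \<open>The multiplication and the identity are the \<open>mult\<close> and \<open>one\<close> fields of the underlying
  module record.\<close>

record ('r, 'c) quad_algebra = "('r, 'c) module" +
  bform :: "'c \<Rightarrow> 'c \<Rightarrow> 'r"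

definition norm_form :: "('r, 'e) ring_scheme \<Rightarrow> ('r, 'c) quad_algebra \<Rightarrow> 'c \<Rightarrow> 'r" where
  "norm_form R C x = (inv\<^bsub>R\<^esub> (\<one>\<^bsub>R\<^esub> \<oplus>\<^bsub>R\<^esub> \<one>\<^bsub>R\<^esub>)) \<otimes>\<^bsub>R\<^esub> bform C x x"

definition octonion_algebra :: "('r, 'e) ring_scheme \<Rightarrow> ('r, 'c) quad_algebra \<Rightarrow> bool" where
  "octonion_algebra R C \<longleftrightarrow>
     cring R \<and> \<one>\<^bsub>R\<^esub> \<oplus>\<^bsub>R\<^esub> \<one>\<^bsub>R\<^esub> \<in> Units R \<and>
     Module.module R C \<and> fin_gen_projective R C \<and> has_rank R C 8 \<and>
     mult C \<in> bilinear_maps R C C \<and>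
     \<one>\<^bsub>C\<^esub> \<in> carrier C \<and>
     (\<forall>x\<in>carrier C. \<one>\<^bsub>C\<^esub> \<otimes>\<^bsub>C\<^esub> x = x \<and> x \<otimes>\<^bsub>C\<^esub> \<one>\<^bsub>C\<^esub> = x) \<and>
     bform C \<in> bilinear_maps R C (self_module R) \<and>
     (\<forall>x\<in>carrier C. \<forall>y\<in>carrier C. bform C x y = bform C y x) \<and>
     bij_betw (bform C) (carrier C) (linear_maps R C (self_module R)) \<and>
     (\<forall>x\<in>carrier C. \<forall>y\<in>carrier C.
        norm_form R C (x \<otimes>\<^bsub>C\<^esub> y) = norm_form R C x \<otimes>\<^bsub>R\<^esub> norm_form R C y)"

definition octonion_morphisms ::
  "('r, 'e) ring_scheme \<Rightarrow> ('r, 'c) quad_algebra \<Rightarrow> ('r, 'c) quad_algebra \<Rightarrow> ('c \<Rightarrow> 'c) set" where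
  "octonion_morphisms R C C' = {f \<in> linear_isos R C C'.
     (\<forall>x\<in>carrier C'. \<forall>y\<in>carrier C'.
        x \<otimes>\<^bsub>C'\<^esub> y = f (inv_into (carrier C) f x \<otimes>\<^bsub>C\<^esub> inv_into (carrier C) f y)) \<and>
     \<one>\<^bsub>C'\<^esub> = f \<one>\<^bsub>C\<^esub> \<and>
     (\<forall>x\<in>carrier C'. \<forall>y\<in>carrier C'.
        bform C' x y = bform C (inv_into (carrier C) f x) (inv_into (carrier C) f y))}"

definition octonion_category ::
  "('r, 'e) ring_scheme \<Rightarrow> (('r, 'c) quad_algebra, 'c \<Rightarrow> 'c) cat" where
  "octonion_category R = \<lparr>Obj = {C. octonion_algebra R C}, Hom = octonion_morphisms R,
     Ide = (\<lambda>C. \<lambda>x\<in>carrier C. x), Cmp = (\<lambda>C D E g f. compose (carrier C) g f)\<rparr>"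


section \<open>Smooth manifolds\<close>

primrec Ck_on ::
  "nat \<Rightarrow> 'a::real_normed_vector set \<Rightarrow> ('a \<Rightarrow> 'b::real_normed_vector) \<Rightarrow> bool" where
  "Ck_on 0 S f \<longleftrightarrow> continuous_on S f"
| "Ck_on (Suc k) S f \<longleftrightarrow> (\<forall>x\<in>S. f differentiable (at x)) \<and>
     (\<forall>v. Ck_on k S (\<lambda>x. frechet_derivative f (at x) v))"

text \<open>Only used on open sets \<open>S\<close>.\<close>

definition smooth_on ::
  "'a::real_normed_vector set \<Rightarrow> ('a \<Rightarrow> 'b::real_normed_vector) \<Rightarrow> bool" where
  "smooth_on S f \<longleftrightarrow> (\<forall>k. Ck_on k S f)"

text \<open>The manifold \<open>M\<close> is the whole type \<open>'a\<close> with its class topology, and an atlas on it. A chart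
  is a pair of its domain and its coordinate map, whose values off the domain are irrelevant.\<close>

type_synonym ('a, 'n) chart = "'a set \<times> ('a \<Rightarrow> real^'n)"

abbreviation chart_dom :: "('a, 'n) chart \<Rightarrow> 'a set" where
  "chart_dom c \<equiv> fst c"

abbreviation coord :: "('a, 'n) chart \<Rightarrow> 'a \<Rightarrow> real^'n" where
  "coord c \<equiv> snd c"

abbreviation chart_img :: "('a, 'n) chart \<Rightarrow> (real^'n) set" where
  "chart_img c \<equiv> coord c ` chart_dom c"

abbreviation chart_inv :: "('a, 'n) chart \<Rightarrow> real^'n \<Rightarrow> 'a" where
  "chart_inv c \<equiv> inv_into (chart_dom c) (coord c)"

abbreviation transition :: "('a, 'n) chart \<Rightarrow> ('a, 'n) chart \<Rightarrow> real^'n \<Rightarrow> real^'n" where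
  "transition c c' \<equiv> coord c' \<circ> chart_inv c"

definition smooth_atlas :: "('a::topological_space, 'n::finite) chart set \<Rightarrow> bool" where
  "smooth_atlas A \<longleftrightarrow>
     (\<forall>c\<in>A. open (chart_dom c) \<and> open (chart_img c) \<and>
        homeomorphism (chart_dom c) (chart_img c) (coord c) (chart_inv c)) \<and>
     (\<Union>c\<in>A. chart_dom c) = UNIV \<and>
     (\<forall>c\<in>A. \<forall>c'\<in>A. smooth_on (coord c ` (chart_dom c \<inter> chart_dom c')) (transition c c'))"

definition smooth_functions :: "('a, 'n::finite) chart set \<Rightarrow> ('a \<Rightarrow> real) set" where
  "smooth_functions A = {f. \<forall>c\<in>A. smooth_on (chart_img c) (f \<circ> chart_inv c)}"

definition smooth_ring :: "('a, 'n::finite) chart set \<Rightarrow> ('a \<Rightarrow> real) ring" where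
  "smooth_ring A = \<lparr>carrier = smooth_functions A, mult = (\<lambda>f h p. f p * h p), one = (\<lambda>p. 1),
     zero = (\<lambda>p. 0), add = (\<lambda>f h p. f p + h p)\<rparr>"

text \<open>A tangent vector at \<open>p\<close> assigns to each chart at \<open>p\<close> a coordinate vector, compatibly with the
  Jacobians of the coordinate changes. It is \<open>0\<close> on all other charts, so that the vector space
  operations are pointwise.\<close>

type_synonym ('a, 'n) tangent = "('a, 'n) chart \<Rightarrow> real^'n"

abbreviation tplus :: "('a, 'n::finite) tangent \<Rightarrow> ('a, 'n) tangent \<Rightarrow> ('a, 'n) tangent" where
  "tplus v w \<equiv> (\<lambda>c. v c + w c)"

abbreviation tscale :: "real \<Rightarrow> ('a, 'n::finite) tangent \<Rightarrow> ('a, 'n) tangent" where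
  "tscale r v \<equiv> (\<lambda>c. r *\<^sub>R v c)"

abbreviation tzero :: "('a, 'n::finite) tangent" where
  "tzero \<equiv> (\<lambda>c. 0)"

definition charts_at :: "('a, 'n) chart set \<Rightarrow> 'a \<Rightarrow> ('a, 'n) chart set" where
  "charts_at A p = {c \<in> A. p \<in> chart_dom c}"

definition tangent_space :: "('a, 'n::finite) chart set \<Rightarrow> 'a \<Rightarrow> ('a, 'n) tangent set" where
  "tangent_space A p = {v. (\<forall>c. c \<notin> charts_at A p \<longrightarrow> v c = 0) \<and>
     (\<forall>c\<in>charts_at A p. \<forall>c'\<in>charts_at A p.
        v c' = frechet_derivative (transition c c') (at (coord c p)) (v c))}"

text \<open>The tangent vector at \<open>p\<close> with coordinate vector \<open>v\<close> in the chart \<open>c\<close>.\<close>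

definition coord_vector ::
  "('a, 'n::finite) chart set \<Rightarrow> ('a, 'n) chart \<Rightarrow> 'a \<Rightarrow> real^'n \<Rightarrow> ('a, 'n) tangent" where
  "coord_vector A c p v = (\<lambda>c'. if c' \<in> charts_at A p
     then frechet_derivative (transition c c') (at (coord c p)) v else 0)"

definition vector_fields :: "('a, 'n::finite) chart set \<Rightarrow> ('a \<Rightarrow> ('a, 'n) tangent) set" where
  "vector_fields A = {X. (\<forall>p. X p \<in> tangent_space A p) \<and>
     (\<forall>c\<in>A. smooth_on (chart_img c) (\<lambda>y. X (chart_inv c y) c))}"

definition vector_field_module ::
  "('a, 'n::finite) chart set \<Rightarrow> ('a \<Rightarrow> real, 'a \<Rightarrow> ('a, 'n) tangent) module" where
  "vector_field_module A = \<lparr>carrier = vector_fields A, mult = undefined, one = undefined,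
     zero = (\<lambda>p. tzero), add = (\<lambda>X Y p. tplus (X p) (Y p)),
     smult = (\<lambda>f X p. tscale (f p) (X p))\<rparr>"

definition tangent_functional ::
  "('a, 'n::finite) chart set \<Rightarrow> 'a \<Rightarrow> (('a, 'n) tangent \<Rightarrow> real) \<Rightarrow> bool" where
  "tangent_functional A p h \<longleftrightarrow>
     (\<forall>v\<in>tangent_space A p. \<forall>w\<in>tangent_space A p. h (tplus v w) = h v + h w) \<and>
     (\<forall>r. \<forall>v\<in>tangent_space A p. h (tscale r v) = r * h v)"

text \<open>Forms and metrics are \<open>undefined\<close> off the tangent spaces, so that they are equal if and only
  if they agree at all points on all tangent vectors. Smoothness is that of the components in all
  charts.\<close>

definition riemannian_metric ::
  "('a, 'n::finite) chart set \<Rightarrow> ('a \<Rightarrow> ('a, 'n) tangent \<Rightarrow> ('a, 'n) tangent \<Rightarrow> real) \<Rightarrow> bool" where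
  "riemannian_metric A g \<longleftrightarrow>
     (\<forall>p v w. \<not> (v \<in> tangent_space A p \<and> w \<in> tangent_space A p) \<longrightarrow> g p v w = undefined) \<and>
     (\<forall>p. \<forall>v\<in>tangent_space A p. tangent_functional A p (\<lambda>w. g p v w)) \<and>
     (\<forall>p. \<forall>v\<in>tangent_space A p. \<forall>w\<in>tangent_space A p. g p v w = g p w v) \<and>
     (\<forall>p. \<forall>v\<in>tangent_space A p. v \<noteq> tzero \<longrightarrow> g p v v > 0) \<and>
     (\<forall>c\<in>A. \<forall>i j. smooth_on (chart_img c)
        (\<lambda>y. g (chart_inv c y) (coord_vector A c (chart_inv c y) (axis i 1))
                               (coord_vector A c (chart_inv c y) (axis j 1))))"

type_synonym ('a, 'n) form3 =
  "'a \<Rightarrow> ('a, 'n) tangent \<Rightarrow> ('a, 'n) tangent \<Rightarrow> ('a, 'n) tangent \<Rightarrow> real"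

definition smooth_form3 :: "('a, 'n::finite) chart set \<Rightarrow> ('a, 'n) form3 \<Rightarrow> bool" where
  "smooth_form3 A \<phi> \<longleftrightarrow>
     (\<forall>p u v w. \<not> (u \<in> tangent_space A p \<and> v \<in> tangent_space A p \<and> w \<in> tangent_space A p)
        \<longrightarrow> \<phi> p u v w = undefined) \<and>
     (\<forall>p. \<forall>v\<in>tangent_space A p. \<forall>w\<in>tangent_space A p.
        tangent_functional A p (\<lambda>u. \<phi> p u v w) \<and>
        tangent_functional A p (\<lambda>u. \<phi> p v u w) \<and>
        tangent_functional A p (\<lambda>u. \<phi> p v w u) \<and>
        \<phi> p v v w = 0 \<and> \<phi> p v w v = 0 \<and> \<phi> p w v v = 0) \<and>
     (\<forall>c\<in>A. \<forall>i j k. smooth_on (chart_img c)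
        (\<lambda>y. \<phi> (chart_inv c y) (coord_vector A c (chart_inv c y) (axis i 1))
                               (coord_vector A c (chart_inv c y) (axis j 1))
                               (coord_vector A c (chart_inv c y) (axis k 1))))"


section \<open>Definite 3-forms and the category of \<open>G\<^sub>2\<close>-structures\<close>

text \<open>The 3-form \<open>e\<^sup>i \<and> e\<^sup>j \<and> e\<^sup>k\<close>, normalised (no factor \<open>1/3!\<close>) to be \<open>1\<close> on \<open>(e\<^sub>i, e\<^sub>j, e\<^sub>k)\<close>. Indices
  live in the seven-element type \<open>7\<close>, in which the numeral \<open>7\<close> is the element \<open>0\<close>.\<close>

definition wedge3 :: "7 \<Rightarrow> 7 \<Rightarrow> 7 \<Rightarrow> real^7 \<Rightarrow> real^7 \<Rightarrow> real^7 \<Rightarrow> real" where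
  "wedge3 i j k x y z =
     det (vector [vector [x$i, y$i, z$i], vector [x$j, y$j, z$j], vector [x$k, y$k, z$k]] :: real^3^3)"

definition phi0 :: "real^7 \<Rightarrow> real^7 \<Rightarrow> real^7 \<Rightarrow> real" where
  "phi0 x y z = wedge3 1 2 3 x y z + wedge3 1 4 5 x y z + wedge3 1 6 7 x y z + wedge3 2 4 6 x y z
     - wedge3 2 5 7 x y z - wedge3 3 4 7 x y z - wedge3 3 5 6 x y z"

definition frames :: "('a, 'n::finite) chart set \<Rightarrow> 'a \<Rightarrow> (real^'n \<Rightarrow> ('a, 'n) tangent) set" where
  "frames A p = {u. bij_betw u UNIV (tangent_space A p) \<and>
     (\<forall>x y. u (x + y) = tplus (u x) (u y)) \<and> (\<forall>r x. u (r *\<^sub>R x) = tscale r (u x))}"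

definition G2_frames :: "('a, 7) chart set \<Rightarrow> ('a, 7) form3 \<Rightarrow> 'a \<Rightarrow> (real^7 \<Rightarrow> ('a, 7) tangent) set"
  where
  "G2_frames A \<phi> p = {u \<in> frames A p. \<forall>x y z. \<phi> p (u x) (u y) (u z) = phi0 x y z}"

definition definite_forms :: "('a, 7) chart set \<Rightarrow> ('a, 7) form3 set" where
  "definite_forms A = {\<phi>. smooth_form3 A \<phi> \<and> (\<forall>p. G2_frames A \<phi> p \<noteq> {})}"

definition assoc_metric ::
  "('a, 7) chart set \<Rightarrow> ('a, 7) form3 \<Rightarrow> 'a \<Rightarrow> ('a, 7) tangent \<Rightarrow> ('a, 7) tangent \<Rightarrow> real" where
  "assoc_metric A \<phi> = (THE g. riemannian_metric A g \<and>
     (\<forall>p. \<forall>u\<in>G2_frames A \<phi> p. \<forall>x y. g p (u x) (u y) = x \<bullet> y))"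

definition G2str_morphisms ::
  "('a, 7) chart set \<Rightarrow> ('a, 7) form3 \<Rightarrow> ('a, 7) form3
    \<Rightarrow> (('a \<Rightarrow> ('a, 7) tangent) \<Rightarrow> ('a \<Rightarrow> ('a, 7) tangent)) set" where
  "G2str_morphisms A \<phi> \<phi>' =
     {f \<in> linear_isos (smooth_ring A) (vector_field_module A) (vector_field_module A).
        \<forall>X\<in>vector_fields A. \<forall>Y\<in>vector_fields A. \<forall>Z\<in>vector_fields A.
          (\<lambda>p. \<phi>' p (X p) (Y p) (Z p)) =
          (\<lambda>p. \<phi> p (inv_into (vector_fields A) f X p) (inv_into (vector_fields A) f Y p)
                   (inv_into (vector_fields A) f Z p))}"

definition G2str ::
  "('a, 7) chart set
    \<Rightarrow> (('a, 7) form3, ('a \<Rightarrow> ('a, 7) tangent) \<Rightarrow> ('a \<Rightarrow> ('a, 7) tangent)) cat" where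
  "G2str A = \<lparr>Obj = definite_forms A, Hom = G2str_morphisms A,
     Ide = (\<lambda>\<phi>. \<lambda>X\<in>vector_fields A. X),
     Cmp = (\<lambda>\<phi> \<phi>' \<phi>'' h f. compose (vector_fields A) h f)\<rparr>"


section \<open>Octonion bundles\<close>

type_synonym ('a, 'n) osection = "('a \<Rightarrow> real) \<times> ('a \<Rightarrow> ('a, 'n) tangent)"

definition osections :: "('a, 'n::finite) chart set \<Rightarrow> ('a, 'n) osection set" where
  "osections A = smooth_functions A \<times> vector_fields A"

definition bundle_form ::
  "('a, 'n::finite) chart set \<Rightarrow> ('a \<Rightarrow> ('a, 'n) tangent \<Rightarrow> ('a, 'n) tangent \<Rightarrow> real)
    \<Rightarrow> ('a, 'n) osection \<Rightarrow> ('a, 'n) osection \<Rightarrow> 'a \<Rightarrow> real" where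
  "bundle_form A g = (\<lambda>x\<in>osections A. \<lambda>y\<in>osections A.
     (\<lambda>p. 2 * fst x p * fst y p + 2 * g p (snd x p) (snd y p)))"

definition bundle_algebra ::
  "('a, 'n::finite) chart set \<Rightarrow> (('a, 'n) osection \<Rightarrow> ('a, 'n) osection \<Rightarrow> ('a, 'n) osection)
    \<Rightarrow> ('a \<Rightarrow> ('a, 'n) tangent \<Rightarrow> ('a, 'n) tangent \<Rightarrow> real)
    \<Rightarrow> ('a \<Rightarrow> real, ('a, 'n) osection) quad_algebra" where
  "bundle_algebra A m g = \<lparr>carrier = osections A, mult = m, one = (\<lambda>p. 1, \<lambda>p. tzero),
     zero = (\<lambda>p. 0, \<lambda>p. tzero),
     add = (\<lambda>x y. (\<lambda>p. fst x p + fst y p, \<lambda>p. tplus (snd x p) (snd y p))),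
     smult = (\<lambda>f x. (\<lambda>p. f p * fst x p, \<lambda>p. tscale (f p) (snd x p))),
     bform = bundle_form A g\<rparr>"

text \<open>A \<open>C\<^sup>\<infinity>(M)\<close>-bilinear multiplication of sections is induced by multiplications on the fibres
  \<open>\<real> \<oplus> T\<^sub>pM\<close>: multiply any two sections through the given points and evaluate at \<open>p\<close>.\<close>

definition eval_at :: "'a \<Rightarrow> ('a, 'n) osection \<Rightarrow> real \<times> ('a, 'n) tangent" where
  "eval_at p x = (fst x p, snd x p)"

definition fibre_mult ::
  "('a, 'n::finite) chart set \<Rightarrow> (('a, 'n) osection \<Rightarrow> ('a, 'n) osection \<Rightarrow> ('a, 'n) osection)
    \<Rightarrow> 'a \<Rightarrow> real \<times> ('a, 'n) tangent \<Rightarrow> real \<times> ('a, 'n) tangent \<Rightarrow> real \<times> ('a, 'n) tangent" where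
  "fibre_mult A m p v w = (THE z. \<exists>x\<in>osections A. \<exists>y\<in>osections A.
     eval_at p x = v \<and> eval_at p y = w \<and> eval_at p (m x y) = z)"

definition non_split_at ::
  "('a, 'n::finite) chart set \<Rightarrow> (('a, 'n) osection \<Rightarrow> ('a, 'n) osection \<Rightarrow> ('a, 'n) osection)
    \<Rightarrow> 'a \<Rightarrow> bool" where
  "non_split_at A m p \<longleftrightarrow>
     (\<forall>v\<in>UNIV \<times> tangent_space A p. \<forall>w\<in>UNIV \<times> tangent_space A p.
        fibre_mult A m p v w = (0, tzero) \<longrightarrow> v = (0, tzero) \<or> w = (0, tzero))"

definition octbun ::
  "('a, 7) chart set
    \<Rightarrow> (('a \<Rightarrow> real, ('a, 7) osection) quad_algebra, ('a, 7) osection \<Rightarrow> ('a, 7) osection) cat" where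
  "octbun A = full_subcategory (octonion_category (smooth_ring A))
     {bundle_algebra A m g | m g. riemannian_metric A g \<and> (\<forall>p. non_split_at A m p)}"


section \<open>The functor\<close>

definition cross_field ::
  "('a, 7) chart set \<Rightarrow> ('a, 7) form3 \<Rightarrow> ('a \<Rightarrow> ('a, 7) tangent) \<Rightarrow> ('a \<Rightarrow> ('a, 7) tangent)
    \<Rightarrow> ('a \<Rightarrow> ('a, 7) tangent)" where
  "cross_field A \<phi> X Y = (THE W. W \<in> vector_fields A \<and>
     (\<forall>Z\<in>vector_fields A. (\<lambda>p. assoc_metric A \<phi> p (W p) (Z p)) = (\<lambda>p. \<phi> p (X p) (Y p) (Z p))))"

definition G2_mult ::
  "('a, 7) chart set \<Rightarrow> ('a, 7) form3 \<Rightarrow> ('a, 7) osection \<Rightarrow> ('a, 7) osection \<Rightarrow> ('a, 7) osection" where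
  "G2_mult A \<phi> = (\<lambda>x\<in>osections A. \<lambda>y\<in>osections A.
     (\<lambda>p. fst x p * fst y p - assoc_metric A \<phi> p (snd x p) (snd y p),
      \<lambda>p. tplus (tplus (tscale (fst x p) (snd y p)) (tscale (fst y p) (snd x p)))
                (cross_field A \<phi> (snd x) (snd y) p)))"

definition G2_algebra ::
  "('a, 7) chart set \<Rightarrow> ('a, 7) form3 \<Rightarrow> ('a \<Rightarrow> real, ('a, 7) osection) quad_algebra" where
  "G2_algebra A \<phi> = bundle_algebra A (G2_mult A \<phi>) (assoc_metric A \<phi>)"

definition id_oplus ::
  "('a, 'n::finite) chart set \<Rightarrow> (('a \<Rightarrow> ('a, 'n) tangent) \<Rightarrow> ('a \<Rightarrow> ('a, 'n) tangent))
    \<Rightarrow> ('a, 'n) osection \<Rightarrow> ('a, 'n) osection" where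
  "id_oplus A f = (\<lambda>x\<in>osections A. (fst x, f (snd x)))"

end

theory Submission
  imports Defs
begin

text \<open>A \<open>G\<^sub>2\<close>-frame at \<open>p\<close> identifies the fibre of \<open>C\<^sub>\<phi>\<close> with the standard octonions
  \<open>\<real> \<oplus> \<real>\<^sup>7\<close>, so the algebra axioms and the functor on morphisms are checked pointwise. That
  \<open>g\<^sub>\<phi>\<close> is well defined and smooth follows from a formula for it: for a covector \<open>\<xi>\<close> with \<open>\<xi>(x) = 1\<close>
  the determinant of \<open>\<phi>(x,\<cdot>,\<cdot>) + \<xi>\<^sup>2\<close> is \<open>|x|\<^sup>4\<close> up to the square of the volume. Conversely, in an
  octonion bundle multiplicativity of the norm makes the imaginary part of the product of vector fields
  a cross product that is tensorial, and the basic triples of octonions produce \<open>G\<^sub>2\<close>-frames.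
  Projectivity and the rank of \<open>\<Gamma>(TM)\<close> on a noncompact \<open>M\<close> rest on finitely many global fields
  that span every tangent space: fourteen generic ones suffice near a compact shell, and shells are
  treated in three disjoint families; Gram determinants then give a dual frame and local bases at all
  prime ideals.\<close>

section \<open>Calculus of smooth functions on open sets\<close>

text \<open>The rank condition is the main obstacle. It quantifies over all prime ideals of the ring
  of smooth functions, and these need not be the functions vanishing at a point, so local
  trivializations alone do not reach them. A finite family of smooth functions without common zero
  does: the sum of its squares is a unit, hence no prime ideal contains the whole family. The Gram
  determinants of 7-tuples from a finite spanning family are such functions. The number fourteen is
  the dimension of the total space of the cotangent bundle; its image under evaluation on fifteen
  fields has measure zero. A skew form on a space of odd dimension is singular, so \<phi>(x,.,.) has
  no useful determinant of its own. The square of a covector that is nonzero on the kernel repairs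
  this at the price of a volume factor, and the determinant of the resulting Gram matrix reveals
  that factor. The inverse functor comes from bijectivity on objects and on each Hom-set;
  tensoriality and nondegeneracy of the form pass between sections and fibres.\<close>

lemma Ck_on_subset: "Ck_on k S f \<Longrightarrow> T \<subseteq> S \<Longrightarrow> Ck_on k T f"
  by (induction k arbitrary: f) (auto intro: continuous_on_subset)

lemma Ck_on_SucD: "Ck_on (Suc k) S f \<Longrightarrow> Ck_on k S f"
proof (induction k arbitrary: f)
  case 0
  then show ?case
    by (auto intro!: continuous_at_imp_continuous_on differentiable_imp_continuous_within)
next
  case (Suc k)
  then show ?case by auto
qed

text \<open>Openness of \<open>S\<close> makes the derivative at a point of \<open>S\<close> depend
  on the values in \<open>S\<close> only, so agreement is inherited by the derivatives and the
  induction goes through.\<close>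

lemma Ck_on_cong:
  assumes "open S" "\<And>x. x \<in> S \<Longrightarrow> f x = g x" "Ck_on k S f"
  shows "Ck_on k S g"
  using assms(2,3)
proof (induction k arbitrary: f g)
  case 0
  then show ?case by (auto cong: continuous_on_cong)
next
  case (Suc k)
  have d: "(g has_derivative D) (at x)" if "(f has_derivative D) (at x)" "x \<in> S" for x D
    using has_derivative_transform_within_open[OF that(1) assms(1) that(2)] Suc.prems(1) by auto
  have fd: "frechet_derivative f (at x) = frechet_derivative g (at x)" "g differentiable (at x)"
    if x: "x \<in> S" for x
  proof -
    have "f differentiable (at x)" using Suc.prems x by auto
    then have "(g has_derivative frechet_derivative f (at x)) (at x)"
      using d x frechet_derivative_works by blast
    then show "frechet_derivative f (at x) = frechet_derivative g (at x)" "g differentiable (at x)"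
      using frechet_derivative_at differentiable_def by blast+
  qed
  have "Ck_on k S (\<lambda>x. frechet_derivative g (at x) v)" for v
    by (rule Suc.IH[where f = "\<lambda>x. frechet_derivative f (at x) v"]) (use fd(1) Suc.prems(2) in auto)
  then show ?case using fd(2) by simp
qed

text \<open>\<open>frechet_derivative\<close> is defined by choice; uniqueness of derivatives lets
  any explicit \<open>D\<close> stand in for it.\<close>

lemma Ck_on_SucI:
  assumes "open S" "\<And>x. x \<in> S \<Longrightarrow> (f has_derivative D x) (at x)"
    "\<And>v. Ck_on k S (\<lambda>x. D x v)"
  shows "Ck_on (Suc k) S f"
  unfolding Ck_on.simps
proof (intro conjI ballI allI)
  fix x assume "x \<in> S" then show "f differentiable at x" using assms(2) differentiableI by blast
next
  fix v
  show "Ck_on k S (\<lambda>x. frechet_derivative f (at x) v)"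
    by (rule Ck_on_cong[OF assms(1) _ assms(3)[of v]]) (metis assms(2) frechet_derivative_at)
qed

lemma Ck_on_SucE:
  assumes "Ck_on (Suc k) S f"
  obtains "\<And>x. x \<in> S \<Longrightarrow> (f has_derivative frechet_derivative f (at x)) (at x)"
    "\<And>v. Ck_on k S (\<lambda>x. frechet_derivative f (at x) v)"
  using assms frechet_derivative_works by auto

lemma Ck_on_local:
  assumes "\<And>x. x \<in> S \<Longrightarrow> \<exists>U. open U \<and> x \<in> U \<and> Ck_on k U f"
  shows "Ck_on k S f"
  using assms
proof (induction k arbitrary: f)
  case 0
  have "isCont f x" if "x \<in> S" for x
    using 0[OF that] by (auto simp: continuous_on_eq_continuous_at)
  then show ?case by (simp add: continuous_at_imp_continuous_on)
next
  case (Suc k)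
  have "f differentiable (at x)" if "x \<in> S" for x using Suc.prems[OF that] by auto
  moreover have "Ck_on k S (\<lambda>x. frechet_derivative f (at x) v)" for v
    by (rule Suc.IH) (use Suc.prems in \<open>fastforce simp: Ck_on.simps(2)\<close>)
  ultimately show ?case by simp
qed

lemma Ck_on_const: "Ck_on k S (\<lambda>x. c)"
proof (induction k arbitrary: c)
  case (Suc k)
  have "frechet_derivative (\<lambda>x. c) (at x) = (\<lambda>v. 0)" for x :: 'a
    using frechet_derivative_at[OF has_derivative_const] by metis
  then show ?case using Suc by simp
qed simp

lemma Ck_on_bounded_linear:
  assumes "bounded_linear L" "open S" "Ck_on k S f"
  shows "Ck_on k S (\<lambda>x. L (f x))"
  using assms(3)
proof (induction k arbitrary: f)
  case 0
  then show ?case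
    using bounded_linear.continuous_on[OF assms(1)] by auto
next
  case (Suc k)
  show ?case
    by (rule Ck_on_SucE[OF Suc.prems], rule Ck_on_SucI[OF assms(2)])
      (auto intro!: bounded_linear.has_derivative[OF assms(1)] Suc.IH)
qed

lemma Ck_on_add:
  assumes "open S" "Ck_on k S f" "Ck_on k S g"
  shows "Ck_on k S (\<lambda>x. f x + g x)"
  using assms(2,3)
proof (induction k arbitrary: f g)
  case 0
  then show ?case by (auto intro: continuous_intros)
next
  case (Suc k)
  show ?case
    by (rule Ck_on_SucE[OF Suc.prems(1)], rule Ck_on_SucE[OF Suc.prems(2)], 
        rule Ck_on_SucI[OF assms(1), where D = "\<lambda>x v. frechet_derivative f (at x) v + frechet_derivative g (at x) v"])
      (auto intro!: has_derivative_add Suc.IH)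
qed

lemma Ck_on_bilinear:
  assumes "bounded_bilinear B" "open S" "Ck_on k S f" "Ck_on k S g"
  shows "Ck_on k S (\<lambda>x. B (f x) (g x))"
  using assms(3,4)
proof (induction k arbitrary: f g)
  case 0
  then show ?case using bounded_bilinear.continuous_on[OF assms(1)] by auto
next
  case (Suc k)
  show ?case
    by (rule Ck_on_SucE[OF Suc.prems(1)], rule Ck_on_SucE[OF Suc.prems(2)], rule Ck_on_SucI[OF assms(2)])
      (auto intro!: bounded_bilinear.FDERIV[OF assms(1)] Ck_on_add[OF assms(2)] Suc.IH
         Ck_on_SucD[OF Suc.prems(1)] Ck_on_SucD[OF Suc.prems(2)])
qed

lemma Ck_on_sum:
  assumes "open S" "\<And>i. i \<in> I \<Longrightarrow> Ck_on k S (f i)"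
  shows "Ck_on k S (\<lambda>x. \<Sum>i\<in>I. f i x)"
proof (cases "finite I")
  case True
  then show ?thesis using assms(2)
    by (induction I rule: finite_induct) (auto intro!: Ck_on_const Ck_on_add[OF assms(1)])
qed (simp add: Ck_on_const)

text \<open>The chain rule applies the derivative of \<open>g\<close> to a vector that varies with
  \<open>x\<close>, while \<open>Ck_on\<close> speaks of fixed directions. Expanding that vector in
  the basis of the middle space leaves a finite sum of products of functions of class
  \<open>k\<close>; hence the finite-dimensional \<open>'b\<close>.\<close>

lemma Ck_on_compose:
  fixes f :: "'a::real_normed_vector \<Rightarrow> 'b::euclidean_space"
    and g :: "'b \<Rightarrow> 'c::real_normed_vector"
  assumes "open S" "f ` S \<subseteq> T" "Ck_on k S f" "Ck_on k T g"
  shows "Ck_on k S (\<lambda>x. g (f x))"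
  using assms(3,4)
proof (induction k arbitrary: g)
  case 0
  then show ?case using continuous_on_compose2 assms(2) by auto
next
  case (Suc k)
  show ?case
  proof (rule Ck_on_SucE[OF Suc.prems(1)], rule Ck_on_SucE[OF Suc.prems(2)])
    assume f: "\<And>x. x \<in> S \<Longrightarrow> (f has_derivative frechet_derivative f (at x)) (at x)"
      "\<And>v. Ck_on k S (\<lambda>x. frechet_derivative f (at x) v)"
      and g: "\<And>x. x \<in> T \<Longrightarrow> (g has_derivative frechet_derivative g (at x)) (at x)"
      "\<And>v. Ck_on k T (\<lambda>x. frechet_derivative g (at x) v)"
    show ?thesis
    proof (rule Ck_on_SucI[OF assms(1)])
      fix x assume x: "x \<in> S"
      let ?D = "\<lambda>x v. \<Sum>b\<in>Basis. (frechet_derivative f (at x) v \<bullet> b) *\<^sub>R frechet_derivative g (at (f x)) b"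
      have lin: "linear (frechet_derivative g (at (f x)))"
        using g(1) assms(2) x has_derivative_linear by blast
      have "frechet_derivative g (at (f x)) (\<Sum>b\<in>Basis. (w \<bullet> b) *\<^sub>R b)
          = (\<Sum>b\<in>Basis. (w \<bullet> b) *\<^sub>R frechet_derivative g (at (f x)) b)" for w
        by (simp add: linear_sum[OF lin] linear_scale[OF lin])
      then have "(\<lambda>v. frechet_derivative g (at (f x)) (frechet_derivative f (at x) v)) = ?D x"
        by (subst (asm) euclidean_representation) blast
      moreover have "((\<lambda>x. g (f x)) has_derivative (\<lambda>v. frechet_derivative g (at (f x)) (frechet_derivative f (at x) v))) (at x)"
        by (rule has_derivative_compose[OF f(1)[OF x]]) (use g(1) assms(2) x in auto)
      ultimately show "((\<lambda>x. g (f x)) has_derivative ?D x) (at x)"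
        by (simp only:)
    next
      fix v
      show "Ck_on k S (\<lambda>x. \<Sum>b\<in>Basis. (frechet_derivative f (at x) v \<bullet> b) *\<^sub>R
               frechet_derivative g (at (f x)) b)"
        by (intro Ck_on_sum Ck_on_bilinear[OF bounded_bilinear_scaleR]
            Ck_on_bounded_linear[OF bounded_linear_inner_left] assms(1) f(2) Suc.IH g(2)
            Ck_on_SucD[OF Suc.prems(1)])
    qed
  qed
qed

lemma Ck_on_inverse:
  fixes f :: "'a::real_normed_vector \<Rightarrow> real"
  assumes "open S" "\<And>x. x \<in> S \<Longrightarrow> f x \<noteq> 0" "Ck_on k S f"
  shows "Ck_on k S (\<lambda>x. inverse (f x))"
  using assms(3)
proof (induction k)
  case 0
  then show ?case using assms(2) by (auto intro: continuous_intros)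
next
  case (Suc k)
  show ?case
  proof (rule Ck_on_SucE[OF Suc.prems], rule Ck_on_SucI[OF assms(1)])
    fix x assume x: "x \<in> S"
    assume f: "\<And>x. x \<in> S \<Longrightarrow> (f has_derivative frechet_derivative f (at x)) (at x)"
    show "((\<lambda>x. inverse (f x)) has_derivative
        (\<lambda>v. - (inverse (f x) * frechet_derivative f (at x) v * inverse (f x)))) (at x)"
      by (rule Deriv.has_derivative_inverse[OF assms(2)[OF x] f[OF x]])
  next
    fix v
    assume f: "\<And>v. Ck_on k S (\<lambda>x. frechet_derivative f (at x) v)"
    show "Ck_on k S (\<lambda>x. - (inverse (f x) * frechet_derivative f (at x) v * inverse (f x)))"
      by (intro Ck_on_bounded_linear[OF bounded_linear_minus[OF bounded_linear_ident]]
          Ck_on_bilinear[OF bounded_bilinear_mult] Suc.IH Ck_on_SucD[OF Suc.prems] f assms(1))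
  qed
qed

lemma Ck_on_powr:
  fixes f :: "'a::real_normed_vector \<Rightarrow> real"
  assumes "open S" "\<And>x. x \<in> S \<Longrightarrow> f x > 0" "Ck_on k S f"
  shows "Ck_on k S (\<lambda>x. f x powr a)"
  using assms(3)
proof (induction k arbitrary: a)
  case 0
  then show ?case using assms(2)
    by (auto intro!: continuous_on_powr simp: less_imp_neq[symmetric])
next
  case (Suc k)
  show ?case
  proof (rule Ck_on_SucE[OF Suc.prems], rule Ck_on_SucI[OF assms(1)])
    fix x assume x: "x \<in> S"
    assume f: "\<And>x. x \<in> S \<Longrightarrow> (f has_derivative frechet_derivative f (at x)) (at x)"
    have "((\<lambda>y. y powr a) has_field_derivative a * f x powr (a - 1)) (at (f x))"
      by (rule has_real_derivative_powr) (use assms(2) x in auto)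
    then have "((\<lambda>y. y powr a) has_derivative (\<lambda>h. a * f x powr (a - 1) * h)) (at (f x))"
      by (simp add: has_field_derivative_def)
    from has_derivative_compose[OF f[OF x] this]
    show "((\<lambda>x. f x powr a) has_derivative
        (\<lambda>v. a * f x powr (a - 1) * frechet_derivative f (at x) v)) (at x)" .
  next
    fix v
    assume f: "\<And>v. Ck_on k S (\<lambda>x. frechet_derivative f (at x) v)"
    show "Ck_on k S (\<lambda>x. a * f x powr (a - 1) * frechet_derivative f (at x) v)"
      by (intro Ck_on_bilinear[OF bounded_bilinear_mult] Ck_on_const f Suc.IH assms(1)
          Ck_on_SucD[OF Suc.prems])
  qed
qed

lemma smooth_onD: "smooth_on S f \<Longrightarrow> Ck_on k S f"
  by (simp add: smooth_on_def)

lemma smooth_on_subset: "smooth_on S f \<Longrightarrow> T \<subseteq> S \<Longrightarrow> smooth_on T f"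
  unfolding smooth_on_def using Ck_on_subset by blast

lemma smooth_on_cong:
  "smooth_on S f \<Longrightarrow> open S \<Longrightarrow> (\<And>x. x \<in> S \<Longrightarrow> f x = g x) \<Longrightarrow> smooth_on S g"
  unfolding smooth_on_def using Ck_on_cong by blast

lemma smooth_on_local:
  "(\<And>x. x \<in> S \<Longrightarrow> \<exists>U. open U \<and> x \<in> U \<and> smooth_on U f) \<Longrightarrow> smooth_on S f"
  unfolding smooth_on_def by (meson Ck_on_local)

lemma smooth_on_const: "smooth_on S (\<lambda>x. c)"
  by (simp add: smooth_on_def Ck_on_const)

lemma smooth_on_id: "open S \<Longrightarrow> smooth_on S (\<lambda>x. x)"
  unfolding smooth_on_def
proof
  fix k assume S: "open S"
  show "Ck_on k S (\<lambda>x. x)"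
    by (cases k) (auto intro!: Ck_on_SucI[OF S] has_derivative_ident Ck_on_const simp del: Ck_on.simps(2))
qed

lemma smooth_on_bounded_linear:
  "bounded_linear L \<Longrightarrow> open S \<Longrightarrow> smooth_on S f \<Longrightarrow> smooth_on S (\<lambda>x. L (f x))"
  by (simp add: smooth_on_def Ck_on_bounded_linear)

lemma smooth_on_add:
  "open S \<Longrightarrow> smooth_on S f \<Longrightarrow> smooth_on S g \<Longrightarrow> smooth_on S (\<lambda>x. f x + g x)"
  by (simp add: smooth_on_def Ck_on_add)

lemma smooth_on_bilinear:
  "bounded_bilinear B \<Longrightarrow> open S \<Longrightarrow> smooth_on S f \<Longrightarrow> smooth_on S g \<Longrightarrow> smooth_on S (\<lambda>x. B (f x) (g x))"
  by (simp add: smooth_on_def Ck_on_bilinear)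

lemmas smooth_on_scaleR = smooth_on_bilinear[OF bounded_bilinear_scaleR]
  and smooth_on_inner = smooth_on_bilinear[OF bounded_bilinear_inner]

lemma smooth_on_mult:
  fixes f g :: "'a::real_normed_vector \<Rightarrow> real"
  shows "open S \<Longrightarrow> smooth_on S f \<Longrightarrow> smooth_on S g \<Longrightarrow> smooth_on S (\<lambda>x. f x * g x)"
  by (rule smooth_on_bilinear[OF bounded_bilinear_mult])

lemma smooth_on_minus: "open S \<Longrightarrow> smooth_on S f \<Longrightarrow> smooth_on S (\<lambda>x. - f x)"
  by (rule smooth_on_bounded_linear[OF bounded_linear_minus[OF bounded_linear_ident]])

lemma smooth_on_diff:
  "open S \<Longrightarrow> smooth_on S f \<Longrightarrow> smooth_on S g \<Longrightarrow> smooth_on S (\<lambda>x. f x - g x)"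
  using smooth_on_add[of S f "\<lambda>x. - g x"] smooth_on_minus[of S g] by simp

lemma smooth_on_sum:
  "open S \<Longrightarrow> (\<And>i. i \<in> I \<Longrightarrow> smooth_on S (f i)) \<Longrightarrow> smooth_on S (\<lambda>x. \<Sum>i\<in>I. f i x)"
  by (simp add: smooth_on_def Ck_on_sum)

lemma smooth_on_prod:
  fixes f :: "'i \<Rightarrow> 'a::real_normed_vector \<Rightarrow> real"
  assumes "open S" "\<And>i. i \<in> I \<Longrightarrow> smooth_on S (f i)"
  shows "smooth_on S (\<lambda>x. \<Prod>i\<in>I. f i x)"
proof (cases "finite I")
  case True
  then show ?thesis using assms(2)
    by (induction I rule: finite_induct) (auto intro!: smooth_on_const smooth_on_mult[OF assms(1)])
qed (simp add: smooth_on_const)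

lemma smooth_on_inverse:
  fixes f :: "'a::real_normed_vector \<Rightarrow> real"
  shows "open S \<Longrightarrow> (\<And>x. x \<in> S \<Longrightarrow> f x \<noteq> 0) \<Longrightarrow> smooth_on S f \<Longrightarrow> smooth_on S (\<lambda>x. inverse (f x))"
  by (simp add: smooth_on_def Ck_on_inverse)

lemma smooth_on_divide:
  fixes f :: "'a::real_normed_vector \<Rightarrow> real"
  shows "open S \<Longrightarrow> (\<And>x. x \<in> S \<Longrightarrow> g x \<noteq> 0) \<Longrightarrow> smooth_on S f \<Longrightarrow> smooth_on S g
    \<Longrightarrow> smooth_on S (\<lambda>x. f x / g x)"
  unfolding divide_inverse by (intro smooth_on_mult smooth_on_inverse)

lemma smooth_on_powr:
  fixes f :: "'a::real_normed_vector \<Rightarrow> real"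
  shows "open S \<Longrightarrow> (\<And>x. x \<in> S \<Longrightarrow> f x > 0) \<Longrightarrow> smooth_on S f \<Longrightarrow> smooth_on S (\<lambda>x. f x powr a)"
  by (simp add: smooth_on_def Ck_on_powr)

lemma smooth_on_compose:
  fixes f :: "'a::real_normed_vector \<Rightarrow> 'b::euclidean_space"
  shows "smooth_on S f \<Longrightarrow> smooth_on T g \<Longrightarrow> open S \<Longrightarrow> f ` S \<subseteq> T \<Longrightarrow> smooth_on S (\<lambda>x. g (f x))"
  unfolding smooth_on_def using Ck_on_compose by blast

lemma smooth_on_nth: "open S \<Longrightarrow> smooth_on S f \<Longrightarrow> smooth_on S (\<lambda>x. f x $ i)"
  by (rule smooth_on_bounded_linear[OF bounded_linear_vec_nth])

lemma smooth_on_det: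
  fixes M :: "'a::real_normed_vector \<Rightarrow> real^'n^'n"
  assumes "open S" "\<And>i j. smooth_on S (\<lambda>x. M x $ i $ j)"
  shows "smooth_on S (\<lambda>x. det (M x))"
  unfolding det_def by (intro smooth_on_sum smooth_on_mult smooth_on_prod smooth_on_const assms)

text \<open>Away from zeros the absolute value is the square root of the positive function
  \<open>f x * f x\<close>.\<close>

lemma smooth_on_abs_nonzero:
  fixes f :: "'a::real_normed_vector \<Rightarrow> real"
  assumes S: "open S" and nz: "\<And>x. x \<in> S \<Longrightarrow> f x \<noteq> 0" and f: "smooth_on S f"
  shows "smooth_on S (\<lambda>x. \<bar>f x\<bar>)"
proof -
  have "0 < f x * f x" if "x \<in> S" for x using nz[OF that] not_square_less_zero[of "f x"] by (smt (verit) mult_eq_0_iff)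
  then have "smooth_on S (\<lambda>x. (f x * f x) powr (1/2))"
    by (intro smooth_on_powr smooth_on_mult S f)
  then show ?thesis
    by (simp add: powr_half_sqrt)
qed

lemma smooth_on_sqrt:
  fixes f :: "'a::real_normed_vector \<Rightarrow> real"
  assumes "open S" "\<And>x. x \<in> S \<Longrightarrow> f x > 0" "smooth_on S f"
  shows "smooth_on S (\<lambda>x. sqrt (f x))"
  using smooth_on_cong[OF smooth_on_powr[OF assms, of "1/2"] assms(1)] assms(2)
  by (simp add: powr_half_sqrt less_imp_le)

lemma smooth_on_differentiable: "smooth_on S f \<Longrightarrow> x \<in> S \<Longrightarrow> f differentiable (at x)"
  using smooth_onD[of S f "Suc 0"] by simp

lemma smooth_on_imp_continuous_on: "smooth_on S f \<Longrightarrow> continuous_on S f"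
  using smooth_onD[of S f 0] by simp

lemma smooth_on_derivative: "smooth_on S f \<Longrightarrow> smooth_on S (\<lambda>x. frechet_derivative f (at x) v)"
  unfolding smooth_on_def using Ck_on.simps(2) by blast

section \<open>A function on the line that vanishes to infinite order at 0\<close>

lemma poly_div_exp_tendsto_0: "((\<lambda>x. x ^ k * poly p x / exp x) \<longlongrightarrow> (0::real)) at_top"
proof (induction p arbitrary: k)
  case (pCons a p)
  \<comment> \<open>The factor \<open>x ^ k\<close> in the statement takes up the variable that
    \<open>pCons\<close> puts in front of the remaining polynomial.\<close>
  have "((\<lambda>x. a * (x ^ k / exp x) + x ^ Suc k * poly p x / exp x) \<longlongrightarrow> a * 0 + 0) at_top"
    by (intro tendsto_intros tendsto_power_div_exp_0 pCons.IH)
  then show ?case by (simp add: algebra_simps add_divide_distrib)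
qed simp

text \<open>The functions \<open>P(1/x) exp(-1/x)\<close>, extended by \<open>0\<close> to \<open>x \<le> 0\<close>, are closed under
  differentiation.\<close>

definition flat :: "real poly \<Rightarrow> real \<Rightarrow> real" where
  "flat p x = (if x \<le> 0 then 0 else poly p (inverse x) / exp (inverse x))"

text \<open>The derivative of p(t) exp(-t) is (p'(t) - p(t)) exp(-t), and the inner derivative of t
  = 1/x is -t^2.\<close>

definition flat_deriv :: "real poly \<Rightarrow> real poly" where
  "flat_deriv p = monom 1 2 * (p - pderiv p)"

lemma flat_has_derivative:
  "(flat p has_real_derivative flat (flat_deriv p) x) (at x)"
proof (cases x "0::real" rule: linorder_cases)
  case less
  have "(flat p has_real_derivative 0) (at x)"
    by (rule has_field_derivative_transform_within_open[where S = "{..<0}" and f = "\<lambda>x. 0"])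
      (use less in \<open>auto simp: flat_def\<close>)
  then show ?thesis using less by (simp add: flat_def)
next
  case greater
  have "((\<lambda>t. poly p t / exp t) has_real_derivative
      (poly (pderiv p) t * exp t - poly p t * exp t) / (exp t * exp t)) (at t)" for t
    by (rule DERIV_divide[OF poly_DERIV DERIV_exp]) simp
  then have "((\<lambda>t. poly p t / exp t) has_real_derivative poly (pderiv p - p) t / exp t) (at t)" for t
    by (simp add: left_diff_distrib[symmetric])
  from DERIV_chain2[OF this DERIV_inverse[of x UNIV]]
  have "((\<lambda>x. poly p (inverse x) / exp (inverse x)) has_real_derivative
      poly (pderiv p - p) (inverse x) / exp (inverse x) * - (inverse x)\<^sup>2) (at x)"
    using greater by (simp add: power2_eq_square)
  moreover have "poly (pderiv p - p) (inverse x) / exp (inverse x) * - (inverse x)\<^sup>2 = flat (flat_deriv p) x"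
    using greater by (simp add: flat_def flat_deriv_def poly_monom right_diff_distrib left_diff_distrib diff_divide_distrib mult.commute)
  ultimately have "((\<lambda>x. poly p (inverse x) / exp (inverse x)) has_real_derivative flat (flat_deriv p) x) (at x)"
    by (simp only:)
  then show ?thesis
    by (rule has_field_derivative_transform_within_open[where S = "{0<..}"])
      (use greater in \<open>auto simp: flat_def\<close>)
next
  case equal
  have "((\<lambda>h. flat p h / h) \<longlongrightarrow> 0) (at_right 0)"
  proof -
    \<comment> \<open>In the variable t = 1/h the difference quotient at 0 is t p(t) exp(-t); this
      is where the exponent 1 comes from.\<close>
    have "((\<lambda>h. inverse h ^ 1 * poly p (inverse h) / exp (inverse h)) \<longlongrightarrow> 0) (at_right 0)"
      by (rule filterlim_compose[OF poly_div_exp_tendsto_0 filterlim_inverse_at_top_right])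
    then show ?thesis
      by (rule Lim_transform_eventually)
        (auto simp: eventually_at_right_field flat_def field_simps intro!: exI[of _ 1])
  qed
  moreover have "((\<lambda>h. flat p h / h) \<longlongrightarrow> 0) (at_left 0)"
    by (rule Lim_transform_eventually[OF tendsto_const])
      (auto simp: eventually_at_left_field flat_def intro!: exI[of _ "-1"])
  ultimately have "((\<lambda>h. flat p h / h) \<longlongrightarrow> 0) (at 0)"
    using filterlim_split_at by blast
  then show ?thesis using equal by (simp add: DERIV_def flat_def)
qed

lemma smooth_on_flat: "smooth_on UNIV (flat p)"
  unfolding smooth_on_def
proof
  fix k show "Ck_on k UNIV (flat p)"
  proof (induction k arbitrary: p)
    case 0
    then show ?case
      using DERIV_isCont[OF flat_has_derivative] by (simp add: continuous_at_imp_continuous_on)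
  next
    case (Suc k)
    show ?case
    proof (rule Ck_on_SucI)
      show "(flat p has_derivative (\<lambda>h. flat (flat_deriv p) x * h)) (at x)" for x
        using flat_has_derivative[of p x] by (simp only: has_field_derivative_def)
      show "Ck_on k UNIV (\<lambda>x. flat (flat_deriv p) x * v)" for v
        by (intro Ck_on_bilinear[OF bounded_bilinear_mult] Suc Ck_on_const open_UNIV)
    qed simp
  qed
qed

lemma flat_1: "x \<le> 0 \<Longrightarrow> flat 1 x = 0" "x > 0 \<Longrightarrow> flat 1 x > 0" "flat 1 x \<ge> 0"
  by (auto simp: flat_def)

section \<open>The standard cross product and \<open>G\<^sub>2\<close> linear algebra on \<open>\<real>\<^sup>7\<close>\<close>

lemma exhaust_7: fixes x :: 7
  shows "x = 1 \<or> x = 2 \<or> x = 3 \<or> x = 4 \<or> x = 5 \<or> x = 6 \<or> x = 7"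
proof (induct x)
  case (of_int z)
  then have "z = 0 \<or> z = 1 \<or> z = 2 \<or> z = 3 \<or> z = 4 \<or> z = 5 \<or> z = 6" by fastforce
  then show ?case by auto
qed

lemma UNIV_7: "UNIV = {1, 2, 3, 4, 5, 6, 7::7}"
  using exhaust_7 by auto

lemma forall_7: "(\<forall>i::7. P i) \<longleftrightarrow> P 1 \<and> P 2 \<and> P 3 \<and> P 4 \<and> P 5 \<and> P 6 \<and> P 7"
  by (metis exhaust_7)

lemma sum_7: "sum f (UNIV::7 set) = f 1 + f 2 + f 3 + f 4 + f 5 + f 6 + f 7"
  unfolding UNIV_7 by (simp add: ac_simps)

lemma inner_7: "x \<bullet> y = x$1 * y$1 + x$2 * y$2 + x$3 * y$3 + x$4 * y$4 + x$5 * y$5 + x$6 * y$6 + x$7 * y$7"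
  for x y :: "real^7"
  by (simp only: inner_vec_def sum_7 inner_real_def)

definition cross0 :: "real^7 \<Rightarrow> real^7 \<Rightarrow> real^7" where
  "cross0 x y = (\<chi> k. phi0 x y (axis k 1))"

lemma wedge3_expand: "wedge3 i j k x y z =
    (x$j * y$k - x$k * y$j) * z$i + (x$k * y$i - x$i * y$k) * z$j + (x$i * y$j - x$j * y$i) * z$k"
  by (simp add: wedge3_def det_3 vector_3 algebra_simps)

lemma phi0_expand: "phi0 x y z =
    ((x$2 * y$3 - x$3 * y$2) + (x$4 * y$5 - x$5 * y$4) + (x$6 * y$7 - x$7 * y$6)) * z$1
  + ((x$3 * y$1 - x$1 * y$3) + (x$4 * y$6 - x$6 * y$4) - (x$5 * y$7 - x$7 * y$5)) * z$2
  + ((x$1 * y$2 - x$2 * y$1) - (x$4 * y$7 - x$7 * y$4) - (x$5 * y$6 - x$6 * y$5)) * z$3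
  + ((x$5 * y$1 - x$1 * y$5) + (x$6 * y$2 - x$2 * y$6) - (x$7 * y$3 - x$3 * y$7)) * z$4
  + ((x$1 * y$4 - x$4 * y$1) - (x$7 * y$2 - x$2 * y$7) - (x$6 * y$3 - x$3 * y$6)) * z$5
  + ((x$7 * y$1 - x$1 * y$7) + (x$2 * y$4 - x$4 * y$2) - (x$3 * y$5 - x$5 * y$3)) * z$6
  + ((x$1 * y$6 - x$6 * y$1) - (x$2 * y$5 - x$5 * y$2) - (x$3 * y$4 - x$4 * y$3)) * z$7"
  by (simp add: phi0_def wedge3_expand algebra_simps)

lemma cross0_nth:
  "cross0 x y $ 1 = (x$2 * y$3 - x$3 * y$2) + (x$4 * y$5 - x$5 * y$4) + (x$6 * y$7 - x$7 * y$6)"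
  "cross0 x y $ 2 = (x$3 * y$1 - x$1 * y$3) + (x$4 * y$6 - x$6 * y$4) - (x$5 * y$7 - x$7 * y$5)"
  "cross0 x y $ 3 = (x$1 * y$2 - x$2 * y$1) - (x$4 * y$7 - x$7 * y$4) - (x$5 * y$6 - x$6 * y$5)"
  "cross0 x y $ 4 = (x$5 * y$1 - x$1 * y$5) + (x$6 * y$2 - x$2 * y$6) - (x$7 * y$3 - x$3 * y$7)"
  "cross0 x y $ 5 = (x$1 * y$4 - x$4 * y$1) - (x$7 * y$2 - x$2 * y$7) - (x$6 * y$3 - x$3 * y$6)"
  "cross0 x y $ 6 = (x$7 * y$1 - x$1 * y$7) + (x$2 * y$4 - x$4 * y$2) - (x$3 * y$5 - x$5 * y$3)"
  "cross0 x y $ 7 = (x$1 * y$6 - x$6 * y$1) - (x$2 * y$5 - x$5 * y$2) - (x$3 * y$4 - x$4 * y$3)"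
  by (simp_all add: cross0_def phi0_expand axis_def)

lemma phi0_cross0: "phi0 x y z = cross0 x y \<bullet> z"
  by (simp only: phi0_expand inner_7 cross0_nth)

lemma bilinear_cross0: "bilinear cross0"
  unfolding bilinear_def
  by (intro conjI allI linearI; simp add: vec_eq_iff forall_7 cross0_nth algebra_simps)

lemma cross0_self: "cross0 x x = 0"
  by (simp add: vec_eq_iff forall_7 cross0_nth)

text \<open>This is the alternative law x(xy) = (xx)y of the octonions, read on imaginary elements.
  Together with the skewness of \<open>phi0\<close> it gives the norm identity
  \<open>inner_cross0\<close>.\<close>

lemma cross0_cross0: "cross0 x (cross0 x y) = (x \<bullet> y) *\<^sub>R x - (x \<bullet> x) *\<^sub>R y"
  unfolding vec_eq_iff forall_7
  by (intro conjI; simp only: cross0_nth inner_7 vector_minus_component vector_scaleR_component real_scaleR_def;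
      simp add: algebra_simps)

lemma phi0_swap: "phi0 x y z = - phi0 x z y" "phi0 x y z = - phi0 y x z"
  by (simp_all add: phi0_expand algebra_simps)

lemma inner_cross0: "cross0 x y \<bullet> cross0 x z = (x \<bullet> x) * (y \<bullet> z) - (x \<bullet> y) * (x \<bullet> z)"
proof -
  have "cross0 x y \<bullet> cross0 x z = - (cross0 x (cross0 x y) \<bullet> z)"
    using phi0_swap(1)[of x z "cross0 x y"] by (simp add: phi0_cross0 inner_commute)
  then show ?thesis by (simp add: cross0_cross0 inner_diff_left)
qed

section \<open>Rank-one perturbations, congruence and determinants\<close>

definition outer :: "real^'n \<Rightarrow> real^'m \<Rightarrow> real^'m^'n" where
  "outer a b = (\<chi> i j. a$i * b$j)"

lemma outer_vector_mult: "outer a b *v x = (b \<bullet> x) *\<^sub>R a"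
  by (simp add: vec_eq_iff outer_def matrix_vector_mult_def inner_vec_def sum_distrib_left mult_ac)

lemma matrix_mul_outer: "A ** outer a b = outer (A *v a) b"
  by (simp add: vec_eq_iff outer_def matrix_matrix_mult_def matrix_vector_mult_def
      sum_distrib_right sum_distrib_left mult_ac)

lemma outer_matrix_mul: "outer a b ** B = outer a (transpose B *v b)"
  by (simp add: vec_eq_iff outer_def matrix_matrix_mult_def vector_matrix_mult_def sum_distrib_left mult_ac)

lemma matrix_add_rdistrib: "(B + C) ** A = B ** A + C ** A" for A :: "'a::semiring_1^'n^'m"
  by (simp add: vec_eq_iff matrix_matrix_mult_def distrib_right sum.distrib)

lemma det_scaleR: "det (c *\<^sub>R A) = c ^ CARD('n) * det A" for A :: "real^'n^'n"
  using det_rows_mul[of "\<lambda>i. c" "\<lambda>i. A $ i"]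
  by (simp add: scalar_mult_eq_scaleR scaleR_vec_def)

text \<open>An orthogonal change of basis turns \<open>a\<close> into a multiple of a coordinate
  vector. Then \<open>outer a b\<close> changes a single row of the identity, and the determinant is
  the diagonal entry of that row.\<close>

lemma det_one_plus_outer: "det (mat 1 + outer a b) = 1 + a \<bullet> b" for a b :: "real^'n"
proof (cases "a = 0")
  case True
  then show ?thesis by (simp add: outer_def zero_vec_def[symmetric])
next
  case False
  fix k :: 'n
  define r where "r = norm a"
  have r: "r \<noteq> 0" using False by (simp add: r_def)
  obtain Q where Q: "orthogonal_matrix Q" "Q *v axis k 1 = a /\<^sub>R r"
    using orthogonal_matrix_exists_basis[of "a /\<^sub>R r" k] False by (auto simp: r_def)
  have a: "a = r *\<^sub>R (Q *v axis k 1)" using Q(2) r by simp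
  have QQ: "transpose Q ** Q = mat 1" using Q(1) by (simp add: orthogonal_matrix_def)
  define x where "x = axis k 1 + r *\<^sub>R (transpose Q *v b)"
  have "transpose Q *v a = r *\<^sub>R axis k 1"
    by (simp add: a matrix_vector_mult_scaleR matrix_vector_mul_assoc QQ)
  then have "transpose Q ** (mat 1 + outer a b) ** Q = mat 1 + outer (r *\<^sub>R axis k 1) (transpose Q *v b)"
    by (simp add: matrix_add_ldistrib matrix_add_rdistrib matrix_mul_outer outer_matrix_mul QQ)
  also have "\<dots> = (\<chi> i. if i = k then \<Sum>i\<in>UNIV. x$i *s row i (mat 1) else row i (mat 1))"
  proof -
    have "(\<Sum>i\<in>UNIV. x$i *s row i (mat 1)) = (\<Sum>i\<in>UNIV. x$i *s axis i 1)"
      by (intro sum.cong) (auto simp: vec_eq_iff row_def mat_def axis_def)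
    then have "(\<Sum>i\<in>UNIV. x$i *s row i (mat 1)) = x" by (simp add: basis_expansion)
    then show ?thesis
      by (auto simp: vec_eq_iff x_def outer_def row_def mat_def axis_def)
  qed
  finally have "det (transpose Q ** (mat 1 + outer a b) ** Q) = x $ k"
    by (simp add: cramer_lemma_transpose)
  moreover have "det (transpose Q ** (mat 1 + outer a b) ** Q) = det (mat 1 + outer a b)"
  proof -
    have "det Q * det Q = 1" using QQ det_mul[of "transpose Q" Q] by simp
    then show ?thesis by (simp add: det_mul)
  qed
  moreover have "x $ k = 1 + a \<bullet> b"
  proof -
    have "(transpose Q *v b) $ k = axis k 1 \<bullet> (transpose Q *v b)" by (simp add: inner_axis')
    also have "\<dots> = (Q *v axis k 1) \<bullet> b" by simp (metis dot_lmul_matrix inner_commute)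
    finally show ?thesis by (simp add: x_def a)
  qed
  ultimately show ?thesis by simp
qed

definition bmat :: "(real^'n \<Rightarrow> real^'n \<Rightarrow> real) \<Rightarrow> real^'n^'n" where
  "bmat \<beta> = (\<chi> i j. \<beta> (axis i 1) (axis j 1))"

lemma linear_axis_expand:
  fixes x :: "real^'n"
  assumes "linear f"
  shows "f x = (\<Sum>i\<in>UNIV. x$i *\<^sub>R f (axis i 1))"
proof -
  have "f x = f (\<Sum>i\<in>UNIV. x$i *\<^sub>R axis i 1)"
    using basis_expansion[of x] by (simp add: scalar_mult_eq_scaleR)
  then show ?thesis by (simp only: linear_sum[OF assms] linear_scale[OF assms])
qed

lemma bmat_apply:
  assumes "bilinear \<beta>"
  shows "x \<bullet> (bmat \<beta> *v y) = \<beta> x y"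
proof -
  have l: "linear (\<lambda>x. \<beta> x y)" "linear (\<beta> x)" for x y
    using assms by (auto simp: bilinear_def)
  have "\<beta> x y = (\<Sum>i\<in>UNIV. x$i *\<^sub>R (\<Sum>j\<in>UNIV. y$j *\<^sub>R \<beta> (axis i 1) (axis j 1)))"
    by (subst linear_axis_expand[OF l(1)], subst linear_axis_expand[OF l(2)]) simp
  then show ?thesis
    by (simp add: bmat_def matrix_vector_mult_def inner_vec_def mult_ac)
qed

lemma bmat_congruence:
  assumes "bilinear \<beta>"
  shows "transpose U ** bmat \<beta> ** U = bmat (\<lambda>x y. \<beta> (U *v x) (U *v y))"
proof -
  have "(transpose U ** bmat \<beta> ** U) $ i $ j = \<beta> (U *v axis i 1) (U *v axis j 1)" for i j
  proof -
    have "(transpose U ** bmat \<beta> ** U) $ i $ j = axis i 1 \<bullet> ((transpose U ** bmat \<beta> ** U) *v axis j 1)"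
      by (simp add: inner_axis' matrix_vector_mult_basis column_def)
    also have "\<dots> = ((bmat \<beta> *v (U *v axis j 1)) v* U) \<bullet> axis i 1"
      by (simp add: matrix_vector_mul_assoc[symmetric] inner_commute)
    also have "\<dots> = (U *v axis i 1) \<bullet> (bmat \<beta> *v (U *v axis j 1))"
      by (metis dot_lmul_matrix inner_commute)
    finally show ?thesis by (simp add: bmat_apply[OF assms])
  qed
  then show ?thesis by (simp add: vec_eq_iff bmat_def)
qed

lemma bmat_phi0:
  "bmat (phi0 a) *v y = - cross0 a y" "transpose (bmat (phi0 a)) *v y = cross0 a y"
proof -
  have l: "bilinear (phi0 a)"
    unfolding bilinear_def phi0_cross0
    by (intro conjI allI linearI)
      (simp_all add: bilinear_radd[OF bilinear_cross0] bilinear_rmul[OF bilinear_cross0] inner_add inner_commute)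
  have "x \<bullet> (bmat (phi0 a) *v y) = x \<bullet> (- cross0 a y)" for x
    using phi0_swap(1)[of a x y] by (simp add: bmat_apply[OF l] phi0_cross0 inner_commute)
  then show 1: "bmat (phi0 a) *v y = - cross0 a y"
    by (metis vector_eq_ldot)
  have "x \<bullet> (transpose (bmat (phi0 a)) *v y) = x \<bullet> cross0 a y" for x
    using bmat_apply[OF l, of y x] by (simp add: dot_lmul_matrix inner_commute[of x] phi0_cross0)
  then show "transpose (bmat (phi0 a)) *v y = cross0 a y"
    by (metis vector_eq_ldot)
qed

text \<open>The skew form \<open>\<phi>\<^sub>0(a,\<cdot>,\<cdot>)\<close> has kernel \<open>a\<close>, so adding \<open>\<zeta>\<^sup>2\<close> makes it nondegenerate and the
  determinant of the sum depends only on \<open>a\<close> and \<open>\<zeta>(a)\<close>. This recovers \<open>|a|\<close> from \<open>\<phi>\<^sub>0\<close> and a volume.\<close>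

lemma det_phi0_plus_outer:
  assumes "\<zeta> \<bullet> a = 1"
  shows "\<bar>det (bmat (phi0 a) + outer \<zeta> \<zeta>)\<bar> = (a \<bullet> a)\<^sup>2"
proof -
  define \<Omega> where "\<Omega> = bmat (phi0 a)"
  define s where "s = a \<bullet> a"
  have "a \<noteq> 0" using assms by auto
  then have s: "s > 0" by (simp add: s_def)
  define \<xi> where "\<xi> = a /\<^sub>R s"
  define \<eta> where "\<eta> = \<zeta> - \<xi>"
  \<comment> \<open>\<open>P\<close> is a shear along the kernel \<open>a\<close> of \<Omega>. It
    leaves \<Omega> unchanged and its transpose carries \<xi> to \<zeta>, so the given covector may
    be replaced by the multiple \<xi> of \<open>a\<close>, for which everything is explicit.\<close>
  define P where "P = mat 1 + outer a \<eta>"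
  define N where "N = \<Omega> + outer \<xi> \<xi>"
  have a\<xi>: "a \<bullet> \<xi> = 1" "\<xi> \<bullet> a = 1" "\<xi> \<bullet> \<xi> = inverse s" using s by (simp_all add: \<xi>_def s_def field_simps)
  have \<Omega>a: "\<Omega> *v a = 0" "transpose \<Omega> *v a = 0" "\<Omega> *v \<xi> = 0"
    by (simp_all add: \<Omega>_def bmat_phi0 bmat_phi0(2)[simplified] cross0_self \<xi>_def matrix_vector_mult_scaleR)
  have z: "outer (0::real^7) x = 0" "outer x (0::real^7) = 0" for x :: "real^7"
    by (simp_all add: outer_def vec_eq_iff)
  have "det P = 1"
    using assms by (simp add: P_def det_one_plus_outer \<eta>_def inner_diff_right a\<xi> inner_commute[of a \<zeta>])
  moreover have "transpose P ** N ** P = \<Omega> + outer \<zeta> \<zeta>"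
  proof -
    have tP: "transpose P = mat 1 + outer \<eta> a"
      by (simp add: P_def transpose_def vec_eq_iff outer_def mat_def mult_ac)
    have 1: "transpose P *v \<xi> = \<zeta>"
      by (simp add: tP matrix_vector_mult_add_rdistrib outer_vector_mult a\<xi> \<eta>_def)
    have "\<Omega> ** P = \<Omega>" "transpose P ** \<Omega> = \<Omega>"
      by (simp_all add: P_def tP[unfolded P_def] matrix_add_ldistrib matrix_add_rdistrib matrix_mul_outer outer_matrix_mul \<Omega>a \<Omega>a(2)[simplified] z)
    then show ?thesis
      by (simp add: N_def matrix_add_ldistrib matrix_add_rdistrib matrix_mul_outer outer_matrix_mul 1 1[simplified])
  qed
  ultimately have 1: "det (\<Omega> + outer \<zeta> \<zeta>) = det N"
    by (metis det_mul det_transpose mult_1 mult.right_neutral)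
  \<comment> \<open>\<open>N ** transpose N\<close> acts as s on the complement of \<open>a\<close>
    and as s^(-2) on \<open>a\<close> itself; \<open>k\<close> is the coefficient of the rank-one
    term that produces the second eigenvalue. Its determinant is therefore s^6 s^(-2) = s^4, and
    that of \<open>N\<close> is s^2 up to sign.\<close>
  define k where "k = (inverse s * inverse s * inverse s - 1) / s"
  have k: "s * k = inverse s * inverse s * inverse s - 1" using s by (simp add: k_def)
  have "N ** transpose N = s *\<^sub>R (mat 1 + outer (k *\<^sub>R a) a)"
  proof -
    have "(N ** transpose N) *v y = s *\<^sub>R ((mat 1 + outer (k *\<^sub>R a) a) *v y)" for y
    proof -
      have t: "transpose N = transpose \<Omega> + outer \<xi> \<xi>"
        by (simp add: N_def transpose_def vec_eq_iff outer_def mult_ac)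
      have "\<xi> \<bullet> cross0 a y = 0"
        using phi0_swap(1)[of a y a] by (simp add: \<xi>_def phi0_cross0[symmetric] inner_commute[of a])
          (simp add: phi0_expand)
      then have \<xi>c: "\<xi> \<bullet> cross0 a y = 0" .
      have c0: "cross0 a \<xi> = 0"
        by (simp add: \<xi>_def bilinear_rmul[OF bilinear_cross0] cross0_self)
      have "transpose N *v y = cross0 a y + (\<xi> \<bullet> y) *\<^sub>R \<xi>"
        unfolding t matrix_vector_mult_add_rdistrib outer_vector_mult \<Omega>_def bmat_phi0 ..
      moreover have "N *v v = - cross0 a v + (\<xi> \<bullet> v) *\<^sub>R \<xi>" for v
        unfolding N_def matrix_vector_mult_add_rdistrib outer_vector_mult \<Omega>_def bmat_phi0 ..
      ultimately have "(N ** transpose N) *v y = - cross0 a (cross0 a y) + (inverse s * (\<xi> \<bullet> y)) *\<^sub>R \<xi>"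
        by (simp only: matrix_vector_mul_assoc[symmetric])
          (simp add: bilinear_radd[OF bilinear_cross0] bilinear_rmul[OF bilinear_cross0] c0 \<xi>c inner_add_right a\<xi> mult.commute)
      also have "\<dots> = s *\<^sub>R y + (inverse s * inverse s * inverse s - 1) *\<^sub>R ((a \<bullet> y) *\<^sub>R a)"
        by (simp add: cross0_cross0 \<xi>_def s_def[symmetric] algebra_simps)
      finally show ?thesis
        unfolding k[symmetric]
        by (simp add: matrix_vector_mult_add_rdistrib outer_vector_mult scaleR_add_right mult_ac)
    qed
    then show ?thesis
      by (simp add: matrix_eq scaleR_matrix_vector_assoc)
  qed
  then have "det N * det N = s ^ 7 * (1 + s * k)"
    by (simp add: det_mul[symmetric, of N "transpose N", unfolded det_transpose] det_scaleR det_one_plus_outer s_def[symmetric] mult.commute)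
  also have "\<dots> = (s\<^sup>2)\<^sup>2"
    unfolding k using s by (simp add: field_simps power_numeral_reduce)
  finally have "\<bar>det N\<bar> = \<bar>s\<^sup>2\<bar>" by (metis power2_eq_square power2_eq_iff abs_eq_iff)
  then show ?thesis using 1 by (simp add: \<Omega>_def s_def)
qed


section \<open>The metric of a definite form from determinants\<close>

text \<open>The squared length of \<open>x\<close> up to volume. The covector is one with value 1 at
  \<open>x\<close>; for forms equivalent to \<open>phi0\<close> any other such covector would give
  the same value. The root turns the fourth power of the length into the second.\<close>

definition form_scale :: "(real^7 \<Rightarrow> real^7 \<Rightarrow> real^7 \<Rightarrow> real) \<Rightarrow> real^7 \<Rightarrow> real" where
  "form_scale \<psi> x = sqrt \<bar>det (bmat (\<psi> x) + outer (x /\<^sub>R (x \<bullet> x)) (x /\<^sub>R (x \<bullet> x)))\<bar>"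

text \<open>Congruence by \<open>U\<close> leads to the matrix of \<open>phi0 a\<close> plus the
  square of a covector that still has the value 1 at \<open>a\<close>. The determinant picks up the
  square of \<open>det U\<close>, of which the root leaves the absolute value.\<close>

lemma form_scale_eq:
  assumes U: "det U \<noteq> 0" and \<psi>: "\<And>x y z. \<psi> (U *v x) (U *v y) (U *v z) = phi0 x y z" and a: "a \<noteq> 0"
  shows "form_scale \<psi> (U *v a) = (a \<bullet> a) / \<bar>det U\<bar>"
proof -
  obtain V where V: "U ** V = mat 1" "V ** U = mat 1"
    using U by (auto simp: invertible_det_nz[symmetric] invertible_def)
  have UV: "U *v (V *v x) = x" for x by (simp add: matrix_vector_mul_assoc V)
  define x where "x = U *v a"
  define \<xi> where "\<xi> = x /\<^sub>R (x \<bullet> x)"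
  have "x \<noteq> 0" using a V(2) by (metis matrix_vector_mul_assoc matrix_vector_mul_lid matrix_vector_mult_0_right x_def)
  then have \<xi>: "\<xi> \<bullet> x = 1" by (simp add: \<xi>_def)
  have "\<psi> x y z = cross0 (V *v x) (V *v y) \<bullet> (V *v z)" for y z
    using \<psi>[of "V *v x" "V *v y" "V *v z"] by (simp add: UV phi0_cross0)
  then have bil: "bilinear (\<psi> x)"
    unfolding bilinear_def
    by (intro conjI allI linearI)
      (simp_all add: bilinear_radd[OF bilinear_cross0] bilinear_rmul[OF bilinear_cross0] inner_add
        matrix_vector_right_distrib matrix_vector_mult_scaleR)
  define N where "N = bmat (\<psi> x) + outer \<xi> \<xi>"
  have "transpose U ** N ** U = bmat (phi0 a) + outer (transpose U *v \<xi>) (transpose U *v \<xi>)"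
    by (simp only: N_def matrix_add_ldistrib matrix_add_rdistrib bmat_congruence[OF bil] matrix_mul_outer
        outer_matrix_mul)
      (simp only: x_def \<psi>)
  moreover have "(transpose U *v \<xi>) \<bullet> a = 1"
    using \<xi> by (simp add: dot_lmul_matrix x_def)
  ultimately have "\<bar>det (transpose U ** N ** U)\<bar> = (a \<bullet> a)\<^sup>2"
    using det_phi0_plus_outer by metis
  then have "\<bar>det N\<bar> = ((a \<bullet> a) / \<bar>det U\<bar>)\<^sup>2"
    using U by (simp add: det_mul abs_mult power2_eq_square field_simps)
  then show ?thesis
    by (simp add: form_scale_def x_def[symmetric] \<xi>_def[symmetric] N_def[symmetric] real_sqrt_divide)
qed

definition form_gram :: "(real^7 \<Rightarrow> real^7 \<Rightarrow> real^7 \<Rightarrow> real) \<Rightarrow> real^7^7" where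
  "form_gram \<psi> = (\<chi> i j. (form_scale \<psi> (axis i 1 + axis j 1)
      - form_scale \<psi> (axis i 1) - form_scale \<psi> (axis j 1)) / 2)"

text \<open>Polarization yields the true Gram matrix divided by d, the absolute value of
  \<open>det U\<close>. Its determinant is d^(-9): seven factors from the scaling and two from the
  true Gram matrix. The power -1/9 of that determinant is the missing factor d.\<close>

definition form_metric :: "(real^7 \<Rightarrow> real^7 \<Rightarrow> real^7 \<Rightarrow> real) \<Rightarrow> real^7^7" where
  "form_metric \<psi> = (det (form_gram \<psi>) powr (- (1/9))) *\<^sub>R form_gram \<psi>"

lemma
  assumes U: "det U \<noteq> 0" and \<psi>: "\<And>x y z. \<psi> (U *v x) (U *v y) (U *v z) = phi0 x y z"
  shows form_scale_pos: "x \<noteq> 0 \<Longrightarrow> form_scale \<psi> x > 0"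
    and det_form_gram_pos: "det (form_gram \<psi>) > 0"
    and form_metric_eq: "(U *v x) \<bullet> (form_metric \<psi> *v (U *v y)) = x \<bullet> y"
proof -
  obtain V where V: "U ** V = mat 1" "V ** U = mat 1"
    using U by (auto simp: invertible_det_nz[symmetric] invertible_def)
  have UV: "U *v (V *v x) = x" for x by (simp add: matrix_vector_mul_assoc V)
  have VU: "V *v (U *v x) = x" for x by (simp add: matrix_vector_mul_assoc V)
  have sc: "form_scale \<psi> x = ((V *v x) \<bullet> (V *v x)) / \<bar>det U\<bar>" if "x \<noteq> 0" for x
    using form_scale_eq[OF U \<psi>, of "V *v x"] UV[of x] that by (metis matrix_vector_mult_0_right)
  then show "form_scale \<psi> x > 0" if "x \<noteq> 0" for x
    using that UV[of x] U by (metis divide_pos_pos inner_gt_zero_iff matrix_vector_mult_0_right zero_less_abs_iff)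
  define G where "G = transpose V ** V"
  have Gx: "x \<bullet> (G *v y) = (V *v x) \<bullet> (V *v y)" for x y
    by (simp add: G_def matrix_vector_mul_assoc[symmetric]) (metis dot_lmul_matrix inner_commute)
  have Gij: "G $ i $ j = (V *v axis i 1) \<bullet> (V *v axis j 1)" for i j
    by (simp only: Gx[symmetric]) (simp add: inner_axis' matrix_vector_mult_basis column_def)
  have ax: "axis i 1 \<noteq> (0::real^7)" for i by (simp add: axis_eq_0_iff)
  have ax2: "axis i 1 + axis j 1 \<noteq> (0::real^7)" for i j
  proof
    assume "axis i 1 + axis j 1 = (0::real^7)"
    then have "(axis i 1 + axis j 1) $ i = (0::real)" by simp
    then show False by (simp add: axis_def split: if_splits)
  qed
  have gram: "form_gram \<psi> = (1 / \<bar>det U\<bar>) *\<^sub>R G"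
  proof -
    have "form_gram \<psi> $ i $ j = (1 / \<bar>det U\<bar>) * G $ i $ j" for i j
      by (simp add: form_gram_def sc ax ax2 Gij matrix_vector_right_distrib inner_add
          diff_divide_distrib[symmetric] inner_commute)
    then show ?thesis by (simp add: vec_eq_iff)
  qed
  have "det U * det V = 1" using V(1) det_mul[of U V] by simp
  then have "det V = 1 / det U" using U by (simp add: field_simps)
  then have "det G = (1 / \<bar>det U\<bar>)\<^sup>2" by (simp add: G_def det_mul power2_eq_square)
  then have d: "det (form_gram \<psi>) = (1 / \<bar>det U\<bar>) ^ 9"
    unfolding gram det_scaleR by (simp only: power_add[symmetric]) simp
  then show "det (form_gram \<psi>) > 0" using U by simp
  have "(1 / \<bar>det U\<bar>) ^ 9 = \<bar>det U\<bar> powr (- 9)"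
    using U by (simp add: powr_minus_divide power_one_over)
  then have "det (form_gram \<psi>) powr (- (1/9)) = \<bar>det U\<bar>"
    unfolding d using U by (simp only: powr_powr) simp
  then have "form_metric \<psi> = G" using U by (simp add: form_metric_def gram)
  then show "(U *v x) \<bullet> (form_metric \<psi> *v (U *v y)) = x \<bullet> y" for x y
    by (simp add: Gx VU)
qed

section \<open>Cross products for an arbitrary inner product\<close>

text \<open>The assumptions are what multiplicativity of the norm gives on a fibre of an octonion
  bundle. In chart coordinates the metric is not the standard inner product, so \<open>g\<close>
  stays general.\<close>

locale cross_product =
  fixes g :: "real^7 \<Rightarrow> real^7 \<Rightarrow> real" and c :: "real^7 \<Rightarrow> real^7 \<Rightarrow> real^7"
  assumes bil_g: "bilinear g" and sym: "g x y = g y x" and pos: "x \<noteq> 0 \<Longrightarrow> g x x > 0"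
    and bil_c: "bilinear c" and self: "c x x = 0" and orth: "g (c x y) y = 0"
    and norm: "g (c x y) (c x y) = g x x * g y y - (g x y)\<^sup>2"
begin

lemmas g_simps = bilinear_ladd[OF bil_g] bilinear_radd[OF bil_g] bilinear_lmul[OF bil_g] bilinear_rmul[OF bil_g]
  bilinear_lneg[OF bil_g] bilinear_rneg[OF bil_g] bilinear_lsub[OF bil_g] bilinear_rsub[OF bil_g]
  bilinear_lzero[OF bil_g] bilinear_rzero[OF bil_g]
lemmas c_simps = bilinear_ladd[OF bil_c] bilinear_radd[OF bil_c] bilinear_lmul[OF bil_c] bilinear_rmul[OF bil_c]
  bilinear_lneg[OF bil_c] bilinear_rneg[OF bil_c] bilinear_lsub[OF bil_c] bilinear_rsub[OF bil_c]
  bilinear_lzero[OF bil_c] bilinear_rzero[OF bil_c]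

lemma skew: "c y x = - c x y"
  using self[of "x + y"] self[of x] self[of y] by (simp add: c_simps eq_neg_iff_add_eq_0 add.commute)

lemma swap: "g (c x z) y = - g (c x y) z"
  using orth[of x "y + z"] orth[of x y] orth[of x z] by (simp add: c_simps g_simps)

lemma orth': "g (c x y) x = 0"
  using orth[of y x] skew[of x y] by (simp add: g_simps)

lemma ext: "(\<And>z. g x z = g y z) \<Longrightarrow> x = y"
  using pos[of "x - y"] by (force simp: g_simps)

lemma norm2: "g (c x y) (c x z) = g x x * g y z - g x y * g x z"
  using norm[of x "y + z"] norm[of x y] norm[of x z] sym[of "c x y" "c x z"] sym[of y z]
  by (simp add: c_simps g_simps power2_eq_square algebra_simps)

lemma cc: "c x (c x y) = g x y *\<^sub>R x - g x x *\<^sub>R y"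
proof (rule ext)
  fix z show "g (c x (c x y)) z = g (g x y *\<^sub>R x - g x x *\<^sub>R y) z"
    using swap[of x "c x y" z] norm2[of x z y] by (simp add: g_simps sym)
qed

text \<open>Polarization of \<open>cc\<close> in the first argument: on mutually orthogonal vectors
  the operators \<open>c x\<close> and \<open>c z\<close> anticommute. The entries of the
  multiplication table that mix three generators start from it.\<close>

lemma cc2: "c x (c z y) = g x y *\<^sub>R z + g z y *\<^sub>R x - (2 * g x z) *\<^sub>R y - c z (c x y)"
  using cc[of "x + z" y] cc[of x y] cc[of z y] sym[of x z]
  by (simp add: c_simps g_simps algebra_simps)

text \<open>Orthogonality for \<open>g\<close> is standard orthogonality to the images under
  \<open>bmat g\<close>, so a dimension count provides the vector and scaling makes it a unit
  vector.\<close>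

lemma ex_unit_orthogonal:
  assumes "finite T" "card T < 7"
  shows "\<exists>x. g x x = 1 \<and> (\<forall>t\<in>T. g t x = 0)"
proof -
  have "dim ((\<lambda>t. bmat g *v t) ` T) < DIM(real^7)"
    using assms dim_le_card'[of "(\<lambda>t. bmat g *v t) ` T"] card_image_le[OF assms(1), of "\<lambda>t. bmat g *v t"] by simp
  from orthogonal_to_subspace_exists[OF this] obtain x where
    x: "x \<noteq> 0" "\<And>y. y \<in> span ((\<lambda>t. bmat g *v t) ` T) \<Longrightarrow> orthogonal x y" by blast
  have "g t x = 0" if "t \<in> T" for t
    using x(2)[OF span_base, of "bmat g *v t"] that bmat_apply[OF bil_g, of x t] sym[of t x]
    by (auto simp: orthogonal_def)
  moreover have "g (x /\<^sub>R sqrt (g x x)) (x /\<^sub>R sqrt (g x x)) = 1"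
    using pos[OF x(1)] by (simp add: g_simps field_simps)
  ultimately show ?thesis
    by (intro exI[of _ "x /\<^sub>R sqrt (g x x)"]) (auto simp: g_simps)
qed

text \<open>The basis is the standard generation of the octonions by three elements:
  \<open>e\<^sub>3 = e\<^sub>1 e\<^sub>2\<close>, then \<open>e\<^sub>4\<close> orthogonal to the quaternions \<open>e\<^sub>1, e\<^sub>2, e\<^sub>3\<close>, and \<open>e\<^sub>5 = e\<^sub>1 e\<^sub>4\<close>, \<open>e\<^sub>6 = e\<^sub>2 e\<^sub>4\<close>,
  \<open>e\<^sub>7 = e\<^sub>1 e\<^sub>6\<close>.\<close>

theorem standard_basis:
  obtains U where "linear U" "\<And>x y. g (U x) (U y) = x \<bullet> y" "\<And>x y. c (U x) (U y) = U (cross0 x y)"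
proof -
  obtain e1 where e1: "g e1 e1 = 1" using ex_unit_orthogonal[of "{}"] by auto
  obtain e2 where e2: "g e2 e2 = 1" "g e1 e2 = 0" using ex_unit_orthogonal[of "{e1}"] by auto
  define e3 where "e3 = c e1 e2"
  obtain e4 where e4: "g e4 e4 = 1" "g e1 e4 = 0" "g e2 e4 = 0" "g e3 e4 = 0"
  proof -
    have "card {e1, e2, e3} \<le> 3"
      using card_length[of "[e1, e2, e3]"] by simp
    then show ?thesis using ex_unit_orthogonal[of "{e1,e2,e3}"] that by auto
  qed
  define e5 where "e5 = c e1 e4"
  define e6 where "e6 = c e2 e4"
  define e7 where "e7 = c e1 e6"
  have o3: "g e1 e3 = 0" "g e2 e3 = 0" "g e3 e3 = 1"
    using orth[of e1 e2] orth'[of e1 e2] norm[of e1 e2] e1 e2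
    by (simp_all add: e3_def sym[of e1 "c e1 e2"] sym[of e2 "c e1 e2"])
  have t12: "c e1 e2 = e3" by (simp add: e3_def)
  have t13: "c e1 e3 = - e2" using e1 e2 by (simp add: e3_def cc)
  have t23: "c e2 e3 = e1" using e1 e2 cc[of e2 e1] by (simp add: e3_def skew[of e1 e2] c_simps sym[of e2 e1])
  have t14: "c e1 e4 = e5" by (simp add: e5_def)
  have t15: "c e1 e5 = - e4" using e1 e4 by (simp add: e5_def cc)
  have t45: "c e4 e5 = e1" using e1 e4 cc[of e4 e1] by (simp add: e5_def skew[of e1 e4] c_simps sym[of e4 e1])
  have t24: "c e2 e4 = e6" by (simp add: e6_def)
  have t26: "c e2 e6 = - e4" using e2 e4 by (simp add: e6_def cc)
  have t46: "c e4 e6 = e2" using e2 e4 cc[of e4 e2] by (simp add: e6_def skew[of e2 e4] c_simps sym[of e4 e2])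
  have o5: "g e1 e5 = 0" "g e2 e5 = 0" "g e3 e5 = 0" "g e4 e5 = 0" "g e5 e5 = 1"
    using orth'[of e1 e4] orth[of e1 e4] swap[of e1 e2 e4] swap[of e1 e3 e4] norm[of e1 e4] e1 e2 e4
    by (simp_all add: t14 t12 t13 g_simps sym[of e1 e5] sym[of e2 e5] sym[of e3 e5] sym[of e4 e5])
  have o6: "g e1 e6 = 0" "g e2 e6 = 0" "g e3 e6 = 0" "g e4 e6 = 0" "g e5 e6 = 0" "g e6 e6 = 1"
  proof -
    have "g (c e4 e1) (c e4 e2) = 0" using e1 e2 e4 by (simp add: norm2 sym[of e4 e1])
    then show "g e5 e6 = 0" using skew[of e4 e1] skew[of e4 e2] by (simp add: t14 t24 g_simps)
  qed (use orth'[of e2 e4] orth[of e2 e4] swap[of e2 e1 e4] swap[of e2 e3 e4] skew[of e2 e1] norm[of e2 e4] e1 e2 e4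
      in \<open>simp_all add: t24 t12 t23 g_simps sym[of e1 e6] sym[of e2 e6] sym[of e3 e6] sym[of e4 e6]\<close>)
  have t16: "c e1 e6 = e7" by (simp add: e7_def)
  have t17: "c e1 e7 = - e6" using e1 o6 by (simp add: e7_def cc)
  have t67: "c e6 e7 = e1" using cc[of e6 e1] o6 by (simp add: e7_def skew[of e1 e6] c_simps sym[of e6 e1])
  \<comment> \<open>The triple e1, e2, e4 antiassociates: (e1 e2) e4 = - e1 (e2 e4). The signs of
    the remaining entries follow from this.\<close>
  have t34: "c e3 e4 = - e7"
    using cc2[of e4 e1 e2] e2 e4 skew[of e3 e4] skew[of e4 e2]
    by (simp add: t12 t24 t16 sym[of e4 e1] sym[of e4 e2] c_simps)
  have t25: "c e2 e5 = - e7"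
    using cc2[of e2 e1 e4] e2 e4 by (simp add: t14 t24 t16 sym[of e2 e1])
  have o7: "g e1 e7 = 0" "g e2 e7 = 0" "g e3 e7 = 0" "g e4 e7 = 0" "g e5 e7 = 0" "g e6 e7 = 0" "g e7 e7 = 1"
    using orth'[of e1 e6] orth[of e1 e6] swap[of e1 e2 e6] swap[of e1 e3 e6] swap[of e1 e4 e6] swap[of e1 e5 e6]
      norm[of e1 e6] e1 o6
    by (simp_all add: t16 t12 t13 t14 t15 g_simps sym[of e1 e7] sym[of e2 e7] sym[of e3 e7] sym[of e4 e7]
        sym[of e5 e7] sym[of e6 e7])
  have t47: "c e4 e7 = - e3" using cc[of e4 e3] e4 skew[of e3 e4] by (simp add: t34 sym[of e4 e3])
  have t37: "c e3 e7 = e4" using cc[of e3 e4] e4 o3 by (simp add: t34 c_simps)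
  have t27: "c e2 e7 = e5" using cc[of e2 e5] e2 o5 by (simp add: t25 c_simps)
  have t57: "c e5 e7 = - e2" using cc[of e5 e2] skew[of e2 e5] o5 by (simp add: t25 c_simps sym[of e5 e2])
  have t35: "c e3 e5 = - e6"
    using cc2[of e3 e1 e4] o3 e4 by (simp add: t14 t34 t17 sym[of e3 e1] c_simps)
  have t36: "c e3 e6 = e5" using cc[of e3 e5] o3 o5 by (simp add: t35 c_simps)
  have t56: "c e5 e6 = - e3" using cc[of e5 e3] skew[of e3 e5] o5 by (simp add: t35 c_simps sym[of e5 e3])
  note t = t12 t13 t14 t15 t16 t17 t23 t24 t25 t26 t27 t34 t35 t36 t37 t45 t46 t47 t56 t57 t67
  have t': "c e2 e1 = - e3" "c e3 e1 = e2" "c e4 e1 = - e5" "c e5 e1 = e4" "c e6 e1 = - e7" "c e7 e1 = e6"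
    "c e3 e2 = - e1" "c e4 e2 = - e6" "c e5 e2 = e7" "c e6 e2 = e4" "c e7 e2 = - e5" "c e4 e3 = e7"
    "c e5 e3 = e6" "c e6 e3 = - e5" "c e7 e3 = - e4" "c e5 e4 = - e1" "c e6 e4 = - e2" "c e7 e4 = e3"
    "c e6 e5 = e3" "c e7 e5 = e2" "c e7 e6 = - e1"
    using skew[of e2 e1] skew[of e3 e1] skew[of e4 e1] skew[of e5 e1] skew[of e6 e1] skew[of e7 e1]
      skew[of e3 e2] skew[of e4 e2] skew[of e5 e2] skew[of e6 e2] skew[of e7 e2] skew[of e4 e3] skew[of e5 e3]
      skew[of e6 e3] skew[of e7 e3] skew[of e5 e4] skew[of e6 e4] skew[of e7 e4] skew[of e6 e5] skew[of e7 e5] skew[of e7 e6]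
    unfolding t by (metis minus_minus)+
  define E :: "7 \<Rightarrow> real^7" where "E i = (if i = 1 then e1 else if i = 2 then e2 else if i = 3 then e3
    else if i = 4 then e4 else if i = 5 then e5 else if i = 6 then e6 else e7)" for i
  have E: "E 1 = e1" "E 2 = e2" "E 3 = e3" "E 4 = e4" "E 5 = e5" "E 6 = e6" "E 7 = e7"
    by (simp_all add: E_def)
  define U where "U x = (\<Sum>i\<in>UNIV. x$i *\<^sub>R E i)" for x :: "real^7"
  have lin: "linear U"
    unfolding U_def by (intro linearI) (simp_all add: scaleR_add_left sum.distrib scaleR_sum_right)
  have Uax: "U (axis i 1) = E i" for i
    by (simp add: U_def axis_def if_distrib[of "\<lambda>r. r *\<^sub>R _"] cong: if_cong)
  have "g (U x) (U y) = x \<bullet> y" for x y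
    unfolding U_def sum_7 inner_7 E
    by (simp add: g_simps e1 e2 e4 o3 o5 o6 o7 sym[of e7 e1] sym[of e7 e2] sym[of e7 e3] sym[of e7 e4] sym[of e7 e5] sym[of e7 e6] sym[of e6 e1] sym[of e6 e2] sym[of e6 e3] sym[of e6 e4] sym[of e6 e5]
        sym[of e5 e1] sym[of e5 e2] sym[of e5 e3] sym[of e5 e4] sym[of e4 e1] sym[of e4 e2] sym[of e4 e3]
        sym[of e3 e1] sym[of e3 e2] sym[of e2 e1])
  moreover have "c (U x) (U y) = U (cross0 x y)" for x y
  proof -
    have b1: "bilinear (\<lambda>x y. c (U x) (U y))"
      unfolding bilinear_def by (intro conjI allI linearI) (simp_all add: c_simps linear_add[OF lin] linear_scale[OF lin])
    have b2: "bilinear (\<lambda>x y. U (cross0 x y))"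
      unfolding bilinear_def
      by (intro conjI allI linearI)
        (simp_all add: bilinear_ladd[OF bilinear_cross0] bilinear_radd[OF bilinear_cross0]
          bilinear_lmul[OF bilinear_cross0] bilinear_rmul[OF bilinear_cross0] linear_add[OF lin] linear_scale[OF lin])
    have "\<forall>i j. c (E i) (E j) = U (cross0 (axis i 1) (axis j 1))"
      unfolding U_def sum_7 forall_7 E cross0_nth t t' self
      by (simp add: axis_def)
    then show ?thesis
      using bilinear_eq_stdbasis[OF b1 b2] by (force simp: Basis_vec_def Uax dest: fun_cong)
  qed
  ultimately show ?thesis using that[OF lin] by blast
qed

end

section \<open>Charts, tangent vectors and smooth sections\<close>

text \<open>The Hausdorff property makes compact supports closed, so that functions and fields
  extend by zero; second countability provides a countable exhaustion.\<close>

locale manifold =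
  fixes A :: "('a::{t2_space, second_countable_topology}, 'n::finite) chart set"
  assumes atlas: "smooth_atlas A"
begin

lemma chart:
  assumes "c \<in> A"
  shows open_chart_dom: "open (chart_dom c)" and open_chart_img: "open (chart_img c)"
    and chart_homeomorphism: "homeomorphism (chart_dom c) (chart_img c) (coord c) (chart_inv c)"
  using atlas assms by (auto simp: smooth_atlas_def)

lemma chart_inv_coord: "c \<in> A \<Longrightarrow> p \<in> chart_dom c \<Longrightarrow> chart_inv c (coord c p) = p"
  using chart_homeomorphism by (auto simp: homeomorphism_def)

lemma coord_chart_inv:
  "y \<in> chart_img c \<Longrightarrow> coord c (chart_inv c y) = y" "y \<in> chart_img c \<Longrightarrow> chart_inv c y \<in> chart_dom c"
  by (auto simp: f_inv_into_f inv_into_into)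

lemma ex_chart: "\<exists>c. c \<in> charts_at A p"
  using atlas by (force simp: smooth_atlas_def charts_at_def)

lemma charts_atD: "c \<in> charts_at A p \<Longrightarrow> c \<in> A \<and> p \<in> chart_dom c"
  by (simp add: charts_at_def)

lemma open_coord_image:
  assumes "c \<in> A" "open U" "U \<subseteq> chart_dom c"
  shows "open (coord c ` U)"
proof -
  have "openin (top_of_set (chart_dom c)) U"
    using assms by (metis Int_absorb1 openin_open)
  then have "openin (top_of_set (chart_img c)) (coord c ` U)"
    using homeomorphism_imp_open_map[OF chart_homeomorphism[OF assms(1)]] by blast
  then show ?thesis using open_chart_img[OF assms(1)] openin_open_trans by blast
qed

lemma transition_smooth:
  "c \<in> A \<Longrightarrow> c' \<in> A \<Longrightarrow> smooth_on (coord c ` (chart_dom c \<inter> chart_dom c')) (transition c c')"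
  using atlas by (auto simp: smooth_atlas_def)

lemma transition_has_derivative:
  assumes "c \<in> charts_at A p" "c' \<in> charts_at A p"
  shows "(transition c c' has_derivative frechet_derivative (transition c c') (at (coord c p))) (at (coord c p))"
  using smooth_on_differentiable[OF transition_smooth[of c c'], of "coord c p"] assms
  by (auto simp: charts_at_def frechet_derivative_works)

lemma transition_derivative_linear:
  "c \<in> charts_at A p \<Longrightarrow> c' \<in> charts_at A p \<Longrightarrow> linear (frechet_derivative (transition c c') (at (coord c p)))"
  using transition_has_derivative has_derivative_linear by blast

lemma transition_coord: "c \<in> charts_at A p \<Longrightarrow> transition c c' (coord c p) = coord c' p"
  by (simp add: charts_at_def chart_inv_coord)

lemma transition_chain:
  assumes "c \<in> charts_at A p" "c' \<in> charts_at A p" "c'' \<in> charts_at A p"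
  shows "frechet_derivative (transition c c'') (at (coord c p)) v
    = frechet_derivative (transition c' c'') (at (coord c' p)) (frechet_derivative (transition c c') (at (coord c p)) v)"
proof -
  let ?O = "chart_dom c \<inter> chart_dom c' \<inter> chart_dom c''"
  have cA: "c \<in> A" "c' \<in> A" "c'' \<in> A" "p \<in> ?O" using assms by (auto simp: charts_at_def)
  have "((\<lambda>y. transition c' c'' (transition c c' y)) has_derivative
      (\<lambda>v. frechet_derivative (transition c' c'') (at (coord c' p)) (frechet_derivative (transition c c') (at (coord c p)) v)))
      (at (coord c p))"
    by (rule has_derivative_compose[OF transition_has_derivative[OF assms(1,2)]])
      (simp only: transition_coord[OF assms(1), of c'] transition_has_derivative[OF assms(2,3)])
  then have "(transition c c'' has_derivative
      (\<lambda>v. frechet_derivative (transition c' c'') (at (coord c' p)) (frechet_derivative (transition c c') (at (coord c p)) v)))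
      (at (coord c p))"
  proof (rule has_derivative_transform_within_open)
    show "open (coord c ` ?O)" by (intro open_coord_image open_Int open_chart_dom cA) auto
    show "coord c p \<in> coord c ` ?O" using cA by blast
    show "transition c' c'' (transition c c' y) = transition c c'' y" if "y \<in> coord c ` ?O" for y
      using that cA by (auto simp: chart_inv_coord)
  qed
  from frechet_derivative_at[OF this] show ?thesis by metis
qed

lemma transition_self:
  assumes "c \<in> charts_at A p"
  shows "frechet_derivative (transition c c) (at (coord c p)) v = v"
proof -
  have cA: "c \<in> A" "p \<in> chart_dom c" using assms by (auto simp: charts_at_def)
  have "(transition c c has_derivative (\<lambda>v. v)) (at (coord c p))"
    by (rule has_derivative_transform_within_open[OF has_derivative_ident open_chart_img[OF cA(1)]])
      (use cA in \<open>auto simp: chart_inv_coord\<close>)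
  from frechet_derivative_at[OF this] show ?thesis by metis
qed

lemma tangent_transition:
  "v \<in> tangent_space A p \<Longrightarrow> c \<in> charts_at A p \<Longrightarrow> c' \<in> charts_at A p
    \<Longrightarrow> v c' = frechet_derivative (transition c c') (at (coord c p)) (v c)"
  unfolding tangent_space_def by blast

lemma tangent_outside: "v \<in> tangent_space A p \<Longrightarrow> c \<notin> charts_at A p \<Longrightarrow> v c = 0"
  unfolding tangent_space_def by blast

lemma tangent_spaceI:
  "(\<And>c. c \<notin> charts_at A p \<Longrightarrow> v c = 0) \<Longrightarrow>
    (\<And>c c'. c \<in> charts_at A p \<Longrightarrow> c' \<in> charts_at A p
      \<Longrightarrow> v c' = frechet_derivative (transition c c') (at (coord c p)) (v c)) \<Longrightarrow> v \<in> tangent_space A p"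
  unfolding tangent_space_def by blast

lemma coord_vector_tangent:
  assumes "c \<in> charts_at A p"
  shows "coord_vector A c p x \<in> tangent_space A p"
proof (rule tangent_spaceI)
  fix c1 c2 assume c: "c1 \<in> charts_at A p" "c2 \<in> charts_at A p"
  show "coord_vector A c p x c2 = frechet_derivative (transition c1 c2) (at (coord c1 p)) (coord_vector A c p x c1)"
    using c transition_chain[OF assms c, of x] by (simp only: coord_vector_def if_True)
qed (simp add: coord_vector_def)

lemma coord_vector_same: "c \<in> charts_at A p \<Longrightarrow> coord_vector A c p x c = x"
  by (simp add: coord_vector_def transition_self)

lemma coord_vector_coord:
  "c \<in> charts_at A p \<Longrightarrow> v \<in> tangent_space A p \<Longrightarrow> coord_vector A c p (v c) = v"
  by (rule ext) (use tangent_outside tangent_transition in \<open>fastforce simp only: coord_vector_def split: if_split\<close>)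

lemma tangent_eqI:
  "v \<in> tangent_space A p \<Longrightarrow> w \<in> tangent_space A p \<Longrightarrow> c \<in> charts_at A p \<Longrightarrow> v c = w c \<Longrightarrow> v = w"
  by (metis coord_vector_coord)

lemma coord_vector_add:
  "c \<in> charts_at A p \<Longrightarrow> coord_vector A c p (x + y) = tplus (coord_vector A c p x) (coord_vector A c p y)"
  by (rule ext) (auto simp: coord_vector_def transition_derivative_linear linear_add)

lemma coord_vector_scale:
  "c \<in> charts_at A p \<Longrightarrow> coord_vector A c p (r *\<^sub>R x) = tscale r (coord_vector A c p x)"
  by (rule ext) (auto simp: coord_vector_def transition_derivative_linear linear_scale)

lemma tangent_space_subspace:
  shows tangent_add: "v \<in> tangent_space A p \<Longrightarrow> w \<in> tangent_space A p \<Longrightarrow> tplus v w \<in> tangent_space A p"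
    and tangent_scale: "v \<in> tangent_space A p \<Longrightarrow> tscale r v \<in> tangent_space A p"
    and tangent_zero: "tzero \<in> tangent_space A p"
    and tangent_sum: "(\<And>i. i \<in> I \<Longrightarrow> w' i \<in> tangent_space A p) \<Longrightarrow> (\<lambda>c. \<Sum>i\<in>I. w' i c) \<in> tangent_space A p"
proof -
  let ?D = "\<lambda>c c'. frechet_derivative (transition c c') (at (coord c p))"
  note lin = transition_derivative_linear
  show "tplus v w \<in> tangent_space A p" if v: "v \<in> tangent_space A p" and w: "w \<in> tangent_space A p"
  proof (rule tangent_spaceI)
    fix c c' assume c: "c \<in> charts_at A p" "c' \<in> charts_at A p"
    show "v c' + w c' = ?D c c' (v c + w c)"
      unfolding linear_add[OF lin[OF c]] using tangent_transition[OF v c] tangent_transition[OF w c] by (simp only:)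
  qed (simp add: tangent_outside[OF v] tangent_outside[OF w])
  show "tscale r v \<in> tangent_space A p" if v: "v \<in> tangent_space A p"
  proof (rule tangent_spaceI)
    fix c c' assume c: "c \<in> charts_at A p" "c' \<in> charts_at A p"
    show "r *\<^sub>R v c' = ?D c c' (r *\<^sub>R v c)"
      unfolding linear_scale[OF lin[OF c]] using tangent_transition[OF v c] by (simp only:)
  qed (simp add: tangent_outside[OF v])
  show "tzero \<in> tangent_space A p"
    by (rule tangent_spaceI) (simp_all only: linear_0[OF lin])
  show "(\<lambda>c. \<Sum>i\<in>I. w' i c) \<in> tangent_space A p" if w: "\<And>i. i \<in> I \<Longrightarrow> w' i \<in> tangent_space A p"
  proof (rule tangent_spaceI)
    fix c c' assume c: "c \<in> charts_at A p" "c' \<in> charts_at A p"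
    show "(\<Sum>i\<in>I. w' i c') = ?D c c' (\<Sum>i\<in>I. w' i c)"
      unfolding linear_sum[OF lin[OF c]]
      by (rule sum.cong[OF refl]) (rule tangent_transition[OF w c])
  qed (simp add: tangent_outside[OF w])
qed

section \<open>Smoothness read in a single chart\<close>

text \<open>Chart and open set are parameters, so that smoothness can be carried from one chart to
  another on an overlap and then glued.\<close>

definition smooth_in :: "('a, 'n) chart \<Rightarrow> 'a set \<Rightarrow> ('a \<Rightarrow> 'b::real_normed_vector) \<Rightarrow> bool" where
  "smooth_in c U h \<longleftrightarrow> smooth_on (coord c ` U) (\<lambda>y. h (chart_inv c y))"

lemma smooth_in_change:
  assumes "c \<in> A" "c' \<in> A" "open U" "U \<subseteq> chart_dom c \<inter> chart_dom c'" "smooth_in c U h"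
  shows "smooth_in c' U h"
proof -
  have op: "open (coord c' ` U)" using assms by (intro open_coord_image) auto
  have "smooth_on (coord c' ` U) (transition c' c)"
    by (rule smooth_on_subset[OF transition_smooth[OF assms(2,1)]]) (use assms in auto)
  then have "smooth_on (coord c' ` U) (\<lambda>y. h (chart_inv c (transition c' c y)))"
    using assms(5) op unfolding smooth_in_def
    by (rule smooth_on_compose) (use assms in \<open>auto simp: chart_inv_coord subset_eq\<close>)
  then show ?thesis
    unfolding smooth_in_def
    by (rule smooth_on_cong[OF _ op]) (use assms in \<open>auto simp: chart_inv_coord subset_eq\<close>)
qed

lemma smooth_in_subset: "smooth_in c U h \<Longrightarrow> V \<subseteq> U \<Longrightarrow> smooth_in c V h"
  unfolding smooth_in_def by (rule smooth_on_subset) auto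

lemma smooth_in_cong:
  assumes "smooth_in c U h" "c \<in> A" "open U" "U \<subseteq> chart_dom c" "\<And>q. q \<in> U \<Longrightarrow> h q = h' q"
  shows "smooth_in c U h'"
  using assms(1) unfolding smooth_in_def
  by (rule smooth_on_cong[OF _ open_coord_image]) (use assms in \<open>auto simp: chart_inv_coord subset_eq\<close>)

lemma smooth_functions_iff: "f \<in> smooth_functions A \<longleftrightarrow> (\<forall>c\<in>A. smooth_in c (chart_dom c) f)"
  by (simp add: smooth_functions_def smooth_in_def o_def)

lemma vector_fields_iff:
  "X \<in> vector_fields A \<longleftrightarrow>
    (\<forall>p. X p \<in> tangent_space A p) \<and> (\<forall>c\<in>A. smooth_in c (chart_dom c) (\<lambda>p. X p c))"
  by (simp add: vector_fields_def smooth_in_def)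

lemma smooth_in_local:
  assumes "c \<in> A" "open S" "S \<subseteq> chart_dom c"
    "\<And>p. p \<in> S \<Longrightarrow> \<exists>U. open U \<and> p \<in> U \<and> U \<subseteq> S \<and> smooth_in c U h"
  shows "smooth_in c S h"
  unfolding smooth_in_def
proof (rule smooth_on_local)
  fix y assume "y \<in> coord c ` S"
  then obtain p where p: "p \<in> S" "y = coord c p" by auto
  from assms(4)[OF p(1)] obtain U where U: "open U" "p \<in> U" "U \<subseteq> S" "smooth_in c U h" by auto
  then show "\<exists>V. open V \<and> y \<in> V \<and> smooth_on V (\<lambda>y. h (chart_inv c y))"
    using open_coord_image[OF assms(1) U(1)] assms(3) p(2) unfolding smooth_in_def by blast
qed

lemma smooth_functionsI_local:
  assumes "\<And>p. \<exists>c\<in>A. \<exists>U. open U \<and> p \<in> U \<and> U \<subseteq> chart_dom c \<and> smooth_in c U f"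
  shows "f \<in> smooth_functions A"
  unfolding smooth_functions_iff
proof (intro ballI smooth_in_local subset_refl open_chart_dom)
  fix c p assume c: "c \<in> A" "p \<in> chart_dom c"
  obtain c' U where U: "c' \<in> A" "open U" "p \<in> U" "U \<subseteq> chart_dom c'" "smooth_in c' U f"
    using assms by blast
  have "smooth_in c (U \<inter> chart_dom c) f"
    by (rule smooth_in_change[OF U(1) c(1)]) (use U c in \<open>auto simp: open_chart_dom intro: smooth_in_subset\<close>)
  then show "\<exists>U. open U \<and> p \<in> U \<and> U \<subseteq> chart_dom c \<and> smooth_in c U f"
    using U c by (intro exI[of _ "U \<inter> chart_dom c"]) (auto simp: open_chart_dom)
qed

text \<open>One chart near each point is enough: the components in another chart are combinations of
  the columns of the Jacobian, which are smooth, with the old components as coefficients.\<close>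

lemma vector_fieldsI_local:
  assumes T: "\<And>p. X p \<in> tangent_space A p"
    and "\<And>p. \<exists>c\<in>A. \<exists>U. open U \<and> p \<in> U \<and> U \<subseteq> chart_dom c \<and> smooth_in c U (\<lambda>p. X p c)"
  shows "X \<in> vector_fields A"
  unfolding vector_fields_iff
proof (intro conjI allI T ballI smooth_in_local subset_refl open_chart_dom)
  fix c p assume c: "c \<in> A" "p \<in> chart_dom c"
  obtain c' U where U: "c' \<in> A" "open U" "p \<in> U" "U \<subseteq> chart_dom c'" "smooth_in c' U (\<lambda>p. X p c')"
    using assms by blast
  let ?V = "U \<inter> chart_dom c"
  have V: "open ?V" "?V \<subseteq> chart_dom c' \<inter> chart_dom c" "?V \<subseteq> chart_dom c" "p \<in> ?V"
    using U c by (auto simp: open_chart_dom)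
  have oV: "open (coord c ` ?V)" "open (coord c' ` ?V)" using V U(1) c(1) by (auto intro: open_coord_image)
  have X: "smooth_in c ?V (\<lambda>p. X p c')"
    by (rule smooth_in_change[OF U(1) c(1) V(1,2)]) (use U in \<open>auto intro: smooth_in_subset\<close>)
  have D: "smooth_in c ?V (\<lambda>q. frechet_derivative (transition c' c) (at (coord c' q)) v)" for v
  proof (rule smooth_in_change[OF U(1) c(1) V(1,2)])
    have "smooth_on (coord c' ` ?V) (\<lambda>y. frechet_derivative (transition c' c) (at y) v)"
      by (rule smooth_on_subset[OF smooth_on_derivative[OF transition_smooth[OF U(1) c(1)]]]) (use U in auto)
    then show "smooth_in c' ?V (\<lambda>q. frechet_derivative (transition c' c) (at (coord c' q)) v)"
      unfolding smooth_in_def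
      by (rule smooth_on_cong[OF _ oV(2)]) (use U in \<open>auto simp: chart_inv_coord subset_eq\<close>)
  qed
  have "smooth_in c ?V (\<lambda>q. \<Sum>i\<in>UNIV. (X q c' $ i) *\<^sub>R
      frechet_derivative (transition c' c) (at (coord c' q)) (axis i 1))"
    using X D unfolding smooth_in_def
    by (intro smooth_on_sum smooth_on_scaleR smooth_on_nth oV)
  then have "smooth_in c ?V (\<lambda>p. X p c)"
  proof (rule smooth_in_cong[OF _ c(1) V(1,3)])
    fix q assume "q \<in> ?V"
    then have "c \<in> charts_at A q" "c' \<in> charts_at A q" using U c by (auto simp: charts_at_def)
    then show "(\<Sum>i\<in>UNIV. (X q c' $ i) *\<^sub>R frechet_derivative (transition c' c) (at (coord c' q)) (axis i 1)) = X q c"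
      using tangent_transition[OF T, of c' q c] linear_axis_expand[OF transition_derivative_linear, of c' q c "X q c'"]
      by (simp only:)
  qed
  then show "\<exists>U. open U \<and> p \<in> U \<and> U \<subseteq> chart_dom c \<and> smooth_in c U (\<lambda>p. X p c)"
    using V by blast
qed

lemma vector_field_tangent: "X \<in> vector_fields A \<Longrightarrow> X p \<in> tangent_space A p"
  by (simp add: vector_fields_def)

lemma vector_fields_glue:
  assumes "\<And>p. \<exists>W Z. open W \<and> p \<in> W \<and> Z \<in> vector_fields A \<and> (\<forall>q\<in>W. X q = Z q)"
  shows "X \<in> vector_fields A"
proof (rule vector_fieldsI_local)
  fix p
  obtain W Z where W: "open W" "p \<in> W" "Z \<in> vector_fields A" "\<forall>q\<in>W. X q = Z q"
    using assms by blast
  then show "X p \<in> tangent_space A p" by (simp add: vector_field_tangent)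
  obtain c where c: "c \<in> A" "p \<in> chart_dom c" using ex_chart charts_atD by metis
  have "smooth_in c (W \<inter> chart_dom c) (\<lambda>p. Z p c)"
    using W(3) c(1) by (auto simp: vector_fields_iff intro: smooth_in_subset)
  then have "smooth_in c (W \<inter> chart_dom c) (\<lambda>p. X p c)"
    by (rule smooth_in_cong) (use W c in \<open>auto simp: open_chart_dom\<close>)
  then show "\<exists>c\<in>A. \<exists>U. open U \<and> p \<in> U \<and> U \<subseteq> chart_dom c \<and> smooth_in c U (\<lambda>p. X p c)"
    using W c by (intro bexI[of _ c] exI[of _ "W \<inter> chart_dom c"]) (auto simp: open_chart_dom)
qed

lemma smooth_functions_continuous:
  assumes "f \<in> smooth_functions A"
  shows "continuous_on UNIV f"
proof (rule continuous_at_imp_continuous_on, rule ballI)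
  fix p
  obtain c where c: "c \<in> A" "p \<in> chart_dom c" using ex_chart charts_atD by metis
  have "continuous_on (chart_img c) (\<lambda>y. f (chart_inv c y))"
    using assms c(1) by (auto simp: smooth_functions_iff smooth_in_def intro: smooth_on_imp_continuous_on)
  moreover have "continuous_on (chart_dom c) (coord c)"
    using chart_homeomorphism[OF c(1)] by (auto simp: homeomorphism_def)
  ultimately have "continuous_on (chart_dom c) (\<lambda>p. f (chart_inv c (coord c p)))"
    by (rule continuous_on_compose2) auto
  then have "continuous_on (chart_dom c) f"
    by (rule continuous_on_eq) (use c in \<open>auto simp: chart_inv_coord\<close>)
  then show "isCont f p" using c open_chart_dom continuous_on_eq_continuous_at by blast
qed

lemma smooth_functions_const: "(\<lambda>p. r) \<in> smooth_functions A"
  by (simp add: smooth_functions_iff smooth_in_def smooth_on_const)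

lemma smooth_functions_add:
  "f \<in> smooth_functions A \<Longrightarrow> h \<in> smooth_functions A \<Longrightarrow> (\<lambda>p. f p + h p) \<in> smooth_functions A"
  by (auto simp: smooth_functions_iff smooth_in_def intro!: smooth_on_add open_chart_img)

lemma smooth_functions_mult:
  "f \<in> smooth_functions A \<Longrightarrow> h \<in> smooth_functions A \<Longrightarrow> (\<lambda>p. f p * h p) \<in> smooth_functions A"
  by (auto simp: smooth_functions_iff smooth_in_def intro!: smooth_on_mult open_chart_img)

lemma smooth_functions_minus: "f \<in> smooth_functions A \<Longrightarrow> (\<lambda>p. - f p) \<in> smooth_functions A"
  by (auto simp: smooth_functions_iff smooth_in_def intro!: smooth_on_minus open_chart_img)

lemma smooth_functions_diff:
  "f \<in> smooth_functions A \<Longrightarrow> h \<in> smooth_functions A \<Longrightarrow> (\<lambda>p. f p - h p) \<in> smooth_functions A"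
  by (auto simp: smooth_functions_iff smooth_in_def intro!: smooth_on_diff open_chart_img)

lemma smooth_functions_sum:
  "(\<And>i. i \<in> I \<Longrightarrow> f i \<in> smooth_functions A) \<Longrightarrow> (\<lambda>p. \<Sum>i\<in>I. f i p) \<in> smooth_functions A"
  by (auto simp: smooth_functions_iff smooth_in_def intro!: smooth_on_sum open_chart_img)

lemma smooth_functions_inverse:
  "f \<in> smooth_functions A \<Longrightarrow> (\<And>p. f p \<noteq> 0) \<Longrightarrow> (\<lambda>p. inverse (f p)) \<in> smooth_functions A"
  by (auto simp: smooth_functions_iff smooth_in_def intro!: smooth_on_inverse open_chart_img)

lemma smooth_functions_det:
  "(\<And>i j. (\<lambda>p. M p $ i $ j) \<in> smooth_functions A) \<Longrightarrow> (\<lambda>p. det (M p :: real^'m^'m)) \<in> smooth_functions A"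
  by (auto simp: smooth_functions_iff smooth_in_def intro!: smooth_on_det open_chart_img)

lemma vector_fields_zero: "(\<lambda>p. tzero) \<in> vector_fields A"
  by (auto simp: vector_fields_iff smooth_in_def tangent_zero intro!: smooth_on_const)

lemma vector_fields_add:
  "X \<in> vector_fields A \<Longrightarrow> Y \<in> vector_fields A \<Longrightarrow> (\<lambda>p. tplus (X p) (Y p)) \<in> vector_fields A"
  by (auto simp: vector_fields_iff smooth_in_def tangent_add intro!: smooth_on_add open_chart_img)

lemma vector_fields_scale:
  "f \<in> smooth_functions A \<Longrightarrow> X \<in> vector_fields A \<Longrightarrow> (\<lambda>p. tscale (f p) (X p)) \<in> vector_fields A"
  by (auto simp: vector_fields_iff smooth_functions_iff smooth_in_def tangent_scale
      intro!: smooth_on_scaleR open_chart_img)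

lemma vector_fields_sum:
  "(\<And>i. i \<in> I \<Longrightarrow> X i \<in> vector_fields A) \<Longrightarrow> (\<lambda>p c. \<Sum>i\<in>I. X i p c) \<in> vector_fields A"
  by (auto simp: vector_fields_iff smooth_in_def tangent_sum intro!: smooth_on_sum open_chart_img)

subsection \<open>Bump functions and cut-off coordinate fields\<close>

text \<open>In a chart, \<open>flat 1\<close> is applied to r^2 minus the squared distance from the
  centre. The result vanishes off the compact preimage \<open>K\<close> of a closed ball, and since
  \<open>K\<close> is closed the extension by zero is smooth across the boundary of the chart
  domain.\<close>

lemma bump_function:
  assumes "open U" "p \<in> U"
  obtains \<beta> K where "\<beta> \<in> smooth_functions A" "compact K" "K \<subseteq> U" "\<And>q. q \<notin> K \<Longrightarrow> \<beta> q = 0"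
    "\<And>q. \<beta> q \<ge> 0" "\<beta> p > 0"
proof -
  obtain c where c: "c \<in> A" "p \<in> chart_dom c" using ex_chart charts_atD by metis
  define V where "V = U \<inter> chart_dom c"
  have V: "open V" "p \<in> V" "V \<subseteq> chart_dom c" using assms c by (auto simp: V_def open_chart_dom)
  have "open (coord c ` V)" by (rule open_coord_image[OF c(1) V(1,3)])
  then obtain r where r: "r > 0" "cball (coord c p) r \<subseteq> coord c ` V"
    using V(2) open_contains_cball by blast
  define K where "K = chart_inv c ` cball (coord c p) r"
  have "continuous_on (chart_img c) (chart_inv c)"
    using chart_homeomorphism[OF c(1)] by (auto simp: homeomorphism_def)
  then have K: "compact K"
    unfolding K_def using r(2) V(3)
    by (intro compact_continuous_image compact_cball) (meson continuous_on_subset image_mono subset_trans)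
  have KV: "K \<subseteq> V" using r(2) V(3) c by (force simp: K_def chart_inv_coord subset_eq)
  have Kin: "q \<in> K" if "q \<in> chart_dom c" "dist (coord c p) (coord c q) \<le> r" for q
    unfolding K_def using chart_inv_coord[OF c(1) that(1)] that(2) by (metis imageI mem_cball)
  define \<beta> where "\<beta> q = (if q \<in> chart_dom c
      then flat 1 (r\<^sup>2 - (coord c q - coord c p) \<bullet> (coord c q - coord c p)) else 0)" for q
  have zero: "\<beta> q = 0" if "q \<notin> K" for q
  proof (cases "q \<in> chart_dom c")
    case True
    then have "r < norm (coord c q - coord c p)"
      using Kin that by (force simp: dist_norm norm_minus_commute)
    then have "r\<^sup>2 \<le> (coord c q - coord c p) \<bullet> (coord c q - coord c p)"
      using r(1) by (simp add: dot_square_norm power_mono)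
    then show ?thesis by (simp add: \<beta>_def flat_1)
  qed (simp add: \<beta>_def)
  have "\<beta> \<in> smooth_functions A"
  proof (rule smooth_functionsI_local)
    fix q
    show "\<exists>c\<in>A. \<exists>U. open U \<and> q \<in> U \<and> U \<subseteq> chart_dom c \<and> smooth_in c U \<beta>"
    proof (cases "q \<in> chart_dom c")
      case True
      have "smooth_on (chart_img c) (\<lambda>y. flat 1 (r\<^sup>2 - (y - coord c p) \<bullet> (y - coord c p)))"
        by (rule smooth_on_compose[OF _ smooth_on_flat])
          (auto intro!: smooth_on_diff smooth_on_inner smooth_on_const smooth_on_id open_chart_img c)
      then have "smooth_in c (chart_dom c) \<beta>"
        unfolding smooth_in_def
        by (rule smooth_on_cong[OF _ open_chart_img[OF c(1)]]) (auto simp: \<beta>_def coord_chart_inv)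
      then show ?thesis using True c open_chart_dom by blast
    next
      case False
      obtain c' where c': "c' \<in> A" "q \<in> chart_dom c'" using ex_chart charts_atD by metis
      have o: "open (chart_dom c' \<inter> - K)"
        using c' K by (auto simp: open_chart_dom open_Int compact_imp_closed open_Compl)
      have "smooth_in c' (chart_dom c' \<inter> - K) (\<lambda>q. 0::real)"
        by (simp add: smooth_in_def smooth_on_const)
      then have "smooth_in c' (chart_dom c' \<inter> - K) \<beta>"
        by (rule smooth_in_cong[OF _ c'(1) o]) (auto simp: zero)
      moreover have "q \<notin> K" using False KV V(3) by auto
      ultimately show ?thesis using c' o by (intro bexI[of _ c'] exI[of _ "chart_dom c' \<inter> - K"]) auto
    qed
  qed
  moreover have "\<beta> q \<ge> 0" for q by (simp add: \<beta>_def flat_1)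
  moreover have "\<beta> p > 0" using r c by (simp add: \<beta>_def flat_1)
  ultimately show ?thesis
    using K KV zero by (intro that[of \<beta> K]) (auto simp: V_def)
qed

definition cutoff_field :: "('a \<Rightarrow> real) \<Rightarrow> ('a, 'n) chart \<Rightarrow> real^'n \<Rightarrow> 'a \<Rightarrow> ('a, 'n) tangent" where
  "cutoff_field \<beta> c v q = (if q \<in> chart_dom c then tscale (\<beta> q) (coord_vector A c q v) else tzero)"

lemma cutoff_field:
  assumes \<beta>: "\<beta> \<in> smooth_functions A" and K: "compact K" "K \<subseteq> chart_dom c" "\<And>q. q \<notin> K \<Longrightarrow> \<beta> q = 0"
    and c: "c \<in> A"
  shows "cutoff_field \<beta> c v \<in> vector_fields A"
proof (rule vector_fieldsI_local)
  show "cutoff_field \<beta> c v p \<in> tangent_space A p" for p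
    using c by (simp add: cutoff_field_def tangent_zero tangent_scale coord_vector_tangent charts_at_def)
  fix q
  show "\<exists>c'\<in>A. \<exists>U. open U \<and> q \<in> U \<and> U \<subseteq> chart_dom c' \<and> smooth_in c' U (\<lambda>p. cutoff_field \<beta> c v p c')"
  proof (cases "q \<in> chart_dom c")
    case True
    have "smooth_in c (chart_dom c) (\<lambda>p. \<beta> p *\<^sub>R v)"
      using \<beta> c by (auto simp: smooth_in_def smooth_functions_iff intro!: smooth_on_scaleR smooth_on_const open_chart_img)
    then have "smooth_in c (chart_dom c) (\<lambda>p. cutoff_field \<beta> c v p c)"
      by (rule smooth_in_cong[OF _ c open_chart_dom[OF c]])
        (use c in \<open>auto simp: cutoff_field_def coord_vector_same charts_at_def\<close>)
    then show ?thesis using True c open_chart_dom by blast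
  next
    case False
    obtain c' where c': "c' \<in> A" "q \<in> chart_dom c'" using ex_chart charts_atD by metis
    have o: "open (chart_dom c' \<inter> - K)"
      using c' K by (auto simp: open_chart_dom open_Int compact_imp_closed open_Compl)
    have "smooth_in c' (chart_dom c' \<inter> - K) (\<lambda>q. 0::real^'n)"
      by (simp add: smooth_in_def smooth_on_const)
    then have "smooth_in c' (chart_dom c' \<inter> - K) (\<lambda>p. cutoff_field \<beta> c v p c')"
      by (rule smooth_in_cong[OF _ c'(1) o]) (auto simp: cutoff_field_def K(3))
    moreover have "q \<notin> K" using False K by auto
    ultimately show ?thesis using c' o by (intro bexI[of _ c'] exI[of _ "chart_dom c' \<inter> - K"]) auto
  qed
qed

subsection \<open>Exhaustion by compact sets\<close>

text \<open>The sets where a bump function is positive are open and lie in compact sets. Lindelof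
  reduces them to countably many, and each step absorbs the next of these sets together with the
  compact set reached so far.\<close>

lemma compact_exhaustion:
  obtains K :: "nat \<Rightarrow> 'a set" where "K 0 = {}" "\<And>i. compact (K i)" "\<And>i. K i \<subseteq> interior (K (Suc i))"
    "(\<Union>i. K i) = UNIV"
proof -
  let ?F = "{V :: 'a set. open V \<and> (\<exists>C. compact C \<and> V \<subseteq> C)}"
  have cover: "\<exists>V\<in>?F. p \<in> V" for p
  proof -
    obtain \<beta> K where \<beta>: "\<beta> \<in> smooth_functions A" "compact K" "\<And>q. q \<notin> K \<Longrightarrow> \<beta> q = 0" "\<beta> p > 0"
      using bump_function[OF open_UNIV UNIV_I, of p] by metis
    have "{q. \<beta> q > 0} \<subseteq> K" using \<beta>(3) by force
    moreover have "open {q. 0 < \<beta> q}"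
      by (rule open_Collect_less[OF continuous_on_const smooth_functions_continuous[OF \<beta>(1)]])
    ultimately have "{q. 0 < \<beta> q} \<in> ?F" using \<beta>(2) by (simp only: mem_Collect_eq) metis
    then show ?thesis using \<beta>(4) by (intro bexI[of _ "{q. 0 < \<beta> q}"]) auto
  qed
  obtain F' where F': "F' \<subseteq> ?F" "countable F'" "\<Union>F' = \<Union>?F"
    using Lindelof[of ?F] by auto
  have U: "\<Union>F' = UNIV" using cover F'(3) by auto
  then have ne: "F' \<noteq> {}" by auto
  have big: "\<exists>K'. compact K' \<and> K \<subseteq> interior K'" if Kc: "compact K" for K :: "'a set"
  proof -
    obtain D where D: "D \<subseteq> ?F" "finite D" "K \<subseteq> \<Union>D"
    proof (rule compactE[OF Kc, of ?F])
      show "K \<subseteq> \<Union>?F" using cover by blast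
    qed auto
    then have "\<forall>V\<in>D. \<exists>C. compact C \<and> V \<subseteq> C" by auto
    then obtain C where C: "\<And>V. V \<in> D \<Longrightarrow> compact (C V) \<and> V \<subseteq> C V" by metis
    have "compact (\<Union>V\<in>D. C V)" by (rule compact_UN[OF D(2)]) (use C in blast)
    moreover have "\<Union>D \<subseteq> interior (\<Union>V\<in>D. C V)"
    proof (rule interior_maximal)
      show "\<Union>D \<subseteq> (\<Union>V\<in>D. C V)" using C by blast
      show "open (\<Union>D)" using D(1) by (intro open_Union) blast
    qed
    ultimately show ?thesis using D(3) by blast
  qed
  let ?V = "from_nat_into F'"
  \<comment> \<open>The clause for \<open>n = 0\<close> belongs to the invariant of the choice so
    that the sequence is sure to start with the empty set.\<close>
  have "\<exists>K. \<forall>n. (compact (K n) \<and> (n = 0 \<longrightarrow> K n = {})) \<and> K n \<union> ?V n \<subseteq> interior (K (Suc n))"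
  proof (rule dependent_nat_choice)
    show "\<exists>K::'a set. compact K \<and> (0 = (0::nat) \<longrightarrow> K = {})" by auto
    fix K :: "'a set" and n :: nat assume K: "compact K \<and> (n = 0 \<longrightarrow> K = {})"
    have "?V n \<in> ?F" using F'(1) from_nat_into[OF ne] by blast
    then obtain C where C: "compact C" "?V n \<subseteq> C" by auto
    from big[of "K \<union> C"] K C(1) obtain K' where "compact K'" "K \<union> C \<subseteq> interior K'" by auto
    then show "\<exists>K'. (compact K' \<and> (Suc n = 0 \<longrightarrow> K' = {})) \<and> K \<union> ?V n \<subseteq> interior K'"
      using C(2) by blast
  qed
  then obtain K where K: "\<And>n. compact (K n)" "K 0 = {}" "\<And>n. K n \<union> ?V n \<subseteq> interior (K (Suc n))" by metis
  have "p \<in> (\<Union>i. K i)" for p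
  proof -
    have "p \<in> \<Union>F'" unfolding U by simp
    then obtain V where V: "V \<in> F'" "p \<in> V" by blast
    then obtain n where "V = ?V n" using from_nat_into_surj[OF F'(2)] by metis
    then show ?thesis using K(3)[of n] V(2) interior_subset by blast
  qed
  then have "(\<Union>i. K i) = UNIV" by blast
  then show ?thesis using K by (intro that[of K]) simp_all
qed

subsection \<open>Families of fields that span the tangent spaces\<close>

text \<open>Spanning is expressed dually, by the absence of a nonzero annihilating covector: the
  covectors over a chart are then parametrized by a Euclidean space, which permits a measure
  argument.\<close>

definition spans_at :: "('a \<Rightarrow> ('a, 'n) tangent) set \<Rightarrow> 'a \<Rightarrow> bool" where
  "spans_at F p \<longleftrightarrow> (\<forall>c\<in>charts_at A p. \<forall>\<omega>. (\<forall>X\<in>F. \<omega> \<bullet> X p c = 0) \<longrightarrow> \<omega> = 0)"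

text \<open>The adjoint of the Jacobian carries annihilating covectors from one chart to the other,
  and its kernel is trivial because the Jacobian is surjective; so one chart decides.\<close>

lemma spans_atI:
  assumes c: "c \<in> charts_at A p" and F: "F \<subseteq> vector_fields A"
    and s: "\<And>\<omega>. (\<And>X. X \<in> F \<Longrightarrow> \<omega> \<bullet> X p c = 0) \<Longrightarrow> \<omega> = 0"
  shows "spans_at F p"
  unfolding spans_at_def
proof (intro ballI allI impI)
  fix c' \<omega> assume c': "c' \<in> charts_at A p" and \<omega>: "\<forall>X\<in>F. \<omega> \<bullet> X p c' = 0"
  let ?D = "frechet_derivative (transition c c') (at (coord c p))"
  have lin: "linear ?D" by (rule transition_derivative_linear[OF c c'])
  have "adjoint ?D \<omega> = 0"
  proof (rule s)
    fix X assume X: "X \<in> F"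
    with F have "X \<in> vector_fields A" by blast
    from tangent_transition[OF vector_field_tangent[OF this] c c']
    have "adjoint ?D \<omega> \<bullet> X p c = \<omega> \<bullet> X p c'" by (simp only: adjoint_clauses(2)[OF lin])
    then show "adjoint ?D \<omega> \<bullet> X p c = 0" using \<omega> X by simp
  qed
  then have 0: "\<omega> \<bullet> ?D x = 0" for x using adjoint_clauses(2)[OF lin, of \<omega> x] by simp
  have "?D (frechet_derivative (transition c' c) (at (coord c' p)) \<omega>) = \<omega>"
    using transition_chain[OF c' c c', of \<omega>] transition_self[OF c', of \<omega>] by (simp only:)
  then show "\<omega> = 0" using 0 by (metis inner_eq_zero_iff)
qed

lemma spans_at_mono: "spans_at F p \<Longrightarrow> F \<subseteq> G \<Longrightarrow> spans_at G p"
  unfolding spans_at_def by blast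

text \<open>Coordinate fields cut off by one bump function span wherever that function is positive,
  and compactness leaves finitely many such neighbourhoods.\<close>

lemma compact_finite_spanning:
  assumes "compact L"
  obtains F where "finite F" "F \<subseteq> vector_fields A" "\<And>p. p \<in> L \<Longrightarrow> spans_at F p"
proof -
  let ?P = "\<lambda>W F. open W \<and> finite F \<and> F \<subseteq> vector_fields A \<and> (\<forall>q\<in>W. spans_at F q)"
  have ex: "\<exists>W F. p \<in> W \<and> ?P W F" for p
  proof -
    obtain c where c: "c \<in> A" "p \<in> chart_dom c" using ex_chart charts_atD by metis
    obtain \<beta> K where \<beta>: "\<beta> \<in> smooth_functions A" "compact K" "K \<subseteq> chart_dom c"
      "\<And>q. q \<notin> K \<Longrightarrow> \<beta> q = 0" "\<beta> p > 0"
      using bump_function[OF open_chart_dom[OF c(1)] c(2)] by metis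
    let ?F = "range (\<lambda>i. cutoff_field \<beta> c (axis i 1))"
    have F: "finite ?F" "?F \<subseteq> vector_fields A" using cutoff_field[OF \<beta>(1-4) c(1)] by auto
    have "spans_at ?F q" if "\<beta> q > 0" for q
    proof -
      have q: "q \<in> chart_dom c" using \<beta>(3,4) that by (metis less_irrefl subsetD)
      then have cq: "c \<in> charts_at A q" using c by (simp add: charts_at_def)
      show ?thesis
      proof (rule spans_atI[OF cq F(2)])
        fix \<omega> :: "real^'n" assume "\<And>X. X \<in> ?F \<Longrightarrow> \<omega> \<bullet> X q c = 0"
        then have "\<omega> \<bullet> cutoff_field \<beta> c (axis i 1) q c = 0" for i by blast
        then have "\<omega> $ i = 0" for i
          using that q by (simp add: cutoff_field_def coord_vector_same[OF cq] inner_axis)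
        then show "\<omega> = 0" by (simp add: vec_eq_iff)
      qed
    qed
    moreover have "open {q. 0 < \<beta> q}"
      by (rule open_Collect_less[OF continuous_on_const smooth_functions_continuous[OF \<beta>(1)]])
    ultimately have "p \<in> {q. 0 < \<beta> q} \<and> ?P {q. 0 < \<beta> q} ?F" using F \<beta>(5) by simp
    then show ?thesis by (intro exI)
  qed
  obtain D where D: "D \<subseteq> {W. \<exists>F. ?P W F}" "finite D" "L \<subseteq> \<Union>D"
  proof (rule compactE[OF assms, of "{W. \<exists>F. ?P W F}"])
    show "L \<subseteq> \<Union>{W. \<exists>F. ?P W F}"
    proof
      fix p
      from ex[of p] obtain W F where W: "p \<in> W" "?P W F" by (elim exE conjE) simp
      from W(2) have "W \<in> {W. \<exists>F. ?P W F}" by (intro CollectI exI[of _ F])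
      then show "p \<in> \<Union>{W. \<exists>F. ?P W F}" using W(1) by (rule UnionI)
    qed
  qed auto
  then have "\<forall>W\<in>D. \<exists>F. ?P W F" by auto
  then obtain F where F: "\<And>W. W \<in> D \<Longrightarrow> ?P W (F W)" by metis
  show ?thesis
  proof (rule that)
    show "finite (\<Union>W\<in>D. F W)" using D(2) F by auto
    show "(\<Union>W\<in>D. F W) \<subseteq> vector_fields A" using F by auto
    fix p assume "p \<in> L"
    then obtain W where W: "W \<in> D" "p \<in> W" using D(3) by auto
    have "spans_at (F W) p" using F[OF W(1)] W(2) by blast
    then show "spans_at (\<Union>W\<in>D. F W) p" by (rule spans_at_mono) (use W(1) in blast)
  qed
qed

text \<open>The bump functions are nonnegative, so nothing cancels in their finite sum.\<close>

lemma compact_bump_function: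
  assumes "compact L" "open U" "L \<subseteq> U"
  obtains \<beta> where "\<beta> \<in> smooth_functions A" "\<And>p. p \<in> L \<Longrightarrow> \<beta> p > 0" "\<And>p. p \<notin> U \<Longrightarrow> \<beta> p = 0"
proof -
  let ?B = "{\<beta> \<in> smooth_functions A. (\<forall>q. \<beta> q \<ge> 0) \<and> (\<forall>q. q \<notin> U \<longrightarrow> \<beta> q = 0)}"
  have op: "open {q. 0 < \<beta> q}" if "\<beta> \<in> ?B" for \<beta>
    using that by (auto intro: open_Collect_less[OF continuous_on_const smooth_functions_continuous])
  have pos: "\<exists>\<beta>\<in>?B. \<beta> p > 0" if "p \<in> L" for p
  proof -
    have "p \<in> U" using assms(3) that by blast
    then obtain \<beta> K where \<beta>: "\<beta> \<in> smooth_functions A" "compact K" "K \<subseteq> U" "\<And>q. q \<notin> K \<Longrightarrow> \<beta> q = 0"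
      "\<And>q. \<beta> q \<ge> 0" "\<beta> p > 0"
      by (rule bump_function[OF assms(2)]) (rule that, simp_all)
    have "\<beta> q = 0" if "q \<notin> U" for q using \<beta>(3,4) that by blast
    then show ?thesis using \<beta>(1,5,6) by (intro bexI[of _ \<beta>]) simp_all
  qed
  obtain D where D: "D \<subseteq> (\<lambda>\<beta>. {q. 0 < \<beta> q}) ` ?B" "finite D" "L \<subseteq> \<Union>D"
  proof (rule compactE[OF assms(1), of "(\<lambda>\<beta>. {q. 0 < \<beta> q}) ` ?B"])
    show "L \<subseteq> \<Union>((\<lambda>\<beta>. {q. 0 < \<beta> q}) ` ?B)"
    proof
      fix p assume "p \<in> L"
      then obtain \<beta> where "\<beta> \<in> ?B" "\<beta> p > 0" using pos by (elim bexE[OF pos]) simp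
      then show "p \<in> \<Union>((\<lambda>\<beta>. {q. 0 < \<beta> q}) ` ?B)" by (intro UN_I[of \<beta>]) simp_all
    qed
    show "open B" if "B \<in> (\<lambda>\<beta>. {q. 0 < \<beta> q}) ` ?B" for B
      using that op by blast
  qed
  then obtain E where E: "E \<subseteq> ?B" "finite E" "D = (\<lambda>\<beta>. {q. 0 < \<beta> q}) ` E"
    by (meson finite_subset_image)
  show ?thesis
  proof (rule that)
    show "(\<lambda>p. \<Sum>\<beta>\<in>E. \<beta> p) \<in> smooth_functions A" using E(1) by (intro smooth_functions_sum) auto
    show "(\<Sum>\<beta>\<in>E. \<beta> p) > 0" if p: "p \<in> L" for p
    proof -
      obtain \<beta> where "\<beta> \<in> E" "\<beta> p > 0" using p D(3) E(3) by auto
      then show ?thesis using E(1,2) by (intro sum_pos2[of E \<beta>]) auto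
    qed
    show "(\<Sum>\<beta>\<in>E. \<beta> p) = 0" if "p \<notin> U" for p using that E(1) by (intro sum.neutral) auto
  qed
qed

end

section \<open>Spanning with a bounded number of fields\<close>

locale manifold7 = manifold A for A :: "('a::{t2_space, second_countable_topology}, 7) chart set"
begin

text \<open>The fibrewise covectors form a space of dimension \<open>14\<close>, so their values on fifteen sections miss
  some vector \<open>w\<close> of \<open>\<real>\<^sup>1\<^sup>5\<close>. Replacing the fifteen sections by their combinations orthogonal to \<open>w\<close> does
  not destroy spanning and removes one section.\<close>

lemma spanning_reduce_step:
  assumes L: "compact L" and F: "finite F" "F \<subseteq> vector_fields A" "\<And>p. p \<in> L \<Longrightarrow> spans_at F p"
    and card: "card F > 14"
  obtains F' where "finite F'" "F' \<subseteq> vector_fields A" "\<And>p. p \<in> L \<Longrightarrow> spans_at F' p" "card F' < card F"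
proof -
  obtain S where S: "S \<subseteq> F" "card S = 15"
    using obtain_subset_with_card_n[of 15 F] card by auto
  have finS: "finite S" using S(2) card.infinite by fastforce
  have "card (UNIV :: 15 set) = card S" using S(2) by simp
  then obtain s :: "15 \<Rightarrow> 'a \<Rightarrow> ('a, 7) tangent" where s: "bij_betw s UNIV S"
    using finS finite_same_card_bij[of "UNIV :: 15 set" S] by auto
  have sV: "s i \<in> vector_fields A" for i using s S(1) F(2) by (auto simp: bij_betw_def)
  have "\<exists>C. C \<subseteq> A \<and> finite C \<and> L \<subseteq> (\<Union>c\<in>C. chart_dom c)"
  proof -
    obtain D where D: "D \<subseteq> chart_dom ` A" "finite D" "L \<subseteq> \<Union>D"
    proof (rule compactE[OF L, of "chart_dom ` A"])
      show "L \<subseteq> \<Union>(chart_dom ` A)" using ex_chart charts_atD by blast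
      show "open B" if "B \<in> chart_dom ` A" for B using that open_chart_dom by blast
    qed
    obtain C where "C \<subseteq> A" "finite C" "D = chart_dom ` C" using D(1,2) by (meson finite_subset_image)
    then show ?thesis using D(3) by blast
  qed
  then obtain C where C: "C \<subseteq> A" "finite C" "L \<subseteq> (\<Union>c\<in>C. chart_dom c)" by auto
  \<comment> \<open>\<open>ev c\<close> takes a base point in coordinates and a covector to the
    values on the fifteen fields. Its source has dimension 14, so its image in
    \<open>real^15\<close> is negligible, and so is the union \<open>bad\<close> over the finitely
    many charts.\<close>
  define ev where "ev c z = (\<chi> i. snd z \<bullet> s i (chart_inv c (fst z)) c)"
    for c :: "('a, 7) chart" and z :: "(real^7) \<times> (real^7)"
  define bad where "bad = (\<Union>c\<in>C. ev c ` (chart_img c \<times> UNIV))"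
  have "negligible (ev c ` (chart_img c \<times> UNIV))" if c: "c \<in> C" for c
  proof (rule negligible_differentiable_image_lowdim)
    show "DIM((real^7) \<times> (real^7)) < DIM(real^15)" by simp
    have "(\<lambda>z. s i (chart_inv c (fst z)) c) differentiable at z" if z: "fst z \<in> chart_img c"
      for i and z :: "(real^7) \<times> (real^7)"
    proof -
      have "(\<lambda>y. s i (chart_inv c y) c) differentiable at (fst z)"
        using sV[of i] c C(1) z by (intro smooth_on_differentiable[of "chart_img c"]) (auto simp: vector_fields_def)
      then show ?thesis
        using differentiable_compose[of "\<lambda>y. s i (chart_inv c y) c" fst z UNIV]
        by (simp add: bounded_linear_fst bounded_linear_imp_differentiable)
    qed
    then have d: "(\<lambda>z. snd z \<bullet> s i (chart_inv c (fst z)) c) differentiable at z" if "fst z \<in> chart_img c"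
      for i and z :: "(real^7) \<times> (real^7)"
      using that differentiable_inner[of snd z UNIV] by (simp add: bounded_linear_snd bounded_linear_imp_differentiable)
    have "ev c differentiable at z" if z: "fst z \<in> chart_img c" for z
    proof (subst differentiable_componentwise_within, rule ballI)
      fix b :: "real^15" assume "b \<in> Basis"
      then obtain i where "b = axis i 1" by (auto simp: Basis_vec_def)
      then have "(\<lambda>z. ev c z \<bullet> b) = (\<lambda>z. snd z \<bullet> s i (chart_inv c (fst z)) c)"
        by (simp add: ev_def inner_axis)
      then show "(\<lambda>z. ev c z \<bullet> b) differentiable at z" using d[OF z, of i] by (simp only:)
    qed
    then show "ev c differentiable_on (chart_img c \<times> UNIV)"
      unfolding differentiable_on_def by (auto intro: differentiable_at_withinI)
  qed
  then have "negligible bad" unfolding bad_def using C(2) by (intro negligible_Union) auto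
  moreover have "negligible {w :: real^15. w $ 1 = 0}"
    using negligible_standard_hyperplane_cart[of "1::15"] by simp
  ultimately have "negligible (bad \<union> {w. w $ 1 = 0})" by (rule negligible_Un)
  then have "bad \<union> {w. w $ 1 = 0} \<noteq> UNIV" by (metis non_negligible_UNIV)
  then obtain w where w: "w \<notin> bad" "w $ 1 \<noteq> 0" by auto
  \<comment> \<open>A covector that annihilates every \<open>s' i\<close> has values on the
    \<open>s i\<close> proportional to \<open>w\<close>. If the factor were not 0, dividing the
    covector by it would exhibit \<open>w\<close> in \<open>bad\<close>. The choice of
    \<open>w\<close> with nonzero first coordinate makes \<open>s' 1\<close> vanish, which is the
    field saved.\<close>
  define s' where "s' i = (\<lambda>p. tplus (s i p) (tscale (- (w $ i / w $ 1)) (s 1 p)))" for i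
  have s'V: "s' i \<in> vector_fields A" for i
    unfolding s'_def by (intro vector_fields_add sV vector_fields_scale[of "\<lambda>p. r" for r] smooth_functions_const)
  define F' where "F' = (F - S) \<union> s' ` (UNIV - {1})"
  show ?thesis
  proof (rule that)
    show "finite F'" using F(1) by (simp add: F'_def)
    show FV: "F' \<subseteq> vector_fields A" using F(2) s'V by (auto simp: F'_def)
    have "card F' \<le> card (F - S) + card (s' ` (UNIV - {1}))" unfolding F'_def by (rule card_Un_le)
    also have "card (s' ` (UNIV - {1})) \<le> card (UNIV - {1::15})" by (rule card_image_le) simp
    also have "card (UNIV - {1::15}) = 14" by (simp add: card_Diff_singleton)
    also have "card (F - S) = card F - 15" using S F(1) by (simp add: card_Diff_subset finS)
    finally show "card F' < card F" using card by linarith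
    fix p assume p: "p \<in> L"
    then obtain c where c: "c \<in> C" "p \<in> chart_dom c" using C(3) by auto
    then have cp: "c \<in> charts_at A p" "c \<in> A" using C(1) by (auto simp: charts_at_def)
    show "spans_at F' p"
    proof (rule spans_atI[OF cp(1) FV])
      fix \<omega> :: "real^7" assume \<omega>: "\<And>X. X \<in> F' \<Longrightarrow> \<omega> \<bullet> X p c = 0"
      define t where "t = \<omega> \<bullet> s 1 p c / w $ 1"
      have si: "\<omega> \<bullet> s i p c = t * w $ i" for i
      proof (cases "i = 1")
        case False
        then have "\<omega> \<bullet> s' i p c = 0" by (intro \<omega>) (simp add: F'_def)
        then show ?thesis by (simp add: s'_def inner_diff_right t_def mult.commute)
      qed (use w(2) in \<open>simp add: t_def\<close>)
      have "t = 0"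
      proof (rule ccontr)
        assume "t \<noteq> 0"
        then have "ev c (coord c p, \<omega> /\<^sub>R t) = w"
          using si chart_inv_coord[OF cp(2) c(2)] by (simp add: ev_def vec_eq_iff)
        then have "w \<in> bad" unfolding bad_def using c by blast
        then show False using w(1) by simp
      qed
      then have "\<omega> \<bullet> X p c = 0" if "X \<in> S" for X using si that s by (force simp: bij_betw_def)
      then have "\<omega> \<bullet> X p c = 0" if "X \<in> F" for X using that \<omega>[of X] by (cases "X \<in> S") (auto simp: F'_def)
      then show "\<omega> = 0" using F(3)[OF p] cp(1) by (auto simp: spans_at_def)
    qed
  qed
qed

lemma compact_spanning_14:
  assumes L: "compact L"
  obtains X :: "nat \<Rightarrow> 'a \<Rightarrow> ('a, 7) tangent"
  where "\<And>a. X a \<in> vector_fields A" "\<And>p. p \<in> L \<Longrightarrow> spans_at (X ` {..<14}) p"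
proof -
  obtain F where F: "finite F" "F \<subseteq> vector_fields A" "\<And>p. p \<in> L \<Longrightarrow> spans_at F p"
    using compact_finite_spanning[OF L] by metis
  have "\<exists>F'. finite F' \<and> F' \<subseteq> vector_fields A \<and> (\<forall>p\<in>L. spans_at F' p) \<and> card F' \<le> 14"
    using F
  proof (induction "card F" arbitrary: F rule: less_induct)
    case less
    show ?case
    proof (cases "card F \<le> 14")
      case True
      then show ?thesis using less.prems by blast
    next
      case False
      then obtain F' where "finite F'" "F' \<subseteq> vector_fields A" "\<And>p. p \<in> L \<Longrightarrow> spans_at F' p" "card F' < card F"
        using spanning_reduce_step[OF L less.prems] by (metis not_le)
      then show ?thesis using less.hyps by blast
    qed
  qed
  then obtain F' where F': "finite F'" "F' \<subseteq> vector_fields A" "\<forall>p\<in>L. spans_at F' p" "card F' \<le> 14" by auto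
  obtain f where f: "bij_betw f {..<card F'} F'"
    using F'(1) ex_bij_betw_nat_finite[of F'] by (auto simp: atLeast0LessThan)
  \<comment> \<open>Padding with the zero field gives all compact sets the same index range, so that
    the fields of different shells can later be added index by index.\<close>
  define X where "X a = (if a < card F' then f a else (\<lambda>p. tzero))" for a
  have "X a \<in> vector_fields A" for a
    using f F'(2) vector_fields_zero by (auto simp: X_def bij_betw_def)
  moreover have "F' \<subseteq> X ` {..<14}"
  proof
    fix Y assume "Y \<in> F'"
    then obtain a where "a < card F'" "Y = f a" using f by (auto simp: bij_betw_def)
    then show "Y \<in> X ` {..<14}" using F'(4) by (auto simp: X_def)
  qed
  ultimately show ?thesis using that[of X] F'(3) spans_at_mono by blast
qed

text \<open>The shells of a compact exhaustion are coloured modulo \<open>3\<close>, so that neighbourhoods of shells of the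
  same colour are disjoint and their fourteen spanning fields can be added.\<close>

theorem finite_global_spanning:
  obtains G where "finite G" "G \<subseteq> vector_fields A" "\<And>p. spans_at G p"
proof -
  obtain K :: "nat \<Rightarrow> 'a set" where K: "K 0 = {}" "\<And>i. compact (K i)" "\<And>i. K i \<subseteq> interior (K (Suc i))"
    "(\<Union>i. K i) = UNIV"
    using compact_exhaustion by metis
  have "K i \<subseteq> K (Suc i)" for i using K(3)[of i] interior_subset[of "K (Suc i)"] by (rule order_trans)
  then have mono: "K i \<subseteq> K j" if "i \<le> j" for i j
    using lift_Suc_mono_le[of K] that by blast
  define L where "L i = K (Suc i) - interior (K i)" for i
  \<comment> \<open>For \<open>i = 0\<close> the truncated subtraction leads to \<open>K 0\<close>,
    which is empty, so nothing is removed.\<close>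
  define U where "U i = interior (K (Suc (Suc i))) - K (i - 1)" for i
  have LU: "compact (L i)" "open (U i)" "L i \<subseteq> U i" for i
  proof -
    show "compact (L i)" unfolding L_def by (rule compact_diff[OF K(2) open_interior])
    show "open (U i)" unfolding U_def by (rule open_Diff[OF open_interior compact_imp_closed[OF K(2)]])
    have "K (i - 1) \<subseteq> interior (K i)" using K(1) K(3)[of "i - 1"] by (cases i) auto
    then show "L i \<subseteq> U i" using K(3)[of "Suc i"] by (auto simp: L_def U_def)
  qed
  have disj: "U i \<inter> U j = {}" if "i + 3 \<le> j" for i j
  proof -
    have "interior (K (Suc (Suc i))) \<subseteq> K (j - 1)"
      using mono[of "Suc (Suc i)" "j - 1"] that interior_subset by fastforce
    then show ?thesis by (auto simp: U_def)
  qed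
  have same: "i = j" if "p \<in> U i" "p \<in> U j" "i mod 3 = j mod 3" for i j p
  proof (rule ccontr)
    assume "i \<noteq> j"
    then have "i + 3 \<le> j \<or> j + 3 \<le> i" using that(3) by presburger
    then show False using disj that by blast
  qed
  have "\<forall>i. \<exists>X. (\<forall>a. X a \<in> vector_fields A) \<and> (\<forall>p\<in>L i. spans_at (X ` {..<14::nat}) p)"
    using compact_spanning_14[OF LU(1)] by metis
  then obtain X where X: "\<And>i a. X i a \<in> vector_fields A" "\<And>i p. p \<in> L i \<Longrightarrow> spans_at (X i ` {..<14::nat}) p"
    by metis
  have "\<forall>i. \<exists>\<beta>. \<beta> \<in> smooth_functions A \<and> (\<forall>p\<in>L i. \<beta> p > 0) \<and> (\<forall>p. p \<notin> U i \<longrightarrow> \<beta> p = 0)"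
    using compact_bump_function[OF LU] by metis
  then obtain \<beta> where \<beta>: "\<And>i. \<beta> i \<in> smooth_functions A" "\<And>i p. p \<in> L i \<Longrightarrow> \<beta> i p > 0"
    "\<And>i p. p \<notin> U i \<Longrightarrow> \<beta> i p = 0" by metis
  define Y where "Y r a p = (\<lambda>c. \<Sum>i\<in>{i. i mod 3 = r \<and> p \<in> U i}. \<beta> i p *\<^sub>R X i a p c)" for r a p
  have YV: "Y r a \<in> vector_fields A" for r a
  proof (rule vector_fields_glue)
    fix p
    obtain m where m: "p \<in> K m" using K(4) by blast
    \<comment> \<open>Neighbourhoods \<open>U i\<close> with \<open>i\<close> greater than
      \<open>Suc m\<close> avoid \<open>K (Suc m)\<close>, so on \<open>?W\<close> the sum agrees
      with one over a fixed finite index set.\<close>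
    let ?W = "interior (K (Suc m))"
    let ?Z = "\<lambda>p c. \<Sum>i\<in>{i\<in>{..Suc m}. i mod 3 = r}. \<beta> i p *\<^sub>R X i a p c"
    have "?Z \<in> vector_fields A"
      by (intro vector_fields_sum vector_fields_scale \<beta>(1) X(1))
    moreover have "Y r a q = ?Z q" if q: "q \<in> ?W" for q
      unfolding Y_def
    proof (rule ext, rule sum.mono_neutral_left)
      show "{i. i mod 3 = r \<and> q \<in> U i} \<subseteq> {i\<in>{..Suc m}. i mod 3 = r}"
      proof safe
        fix i assume "q \<in> U i"
        then have "q \<notin> K (i - 1)" by (simp add: U_def)
        then have "\<not> Suc m \<le> i - 1" using q mono interior_subset by blast
        then show "i \<le> Suc m" by simp
      qed
    qed (use \<beta>(3) in auto)
    ultimately show "\<exists>W Z. open W \<and> p \<in> W \<and> Z \<in> vector_fields A \<and> (\<forall>q\<in>W. Y r a q = Z q)"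
      using m K(3) by (intro exI[of _ ?W] exI[of _ ?Z]) auto
  qed
  let ?G = "(\<lambda>(r, a). Y r a) ` ({..<3} \<times> {..<14})"
  show ?thesis
  proof (rule that)
    show "finite ?G" by simp
    show G: "?G \<subseteq> vector_fields A" using YV by auto
    fix p
    define i where "i = (LEAST i. p \<in> K (Suc i))"
    obtain m where "p \<in> K m" using K(4) by blast
    then have "p \<in> K (Suc m)" using mono[of m "Suc m"] by auto
    then have i: "p \<in> K (Suc i)" unfolding i_def by (rule LeastI)
    have "p \<notin> K i"
    proof (cases i)
      case (Suc j)
      then show ?thesis using not_less_Least[of j "\<lambda>i. p \<in> K (Suc i)"] by (simp add: i_def)
    qed (simp add: K(1))
    then have pL: "p \<in> L i" using i interior_subset by (auto simp: L_def)
    then have pU: "p \<in> U i" using LU(3) by auto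
    have "{j. j mod 3 = i mod 3 \<and> p \<in> U j} = {i}" using same pU by auto
    then have Yp: "Y (i mod 3) a p c = \<beta> i p *\<^sub>R X i a p c" for a c by (simp add: Y_def)
    obtain c where c: "c \<in> charts_at A p" using ex_chart by metis
    show "spans_at ?G p"
    proof (rule spans_atI[OF c G])
      fix \<omega> :: "real^7" assume \<omega>: "\<And>X. X \<in> ?G \<Longrightarrow> \<omega> \<bullet> X p c = 0"
      have "\<omega> \<bullet> X i a p c = 0" if "a < 14" for a
      proof -
        have "Y (i mod 3) a \<in> ?G" using that by force
        then have "\<omega> \<bullet> Y (i mod 3) a p c = 0" by (rule \<omega>)
        then show ?thesis using \<beta>(2)[OF pL] by (simp add: Yp)
      qed
      then show "\<omega> = 0" using X(2)[OF pL] c by (auto simp: spans_at_def)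
    qed
  qed
qed

end

section \<open>Metrics, forms and global frames\<close>

context manifold
begin

lemma tangent_expand:
  assumes c: "c \<in> charts_at A p" and v: "v \<in> tangent_space A p"
  shows "v = (\<lambda>c'. \<Sum>i\<in>UNIV. (v c $ i) *\<^sub>R coord_vector A c p (axis i 1) c')"
proof (rule tangent_eqI[OF v _ c])
  show "(\<lambda>c'. \<Sum>i\<in>UNIV. (v c $ i) *\<^sub>R coord_vector A c p (axis i 1) c') \<in> tangent_space A p"
    by (rule tangent_sum[where w' = "\<lambda>i. tscale (v c $ i) (coord_vector A c p (axis i 1))"])
      (rule tangent_scale[OF coord_vector_tangent[OF c]])
  show "v c = (\<Sum>i\<in>UNIV. (v c $ i) *\<^sub>R coord_vector A c p (axis i 1) c)"
    using basis_expansion[of "v c"] by (simp add: coord_vector_same[OF c] scalar_mult_eq_scaleR)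
qed

lemma tangent_lincomb:
  "(\<And>i. i \<in> I \<Longrightarrow> w i \<in> tangent_space A p) \<Longrightarrow> (\<lambda>c. \<Sum>i\<in>I. r i *\<^sub>R w i c) \<in> tangent_space A p"
  by (rule tangent_sum[where w' = "\<lambda>i. tscale (r i) (w i)"]) (rule tangent_scale)

lemma tangent_functional_add:
  "tangent_functional A p h \<Longrightarrow> v \<in> tangent_space A p \<Longrightarrow> w \<in> tangent_space A p \<Longrightarrow> h (tplus v w) = h v + h w"
  unfolding tangent_functional_def by blast

lemma tangent_functional_scale:
  "tangent_functional A p h \<Longrightarrow> v \<in> tangent_space A p \<Longrightarrow> h (tscale r v) = r * h v"
  unfolding tangent_functional_def by blast

lemma tangent_functional_zero: "tangent_functional A p h \<Longrightarrow> h tzero = 0"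
  using tangent_functional_scale[of p h tzero 0] tangent_zero by simp

lemma tangent_functional_sum:
  assumes h: "tangent_functional A p h" and "finite I" and w: "\<And>i. i \<in> I \<Longrightarrow> w i \<in> tangent_space A p"
  shows "h (\<lambda>c. \<Sum>i\<in>I. r i *\<^sub>R w i c) = (\<Sum>i\<in>I. r i * h (w i))"
  using assms(2) w
proof (induction I rule: finite_induct)
  case empty
  then show ?case by (simp add: tangent_functional_zero[OF h])
next
  case (insert j J)
  have "h (tplus (tscale (r j) (w j)) (\<lambda>c. \<Sum>i\<in>J. r i *\<^sub>R w i c)) = r j * h (w j) + (\<Sum>i\<in>J. r i * h (w i))"
    by (subst tangent_functional_add[OF h])
      (use insert in \<open>simp_all add: tangent_scale tangent_lincomb tangent_functional_scale[OF h]\<close>)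
  then show ?case using insert by simp
qed

lemma tangent_functional_expand:
  assumes "tangent_functional A p h" "c \<in> charts_at A p" "v \<in> tangent_space A p"
  shows "h v = (\<Sum>i\<in>UNIV. v c $ i * h (coord_vector A c p (axis i 1)))"
  by (subst tangent_expand[OF assms(2,3)])
    (rule tangent_functional_sum[OF assms(1)], simp_all add: coord_vector_tangent assms(2))

context
  fixes g assumes g: "riemannian_metric A g"
begin

lemma metric_functional: "v \<in> tangent_space A p \<Longrightarrow> tangent_functional A p (g p v)"
  using g by (simp add: riemannian_metric_def)

lemma metric_sym: "v \<in> tangent_space A p \<Longrightarrow> w \<in> tangent_space A p \<Longrightarrow> g p v w = g p w v"
  using g unfolding riemannian_metric_def by blast

lemma metric_pos: "v \<in> tangent_space A p \<Longrightarrow> v \<noteq> tzero \<Longrightarrow> g p v v > 0"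
  using g unfolding riemannian_metric_def by blast

lemma metric_functional_left:
  assumes "w \<in> tangent_space A p"
  shows "tangent_functional A p (\<lambda>v. g p v w)"
  using metric_functional[OF assms] metric_sym[OF assms] tangent_add tangent_scale
  unfolding tangent_functional_def by (metis (no_types, lifting))

lemma metric_eqI:
  assumes v: "v \<in> tangent_space A p" and w: "w \<in> tangent_space A p"
    and eq: "\<And>z. z \<in> tangent_space A p \<Longrightarrow> g p v z = g p w z"
  shows "v = w"
proof -
  let ?d = "tplus v (tscale (-1) w)"
  have w': "tscale (-1) w \<in> tangent_space A p" by (rule tangent_scale[OF w])
  have d: "?d \<in> tangent_space A p" by (rule tangent_add[OF v w'])
  have "g p ?d ?d = g p v ?d + (-1) * g p w ?d"
    by (simp only: tangent_functional_add[OF metric_functional_left[OF d] v w']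
      tangent_functional_scale[OF metric_functional_left[OF d] w])
  then have "?d = tzero" using metric_pos[OF d] eq[OF d] by (cases "?d = tzero") simp_all
  then have "v c - w c = 0" for c by (metis (no_types, lifting) scaleR_minus1_left uminus_add_conv_diff add.commute)
  then show ?thesis by (intro ext) simp
qed

lemma metric_bilinear:
  assumes c: "c \<in> charts_at A p"
  shows "bilinear (\<lambda>x y. g p (coord_vector A c p x) (coord_vector A c p y))"
  unfolding bilinear_def
  by (intro conjI allI linearI)
    (simp_all add: coord_vector_add[OF c] coord_vector_scale[OF c] coord_vector_tangent[OF c]
      tangent_functional_add[OF metric_functional] tangent_functional_scale[OF metric_functional]
      tangent_functional_add[OF metric_functional_left] tangent_functional_scale[OF metric_functional_left])

lemma metric_smooth:
  assumes X: "X \<in> vector_fields A" and Y: "Y \<in> vector_fields A"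
  shows "(\<lambda>p. g p (X p) (Y p)) \<in> smooth_functions A"
  unfolding smooth_functions_iff
proof
  fix c assume c: "c \<in> A"
  let ?e = "\<lambda>p i. coord_vector A c p (axis i 1)"
  have "smooth_in c (chart_dom c) (\<lambda>p. \<Sum>i\<in>UNIV. X p c $ i * (\<Sum>j\<in>UNIV. Y p c $ j * g p (?e p i) (?e p j)))"
    using X Y g c unfolding smooth_in_def vector_fields_def riemannian_metric_def
    by (intro smooth_on_sum smooth_on_mult smooth_on_nth open_chart_img c) auto
  then show "smooth_in c (chart_dom c) (\<lambda>p. g p (X p) (Y p))"
  proof (rule smooth_in_cong[OF _ c open_chart_dom[OF c] subset_refl])
    fix p assume "p \<in> chart_dom c"
    then have cp: "c \<in> charts_at A p" using c by (simp add: charts_at_def)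
    have XT: "X p \<in> tangent_space A p" and YT: "Y p \<in> tangent_space A p" using X Y by (auto simp: vector_field_tangent)
    have eT: "?e p i \<in> tangent_space A p" for i by (rule coord_vector_tangent[OF cp])
    show "(\<Sum>i\<in>UNIV. X p c $ i * (\<Sum>j\<in>UNIV. Y p c $ j * g p (?e p i) (?e p j))) = g p (X p) (Y p)"
      unfolding tangent_functional_expand[OF metric_functional_left[OF YT] cp XT]
        tangent_functional_expand[OF metric_functional[OF eT] cp YT] ..
  qed
qed

end

context
  fixes \<phi> assumes \<phi>: "smooth_form3 A \<phi>"
begin

lemma form_functional:
  assumes "v \<in> tangent_space A p" "w \<in> tangent_space A p"
  shows "tangent_functional A p (\<lambda>u. \<phi> p u v w)" "tangent_functional A p (\<lambda>u. \<phi> p v u w)"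
    "tangent_functional A p (\<phi> p v w)"
  using \<phi> assms unfolding smooth_form3_def by (simp_all add: eta_contract_eq)

lemma form_smooth:
  assumes X: "X \<in> vector_fields A" and Y: "Y \<in> vector_fields A" and Z: "Z \<in> vector_fields A"
  shows "(\<lambda>p. \<phi> p (X p) (Y p) (Z p)) \<in> smooth_functions A"
  unfolding smooth_functions_iff
proof
  fix c assume c: "c \<in> A"
  let ?e = "\<lambda>p i. coord_vector A c p (axis i 1)"
  have "smooth_on (chart_img c) (\<lambda>y. \<phi> (chart_inv c y) (?e (chart_inv c y) i) (?e (chart_inv c y) j) (?e (chart_inv c y) k))"
    for i j k using \<phi> c by (simp add: smooth_form3_def)
  then have "smooth_in c (chart_dom c) (\<lambda>p. \<Sum>i\<in>UNIV. X p c $ i * (\<Sum>j\<in>UNIV. Y p c $ j *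
      (\<Sum>k\<in>UNIV. Z p c $ k * \<phi> p (?e p i) (?e p j) (?e p k))))"
    using X Y Z c unfolding smooth_in_def vector_fields_def
    by (intro smooth_on_sum smooth_on_mult smooth_on_nth open_chart_img c) auto
  then show "smooth_in c (chart_dom c) (\<lambda>p. \<phi> p (X p) (Y p) (Z p))"
  proof (rule smooth_in_cong[OF _ c open_chart_dom[OF c] subset_refl])
    fix p assume "p \<in> chart_dom c"
    then have cp: "c \<in> charts_at A p" using c by (simp add: charts_at_def)
    have T: "X p \<in> tangent_space A p" "Y p \<in> tangent_space A p" "Z p \<in> tangent_space A p"
      using X Y Z by (auto simp: vector_field_tangent)
    have eT: "?e p i \<in> tangent_space A p" for i by (rule coord_vector_tangent[OF cp])
    show "(\<Sum>i\<in>UNIV. X p c $ i * (\<Sum>j\<in>UNIV. Y p c $ j *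
      (\<Sum>k\<in>UNIV. Z p c $ k * \<phi> p (?e p i) (?e p j) (?e p k)))) = \<phi> p (X p) (Y p) (Z p)"
      unfolding tangent_functional_expand[OF form_functional(1)[OF T(2,3)] cp T(1)]
        tangent_functional_expand[OF form_functional(2)[OF eT T(3)] cp T(2)]
        tangent_functional_expand[OF form_functional(3)[OF eT eT] cp T(3)] ..
  qed
qed

end

end

section \<open>Cramer's rule and Gram determinants\<close>

text \<open>An entry of the adjugate matrix, in the form that Cramer's rule gives it. It is
  polynomial in the entries of \<open>G\<close>, so it stays smooth where the determinant
  vanishes.\<close>

definition cofac :: "real^'n^'n \<Rightarrow> 'n \<Rightarrow> 'n \<Rightarrow> real" where
  "cofac G i j = det (\<chi> a b. if b = i then axis j 1 $ a else G $ a $ b)"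

lemma cofac_mult:
  assumes "det G \<noteq> 0"
  shows "(\<Sum>j\<in>UNIV. cofac G i j * (G *v x) $ j) = det G * x $ i"
proof -
  define C where "C = (\<chi> i j. cofac G i j / det G)"
  have "G *v column j C = axis j 1" for j
    by (subst cramer[OF assms]) (simp add: C_def column_def cofac_def)
  then have "G ** C = mat 1"
    by (simp add: vec_eq_iff matrix_vector_mult_def matrix_matrix_mult_def column_def mat_def axis_def)
  then have "C ** G = mat 1" by (simp add: matrix_left_right_inverse)
  then have "(C *v (G *v x)) $ i = x $ i" by (simp add: matrix_vector_mul_assoc)
  then show ?thesis
    using assms by (simp add: C_def matrix_vector_mult_def[of "vec_lambda _"] sum_divide_distrib[symmetric] field_simps)
qed

lemma bmat_pos_def_det:
  assumes "bilinear \<beta>" "\<And>x. x \<noteq> 0 \<Longrightarrow> \<beta> x x > 0"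
  shows "det (bmat \<beta>) \<noteq> 0"
proof -
  have "x = 0" if "bmat \<beta> *v x = 0" for x
    using bmat_apply[OF assms(1), of x x] assms(2)[of x] that by force
  then show ?thesis
    using invertible_det_nz invertible_left_inverse matrix_left_invertible_ker by metis
qed

text \<open>The coordinates of \<open>v\<close> in the basis \<open>x\<close> solve the linear
  system with matrix \<open>G\<close> and right-hand side \<beta>(x_j, v). Multiplication by
  \<open>det G\<close> clears the denominators of Cramer's rule, which keeps the coefficients
  smooth.\<close>

lemma gram_expand:
  fixes x :: "'n::finite \<Rightarrow> real^'n" and v a :: "real^'n" and G :: "real^'n^'n"
  assumes \<beta>: "bilinear \<beta>" and G: "G = (\<chi> i j. \<beta> (x i) (x j))" "det G \<noteq> 0"
  shows "(det G) *\<^sub>R v = (\<Sum>i\<in>UNIV. (\<Sum>j\<in>UNIV. cofac G i j * \<beta> (x j) v) *\<^sub>R x i)" (is ?expand)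
    and "(\<Sum>i\<in>UNIV. a$i *\<^sub>R x i) = 0 \<Longrightarrow> a = 0"
proof -
  define M :: "real^'n^'n" where "M = (\<chi> a i. x i $ a)"
  have Mx: "M *v axis i 1 = x i" for i
    by (simp add: matrix_vector_mult_basis column_def M_def)
  have Ma: "M *v a = (\<Sum>i\<in>UNIV. a$i *\<^sub>R x i)" for a
    by (simp add: M_def matrix_vector_mult_def vec_eq_iff mult.commute)
  have GM: "G = transpose M ** bmat \<beta> ** M"
    by (simp only: bmat_congruence[OF \<beta>] G(1)) (simp only: bmat_def Mx)
  then have "det M \<noteq> 0" using G(2) by (auto simp: det_mul)
  then obtain N where N: "M ** N = mat 1" "N ** M = mat 1"
    by (auto simp: invertible_det_nz[symmetric] invertible_def)
  show "(\<Sum>i\<in>UNIV. a$i *\<^sub>R x i) = 0 \<Longrightarrow> a = 0"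
    unfolding Ma[symmetric] by (metis N(2) matrix_vector_mul_assoc matrix_vector_mul_lid matrix_vector_mult_0_right)
  define y where "y = N *v v"
  have v: "v = M *v y" by (simp add: y_def matrix_vector_mul_assoc N)
  have "(G *v y) $ j = \<beta> (x j) v" for j
  proof -
    have "(G *v y) $ j = axis j 1 \<bullet> (G *v y)" by (simp add: inner_axis')
    also have "axis j 1 \<bullet> (G *v y) = \<beta> (M *v axis j 1) (M *v y)"
      unfolding GM bmat_congruence[OF \<beta>]
      by (rule bmat_apply)
        (simp add: bilinear_def linear_iff matrix_vector_right_distrib matrix_vector_mult_scaleR
          bilinear_ladd[OF \<beta>] bilinear_radd[OF \<beta>] bilinear_lmul[OF \<beta>] bilinear_rmul[OF \<beta>])
    finally show ?thesis by (simp add: Mx v)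
  qed
  then have "(\<Sum>j\<in>UNIV. cofac G i j * \<beta> (x j) v) = det G * y $ i" for i
    using cofac_mult[OF G(2), of i y] by simp
  then show ?expand
    by (simp add: v Ma scaleR_sum_right)
qed

text \<open>A basis can be selected from the spanning values; the Gram matrix is the congruence of a
  positive definite matrix by the invertible matrix of that basis.\<close>

lemma spanning_gram_det:
  fixes \<beta> :: "real^'n::finite \<Rightarrow> real^'n \<Rightarrow> real"
  assumes \<beta>: "bilinear \<beta>" "\<And>x. x \<noteq> 0 \<Longrightarrow> \<beta> x x > 0" and F: "finite F"
    and span: "\<And>\<omega>. (\<And>X. X \<in> F \<Longrightarrow> \<omega> \<bullet> f X = 0) \<Longrightarrow> \<omega> = (0 :: real^'n::finite)"
  obtains S :: "'n::finite \<Rightarrow> 'x" where "range S \<subseteq> F" "det (\<chi> i j. \<beta> (f (S i)) (f (S j))) \<noteq> 0"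
proof -
  have "span (f ` F) = UNIV"
  proof (rule ccontr)
    assume "span (f ` F) \<noteq> UNIV"
    then have "dim (f ` F) < DIM(real^'n)"
      using dim_eq_full[of "f ` F"] dim_subset_UNIV[of "f ` F"] by linarith
    from orthogonal_to_subspace_exists[OF this] obtain \<omega> where
      "\<omega> \<noteq> 0" "\<And>y. y \<in> span (f ` F) \<Longrightarrow> orthogonal \<omega> y" by blast
    then show False using span[of \<omega>] by (auto simp: orthogonal_def span_base)
  qed
  moreover obtain B where B: "B \<subseteq> f ` F" "independent B" "f ` F \<subseteq> span B"
    using maximal_independent_subset[of "f ` F"] by blast
  ultimately have spanB: "span B = UNIV" by (metis span_minimal subspace_span top.extremum_uniqueI)
  then have "card B = card (UNIV :: 'n set)"
    using dim_eq_card[of B UNIV] B(2) by (simp add: dim_UNIV)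
  moreover have "finite B" using B(1) F finite_subset by blast
  ultimately obtain b :: "'n \<Rightarrow> real^'n" where b: "bij_betw b UNIV B"
    using finite_same_card_bij[of "UNIV :: 'n set" B] by auto
  have "\<forall>i. \<exists>X\<in>F. f X = b i"
  proof
    fix i
    have "b i \<in> f ` F" using bij_betwE[OF b] B(1) by blast
    then show "\<exists>X\<in>F. f X = b i" by auto
  qed
  then obtain S where S: "\<And>i. S i \<in> F" "\<And>i. f (S i) = b i" by metis
  define M :: "real^'n^'n" where "M = (\<chi> a i. b i $ a)"
  have Mx: "M *v axis i 1 = b i" for i
    by (simp add: matrix_vector_mult_basis column_def M_def)
  have "B \<subseteq> range ((*v) M)"
    using bij_betw_imp_surj_on[OF b] Mx by (metis image_subset_iff rangeI)
  then have "span B \<subseteq> range ((*v) M)"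
    by (intro span_minimal linear_subspace_image) (auto simp: subspace_UNIV)
  then have "surj ((*v) M)" using spanB by auto
  then have "det M \<noteq> 0"
    by (metis invertible_det_nz invertible_right_inverse matrix_right_invertible_surjective)
  moreover have "(\<chi> i j. \<beta> (f (S i)) (f (S j))) = transpose M ** bmat \<beta> ** M"
    by (simp only: bmat_congruence[OF \<beta>(1)]) (simp only: bmat_def S Mx)
  ultimately have "det (\<chi> i j. \<beta> (f (S i)) (f (S j))) \<noteq> 0"
    using bmat_pos_def_det[OF \<beta>] by (simp add: det_mul)
  then show ?thesis using that[of S] S(1) by auto
qed

context manifold7
begin

definition gram :: "('a \<Rightarrow> ('a, 7) tangent \<Rightarrow> ('a, 7) tangent \<Rightarrow> real) \<Rightarrow> (7 \<Rightarrow> 'a \<Rightarrow> ('a, 7) tangent) \<Rightarrow> 'a \<Rightarrow> real^7^7"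
  where "gram g S p = (\<chi> i j. g p (S i p) (S j p))"

context
  fixes g assumes g: "riemannian_metric A g"
begin

lemma gram_smooth:
  assumes "\<And>i. S i \<in> vector_fields A"
  shows "(\<lambda>p. det (gram g S p)) \<in> smooth_functions A" "(\<lambda>p. cofac (gram g S p) i j) \<in> smooth_functions A"
proof -
  have e: "(\<lambda>p. gram g S p $ a $ b) \<in> smooth_functions A" for a b
    using assms by (simp add: gram_def metric_smooth[OF g])
  then show "(\<lambda>p. det (gram g S p)) \<in> smooth_functions A" by (rule smooth_functions_det)
  have "(\<lambda>p. (\<chi> a b. if b = i then axis j 1 $ a else gram g S p $ a $ b) $ a $ b) \<in> smooth_functions A" for a b
    using e by (cases "b = i") (simp_all add: smooth_functions_const)
  then show "(\<lambda>p. cofac (gram g S p) i j) \<in> smooth_functions A"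
    unfolding cofac_def by (rule smooth_functions_det)
qed

lemma gram_tangent_expand:
  assumes S: "\<And>i. S i \<in> vector_fields A" and v: "v \<in> tangent_space A p" and d: "det (gram g S p) \<noteq> 0"
  shows "tscale (det (gram g S p)) v
    = (\<lambda>c. \<Sum>i\<in>UNIV. (\<Sum>j\<in>UNIV. cofac (gram g S p) i j * g p (S j p) v) *\<^sub>R S i p c)"
proof -
  obtain c where c: "c \<in> charts_at A p" using ex_chart by metis
  have T: "S i p \<in> tangent_space A p" for i by (rule vector_field_tangent[OF S])
  have G: "gram g S p = (\<chi> i j. g p (coord_vector A c p (S i p c)) (coord_vector A c p (S j p c)))"
    by (simp add: gram_def coord_vector_coord[OF c T])
  show ?thesis
  proof (rule tangent_eqI[OF tangent_scale[OF v] tangent_lincomb c])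
    show "S i p \<in> tangent_space A p" for i by (rule T)
    show "det (gram g S p) *\<^sub>R v c = (\<Sum>i\<in>UNIV. (\<Sum>j\<in>UNIV. cofac (gram g S p) i j * g p (S j p) v) *\<^sub>R S i p c)"
      using gram_expand(1)[OF metric_bilinear[OF g c] G d, of "v c"]
      by (simp add: coord_vector_coord[OF c T] coord_vector_coord[OF c v])
  qed
qed

lemma gram_tangent_independent:
  assumes S: "\<And>i. S i \<in> vector_fields A" and d: "det (gram g S p) \<noteq> 0"
    and 0: "(\<lambda>c. \<Sum>i\<in>UNIV. a i *\<^sub>R S i p c) = tzero"
  shows "a i = 0"
proof -
  obtain c where c: "c \<in> charts_at A p" using ex_chart by metis
  have T: "S i p \<in> tangent_space A p" for i by (rule vector_field_tangent[OF S])
  have G: "gram g S p = (\<chi> i j. g p (coord_vector A c p (S i p c)) (coord_vector A c p (S j p c)))"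
    by (simp add: gram_def coord_vector_coord[OF c T])
  have "(\<chi> i. a i) = 0"
    by (rule gram_expand(2)[OF metric_bilinear[OF g c] G d]) (use fun_cong[OF 0, of c] in simp)
  then show ?thesis by (simp add: vec_eq_iff)
qed

lemma finite_gram_cover:
  obtains \<S> where "finite \<S>" "\<And>S i. S \<in> \<S> \<Longrightarrow> S i \<in> vector_fields A" "\<And>p. \<exists>S\<in>\<S>. det (gram g S p) \<noteq> 0"
proof -
  obtain F where F: "finite F" "F \<subseteq> vector_fields A" "\<And>p. spans_at F p"
    using finite_global_spanning by metis
  let ?S = "{S :: 7 \<Rightarrow> _. range S \<subseteq> F}"
  have "?S = PiE UNIV (\<lambda>_. F)" by (auto simp: PiE_UNIV_domain)
  then have "finite ?S" by (simp add: finite_PiE F(1))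
  moreover have "\<exists>S\<in>?S. det (gram g S p) \<noteq> 0" for p
  proof -
    obtain c where c: "c \<in> charts_at A p" using ex_chart by metis
    have pos: "0 < g p (coord_vector A c p x) (coord_vector A c p x)" if "x \<noteq> 0" for x
      using that coord_vector_same[OF c, of x]
      by (intro metric_pos[OF g] coord_vector_tangent[OF c]) (metis)
    have sp: "\<omega> = 0" if "\<And>X. X \<in> F \<Longrightarrow> \<omega> \<bullet> X p c = 0" for \<omega>
      using F(3)[of p] c that unfolding spans_at_def by blast
    obtain S :: "7 \<Rightarrow> 'a \<Rightarrow> ('a, 7) tangent" where S: "range S \<subseteq> F"
      "det (\<chi> i j. g p (coord_vector A c p (S i p c)) (coord_vector A c p (S j p c))) \<noteq> 0"
      by (rule spanning_gram_det[OF metric_bilinear[OF g c] _ F(1), where f = "\<lambda>X. X p c"])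
        (use pos sp that in blast)+
    have "coord_vector A c p (S i p c) = S i p" for i
      by (rule coord_vector_coord[OF c vector_field_tangent]) (use S(1) F(2) in auto)
    then have "det (gram g S p) \<noteq> 0" using S(2) by (simp add: gram_def)
    then show ?thesis using S(1) by blast
  qed
  moreover have "S i \<in> vector_fields A" if "S \<in> ?S" for S i using that F(2) rangeI[of S i] by blast
  ultimately show ?thesis by (intro that[of ?S]) simp_all
qed

section \<open>Global frames and their duals\<close>

text \<open>An overcomplete frame \<open>V\<close> with a dual \<open>U\<close>, paired through
  \<open>g\<close>. The identity exhibits the tangent bundle as a direct summand of the trivial
  bundle of rank \<open>N\<close>.\<close>

definition frame_pair :: "nat \<Rightarrow> (nat \<Rightarrow> 'a \<Rightarrow> ('a, 7) tangent) \<Rightarrow> (nat \<Rightarrow> 'a \<Rightarrow> ('a, 7) tangent) \<Rightarrow> bool" where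
  "frame_pair N U V \<longleftrightarrow> (\<forall>k. U k \<in> vector_fields A) \<and> (\<forall>k. V k \<in> vector_fields A) \<and>
    (\<forall>p. \<forall>v\<in>tangent_space A p. v = (\<lambda>c. \<Sum>k<N. g p (U k p) v *\<^sub>R V k p c))"

lemma frame_pairD:
  assumes "frame_pair N U V"
  shows "U k \<in> vector_fields A" "V k \<in> vector_fields A"
    "v \<in> tangent_space A p \<Longrightarrow> v = (\<lambda>c. \<Sum>k<N. g p (U k p) v *\<^sub>R V k p c)"
  using assms unfolding frame_pair_def by blast+

text \<open>Each tuple expands \<delta> v, where \<delta> is its Gram determinant. Weighting this
  with a second factor \<delta> and dividing by the sum \<open>D\<close> of all squares makes the
  expansions add up to v; a tuple that degenerates at a point contributes nothing there.\<close>

theorem global_frame: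
  obtains N U V where "frame_pair N U V"
proof -
  obtain \<S> where \<S>: "finite \<S>" "\<And>S i. S \<in> \<S> \<Longrightarrow> S i \<in> vector_fields A" "\<And>p. \<exists>S\<in>\<S>. det (gram g S p) \<noteq> 0"
    using finite_gram_cover by metis
  define \<delta> where "\<delta> S p = det (gram g S p)" for S p
  define D where "D p = (\<Sum>S\<in>\<S>. \<delta> S p * \<delta> S p)" for p
  have Dpos: "D p \<noteq> 0" for p
  proof -
    obtain S where "S \<in> \<S>" "\<delta> S p \<noteq> 0" using \<S>(3) by (auto simp: \<delta>_def)
    then have "D p > 0" unfolding D_def by (intro sum_pos2[OF \<S>(1)]) (auto simp: zero_less_mult_iff linorder_neq_iff)
    then show ?thesis by simp
  qed
  have Dsm: "(\<lambda>p. inverse (D p)) \<in> smooth_functions A"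
    unfolding D_def by (intro smooth_functions_inverse smooth_functions_sum smooth_functions_mult)
      (use gram_smooth(1) \<S>(2) Dpos in \<open>auto simp: \<delta>_def D_def\<close>)
  define u where "u S i p = (\<lambda>c. \<Sum>j\<in>UNIV. (inverse (D p) * (\<delta> S p * cofac (gram g S p) i j)) *\<^sub>R S j p c)"
    for S :: "7 \<Rightarrow> 'a \<Rightarrow> ('a, 7) tangent" and i p
  have uV: "u S i \<in> vector_fields A" if "S \<in> \<S>" for S i
    unfolding u_def \<delta>_def using \<S>(2)[OF that]
    by (intro vector_fields_sum vector_fields_scale smooth_functions_mult Dsm gram_smooth) auto
  have key: "v = (\<lambda>c. \<Sum>(S, i)\<in>\<S> \<times> UNIV. g p (u S i p) v *\<^sub>R S i p c)" if v: "v \<in> tangent_space A p" for p v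
  proof
    fix c
    have "(\<Sum>i\<in>UNIV. g p (u S i p) v *\<^sub>R S i p c) = (inverse (D p) * (\<delta> S p * \<delta> S p)) *\<^sub>R v c" if S: "S \<in> \<S>" for S
    proof -
      have gu: "g p (u S i p) v = inverse (D p) * (\<delta> S p * (\<Sum>j\<in>UNIV. cofac (gram g S p) i j * g p (S j p) v))" for i
        unfolding u_def
        using tangent_functional_sum[OF metric_functional_left[OF g v], of UNIV "\<lambda>j. S j p"] \<S>(2)[OF S]
        by (simp add: vector_field_tangent sum_distrib_left mult_ac)
      show ?thesis
      proof (cases "\<delta> S p = 0")
        case False
        then have "(\<Sum>i\<in>UNIV. (\<Sum>j\<in>UNIV. cofac (gram g S p) i j * g p (S j p) v) *\<^sub>R S i p c) = \<delta> S p *\<^sub>R v c"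
          using fun_cong[OF gram_tangent_expand[where S = S, OF \<S>(2)[OF S] v], where x = c] by (simp add: \<delta>_def)
        then have "inverse (D p) *\<^sub>R \<delta> S p *\<^sub>R (\<Sum>i\<in>UNIV. (\<Sum>j\<in>UNIV. cofac (gram g S p) i j * g p (S j p) v) *\<^sub>R S i p c)
            = inverse (D p) *\<^sub>R \<delta> S p *\<^sub>R \<delta> S p *\<^sub>R v c" by simp
        then show ?thesis by (simp add: gu scaleR_sum_right mult_ac)
      qed (simp add: gu)
    qed
    then have "(\<Sum>(S, i)\<in>\<S> \<times> UNIV. g p (u S i p) v *\<^sub>R S i p c) = (\<Sum>S\<in>\<S>. (inverse (D p) * (\<delta> S p * \<delta> S p)) *\<^sub>R v c)"
      by (simp add: sum.cartesian_product[symmetric])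
    also have "\<dots> = (inverse (D p) * D p) *\<^sub>R v c"
      by (simp add: D_def scaleR_sum_left[symmetric] sum_distrib_left)
    finally show "v c = (\<Sum>(S, i)\<in>\<S> \<times> UNIV. g p (u S i p) v *\<^sub>R S i p c)" using Dpos by simp
  qed
  obtain f where f: "bij_betw f {..<card (\<S> \<times> (UNIV :: 7 set))} (\<S> \<times> (UNIV :: 7 set))"
    using ex_bij_betw_nat_finite[of "\<S> \<times> (UNIV :: 7 set)"] \<S>(1) by (auto simp: atLeast0LessThan)
  define N where "N = card (\<S> \<times> (UNIV :: 7 set))"
  define U where "U k = (if k < N then u (fst (f k)) (snd (f k)) else (\<lambda>p. tzero))" for k
  define V where "V k = (if k < N then fst (f k) (snd (f k)) else (\<lambda>p. tzero))" for k
  have fk: "fst (f k) \<in> \<S>" if "k < N" for k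
    using bij_betwE[OF f] that by (auto simp: N_def mem_Times_iff)
  have "frame_pair N U V"
    unfolding frame_pair_def
  proof (intro conjI allI ballI)
    show "U k \<in> vector_fields A" "V k \<in> vector_fields A" for k
      using fk uV \<S>(2) vector_fields_zero by (simp_all add: U_def V_def)
    fix p v assume v: "v \<in> tangent_space A p"
    have "(\<Sum>k<N. g p (U k p) v *\<^sub>R V k p c) = (\<Sum>(S, i)\<in>\<S> \<times> UNIV. g p (u S i p) v *\<^sub>R S i p c)" for c
      unfolding sum.reindex_bij_betw[OF f, symmetric] N_def[symmetric]
      by (intro sum.cong) (auto simp: U_def V_def case_prod_unfold)
    then show "v = (\<lambda>c. \<Sum>k<N. g p (U k p) v *\<^sub>R V k p c)" using key[OF v] by simp
  qed
  then show ?thesis by (rule that)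
qed

end

end

section \<open>Localisation and modules of constant rank\<close>

locale localization = Module.module R M for R (structure) and M :: "('r, 'm, 'd) module_scheme" (structure) +
  fixes S
  assumes S_sub: "S \<subseteq> carrier R" and S_one: "\<one>\<^bsub>R\<^esub> \<in> S"
    and S_mult: "s \<in> S \<Longrightarrow> t \<in> S \<Longrightarrow> s \<otimes>\<^bsub>R\<^esub> t \<in> S"
begin

lemma S_carrier: "s \<in> S \<Longrightarrow> s \<in> carrier R" using S_sub by blast

lemma smult_left_commute:
  "a \<in> carrier R \<Longrightarrow> b \<in> carrier R \<Longrightarrow> x \<in> carrier M \<Longrightarrow> a \<odot>\<^bsub>M\<^esub> (b \<odot>\<^bsub>M\<^esub> x) = b \<odot>\<^bsub>M\<^esub> (a \<odot>\<^bsub>M\<^esub> x)"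
  by (simp add: smult_assoc1[symmetric] R.m_comm)

lemma frac_relI:
  "x \<in> carrier M \<Longrightarrow> y \<in> carrier M \<Longrightarrow> s \<in> S \<Longrightarrow> t \<in> S \<Longrightarrow> u \<in> S
    \<Longrightarrow> u \<odot>\<^bsub>M\<^esub> (t \<odot>\<^bsub>M\<^esub> x) = u \<odot>\<^bsub>M\<^esub> (s \<odot>\<^bsub>M\<^esub> y) \<Longrightarrow> ((x, s), (y, t)) \<in> frac_rel R S M"
  unfolding frac_rel_def by blast

lemma equiv_frac_rel: "equiv (carrier M \<times> S) (frac_rel R S M)"
proof (rule equivI)
  show "frac_rel R S M \<subseteq> (carrier M \<times> S) \<times> (carrier M \<times> S)" by (auto simp: frac_rel_def)
  show "refl_on (carrier M \<times> S) (frac_rel R S M)"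
    using S_one by (auto simp: refl_on_def intro!: frac_relI)
  show "sym (frac_rel R S M)"
    unfolding sym_def frac_rel_def by (auto simp: eq_commute)
  show "trans (frac_rel R S M)"
  proof (rule transI, clarify)
    fix x s y t z r
    assume "((x, s), (y, t)) \<in> frac_rel R S M" "((y, t), (z, r)) \<in> frac_rel R S M"
    then obtain u v where *: "x \<in> carrier M" "y \<in> carrier M" "z \<in> carrier M" "s \<in> S" "t \<in> S" "r \<in> S"
      "u \<in> S" "v \<in> S" and u: "u \<odot>\<^bsub>M\<^esub> (t \<odot>\<^bsub>M\<^esub> x) = u \<odot>\<^bsub>M\<^esub> (s \<odot>\<^bsub>M\<^esub> y)"
      and v: "v \<odot>\<^bsub>M\<^esub> (r \<odot>\<^bsub>M\<^esub> y) = v \<odot>\<^bsub>M\<^esub> (t \<odot>\<^bsub>M\<^esub> z)"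
      unfolding frac_rel_def by auto
    have c: "s \<in> carrier R" "t \<in> carrier R" "r \<in> carrier R" "u \<in> carrier R" "v \<in> carrier R"
      using * S_carrier by auto
    note lc = smult_left_commute
    have "u \<odot>\<^bsub>M\<^esub> (v \<odot>\<^bsub>M\<^esub> (t \<odot>\<^bsub>M\<^esub> (r \<odot>\<^bsub>M\<^esub> x))) = v \<odot>\<^bsub>M\<^esub> (r \<odot>\<^bsub>M\<^esub> (u \<odot>\<^bsub>M\<^esub> (t \<odot>\<^bsub>M\<^esub> x)))"
      using c * by (simp add: lc)
    also have "\<dots> = v \<odot>\<^bsub>M\<^esub> (r \<odot>\<^bsub>M\<^esub> (u \<odot>\<^bsub>M\<^esub> (s \<odot>\<^bsub>M\<^esub> y)))" by (simp only: u)
    also have "\<dots> = u \<odot>\<^bsub>M\<^esub> (s \<odot>\<^bsub>M\<^esub> (v \<odot>\<^bsub>M\<^esub> (r \<odot>\<^bsub>M\<^esub> y)))"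
      using c * by (simp add: lc)
    also have "\<dots> = u \<odot>\<^bsub>M\<^esub> (v \<odot>\<^bsub>M\<^esub> (t \<odot>\<^bsub>M\<^esub> (s \<odot>\<^bsub>M\<^esub> z)))"
      using c * by (simp only: v) (simp add: lc)
    finally have "((u \<otimes> v) \<otimes> t) \<odot>\<^bsub>M\<^esub> (r \<odot>\<^bsub>M\<^esub> x) = ((u \<otimes> v) \<otimes> t) \<odot>\<^bsub>M\<^esub> (s \<odot>\<^bsub>M\<^esub> z)"
      using c * by (simp add: smult_assoc1)
    then show "((x, s), (z, r)) \<in> frac_rel R S M"
      by (rule frac_relI[rotated 5]) (use * S_mult in auto)
  qed
qed

lemma frac_eq_iff:
  assumes "x \<in> carrier M" "y \<in> carrier M" "s \<in> S" "t \<in> S"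
  shows "frac R S M x s = frac R S M y t \<longleftrightarrow> (\<exists>u\<in>S. u \<odot>\<^bsub>M\<^esub> (t \<odot>\<^bsub>M\<^esub> x) = u \<odot>\<^bsub>M\<^esub> (s \<odot>\<^bsub>M\<^esub> y))"
  unfolding frac_def using eq_equiv_class_iff[OF equiv_frac_rel, of "(x, s)" "(y, t)"] assms
  by (auto simp: frac_rel_def)

lemma frac_self: "x \<in> carrier M \<Longrightarrow> s \<in> S \<Longrightarrow> (x, s) \<in> frac R S M x s"
  unfolding frac_def using S_one by (auto intro!: frac_relI)

lemma fracD:
  assumes "(y, t) \<in> frac R S M x s"
  shows "y \<in> carrier M" "t \<in> S" "\<exists>u\<in>S. u \<odot>\<^bsub>M\<^esub> (t \<odot>\<^bsub>M\<^esub> x) = u \<odot>\<^bsub>M\<^esub> (s \<odot>\<^bsub>M\<^esub> y)"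
  using assms by (auto simp: frac_def frac_rel_def)

lemma frac_cancel:
  assumes "x \<in> carrier M" "s \<in> S" "t \<in> S"
  shows "frac R S M (t \<odot>\<^bsub>M\<^esub> x) (t \<otimes> s) = frac R S M x s"
  using assms S_carrier S_mult
  by (subst frac_eq_iff) (auto intro!: bexI[OF _ S_one] simp: smult_assoc1 smult_left_commute)

lemma UN_const: "e \<in> X \<Longrightarrow> (\<And>e. e \<in> X \<Longrightarrow> F e = C) \<Longrightarrow> (\<Union>e\<in>X. F e) = C"
  by auto

text \<open>The sum of two classes is defined as a union over all representatives. Every
  representative gives the same class, so the union collapses to that class.\<close>

lemma loc_module_add:
  assumes "x \<in> carrier M" "y \<in> carrier M" "s \<in> S" "t \<in> S"
  shows "frac R S M x s \<oplus>\<^bsub>loc_module R S M\<^esub> frac R S M y t = frac R S M (t \<odot>\<^bsub>M\<^esub> x \<oplus>\<^bsub>M\<^esub> s \<odot>\<^bsub>M\<^esub> y) (s \<otimes> t)"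
proof -
  let ?F = "\<lambda>x s y t. frac R S M (t \<odot>\<^bsub>M\<^esub> x \<oplus>\<^bsub>M\<^esub> s \<odot>\<^bsub>M\<^esub> y) (s \<otimes> t)"
  have key: "?F x' s' y' t' = ?F x s y t" if X: "(x', s') \<in> frac R S M x s" and Y: "(y', t') \<in> frac R S M y t" for x' s' y' t'
  proof -
    note fx = fracD[OF X] and fy = fracD[OF Y]
    obtain u v where u: "u \<in> S" "u \<odot>\<^bsub>M\<^esub> (s' \<odot>\<^bsub>M\<^esub> x) = u \<odot>\<^bsub>M\<^esub> (s \<odot>\<^bsub>M\<^esub> x')"
      and v: "v \<in> S" "v \<odot>\<^bsub>M\<^esub> (t' \<odot>\<^bsub>M\<^esub> y) = v \<odot>\<^bsub>M\<^esub> (t \<odot>\<^bsub>M\<^esub> y')" using fx(3) fy(3) by auto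
    have c: "s \<in> carrier R" "t \<in> carrier R" "s' \<in> carrier R" "t' \<in> carrier R" "u \<in> carrier R" "v \<in> carrier R"
      using assms fx fy u v S_carrier by auto
    note m = assms(1,2) fx(1) fy(1) c
    note lc = smult_left_commute
    have 1: "u \<odot>\<^bsub>M\<^esub> (v \<odot>\<^bsub>M\<^esub> (s \<odot>\<^bsub>M\<^esub> (t \<odot>\<^bsub>M\<^esub> (t' \<odot>\<^bsub>M\<^esub> x')))) = u \<odot>\<^bsub>M\<^esub> (v \<odot>\<^bsub>M\<^esub> (s' \<odot>\<^bsub>M\<^esub> (t' \<odot>\<^bsub>M\<^esub> (t \<odot>\<^bsub>M\<^esub> x))))"
    proof -
      have "u \<odot>\<^bsub>M\<^esub> (v \<odot>\<^bsub>M\<^esub> (s \<odot>\<^bsub>M\<^esub> (t \<odot>\<^bsub>M\<^esub> (t' \<odot>\<^bsub>M\<^esub> x')))) = v \<odot>\<^bsub>M\<^esub> (t \<odot>\<^bsub>M\<^esub> (t' \<odot>\<^bsub>M\<^esub> (u \<odot>\<^bsub>M\<^esub> (s \<odot>\<^bsub>M\<^esub> x'))))"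
        using m by (simp add: lc)
      also have "\<dots> = v \<odot>\<^bsub>M\<^esub> (t \<odot>\<^bsub>M\<^esub> (t' \<odot>\<^bsub>M\<^esub> (u \<odot>\<^bsub>M\<^esub> (s' \<odot>\<^bsub>M\<^esub> x))))" by (simp only: u)
      finally show ?thesis using m by (simp add: lc)
    qed
    have 2: "u \<odot>\<^bsub>M\<^esub> (v \<odot>\<^bsub>M\<^esub> (s \<odot>\<^bsub>M\<^esub> (t \<odot>\<^bsub>M\<^esub> (s' \<odot>\<^bsub>M\<^esub> y')))) = u \<odot>\<^bsub>M\<^esub> (v \<odot>\<^bsub>M\<^esub> (s' \<odot>\<^bsub>M\<^esub> (t' \<odot>\<^bsub>M\<^esub> (s \<odot>\<^bsub>M\<^esub> y))))"
    proof -
      have "u \<odot>\<^bsub>M\<^esub> (v \<odot>\<^bsub>M\<^esub> (s \<odot>\<^bsub>M\<^esub> (t \<odot>\<^bsub>M\<^esub> (s' \<odot>\<^bsub>M\<^esub> y')))) = u \<odot>\<^bsub>M\<^esub> (s \<odot>\<^bsub>M\<^esub> (s' \<odot>\<^bsub>M\<^esub> (v \<odot>\<^bsub>M\<^esub> (t \<odot>\<^bsub>M\<^esub> y'))))"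
        using m by (simp add: lc)
      also have "\<dots> = u \<odot>\<^bsub>M\<^esub> (s \<odot>\<^bsub>M\<^esub> (s' \<odot>\<^bsub>M\<^esub> (v \<odot>\<^bsub>M\<^esub> (t' \<odot>\<^bsub>M\<^esub> y))))" by (simp only: v)
      finally show ?thesis using m by (simp add: lc)
    qed
    have "(u \<otimes> v) \<odot>\<^bsub>M\<^esub> ((s \<otimes> t) \<odot>\<^bsub>M\<^esub> (t' \<odot>\<^bsub>M\<^esub> x' \<oplus>\<^bsub>M\<^esub> s' \<odot>\<^bsub>M\<^esub> y'))
        = (u \<otimes> v) \<odot>\<^bsub>M\<^esub> ((s' \<otimes> t') \<odot>\<^bsub>M\<^esub> (t \<odot>\<^bsub>M\<^esub> x \<oplus>\<^bsub>M\<^esub> s \<odot>\<^bsub>M\<^esub> y))"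
      using m 1 2 by (simp add: smult_assoc1 smult_r_distr)
    then show ?thesis
      using m assms fx fy u v S_mult by (subst frac_eq_iff) auto
  qed
  have "(\<Union>(x', s')\<in>frac R S M x s. \<Union>(y', t')\<in>frac R S M y t. ?F x' s' y' t') = ?F x s y t"
  proof (rule UN_const[OF frac_self[OF assms(1,3)]], clarify)
    fix x' s' assume X: "(x', s') \<in> frac R S M x s"
    show "(\<Union>(y', t')\<in>frac R S M y t. ?F x' s' y' t') = ?F x s y t"
      by (rule UN_const[OF frac_self[OF assms(2,4)]]) (use key[OF X] in auto)
  qed
  then show ?thesis by (simp add: loc_module_def)
qed

lemma loc_module_smult:
  assumes r: "r \<in> carrier R" "s \<in> S" and x: "x \<in> carrier M" "t \<in> S"
    and loc: "localization R (self_module R) S"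
  shows "frac R S (self_module R) r s \<odot>\<^bsub>loc_module R S M\<^esub> frac R S M x t = frac R S M (r \<odot>\<^bsub>M\<^esub> x) (s \<otimes> t)"
proof -
  interpret L: localization R "self_module R" S by (rule loc)
  let ?F = "\<lambda>r s x t. frac R S M (r \<odot>\<^bsub>M\<^esub> x) (s \<otimes> t)"
  have key: "?F r' s' x' t' = ?F r s x t" if Q: "(r', s') \<in> frac R S (self_module R) r s" and X: "(x', t') \<in> frac R S M x t"
    for r' s' x' t'
  proof -
    note fq = L.fracD[OF Q] and fx = fracD[OF X]
    obtain u v where u: "u \<in> S" "u \<otimes> (s' \<otimes> r) = u \<otimes> (s \<otimes> r')"
      and v: "v \<in> S" "v \<odot>\<^bsub>M\<^esub> (t' \<odot>\<^bsub>M\<^esub> x) = v \<odot>\<^bsub>M\<^esub> (t \<odot>\<^bsub>M\<^esub> x')"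
      using fq(3) fx(3) by (auto simp: self_module_def)
    have r': "r' \<in> carrier R" using fq(1) by (simp add: self_module_def)
    have c: "s \<in> carrier R" "t \<in> carrier R" "s' \<in> carrier R" "t' \<in> carrier R" "u \<in> carrier R" "v \<in> carrier R"
      using assms fx fq u v S_carrier by auto
    note m = r(1) r' x(1) fx(1) c
    have a: "(u \<otimes> (s \<otimes> r')) \<odot>\<^bsub>M\<^esub> (v \<odot>\<^bsub>M\<^esub> (t \<odot>\<^bsub>M\<^esub> x')) = (u \<otimes> (s' \<otimes> r)) \<odot>\<^bsub>M\<^esub> (v \<odot>\<^bsub>M\<^esub> (t' \<odot>\<^bsub>M\<^esub> x))"
      by (simp only: u v)
    note lc = smult_left_commute
    have "(u \<otimes> v) \<odot>\<^bsub>M\<^esub> ((s \<otimes> t) \<odot>\<^bsub>M\<^esub> (r' \<odot>\<^bsub>M\<^esub> x')) = (u \<otimes> v) \<odot>\<^bsub>M\<^esub> ((s' \<otimes> t') \<odot>\<^bsub>M\<^esub> (r \<odot>\<^bsub>M\<^esub> x))"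
      using m a by (simp add: smult_assoc1 lc)
    then show ?thesis
      using m assms(1-4) fx fq u v S_mult by (subst frac_eq_iff) auto
  qed
  have "r \<in> carrier (self_module R)" using r by (simp add: self_module_def)
  from L.frac_self[OF this r(2)] have self: "(r, s) \<in> frac R S (self_module R) r s" .
  have "(\<Union>(r', s')\<in>frac R S (self_module R) r s. \<Union>(x', t')\<in>frac R S M x t. ?F r' s' x' t') = ?F r s x t"
  proof (rule UN_const[OF self], clarify)
    fix r' s' assume Q: "(r', s') \<in> frac R S (self_module R) r s"
    show "(\<Union>(x', t')\<in>frac R S M x t. ?F r' s' x' t') = ?F r s x t"
      by (rule UN_const[OF frac_self[OF x]]) (use key[OF Q] in auto)
  qed
  then show ?thesis by (simp add: loc_module_def)
qed

end

section \<open>A criterion for constant rank\<close>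

lemma (in cring) self_module_module: "Module.module R (self_module R)"
  by (rule Module.moduleI)
    (auto simp: self_module_def is_cring m_assoc l_distr r_distr
      intro!: abelian_groupI a_assoc a_comm bexI[of _ "\<ominus> x" for x] l_neg)

text \<open>An element \<open>D\<close> outside \<open>P\<close> becomes a unit in the localization,
  so the two conditions turn into generation by the \<open>b i\<close> and their independence.
  Stated with \<open>D\<close>, the criterion can be checked in \<open>M\<close> itself without
  fractions.\<close>

lemma (in Module.module) has_rankI:
  assumes ex: "\<And>P. primeideal P R \<Longrightarrow> \<exists>b D. b \<in> {..<n} \<rightarrow> carrier M \<and> D \<in> carrier R \<and> D \<notin> P \<and>
    (\<forall>x\<in>carrier M. \<exists>c\<in>{..<n} \<rightarrow> carrier R. D \<odot>\<^bsub>M\<^esub> x = (\<Oplus>\<^bsub>M\<^esub>i\<in>{..<n}. c i \<odot>\<^bsub>M\<^esub> b i)) \<and>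
    (\<forall>c\<in>{..<n} \<rightarrow> carrier R. (\<Oplus>\<^bsub>M\<^esub>i\<in>{..<n}. c i \<odot>\<^bsub>M\<^esub> b i) = \<zero>\<^bsub>M\<^esub> \<longrightarrow> (\<forall>i<n. D \<otimes> c i = \<zero>))"
  shows "has_rank R M n"
  unfolding has_rank_def
proof (intro allI impI)
  fix P assume P: "primeideal P R"
  interpret P: primeideal P R by (rule P)
  obtain b D where b: "b \<in> {..<n} \<rightarrow> carrier M" and D: "D \<in> carrier R" "D \<notin> P"
    and gen: "\<And>x. x \<in> carrier M \<Longrightarrow> \<exists>c\<in>{..<n} \<rightarrow> carrier R. D \<odot>\<^bsub>M\<^esub> x = (\<Oplus>\<^bsub>M\<^esub>i\<in>{..<n}. c i \<odot>\<^bsub>M\<^esub> b i)"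
    and ind: "\<And>c i. c \<in> {..<n} \<rightarrow> carrier R \<Longrightarrow> (\<Oplus>\<^bsub>M\<^esub>i\<in>{..<n}. c i \<odot>\<^bsub>M\<^esub> b i) = \<zero>\<^bsub>M\<^esub> \<Longrightarrow> i < n \<Longrightarrow> D \<otimes> c i = \<zero>"
    using ex[OF P] by blast
  define S where "S = carrier R - P"
  have one: "\<one> \<notin> P" using P.I_notcarr P.one_imp_carrier by blast
  have S1: "S \<subseteq> carrier R" "\<one> \<in> S" using one by (auto simp: S_def)
  have S2: "s \<otimes> t \<in> S" if "s \<in> S" "t \<in> S" for s t
    using that P.I_prime by (auto simp: S_def)
  interpret L: localization R M S
    by (intro localization.intro localization_axioms.intro module_axioms S1 S2)
  have loc: "localization R (self_module R) S"
    by (intro localization.intro localization_axioms.intro R.self_module_module S1 S2)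
  interpret Q: localization R "self_module R" S by (rule loc)
  have carr: "carrier (self_module R) = carrier R" by (simp add: self_module_def)
  let ?q = "frac R S (self_module R)" and ?f = "frac R S M"
  define \<Sigma> where "\<Sigma> c = (\<Oplus>\<^bsub>M\<^esub>i\<in>{..<n}. c i \<odot>\<^bsub>M\<^esub> b i)" for c
  have \<Sigma>_cl: "\<Sigma> c \<in> carrier M" if "c \<in> {..<n} \<rightarrow> carrier R" for c
    unfolding \<Sigma>_def using that b by (intro M.finsum_closed) auto
  have \<Sigma>_cong: "\<Sigma> c = \<Sigma> c'" if "c' \<in> {..<n} \<rightarrow> carrier R" "\<And>i. i < n \<Longrightarrow> c i = c' i" for c c'
    unfolding \<Sigma>_def using that b by (intro M.finsum_cong') auto
  have \<Sigma>_smult: "\<Sigma> (\<lambda>i. r \<otimes> c i) = r \<odot>\<^bsub>M\<^esub> \<Sigma> c" if "r \<in> carrier R" "c \<in> {..<n} \<rightarrow> carrier R" for r c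
  proof -
    have "\<Sigma> (\<lambda>i. r \<otimes> c i) = (\<Oplus>\<^bsub>M\<^esub>i\<in>{..<n}. r \<odot>\<^bsub>M\<^esub> (c i \<odot>\<^bsub>M\<^esub> b i))"
      unfolding \<Sigma>_def using that b by (intro M.finsum_cong') (auto simp: smult_assoc1 Pi_iff)
    then show ?thesis
      unfolding \<Sigma>_def using that b by (subst finsum_smult_ldistr) auto
  qed
  have \<Sigma>_add: "\<Sigma> (\<lambda>i. c i \<oplus> d i) = \<Sigma> c \<oplus>\<^bsub>M\<^esub> \<Sigma> d"
    if "c \<in> {..<n} \<rightarrow> carrier R" "d \<in> {..<n} \<rightarrow> carrier R" for c d
  proof -
    have "\<Sigma> (\<lambda>i. c i \<oplus> d i) = (\<Oplus>\<^bsub>M\<^esub>i\<in>{..<n}. c i \<odot>\<^bsub>M\<^esub> b i \<oplus>\<^bsub>M\<^esub> d i \<odot>\<^bsub>M\<^esub> b i)"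
      unfolding \<Sigma>_def using that b by (intro M.finsum_cong') (auto simp: smult_l_distr Pi_iff)
    then show ?thesis
      unfolding \<Sigma>_def using that b by (subst M.finsum_addf[symmetric]) auto
  qed
  define rep where "rep x c s \<longleftrightarrow> s \<in> S \<and> c \<in> {..<n} \<rightarrow> carrier R \<and> (\<forall>i<n. x i = ?q (c i) s)"
    for x :: "nat \<Rightarrow> _" and c s
  let ?X = "carrier (free_module (loc_ring R S) n)"
  have ring_carr: "carrier (loc_ring R S) = {?q r s | r s. r \<in> carrier R \<and> s \<in> S}"
    by (auto simp: loc_ring_def loc_module_def Let_def self_module_def)
  have q_cancel: "?q (t \<otimes> r) (t \<otimes> s) = ?q r s" if "r \<in> carrier R" "s \<in> S" "t \<in> S" for r s t
    using Q.frac_cancel[of r s t] that by (simp add: self_module_def)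
  have f_cancel: "?f (t \<odot>\<^bsub>M\<^esub> x) (t \<otimes> s) = ?f x s" if "x \<in> carrier M" "s \<in> S" "t \<in> S" for x s t
    using L.frac_cancel[of x s t] that by simp
  have ex_rep: "\<exists>c s. rep x c s" if x: "\<And>i. i < k \<Longrightarrow> x i \<in> carrier (loc_ring R S)" "k = n" for x k
  proof -
    \<comment> \<open>The denominators are brought to a common one coordinate by coordinate, by
      multiplying numerators crosswise.\<close>
    have "\<exists>c s. s \<in> S \<and> c \<in> {..<k} \<rightarrow> carrier R \<and> (\<forall>i<k. x i = ?q (c i) s)"
      using x(1)
    proof (induction k)
      case 0
      then show ?case using S1 by auto
    next
      case (Suc k)
      then obtain c s where cs: "s \<in> S" "c \<in> {..<k} \<rightarrow> carrier R" "\<And>i. i < k \<Longrightarrow> x i = ?q (c i) s"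
        by (metis less_SucI)
      obtain r t where rt: "r \<in> carrier R" "t \<in> S" "x k = ?q r t"
        using Suc.prems[of k] by (auto simp: ring_carr)
      have c: "s \<in> carrier R" "t \<in> carrier R" using cs rt S1 by auto
      define c' where "c' i = (if i < k then t \<otimes> c i else s \<otimes> r)" for i
      have "x i = ?q (c' i) (t \<otimes> s)" if "i < Suc k" for i
      proof (cases "i < k")
        case True
        then show ?thesis using cs q_cancel[of "c i" s t] rt by (simp add: c'_def Pi_iff)
      next
        case False
        then have "i = k" using that by simp
        then show ?thesis using q_cancel[of r t s] cs rt c by (simp add: c'_def R.m_comm[of t s])
      qed
      moreover have "c' \<in> {..<Suc k} \<rightarrow> carrier R" using cs rt c by (auto simp: c'_def Pi_iff)
      ultimately show ?case using S2[OF rt(2) cs(1)] by blast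
    qed
    then show ?thesis using x(2) by (simp add: rep_def)
  qed
  have rep_unique: "?f (\<Sigma> c) s = ?f (\<Sigma> d) t" if c: "rep x c s" and d: "rep x d t" for x c s d t
  proof -
    have *: "s \<in> S" "t \<in> S" "c \<in> {..<n} \<rightarrow> carrier R" "d \<in> {..<n} \<rightarrow> carrier R"
      "\<And>i. i < n \<Longrightarrow> ?q (c i) s = ?q (d i) t" using c d by (auto simp: rep_def)
    have st: "s \<in> carrier R" "t \<in> carrier R" using * S1 by auto
    \<comment> \<open>Each coordinate comes with its own witness for equality of fractions; their
      product serves all coordinates, which is needed before the numerators can be summed.\<close>
    have "\<exists>u\<in>S. \<forall>i<k. u \<otimes> (t \<otimes> c i) = u \<otimes> (s \<otimes> d i)" if "k \<le> n" for k
      using that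
    proof (induction k)
      case 0
      then show ?case using S1 by auto
    next
      case (Suc k)
      then obtain u where u: "u \<in> S" "\<And>i. i < k \<Longrightarrow> u \<otimes> (t \<otimes> c i) = u \<otimes> (s \<otimes> d i)" by auto
      have k: "k < n" using Suc by simp
      have ck: "c k \<in> carrier R" "d k \<in> carrier R" using * k by auto
      obtain v where v: "v \<in> S" "v \<otimes> (t \<otimes> c k) = v \<otimes> (s \<otimes> d k)"
        using *(5)[OF k] Q.frac_eq_iff[of "c k" "d k" s t] ck *(1,2) by (auto simp: self_module_def)
      have uv: "u \<in> carrier R" "v \<in> carrier R" using u v S1 by auto
      have "(v \<otimes> u) \<otimes> (t \<otimes> c i) = (v \<otimes> u) \<otimes> (s \<otimes> d i)" if "i < Suc k" for i
      proof -
        have i: "c i \<in> carrier R" "d i \<in> carrier R" using * k that by auto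
        show ?thesis
        proof (cases "i < k")
          case True
          then show ?thesis using u(2)[OF True] uv i st by (simp add: R.m_assoc)
        next
          case False
          then have "i = k" using that by simp
          then show ?thesis using v(2) uv i st by (simp add: R.m_comm[of v u] R.m_assoc)
        qed
      qed
      then show ?case using S2[OF v(1) u(1)] by blast
    qed
    then obtain u where u: "u \<in> S" "\<And>i. i < n \<Longrightarrow> u \<otimes> (t \<otimes> c i) = u \<otimes> (s \<otimes> d i)" by blast
    have uc: "u \<in> carrier R" using u S1 by auto
    have "u \<odot>\<^bsub>M\<^esub> (t \<odot>\<^bsub>M\<^esub> \<Sigma> c) = \<Sigma> (\<lambda>i. u \<otimes> (t \<otimes> c i))"
      using * st uc by (subst \<Sigma>_smult) (auto simp: \<Sigma>_smult Pi_iff)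
    also have "\<dots> = \<Sigma> (\<lambda>i. u \<otimes> (s \<otimes> d i))"
      using * st uc u(2) by (intro \<Sigma>_cong) (auto simp: Pi_iff)
    also have "\<dots> = u \<odot>\<^bsub>M\<^esub> (s \<odot>\<^bsub>M\<^esub> \<Sigma> d)"
      using * st uc by (subst \<Sigma>_smult) (auto simp: \<Sigma>_smult Pi_iff)
    finally show ?thesis
      using u(1) * by (subst L.frac_eq_iff) (auto simp: \<Sigma>_cl)
  qed
  \<comment> \<open>The map sends coordinates with common denominator \<open>s\<close> to the
    combination of the \<open>b i\<close> over \<open>s\<close>. The choice of numerators and
    denominator is harmless by \<open>rep_unique\<close>.\<close>
  define F where "F = (\<lambda>x\<in>?X. SOME z. \<exists>c s. rep x c s \<and> z = ?f (\<Sigma> c) s)"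
  have F: "F x = ?f (\<Sigma> c) s" if "x \<in> ?X" "rep x c s" for x c s
  proof -
    have "F x = (SOME z. \<exists>c s. rep x c s \<and> z = ?f (\<Sigma> c) s)" using that(1) by (simp only: F_def restrict_apply if_True)
    also have "\<dots> = ?f (\<Sigma> c) s"
    proof (rule some_equality)
      show "\<exists>c' s'. rep x c' s' \<and> ?f (\<Sigma> c) s = ?f (\<Sigma> c') s'" using that(2) by (intro exI[of _ c] exI[of _ s]) simp
      show "z = ?f (\<Sigma> c) s" if "\<exists>c s. rep x c s \<and> z = ?f (\<Sigma> c) s" for z
        using that rep_unique[OF _ \<open>rep x c s\<close>] by (elim exE conjE) simp
    qed
    finally show ?thesis .
  qed
  have X_rep: "\<exists>c s. rep x c s" if "x \<in> ?X" for x
    using that by (intro ex_rep[of n]) (auto simp: free_module_def)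
  have rep_X: "\<exists>x\<in>?X. rep x c s" if "c \<in> {..<n} \<rightarrow> carrier R" "s \<in> S" for c s
    using that by (intro bexI[of _ "\<lambda>i\<in>{..<n}. ?q (c i) s"]) (auto simp: rep_def free_module_def ring_carr)
  have rep_carr: "rep x c s \<Longrightarrow> s \<in> S \<and> s \<in> carrier R \<and> c \<in> {..<n} \<rightarrow> carrier R" for x c s
    using S1 by (auto simp: rep_def)
  have loc_carr: "?f x s \<in> carrier (loc_module R S M)" if "x \<in> carrier M" "s \<in> S" for x s
    using that by (force simp: loc_module_def)
  have free_carr: "x \<in> ?X" if "rep x c s" "x \<in> extensional {..<n}" for x c s
    using that by (auto simp: free_module_def ring_carr PiE_def rep_def Pi_iff)
  have lin: "F \<in> linear_maps (loc_ring R S) (free_module (loc_ring R S) n) (loc_module R S M)"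
    unfolding linear_maps_def
  proof (intro CollectI conjI ballI)
    show "F \<in> ?X \<rightarrow>\<^sub>E carrier (loc_module R S M)"
    proof
      fix x assume x: "x \<in> ?X"
      then obtain c s where "rep x c s" using X_rep by blast
      then show "F x \<in> carrier (loc_module R S M)"
        using F[OF x] rep_carr[of x c s] \<Sigma>_cl loc_carr by simp
    qed (simp add: F_def)
    fix x assume x: "x \<in> ?X"
    then obtain c s where cs: "rep x c s" using X_rep by blast
    note c = rep_carr[OF cs]
    { fix y assume y: "y \<in> ?X"
      then obtain d t where dt: "rep y d t" using X_rep by blast
      note d = rep_carr[OF dt]
      have xi: "?q (c i) s \<oplus>\<^bsub>loc_ring R S\<^esub> ?q (d i) t = ?q (t \<otimes> c i \<oplus> s \<otimes> d i) (s \<otimes> t)" if "i < n" for i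
        using Q.loc_module_add[of "c i" "d i" s t] c d that
        by (simp add: loc_ring_def Let_def carr Pi_iff) (simp add: self_module_def)
      have st: "s \<otimes> t \<in> S" using S2 c d by blast
      let ?e = "\<lambda>i. t \<otimes> c i \<oplus> s \<otimes> d i"
      have e: "?e \<in> {..<n} \<rightarrow> carrier R" using c d by (auto simp: Pi_iff)
      let ?z = "x \<oplus>\<^bsub>free_module (loc_ring R S) n\<^esub> y"
      have z: "rep ?z ?e (s \<otimes> t)"
        using cs dt st e xi by (auto simp: rep_def free_module_def)
      have "?z \<in> ?X"
        by (rule free_carr[OF z]) (simp add: free_module_def)
      then have "F ?z = ?f (\<Sigma> ?e) (s \<otimes> t)" using F z by blast
      also have "\<Sigma> ?e = t \<odot>\<^bsub>M\<^esub> \<Sigma> c \<oplus>\<^bsub>M\<^esub> s \<odot>\<^bsub>M\<^esub> \<Sigma> d"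
        using c d by (subst \<Sigma>_add) (auto simp: \<Sigma>_smult Pi_iff)
      also have "?f (t \<odot>\<^bsub>M\<^esub> \<Sigma> c \<oplus>\<^bsub>M\<^esub> s \<odot>\<^bsub>M\<^esub> \<Sigma> d) (s \<otimes> t) = ?f (\<Sigma> c) s \<oplus>\<^bsub>loc_module R S M\<^esub> ?f (\<Sigma> d) t"
        using c d \<Sigma>_cl by (intro L.loc_module_add[symmetric]) auto
      finally show "F ?z = F x \<oplus>\<^bsub>loc_module R S M\<^esub> F y" using F[OF x cs] F[OF y dt] by simp
    }
    fix r assume "r \<in> carrier (loc_ring R S)"
    then obtain a u where a: "a \<in> carrier R" "u \<in> S" "r = ?q a u" by (auto simp: ring_carr)
    have ri: "?q a u \<otimes>\<^bsub>loc_ring R S\<^esub> ?q (c i) s = ?q (a \<otimes> c i) (u \<otimes> s)" if "i < n" for i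
      using Q.loc_module_smult[OF a(1,2) _ _ loc, of "c i" s] c that
      by (simp add: loc_ring_def Let_def carr Pi_iff) (simp add: self_module_def)
    have us: "u \<otimes> s \<in> S" using S2 c a by blast
    let ?e = "\<lambda>i. a \<otimes> c i"
    have e: "?e \<in> {..<n} \<rightarrow> carrier R" using c a by (auto simp: Pi_iff)
    let ?z = "r \<odot>\<^bsub>free_module (loc_ring R S) n\<^esub> x"
    have z: "rep ?z ?e (u \<otimes> s)"
      using cs us e ri a(3) by (auto simp: rep_def free_module_def)
    have "?z \<in> ?X"
      by (rule free_carr[OF z]) (simp add: free_module_def)
    then have "F ?z = ?f (\<Sigma> ?e) (u \<otimes> s)" using F z by blast
    also have "\<Sigma> ?e = a \<odot>\<^bsub>M\<^esub> \<Sigma> c" using c a by (simp add: \<Sigma>_smult)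
    also have "?f (a \<odot>\<^bsub>M\<^esub> \<Sigma> c) (u \<otimes> s) = ?q a u \<odot>\<^bsub>loc_module R S M\<^esub> ?f (\<Sigma> c) s"
      using c a \<Sigma>_cl loc by (intro L.loc_module_smult[symmetric]) auto
    finally show "F ?z = r \<odot>\<^bsub>loc_module R S M\<^esub> F x" using F[OF x cs] a(3) by simp
  qed
  have "bij_betw F ?X (carrier (loc_module R S M))"
    unfolding bij_betw_def
  proof
    show "inj_on F ?X"
    proof (rule inj_onI)
      fix x y assume x: "x \<in> ?X" and y: "y \<in> ?X" and eq: "F x = F y"
      obtain c s where cs: "rep x c s" using X_rep[OF x] by blast
      obtain d t where dt: "rep y d t" using X_rep[OF y] by blast
      note c = rep_carr[OF cs] and d = rep_carr[OF dt]
      obtain u where u: "u \<in> S" "u \<odot>\<^bsub>M\<^esub> (t \<odot>\<^bsub>M\<^esub> \<Sigma> c) = u \<odot>\<^bsub>M\<^esub> (s \<odot>\<^bsub>M\<^esub> \<Sigma> d)"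
        using eq L.frac_eq_iff[of "\<Sigma> c" "\<Sigma> d" s t] c d \<Sigma>_cl by (auto simp: F[OF x cs] F[OF y dt])
      have uc: "u \<in> carrier R" using u S1 by auto
      \<comment> \<open>The sign is written as the scalar minus one, so that \<Sigma>-linearity for
        sums and scalars covers the difference.\<close>
      let ?c = "\<lambda>i. u \<otimes> (t \<otimes> c i)" and ?d = "\<lambda>i. \<ominus> \<one> \<otimes> (u \<otimes> (s \<otimes> d i))"
      have cd: "?c \<in> {..<n} \<rightarrow> carrier R" "?d \<in> {..<n} \<rightarrow> carrier R" "(\<lambda>i. u \<otimes> (s \<otimes> d i)) \<in> {..<n} \<rightarrow> carrier R"
        "(\<lambda>i. t \<otimes> c i) \<in> {..<n} \<rightarrow> carrier R" "(\<lambda>i. s \<otimes> d i) \<in> {..<n} \<rightarrow> carrier R"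
        using c d uc by (auto simp: Pi_iff)
      have "\<Sigma> (\<lambda>i. ?c i \<oplus> ?d i) = \<Sigma> ?c \<oplus>\<^bsub>M\<^esub> \<ominus> \<one> \<odot>\<^bsub>M\<^esub> \<Sigma> (\<lambda>i. u \<otimes> (s \<otimes> d i))"
        using cd by (simp add: \<Sigma>_add \<Sigma>_smult)
      also have "\<Sigma> ?c = u \<odot>\<^bsub>M\<^esub> (t \<odot>\<^bsub>M\<^esub> \<Sigma> c)" using c d uc cd by (simp add: \<Sigma>_smult)
      also have "\<Sigma> (\<lambda>i. u \<otimes> (s \<otimes> d i)) = u \<odot>\<^bsub>M\<^esub> (t \<odot>\<^bsub>M\<^esub> \<Sigma> c)" using c d uc cd u by (simp add: \<Sigma>_smult)
      also have "u \<odot>\<^bsub>M\<^esub> (t \<odot>\<^bsub>M\<^esub> \<Sigma> c) \<oplus>\<^bsub>M\<^esub> \<ominus> \<one> \<odot>\<^bsub>M\<^esub> (u \<odot>\<^bsub>M\<^esub> (t \<odot>\<^bsub>M\<^esub> \<Sigma> c)) = \<zero>\<^bsub>M\<^esub>"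
        using c d uc \<Sigma>_cl by (simp add: smult_l_minus M.r_neg)
      finally have 0: "\<Sigma> (\<lambda>i. ?c i \<oplus> ?d i) = \<zero>\<^bsub>M\<^esub>" .
      have "x i = y i" if i: "i < n" for i
      proof -
        have ci: "c i \<in> carrier R" "d i \<in> carrier R" using c d i by auto
        \<comment> \<open>The difference of the numerators is a relation among the
          \<open>b i\<close>, so \<open>D\<close> kills its coefficients. Then
          \<open>D \<otimes> u\<close> lies in \<open>S\<close> and witnesses equality of the
          fractions.\<close>
        have "D \<otimes> (?c i \<oplus> ?d i) = \<zero>"
          by (rule ind) (use cd 0 i in \<open>auto simp: \<Sigma>_def Pi_iff\<close>)
        then have "(D \<otimes> u) \<otimes> (t \<otimes> c i) \<oplus> \<ominus> ((D \<otimes> u) \<otimes> (s \<otimes> d i)) = \<zero>"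
          using D uc c d ci by (simp add: R.r_distr R.l_minus R.r_minus R.m_assoc)
        then have "(D \<otimes> u) \<otimes> (t \<otimes> c i) = (D \<otimes> u) \<otimes> (s \<otimes> d i)"
          using D uc c d ci R.minus_equality[of "(D \<otimes> u) \<otimes> (t \<otimes> c i)" "\<ominus> ((D \<otimes> u) \<otimes> (s \<otimes> d i))"] by simp
        moreover have "D \<otimes> u \<in> S" using S2 u D by (auto simp: S_def)
        ultimately have "?q (c i) s = ?q (d i) t"
          using c d ci by (subst Q.frac_eq_iff) (auto simp: self_module_def)
        then show ?thesis using cs dt i by (simp add: rep_def)
      qed
      then show "x = y" using x y by (intro extensionalityI[of _ "{..<n}"]) (auto simp: free_module_def PiE_def)
    qed
    show "F ` ?X = carrier (loc_module R S M)"
    proof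
      show "F ` ?X \<subseteq> carrier (loc_module R S M)" using lin by (auto simp: linear_maps_def)
      show "carrier (loc_module R S M) \<subseteq> F ` ?X"
      proof
        fix z assume "z \<in> carrier (loc_module R S M)"
        then obtain m s where z: "z = ?f m s" "m \<in> carrier M" "s \<in> S" by (auto simp: loc_module_def)
        obtain c where c: "c \<in> {..<n} \<rightarrow> carrier R" "D \<odot>\<^bsub>M\<^esub> m = \<Sigma> c" using gen[OF z(2)] by (auto simp: \<Sigma>_def)
        have DS: "D \<in> S" using D by (simp add: S_def)
        obtain x where x: "x \<in> ?X" "rep x c (D \<otimes> s)" using rep_X[OF c(1) S2[OF DS z(3)]] by blast
        have "F x = z" using F[OF x] f_cancel[OF z(2,3) DS] c(2) z(1) by simp
        then show "z \<in> F ` ?X" using x(1) by blast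
      qed
    qed
  qed
  then have "F \<in> linear_isos (loc_ring R S) (free_module (loc_ring R S) n) (loc_module R S M)"
    using lin by (simp add: linear_isos_def)
  then show "linear_isos (loc_ring R (carrier R - P)) (free_module (loc_ring R (carrier R - P)) n)
      (loc_module R (carrier R - P) M) \<noteq> {}"
    unfolding S_def by blast
qed

section \<open>The module of sections of \<open>\<real> \<oplus> TM\<close>\<close>

context manifold
begin

lemma smooth_ring_simps [simp]:
  "carrier (smooth_ring A) = smooth_functions A"
  "f \<otimes>\<^bsub>smooth_ring A\<^esub> h = (\<lambda>p. f p * h p)" "\<one>\<^bsub>smooth_ring A\<^esub> = (\<lambda>p. 1)"
  "f \<oplus>\<^bsub>smooth_ring A\<^esub> h = (\<lambda>p. f p + h p)" "\<zero>\<^bsub>smooth_ring A\<^esub> = (\<lambda>p. 0)"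
  by (simp_all add: smooth_ring_def)

lemma smooth_ring_cring: "cring (smooth_ring A)"
proof (rule cringI)
  show "abelian_group (smooth_ring A)"
  proof (rule abelian_groupI)
    show "\<exists>y\<in>carrier (smooth_ring A). y \<oplus>\<^bsub>smooth_ring A\<^esub> x = \<zero>\<^bsub>smooth_ring A\<^esub>" if "x \<in> carrier (smooth_ring A)" for x
      using that smooth_functions_minus[of x] by (intro bexI[of _ "\<lambda>p. - x p"]) simp_all
  qed (simp_all add: smooth_functions_add smooth_functions_const add_ac)
  show "comm_monoid (smooth_ring A)"
    by (rule comm_monoidI) (simp_all add: smooth_functions_mult smooth_functions_const mult_ac)
qed (simp add: distrib_right)

lemma smooth_ring_two:
  "\<one>\<^bsub>smooth_ring A\<^esub> \<oplus>\<^bsub>smooth_ring A\<^esub> \<one>\<^bsub>smooth_ring A\<^esub> \<in> Units (smooth_ring A)"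
  "inv\<^bsub>smooth_ring A\<^esub> (\<one>\<^bsub>smooth_ring A\<^esub> \<oplus>\<^bsub>smooth_ring A\<^esub> \<one>\<^bsub>smooth_ring A\<^esub>) = (\<lambda>p. 1 / 2)"
proof -
  interpret cring "smooth_ring A" by (rule smooth_ring_cring)
  show "\<one>\<^bsub>smooth_ring A\<^esub> \<oplus>\<^bsub>smooth_ring A\<^esub> \<one>\<^bsub>smooth_ring A\<^esub> \<in> Units (smooth_ring A)"
    unfolding Units_def by (auto simp: smooth_functions_const intro!: bexI[of _ "\<lambda>p. 1 / 2"])
  show "inv\<^bsub>smooth_ring A\<^esub> (\<one>\<^bsub>smooth_ring A\<^esub> \<oplus>\<^bsub>smooth_ring A\<^esub> \<one>\<^bsub>smooth_ring A\<^esub>) = (\<lambda>p. 1 / 2)"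
    by (rule comm_inv_char) (simp_all add: smooth_functions_const)
qed

lemma osections_iff: "x \<in> osections A \<longleftrightarrow> fst x \<in> smooth_functions A \<and> snd x \<in> vector_fields A"
  by (cases x) (simp add: osections_def)

lemma bundle_simps [simp]:
  "carrier (bundle_algebra A m g) = osections A" "mult (bundle_algebra A m g) = m"
  "one (bundle_algebra A m g) = (\<lambda>p. 1, \<lambda>p. tzero)" "zero (bundle_algebra A m g) = (\<lambda>p. 0, \<lambda>p. tzero)"
  "add (bundle_algebra A m g) x y = (\<lambda>p. fst x p + fst y p, \<lambda>p. tplus (snd x p) (snd y p))"
  "smult (bundle_algebra A m g) f x = (\<lambda>p. f p * fst x p, \<lambda>p. tscale (f p) (snd x p))"
  "bform (bundle_algebra A m g) = bundle_form A g"
  by (simp_all add: bundle_algebra_def)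

lemma self_module_simps [simp]:
  "carrier (self_module R) = carrier R" "add (self_module R) = add R" "smult (self_module R) = mult R"
  by (simp_all add: self_module_def)

lemma bundle_module: "Module.module (smooth_ring A) (bundle_algebra A m g)"
proof (rule Module.moduleI[OF smooth_ring_cring])
  show "abelian_group (bundle_algebra A m g)"
  proof (rule abelian_groupI)
    show "\<exists>y\<in>carrier (bundle_algebra A m g). y \<oplus>\<^bsub>bundle_algebra A m g\<^esub> x = \<zero>\<^bsub>bundle_algebra A m g\<^esub>"
      if "x \<in> carrier (bundle_algebra A m g)" for x
      using that smooth_functions_minus[of "fst x"] vector_fields_scale[OF smooth_functions_const, of "snd x" "-1"]
      by (intro bexI[of _ "(\<lambda>p. - fst x p, \<lambda>p. tscale (-1) (snd x p))"]) (simp_all add: osections_iff)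
  qed (auto simp: osections_iff smooth_functions_add vector_fields_add smooth_functions_const vector_fields_zero add_ac)
qed (auto simp: osections_iff smooth_functions_mult vector_fields_scale algebra_simps prod_eq_iff)

lemma bundle_finsum:
  fixes h :: "nat \<Rightarrow> ('a, 'n) osection"
  assumes "\<And>i. i < n \<Longrightarrow> h i \<in> osections A"
  shows "finsum (bundle_algebra A m g) h {..<n} = (\<lambda>p. \<Sum>i<n. fst (h i) p, \<lambda>p c. \<Sum>i<n. snd (h i) p c)"
  using assms
proof (induction n)
  case 0
  interpret Module.module "smooth_ring A" "bundle_algebra A m g" by (rule bundle_module)
  show ?case by simp
next
  case (Suc n)
  interpret Module.module "smooth_ring A" "bundle_algebra A m g" by (rule bundle_module)
  have "finsum (bundle_algebra A m g) h (insert n {..<n})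
      = h n \<oplus>\<^bsub>bundle_algebra A m g\<^esub> finsum (bundle_algebra A m g) h {..<n}"
    by (rule M.finsum_insert) (use Suc.prems in auto)
  then show ?case using Suc by (simp add: lessThan_Suc add.commute)
qed

end

context manifold7
begin

context
  fixes g assumes g: "riemannian_metric A g"
begin

text \<open>The coefficients of \<open>v\<close> in the global frame are frozen at \<open>p\<close>
  and used as constants everywhere. Unlike an arbitrary extension, this one is linear in
  \<open>v\<close>, so identities between fields descend to bilinear maps on the tangent
  space.\<close>

lemma linear_extension:
  obtains E :: "'a \<Rightarrow> ('a, 7) tangent \<Rightarrow> 'a \<Rightarrow> ('a, 7) tangent"
  where "\<And>p v. E p v \<in> vector_fields A" "\<And>p v. v \<in> tangent_space A p \<Longrightarrow> E p v p = v"
    "\<And>p v w. v \<in> tangent_space A p \<Longrightarrow> w \<in> tangent_space A p \<Longrightarrow>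
      E p (tplus v w) = (\<lambda>q. tplus (E p v q) (E p w q))"
    "\<And>p r v. v \<in> tangent_space A p \<Longrightarrow> E p (tscale r v) = (\<lambda>q. tscale r (E p v q))"
proof -
  obtain N U V where fr: "frame_pair g N U V" by (rule global_frame[OF g])
  note UV = frame_pairD[OF g fr]
  define E where "E p v = (\<lambda>q c. \<Sum>k<N. g p (U k p) v *\<^sub>R V k q c)" for p v
  have U: "tangent_functional A p (g p (U k p))" for p k
    by (rule metric_functional[OF g vector_field_tangent[OF UV(1)]])
  show ?thesis
  proof (rule that)
    show "E p v \<in> vector_fields A" for p v
      unfolding E_def by (intro vector_fields_sum vector_fields_scale smooth_functions_const UV(1,2))
    show "E p v p = v" if "v \<in> tangent_space A p" for p v
      using UV(3)[OF that] by (simp add: E_def)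
    show "E p (tplus v w) = (\<lambda>q. tplus (E p v q) (E p w q))"
      if "v \<in> tangent_space A p" "w \<in> tangent_space A p" for p v w
      by (simp add: E_def tangent_functional_add[OF U that] scaleR_add_left sum.distrib)
    show "E p (tscale r v) = (\<lambda>q. tscale r (E p v q))" if "v \<in> tangent_space A p" for p r v
      by (simp add: E_def tangent_functional_scale[OF U that] scaleR_sum_right)
  qed
qed

lemma ex_field_through:
  assumes "v \<in> tangent_space A p"
  shows "\<exists>X\<in>vector_fields A. X p = v"
  by (rule linear_extension) (use assms in blast)

text \<open>Pairing with \<open>U\<close> embeds the sections into a free module and combining the
  \<open>V\<close> retracts it; the frame identity says that the composite is the identity. Index 0
  carries the function summand.\<close>

lemma bundle_fin_gen_projective: "fin_gen_projective (smooth_ring A) (bundle_algebra A m h)"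
proof -
  obtain N U V where fr: "frame_pair g N U V" by (rule global_frame[OF g])
  note UV = frame_pairD[OF g fr]
  have U: "tangent_functional A p (g p (U k p))" for p k
    by (rule metric_functional[OF g vector_field_tangent[OF UV(1)]])
  let ?R = "smooth_ring A" and ?C = "bundle_algebra A m h"
  define i where "i = (\<lambda>x\<in>osections A. \<lambda>k\<in>{..<Suc N}. case k of 0 \<Rightarrow> fst x | Suc j \<Rightarrow> (\<lambda>p. g p (U j p) (snd x p)))"
  define r where "r = (\<lambda>a\<in>{..<Suc N} \<rightarrow>\<^sub>E smooth_functions A. (a 0, \<lambda>p c. \<Sum>k<N. a (Suc k) p *\<^sub>R V k p c))"
  have os: "fst x \<in> smooth_functions A" "snd x \<in> vector_fields A" if "x \<in> osections A" for x
    using that by (auto simp: osections_iff)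
  have sT: "snd x p \<in> tangent_space A p" if "x \<in> osections A" for x p
    using os(2)[OF that] by (rule vector_field_tangent)
  have free: "carrier (free_module ?R (Suc N)) = {..<Suc N} \<rightarrow>\<^sub>E smooth_functions A"
    by (simp add: free_module_def)
  have i_car: "i x \<in> {..<Suc N} \<rightarrow>\<^sub>E smooth_functions A" if "x \<in> osections A" for x
    using that by (auto simp: i_def os metric_smooth[OF g] UV(1,2) split: nat.split)
  have "i \<in> linear_maps ?R ?C (free_module ?R (Suc N))"
    unfolding linear_maps_def
  proof (intro CollectI conjI ballI)
    show "i \<in> carrier ?C \<rightarrow>\<^sub>E carrier (free_module ?R (Suc N))"
      using i_car unfolding free by (auto simp: i_def)
    fix x assume x: "x \<in> carrier ?C"
    then have x': "x \<in> osections A" by simp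
    { fix y assume "y \<in> carrier ?C"
      then have y: "y \<in> osections A" by simp
      have xy: "x \<oplus>\<^bsub>?C\<^esub> y \<in> osections A"
        using os[OF x'] os[OF y] by (simp add: osections_iff smooth_functions_add vector_fields_add)
      show "i (x \<oplus>\<^bsub>?C\<^esub> y) = i x \<oplus>\<^bsub>free_module ?R (Suc N)\<^esub> i y"
      proof
        fix k show "i (x \<oplus>\<^bsub>?C\<^esub> y) k = (i x \<oplus>\<^bsub>free_module ?R (Suc N)\<^esub> i y) k"
          using x' y xy by (simp add: i_def free_module_def tangent_functional_add[OF U sT sT] split: nat.split)
      qed }
    fix f assume "f \<in> carrier ?R"
    then have fx: "f \<odot>\<^bsub>?C\<^esub> x \<in> osections A"
      using os[OF x'] by (simp add: osections_iff smooth_functions_mult vector_fields_scale)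
    show "i (f \<odot>\<^bsub>?C\<^esub> x) = f \<odot>\<^bsub>free_module ?R (Suc N)\<^esub> i x"
    proof
      fix k show "i (f \<odot>\<^bsub>?C\<^esub> x) k = (f \<odot>\<^bsub>free_module ?R (Suc N)\<^esub> i x) k"
        using x' fx by (simp add: i_def free_module_def tangent_functional_scale[OF U sT] split: nat.split)
    qed
  qed
  moreover have "r \<in> linear_maps ?R (free_module ?R (Suc N)) ?C"
    unfolding linear_maps_def
  proof (intro CollectI conjI ballI)
    show "r \<in> carrier (free_module ?R (Suc N)) \<rightarrow>\<^sub>E carrier ?C"
      unfolding free
    proof
      fix a assume a: "a \<in> {..<Suc N} \<rightarrow>\<^sub>E smooth_functions A"
      then have "a k \<in> smooth_functions A" if "k < Suc N" for k using that by auto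
      then show "r a \<in> carrier ?C"
        using a by (auto simp: r_def osections_iff UV(1,2) intro!: vector_fields_sum vector_fields_scale)
    qed (simp add: r_def)
    fix a assume a: "a \<in> carrier (free_module ?R (Suc N))"
    { fix b assume b: "b \<in> carrier (free_module ?R (Suc N))"
      have "a \<oplus>\<^bsub>free_module ?R (Suc N)\<^esub> b \<in> {..<Suc N} \<rightarrow>\<^sub>E smooth_functions A"
        using a b by (auto simp: free_module_def intro!: smooth_functions_add)
      then show "r (a \<oplus>\<^bsub>free_module ?R (Suc N)\<^esub> b) = r a \<oplus>\<^bsub>?C\<^esub> r b"
        using a b unfolding free by (simp add: r_def free_module_def scaleR_add_left sum.distrib) }
    fix f assume f: "f \<in> carrier ?R"
    have "f \<odot>\<^bsub>free_module ?R (Suc N)\<^esub> a \<in> {..<Suc N} \<rightarrow>\<^sub>E smooth_functions A"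
      using a f by (auto simp: free_module_def intro!: smooth_functions_mult)
    then show "r (f \<odot>\<^bsub>free_module ?R (Suc N)\<^esub> a) = f \<odot>\<^bsub>?C\<^esub> r a"
      using a unfolding free by (simp add: r_def free_module_def scaleR_sum_right)
  qed
  moreover have "r (i x) = x" if x: "x \<in> carrier ?C" for x
  proof -
    have x': "x \<in> osections A" using x by simp
    have "snd x p = (\<lambda>c. \<Sum>k<N. g p (U k p) (snd x p) *\<^sub>R V k p c)" for p
      by (rule UV(3)[OF sT[OF x']])
    then have "(\<lambda>p c. \<Sum>k<N. g p (U k p) (snd x p) *\<^sub>R V k p c) = snd x" by (intro ext) metis
    then show ?thesis
      unfolding r_def restrict_apply' [OF i_car[OF x']] using x' by (simp add: i_def)
  qed
  ultimately show ?thesis unfolding fin_gen_projective_def by blast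
qed

text \<open>If a prime ideal contained all Gram determinants, it would contain the sum of their
  squares, which is a unit. So some tuple has its determinant outside the ideal, and with the unit
  section it supplies the eight elements for \<open>has_rankI\<close>.\<close>

lemma bundle_has_rank: "has_rank (smooth_ring A) (bundle_algebra A m h) 8"
proof (rule module.has_rankI[OF bundle_module])
  fix P assume P: "primeideal P (smooth_ring A)"
  interpret P: primeideal P "smooth_ring A" by (rule P)
  obtain \<S> where \<S>: "finite \<S>" "\<And>S i. S \<in> \<S> \<Longrightarrow> S i \<in> vector_fields A" "\<And>p. \<exists>S\<in>\<S>. det (gram g S p) \<noteq> 0"
    using finite_gram_cover[OF g] by metis
  define \<delta> where "\<delta> S = (\<lambda>p. det (gram g S p))" for S
  have \<delta>sm: "\<delta> S \<in> smooth_functions A" if "S \<in> \<S>" for S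
    unfolding \<delta>_def by (rule gram_smooth(1)[OF g \<S>(2)[OF that]])
  have "\<exists>S\<in>\<S>. \<delta> S \<notin> P"
  proof (rule ccontr)
    assume "\<not> ?thesis"
    then have in_P: "\<delta> S \<in> P" if "S \<in> \<S>" for S using that by blast
    define D where "D = (\<lambda>p. \<Sum>S\<in>\<S>. \<delta> S p * \<delta> S p)"
    have "(\<lambda>p. \<Sum>S\<in>T. \<delta> S p * \<delta> S p) \<in> P" if "T \<subseteq> \<S>" for T
      using finite_subset[OF that \<S>(1)] that
    proof (induction T rule: finite_induct)
      case empty
      then show ?case using additive_subgroup.zero_closed[OF P.is_additive_subgroup] by simp
    next
      case (insert S T)
      have "(\<lambda>p. \<delta> S p * \<delta> S p) \<in> P"
        using P.I_l_closed[of "\<delta> S" "\<delta> S"] in_P[of S] \<delta>sm[of S] insert by simp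
      then have "(\<lambda>p. \<delta> S p * \<delta> S p + (\<Sum>S\<in>T. \<delta> S p * \<delta> S p)) \<in> P"
        using additive_subgroup.a_closed[OF P.is_additive_subgroup, of "\<lambda>p. \<delta> S p * \<delta> S p" "\<lambda>p. \<Sum>S\<in>T. \<delta> S p * \<delta> S p"] insert by simp
      then show ?case using insert by simp
    qed
    then have "D \<in> P" by (simp add: D_def)
    have Dpos: "D p \<noteq> 0" for p
    proof -
      obtain S where "S \<in> \<S>" "\<delta> S p \<noteq> 0" using \<S>(3) by (auto simp: \<delta>_def)
      then have "D p > 0" unfolding D_def by (intro sum_pos2[OF \<S>(1)]) (auto simp: zero_less_mult_iff linorder_neq_iff)
      then show ?thesis by simp
    qed
    have "D \<in> smooth_functions A" unfolding D_def by (intro smooth_functions_sum smooth_functions_mult \<delta>sm)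
    then have "(\<lambda>p. inverse (D p)) \<in> smooth_functions A" using Dpos by (rule smooth_functions_inverse)
    then have "(\<lambda>p. inverse (D p) * D p) \<in> P" using P.I_l_closed[OF \<open>D \<in> P\<close>, of "\<lambda>p. inverse (D p)"] by simp
    then have "\<one>\<^bsub>smooth_ring A\<^esub> \<in> P" using Dpos by simp
    then show False using P.I_notcarr P.one_imp_carrier by blast
  qed
  then obtain S where S: "S \<in> \<S>" "\<delta> S \<notin> P" by blast
  have SV: "S i \<in> vector_fields A" for i by (rule \<S>(2)[OF S(1)])
  note \<delta>S = \<delta>sm[OF S(1)]
  obtain e :: "nat \<Rightarrow> 7" where e: "bij_betw e {..<7} UNIV"
    using ex_bij_betw_nat_finite[of "UNIV :: 7 set"] by (auto simp: atLeast0LessThan)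
  define b :: "nat \<Rightarrow> ('a, 7) osection" where "b k = (case k of 0 \<Rightarrow> (\<lambda>p. 1, \<lambda>p. tzero) | Suc j \<Rightarrow> (\<lambda>p. 0, S (e j)))" for k
  \<comment> \<open>\<open>gram_tangent_expand\<close> is available only where the determinant is
    nonzero. The second factor makes both sides of the expansion vanish at the other points, and
    primality keeps the square outside the ideal.\<close>
  define D where "D = (\<lambda>p. \<delta> S p * \<delta> S p)"
  let ?C = "bundle_algebra A m h" and ?R = "smooth_ring A"
  have b: "b k \<in> osections A" for k
    using SV by (simp add: b_def osections_iff smooth_functions_const vector_fields_zero split: nat.split)
  have sum8: "(\<Sum>i<8. F i) = F 0 + (\<Sum>j<7. F (Suc j))" for F :: "nat \<Rightarrow> 'x::comm_monoid_add"
    using sum.lessThan_Suc_shift[of F 7] by simp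
  have comb: "(\<Oplus>\<^bsub>?C\<^esub>i\<in>{..<8}. c i \<odot>\<^bsub>?C\<^esub> b i)
      = (c 0, \<lambda>p d. \<Sum>j<7. c (Suc j) p *\<^sub>R S (e j) p d)" if c: "c \<in> {..<8} \<rightarrow> carrier ?R" for c
  proof -
    have "c i \<odot>\<^bsub>?C\<^esub> b i \<in> osections A" if "i < 8" for i
      using b[of i] c that by (auto simp: osections_iff Pi_iff intro!: smooth_functions_mult vector_fields_scale)
    then show ?thesis by (subst bundle_finsum) (simp_all add: sum8 b_def)
  qed
  have reindex: "(\<Sum>j<7. F (e j)) = (\<Sum>i\<in>UNIV. F i)" for F :: "7 \<Rightarrow> 'x::comm_monoid_add"
    by (rule sum.reindex_bij_betw[OF e])
  define e' where "e' = inv_into {..<7} e"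
  have e': "e (e' i) = i" "e' i < 7" for i
    using e by (auto simp: e'_def bij_betw_def f_inv_into_f) (metis UNIV_I inv_into_into lessThan_iff)
  have e'e: "e' (e j) = j" if "j < 7" for j
    using e that by (simp add: e'_def bij_betw_def)
  show "\<exists>b D. b \<in> {..<8::nat} \<rightarrow> carrier ?C \<and> D \<in> carrier ?R \<and> D \<notin> P \<and>
    (\<forall>x\<in>carrier ?C. \<exists>c\<in>{..<8::nat} \<rightarrow> carrier ?R. D \<odot>\<^bsub>?C\<^esub> x = (\<Oplus>\<^bsub>?C\<^esub>i\<in>{..<8::nat}. c i \<odot>\<^bsub>?C\<^esub> b i)) \<and>
    (\<forall>c\<in>{..<8::nat} \<rightarrow> carrier ?R. (\<Oplus>\<^bsub>?C\<^esub>i\<in>{..<8::nat}. c i \<odot>\<^bsub>?C\<^esub> b i) = \<zero>\<^bsub>?C\<^esub> \<longrightarrow>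
      (\<forall>i<8. D \<otimes>\<^bsub>?R\<^esub> c i = \<zero>\<^bsub>?R\<^esub>))"
  proof (intro exI[of _ b] exI[of _ D] conjI ballI impI allI)
    show "b \<in> {..<8} \<rightarrow> carrier ?C" using b by auto
    show Dsm: "D \<in> carrier ?R" unfolding D_def using \<delta>S by (simp add: smooth_functions_mult)
    show "D \<notin> P" using P.I_prime[of "\<delta> S" "\<delta> S"] S(2) \<delta>S by (auto simp: D_def)
    show "\<exists>c\<in>{..<8} \<rightarrow> carrier ?R. D \<odot>\<^bsub>?C\<^esub> x = (\<Oplus>\<^bsub>?C\<^esub>i\<in>{..<8}. c i \<odot>\<^bsub>?C\<^esub> b i)" if "x \<in> carrier ?C" for x
    proof -
      have x: "fst x \<in> smooth_functions A" "snd x \<in> vector_fields A" using that by (auto simp: osections_iff)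
      define k where "k i = (\<lambda>p. \<delta> S p * (\<Sum>j\<in>UNIV. cofac (gram g S p) i j * g p (S j p) (snd x p)))" for i
      define c where "c l = (case l of 0 \<Rightarrow> (\<lambda>p. D p * fst x p) | Suc j \<Rightarrow> k (e j))" for l
      have "k i \<in> smooth_functions A" for i
        unfolding k_def
        by (intro smooth_functions_mult smooth_functions_sum \<delta>S gram_smooth(2)[OF g] metric_smooth[OF g] SV x)
      then have c: "c \<in> {..<8} \<rightarrow> carrier ?R"
        using Dsm x by (auto simp: c_def smooth_functions_mult split: nat.split)
      have "tscale (D p) (snd x p) = (\<lambda>d. \<Sum>i\<in>UNIV. k i p *\<^sub>R S i p d)" for p
      proof (cases "\<delta> S p = 0")
        case False
        show ?thesis
        proof
          fix d
          have "\<delta> S p *\<^sub>R \<delta> S p *\<^sub>R snd x p d = \<delta> S p *\<^sub>R (\<Sum>i\<in>UNIV.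
              (\<Sum>j\<in>UNIV. cofac (gram g S p) i j * g p (S j p) (snd x p)) *\<^sub>R S i p d)"
            using fun_cong[OF gram_tangent_expand[where S = S, OF g SV vector_field_tangent[OF x(2)]], where x = d] False
            by (simp add: \<delta>_def)
          then show "D p *\<^sub>R snd x p d = (\<Sum>i\<in>UNIV. k i p *\<^sub>R S i p d)"
            by (simp add: D_def k_def scaleR_sum_right)
        qed
      qed (simp add: D_def k_def)
      then have "D \<odot>\<^bsub>?C\<^esub> x = (\<Oplus>\<^bsub>?C\<^esub>i\<in>{..<8}. c i \<odot>\<^bsub>?C\<^esub> b i)"
        unfolding comb[OF c] using reindex[of "\<lambda>i. k i p *\<^sub>R S i p d" for p d] by (simp add: c_def)
      then show ?thesis using c by blast
    qed
    fix c i assume c: "c \<in> {..<8} \<rightarrow> carrier ?R" and 0: "(\<Oplus>\<^bsub>?C\<^esub>i\<in>{..<8}. c i \<odot>\<^bsub>?C\<^esub> b i) = \<zero>\<^bsub>?C\<^esub>" and i: "i < (8::nat)"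
    have c0: "c 0 = (\<lambda>p. 0)" and cj: "(\<lambda>p d. \<Sum>j<7. c (Suc j) p *\<^sub>R S (e j) p d) = (\<lambda>p. tzero)"
      using 0 unfolding comb[OF c] by simp_all
    have "D p * c i p = 0" for p
    proof (cases i)
      case (Suc j)
      then have j: "j < 7" using i by simp
      have z: "(\<lambda>d. \<Sum>i\<in>UNIV. c (Suc (e' i)) p *\<^sub>R S i p d) = tzero"
      proof
        fix d
        have "(\<Sum>i\<in>UNIV. c (Suc (e' i)) p *\<^sub>R S i p d) = (\<Sum>j<7. c (Suc (e' (e j))) p *\<^sub>R S (e j) p d)"
          by (rule reindex[symmetric])
        also have "\<dots> = (\<Sum>j<7. c (Suc j) p *\<^sub>R S (e j) p d)" by (intro sum.cong) (simp_all add: e'e)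
        also have "\<dots> = 0" using fun_cong[OF fun_cong[OF cj, of p], of d] by simp
        finally show "(\<Sum>i\<in>UNIV. c (Suc (e' i)) p *\<^sub>R S i p d) = 0" .
      qed
      have "c (Suc (e' (e j))) p = 0" if "det (gram g S p) \<noteq> 0"
        by (rule gram_tangent_independent[where S = S and p = p and i = "e j" and a = "\<lambda>i. c (Suc (e' i)) p",
              OF g SV that z])
      then show ?thesis using e'e[OF j] Suc by (auto simp: D_def \<delta>_def)
    qed (simp add: c0)
    then show "D \<otimes>\<^bsub>?R\<^esub> c i = \<zero>\<^bsub>?R\<^esub>" by (simp only: smooth_ring_simps)
  qed
qed

section \<open>The bilinear form of a bundle\<close>

lemma bundle_form_apply:
  "x \<in> osections A \<Longrightarrow> y \<in> osections A \<Longrightarrow>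
    bundle_form A g x y = (\<lambda>p. 2 * fst x p * fst y p + 2 * g p (snd x p) (snd y p))"
  by (simp add: bundle_form_def)

lemma bundle_form_sym: "x \<in> osections A \<Longrightarrow> y \<in> osections A \<Longrightarrow> bundle_form A g x y = bundle_form A g y x"
  using metric_sym[OF g] by (simp add: bundle_form_apply osections_iff vector_field_tangent mult_ac)

lemma bundle_form_smooth:
  "x \<in> osections A \<Longrightarrow> y \<in> osections A \<Longrightarrow> bundle_form A g x y \<in> smooth_functions A"
  by (auto simp: bundle_form_apply osections_iff
      intro!: smooth_functions_add smooth_functions_mult smooth_functions_const metric_smooth[OF g])

lemma bundle_form_linear:
  assumes x: "x \<in> osections A"
  shows "bundle_form A g x \<in> linear_maps (smooth_ring A) (bundle_algebra A m h) (self_module (smooth_ring A))"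
  unfolding linear_maps_def
proof (intro CollectI conjI ballI)
  have G: "tangent_functional A p (g p (snd x p))" for p
    using x by (intro metric_functional[OF g]) (simp add: osections_iff vector_field_tangent)
  show "bundle_form A g x \<in> carrier (bundle_algebra A m h) \<rightarrow>\<^sub>E carrier (self_module (smooth_ring A))"
  proof
    show "bundle_form A g x y \<in> carrier (self_module (smooth_ring A))" if "y \<in> carrier (bundle_algebra A m h)" for y
      using bundle_form_smooth[OF x] that by simp
  qed (use x in \<open>simp add: bundle_form_def\<close>)
  fix y assume "y \<in> carrier (bundle_algebra A m h)"
  then have y: "y \<in> osections A" by simp
  { fix z assume "z \<in> carrier (bundle_algebra A m h)"
    then have z: "z \<in> osections A" by simp
    have "y \<oplus>\<^bsub>bundle_algebra A m h\<^esub> z \<in> osections A"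
      using y z by (simp add: osections_iff smooth_functions_add vector_fields_add)
    then show "bundle_form A g x (y \<oplus>\<^bsub>bundle_algebra A m h\<^esub> z)
        = bundle_form A g x y \<oplus>\<^bsub>self_module (smooth_ring A)\<^esub> bundle_form A g x z"
      using x y z by (simp add: bundle_form_apply tangent_functional_add[OF G] osections_iff vector_field_tangent
          algebra_simps) }
  fix f assume "f \<in> carrier (smooth_ring A)"
  then have "f \<odot>\<^bsub>bundle_algebra A m h\<^esub> y \<in> osections A"
    using y by (simp add: osections_iff smooth_functions_mult vector_fields_scale)
  then show "bundle_form A g x (f \<odot>\<^bsub>bundle_algebra A m h\<^esub> y)
      = f \<odot>\<^bsub>self_module (smooth_ring A)\<^esub> bundle_form A g x y"
    using x y by (simp add: bundle_form_apply tangent_functional_scale[OF G] osections_iff vector_field_tangent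
        algebra_simps)
qed

lemma bundle_form_bilinear:
  "bundle_form A g \<in> bilinear_maps (smooth_ring A) (bundle_algebra A m h) (self_module (smooth_ring A))"
  unfolding bilinear_maps_def
proof (intro CollectI conjI ballI)
  show "bundle_form A g \<in> extensional (carrier (bundle_algebra A m h))" by (simp add: bundle_form_def)
  show "bundle_form A g x \<in> linear_maps (smooth_ring A) (bundle_algebra A m h) (self_module (smooth_ring A))"
    if "x \<in> carrier (bundle_algebra A m h)" for x using that by (simp add: bundle_form_linear)
  fix y assume "y \<in> carrier (bundle_algebra A m h)"
  then have y: "y \<in> osections A" by simp
  have "(\<lambda>x\<in>carrier (bundle_algebra A m h). bundle_form A g x y) = bundle_form A g y"
    by (rule extensionalityI[of _ "osections A"]) (use y in \<open>simp_all add: bundle_form_sym, simp_all add: bundle_form_def\<close>)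
  then show "(\<lambda>x\<in>carrier (bundle_algebra A m h). bundle_form A g x y)
      \<in> linear_maps (smooth_ring A) (bundle_algebra A m h) (self_module (smooth_ring A))"
    using bundle_form_linear[OF y] by simp
qed

lemma metric_eqI_fields:
  assumes v: "v \<in> tangent_space A p" and w: "w \<in> tangent_space A p"
    and eq: "\<And>Z. Z \<in> vector_fields A \<Longrightarrow> g p v (Z p) = g p w (Z p)"
  shows "v = w"
  by (rule metric_eqI[OF g v w]) (use ex_field_through eq in metis)

lemma linear_functional_sum:
  fixes V :: "nat \<Rightarrow> 'a \<Rightarrow> ('a, 7) tangent"
  assumes \<omega>: "\<omega> \<in> linear_maps (smooth_ring A) (bundle_algebra A m h) (self_module (smooth_ring A))"
    and a: "\<And>k. a k \<in> smooth_functions A" and V: "\<And>k. V k \<in> vector_fields A"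
  shows "\<omega> (\<lambda>p. 0, \<lambda>p c. \<Sum>k<n. a k p *\<^sub>R V k p c) = (\<lambda>p. \<Sum>k<n. a k p * \<omega> (\<lambda>p. 0, V k) p)"
proof (induction n)
  have zero: "(\<lambda>p. 0, \<lambda>p. tzero) \<in> osections A" by (simp add: osections_iff smooth_functions_const vector_fields_zero)
  have hom: "\<omega> (\<lambda>p. f p * fst x p, \<lambda>p. tscale (f p) (snd x p)) = (\<lambda>p. f p * \<omega> x p)"
    if "f \<in> smooth_functions A" "x \<in> osections A" for f x
    using \<omega> that unfolding linear_maps_def by auto
  have add: "\<omega> (\<lambda>p. fst x p + fst y p, \<lambda>p. tplus (snd x p) (snd y p)) = (\<lambda>p. \<omega> x p + \<omega> y p)"
    if "x \<in> osections A" "y \<in> osections A" for x y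
    using \<omega> that unfolding linear_maps_def by auto
  {
    case 0
    show ?case using hom[OF smooth_functions_const[of 0] zero] by simp
  next
    case (Suc n)
    have V': "(\<lambda>p. 0, V n) \<in> osections A" using V by (simp add: osections_iff smooth_functions_const)
    have aV: "(\<lambda>p. 0, \<lambda>p. tscale (a n p) (V n p)) \<in> osections A"
      using V a by (simp add: osections_iff smooth_functions_const vector_fields_scale)
    have s: "(\<lambda>p. 0, \<lambda>p c. \<Sum>k<n. a k p *\<^sub>R V k p c) \<in> osections A"
      using V a by (simp add: osections_iff smooth_functions_const vector_fields_sum vector_fields_scale)
    show ?case using add[OF s aV] hom[OF a V'] Suc by simp
  }
qed

text \<open>A functional is determined by its values on the unit section and on the frame
  \<open>V\<close>. The section representing it combines \<open>U\<close> with the latter values,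
  and the factors 1/2 cancel the 2 in \<open>bundle_form\<close>.\<close>

lemma bundle_form_perfect:
  "bij_betw (bundle_form A g) (osections A)
    (linear_maps (smooth_ring A) (bundle_algebra A m h) (self_module (smooth_ring A)))"
  (is "bij_betw _ _ ?L")
  unfolding bij_betw_def
proof
  have one: "(\<lambda>p. 1, \<lambda>p. tzero) \<in> osections A" by (simp add: osections_iff smooth_functions_const vector_fields_zero)
  show "inj_on (bundle_form A g) (osections A)"
  proof (rule inj_onI)
    fix x y assume x: "x \<in> osections A" and y: "y \<in> osections A" and eq: "bundle_form A g x = bundle_form A g y"
    have T: "snd x p \<in> tangent_space A p" "snd y p \<in> tangent_space A p" for p
      using x y by (auto simp: osections_iff vector_field_tangent)
    have 1: "fst x p = fst y p" for p
      using fun_cong[OF fun_cong[OF eq, of "(\<lambda>p. 1, \<lambda>p. tzero)"], of p]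
        tangent_functional_zero[OF metric_functional[OF g T(1)], of p]
        tangent_functional_zero[OF metric_functional[OF g T(2)], of p]
      by (simp add: bundle_form_apply x y one)
    have "snd x p = snd y p" for p
    proof (rule metric_eqI_fields[OF T])
      fix Z assume Z: "Z \<in> vector_fields A"
      then have "(\<lambda>p. 0, Z) \<in> osections A" by (simp add: osections_iff smooth_functions_const)
      then show "g p (snd x p) (Z p) = g p (snd y p) (Z p)"
        using fun_cong[OF fun_cong[OF eq, of "(\<lambda>p. 0, Z)"], of p] by (simp add: bundle_form_apply x y)
    qed
    then show "x = y" using 1 by (intro prod_eqI ext) metis+
  qed
  show "bundle_form A g ` osections A = ?L"
  proof
    show "bundle_form A g ` osections A \<subseteq> ?L" using bundle_form_linear by blast
    show "?L \<subseteq> bundle_form A g ` osections A"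
    proof
      fix \<omega> assume \<omega>: "\<omega> \<in> ?L"
      have \<omega>sm: "\<omega> x \<in> smooth_functions A" if "x \<in> osections A" for x
        using \<omega> that by (auto simp: linear_maps_def)
      have hom: "\<omega> (\<lambda>p. f p * fst x p, \<lambda>p. tscale (f p) (snd x p)) = (\<lambda>p. f p * \<omega> x p)"
        if "f \<in> smooth_functions A" "x \<in> osections A" for f x
        using \<omega> that unfolding linear_maps_def by auto
      have add: "\<omega> (\<lambda>p. fst x p + fst y p, \<lambda>p. tplus (snd x p) (snd y p)) = (\<lambda>p. \<omega> x p + \<omega> y p)"
        if "x \<in> osections A" "y \<in> osections A" for x y
        using \<omega> that unfolding linear_maps_def by auto
      obtain N U V where fr: "frame_pair g N U V" by (rule global_frame[OF g])
      note UV = frame_pairD[OF g fr]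
      have V': "(\<lambda>p. 0, V k) \<in> osections A" for k using UV(2) by (simp add: osections_iff smooth_functions_const)
      define W where "W = (\<lambda>p c. \<Sum>k<N. (1/2 * \<omega> (\<lambda>p. 0, V k) p) *\<^sub>R U k p c)"
      have WV: "W \<in> vector_fields A"
        unfolding W_def
        by (intro vector_fields_sum vector_fields_scale smooth_functions_mult smooth_functions_const \<omega>sm V' UV(1))
      define w where "w = (\<lambda>p. 1/2 * \<omega> (\<lambda>p. 1, \<lambda>p. tzero) p, W)"
      have w: "w \<in> osections A"
        using WV \<omega>sm[OF one] smooth_functions_mult[OF smooth_functions_const[of "1/2"]] by (simp add: w_def osections_iff)
      have "bundle_form A g w = \<omega>"
      proof (rule extensionalityI)
        show "bundle_form A g w \<in> extensional (osections A)" using w by (simp add: bundle_form_def)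
        show "\<omega> \<in> extensional (osections A)" using \<omega> by (simp add: linear_maps_def PiE_def)
        fix x assume x: "x \<in> osections A"
        have x': "fst x \<in> smooth_functions A" "snd x \<in> vector_fields A" using x by (auto simp: osections_iff)
        have xT: "snd x p \<in> tangent_space A p" for p by (rule vector_field_tangent[OF x'(2)])
        have "snd x = (\<lambda>p c. \<Sum>k<N. g p (U k p) (snd x p) *\<^sub>R V k p c)"
          by (rule ext) (rule UV(3)[OF xT])
        then have "\<omega> (\<lambda>p. 0, snd x) = (\<lambda>p. \<Sum>k<N. g p (U k p) (snd x p) * \<omega> (\<lambda>p. 0, V k) p)"
          using linear_functional_sum[OF \<omega>, of "\<lambda>k p. g p (U k p) (snd x p)" V N] metric_smooth[OF g UV(1) x'(2)] UV(2)
          by simp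
        moreover have "\<omega> (fst x, \<lambda>p. tzero) = (\<lambda>p. fst x p * \<omega> (\<lambda>p. 1, \<lambda>p. tzero) p)"
          using hom[OF x'(1) one] by simp
        moreover have "\<omega> x = (\<lambda>p. \<omega> (fst x, \<lambda>p. tzero) p + \<omega> (\<lambda>p. 0, snd x) p)"
          using add[of "(fst x, \<lambda>p. tzero)" "(\<lambda>p. 0, snd x)"] x'
          by (simp add: osections_iff smooth_functions_const vector_fields_zero)
        moreover have "g p (W p) (snd x p) = (\<Sum>k<N. (1/2 * \<omega> (\<lambda>p. 0, V k) p) * g p (U k p) (snd x p))" for p
          unfolding W_def
          by (rule tangent_functional_sum[OF metric_functional_left[OF g xT]]) (auto intro: vector_field_tangent UV(1))
        ultimately show "bundle_form A g w x = \<omega> x"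
          by (simp add: bundle_form_apply w x) (simp add: w_def sum_distrib_left mult_ac)
      qed
      then show "\<omega> \<in> bundle_form A g ` osections A" using w by blast
    qed
  qed
qed

lemma bundle_norm_form:
  assumes "x \<in> osections A"
  shows "norm_form (smooth_ring A) (bundle_algebra A m g) x = (\<lambda>p. fst x p * fst x p + g p (snd x p) (snd x p))"
  by (simp only: norm_form_def smooth_ring_two) (simp add: bundle_form_apply[OF assms assms] add_divide_distrib)

text \<open>The module and the form satisfy their axioms for every Riemannian metric; what remains
  are the conditions on \<open>m\<close>.\<close>

lemma octonion_algebra_bundle_iff:
  "octonion_algebra (smooth_ring A) (bundle_algebra A m g) \<longleftrightarrow>
    m \<in> bilinear_maps (smooth_ring A) (bundle_algebra A m g) (bundle_algebra A m g) \<and>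
    (\<forall>x\<in>osections A. m (\<lambda>p. 1, \<lambda>p. tzero) x = x \<and> m x (\<lambda>p. 1, \<lambda>p. tzero) = x) \<and>
    (\<forall>x\<in>osections A. \<forall>y\<in>osections A.
        norm_form (smooth_ring A) (bundle_algebra A m g) (m x y) =
        (\<lambda>p. norm_form (smooth_ring A) (bundle_algebra A m g) x p * norm_form (smooth_ring A) (bundle_algebra A m g) y p))"
  unfolding octonion_algebra_def
  using smooth_ring_cring smooth_ring_two(1) bundle_module bundle_fin_gen_projective bundle_has_rank
    bundle_form_bilinear bundle_form_sym bundle_form_perfect[of m g]
  by (auto simp: osections_iff smooth_functions_const vector_fields_zero)

end

end

section \<open>The metric and the cross product of a definite form\<close>

context manifold7
begin

lemma
  assumes "u \<in> frames A p"
  shows frame_add: "u (x + y) = tplus (u x) (u y)" and frame_scale: "u (r *\<^sub>R x) = tscale r (u x)"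
    and frame_tangent: "u x \<in> tangent_space A p" and frame_inj: "u x = u y \<Longrightarrow> x = y"
    and frame_surj: "v \<in> tangent_space A p \<Longrightarrow> \<exists>x. v = u x"
  using assms by (auto simp: frames_def bij_betw_def dest: injD)

lemma frame_zero: "u \<in> frames A p \<Longrightarrow> u 0 = tzero"
  using frame_scale[of u p 0 0] by simp

lemma frame_matrix:
  assumes u: "u \<in> frames A p" and c: "c \<in> charts_at A p"
  obtains M where "det M \<noteq> 0" "\<And>x. u x c = M *v x"
proof -
  have lin: "linear (\<lambda>x. u x c)" by (rule linearI) (simp_all add: frame_add[OF u] frame_scale[OF u])
  then have M: "u x c = matrix (\<lambda>x. u x c) *v x" for x by (simp add: matrix_works)
  have "inj (\<lambda>x. u x c)"
    by (rule injI) (metis tangent_eqI[OF frame_tangent[OF u] frame_tangent[OF u] c] frame_inj[OF u])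
  then have "det (matrix (\<lambda>x. u x c)) \<noteq> 0" using det_nz_iff_inj[OF lin] by simp
  then show ?thesis using that M by blast
qed

lemma linear_injective_frame:
  assumes T: "\<And>x. u x \<in> tangent_space A p" and add: "\<And>x y. u (x + y) = tplus (u x) (u y)"
    and scale: "\<And>r x. u (r *\<^sub>R x) = tscale r (u x)" and inj: "\<And>x. u x = tzero \<Longrightarrow> x = (0 :: real^7)"
  shows "u \<in> frames A p"
proof -
  obtain c where c: "c \<in> charts_at A p" using ex_chart by metis
  have lin: "linear (\<lambda>x. u x c)" by (rule linearI) (simp_all add: add scale)
  have "x = 0" if "u x c = 0" for x
    by (rule inj, rule tangent_eqI[OF T tangent_zero c]) (use that in simp)
  then have inj': "inj (\<lambda>x. u x c)" by (simp add: linear_injective_0[OF lin])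
  then have surj: "surj (\<lambda>x. u x c)" using lin linear_injective_imp_surjective by blast
  have "v \<in> range u" if v: "v \<in> tangent_space A p" for v
  proof -
    obtain x where "v c = u x c" using surj by (metis surjD)
    then have "v = u x" by (rule tangent_eqI[OF v T c])
    then show ?thesis by blast
  qed
  moreover have "inj u" using inj' by (auto simp: inj_on_def)
  ultimately have "bij_betw u UNIV (tangent_space A p)" using T by (auto simp: bij_betw_def)
  then show ?thesis using add scale by (simp add: frames_def)
qed

lemma frame_in_chart:
  assumes c: "c \<in> charts_at A p" and U: "linear U" "\<And>x. U x = 0 \<Longrightarrow> x = (0 :: real^7)"
  shows "(\<lambda>x. coord_vector A c p (U x)) \<in> frames A p"
  by (rule linear_injective_frame)
    (use U(2) coord_vector_same[OF c] in \<open>auto simp: coord_vector_tangent[OF c] linear_add[OF U(1)] linear_scale[OF U(1)]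
      coord_vector_add[OF c] coord_vector_scale[OF c] dest: fun_cong[where x = c]\<close>)

definition chart_form :: "('a, 7) form3 \<Rightarrow> ('a, 7) chart \<Rightarrow> 'a \<Rightarrow> real^7 \<Rightarrow> real^7 \<Rightarrow> real^7 \<Rightarrow> real" where
  "chart_form \<phi> c p x y z = \<phi> p (coord_vector A c p x) (coord_vector A c p y) (coord_vector A c p z)"

lemma G2_frameD:
  assumes "u \<in> G2_frames A \<phi> p"
  shows "u \<in> frames A p" "\<phi> p (u x) (u y) (u z) = phi0 x y z"
  using assms by (auto simp: G2_frames_def)

lemma G2_frame_matrix:
  assumes u: "u \<in> G2_frames A \<phi> p" and c: "c \<in> charts_at A p"
  obtains M where "det M \<noteq> 0" "\<And>x. u x c = M *v x"
    "\<And>x y z. chart_form \<phi> c p (M *v x) (M *v y) (M *v z) = phi0 x y z"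
proof -
  note uf = G2_frameD(1)[OF u]
  obtain M where M: "det M \<noteq> 0" "\<And>x. u x c = M *v x" by (rule frame_matrix[OF uf c]) (rule that, simp_all)
  have "chart_form \<phi> c p (M *v x) (M *v y) (M *v z) = phi0 x y z" for x y z
    unfolding chart_form_def M(2)[symmetric] coord_vector_coord[OF c frame_tangent[OF uf]] by (rule G2_frameD(2)[OF u])
  then show ?thesis using that M by blast
qed

lemma G2_frame_metric:
  assumes u: "u \<in> G2_frames A \<phi> p" and c: "c \<in> charts_at A p"
  shows "u x c \<bullet> (form_metric (chart_form \<phi> c p) *v u y c) = x \<bullet> y"
proof -
  obtain M where M: "det M \<noteq> 0" "\<And>x. u x c = M *v x"
    "\<And>x y z. chart_form \<phi> c p (M *v x) (M *v y) (M *v z) = phi0 x y z"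
    by (rule G2_frame_matrix[OF u c]) (rule that, simp_all)
  show ?thesis unfolding M(2) by (rule form_metric_eq[OF M(1,3)])
qed

text \<open>The chart is arbitrary: a \<open>G2_frames\<close> member computes the same value in
  every chart, by \<open>G2_frame_metric\<close>.\<close>

definition metric_of_form :: "('a, 7) form3 \<Rightarrow> 'a \<Rightarrow> ('a, 7) tangent \<Rightarrow> ('a, 7) tangent \<Rightarrow> real" where
  "metric_of_form \<phi> p v w = (if v \<in> tangent_space A p \<and> w \<in> tangent_space A p
    then (let c = SOME c. c \<in> charts_at A p in v c \<bullet> (form_metric (chart_form \<phi> c p) *v w c)) else undefined)"

lemma metric_of_form_frame:
  assumes u: "u \<in> G2_frames A \<phi> p"
  shows "metric_of_form \<phi> p (u x) (u y) = x \<bullet> y"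
proof -
  have "(SOME c. c \<in> charts_at A p) \<in> charts_at A p" using ex_chart[of p] by (rule someI_ex)
  then show ?thesis
    by (simp add: metric_of_form_def frame_tangent[OF G2_frameD(1)[OF u]] Let_def G2_frame_metric[OF u])
qed

lemma metric_of_form_chart:
  assumes u: "u \<in> G2_frames A \<phi> p" and c: "c \<in> charts_at A p"
    and v: "v \<in> tangent_space A p" and w: "w \<in> tangent_space A p"
  shows "metric_of_form \<phi> p v w = v c \<bullet> (form_metric (chart_form \<phi> c p) *v w c)"
proof -
  obtain x y where "v = u x" "w = u y"
    using frame_surj[OF G2_frameD(1)[OF u] v] frame_surj[OF G2_frameD(1)[OF u] w] by blast
  then show ?thesis by (simp add: metric_of_form_frame[OF u] G2_frame_metric[OF u c])
qed

text \<open>\<open>form_metric\<close> is made from components of the form by determinants, roots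
  and powers. Frames, chosen separately at each point, only show that the determinants under
  absolute values are nonzero and the arguments of roots and powers positive; no smooth choice of
  frames is made.\<close>

lemma metric_of_form_smooth:
  assumes \<phi>: "\<phi> \<in> definite_forms A" and c: "c \<in> A"
  shows "smooth_on (chart_img c) (\<lambda>y. form_metric (chart_form \<phi> c (chart_inv c y)) $ i $ j)"
proof -
  let ?S = "chart_img c" and ?\<psi> = "\<lambda>y. chart_form \<phi> c (chart_inv c y)"
  have S: "open ?S" by (rule open_chart_img[OF c])
  have \<phi>s: "smooth_form3 A \<phi>" using \<phi> by (simp add: definite_forms_def)
  have ch: "c \<in> charts_at A (chart_inv c y)" if "y \<in> ?S" for y
    using coord_chart_inv[OF that] c by (simp add: charts_at_def)
  have M: "\<exists>M. det M \<noteq> 0 \<and> (\<forall>a b d. ?\<psi> y (M *v a) (M *v b) (M *v d) = phi0 a b d)" if y: "y \<in> ?S" for y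
  proof -
    obtain u where "u \<in> G2_frames A \<phi> (chart_inv c y)" using \<phi> by (auto simp: definite_forms_def)
    from this ch[OF y] show ?thesis by (rule G2_frame_matrix) blast
  qed
  have sc_pos: "form_scale (?\<psi> y) x > 0" if "y \<in> ?S" "x \<noteq> 0" for x y
    using M[OF that(1)] form_scale_pos[of _ "?\<psi> y", OF _ _ that(2)] by blast
  have gram_pos: "det (form_gram (?\<psi> y)) > 0" if "y \<in> ?S" for y
    using M[OF that] det_form_gram_pos[of _ "?\<psi> y"] by blast
  have "smooth_on ?S (\<lambda>y. ?\<psi> y x (axis i 1) (axis j 1))" for x i j
  proof -
    have "smooth_on ?S (\<lambda>y. \<Sum>k\<in>UNIV. x $ k * ?\<psi> y (axis k 1) (axis i 1) (axis j 1))"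
      using \<phi>s c unfolding chart_form_def smooth_form3_def
      by (intro smooth_on_sum smooth_on_mult smooth_on_const S) auto
    then show ?thesis
    proof (rule smooth_on_cong[OF _ S])
      fix y assume y: "y \<in> ?S"
      note cv = coord_vector_tangent[OF ch[OF y]]
      show "(\<Sum>k\<in>UNIV. x $ k * ?\<psi> y (axis k 1) (axis i 1) (axis j 1)) = ?\<psi> y x (axis i 1) (axis j 1)"
        unfolding chart_form_def
          tangent_functional_expand[OF form_functional(1)[OF \<phi>s cv[of "axis i 1"] cv[of "axis j 1"]] ch[OF y] cv[of x]]
          coord_vector_same[OF ch[OF y]] ..
    qed
  qed
  then have d: "smooth_on ?S (\<lambda>y. det (bmat (?\<psi> y x) + outer \<xi> \<xi>))" for x \<xi>
    by (intro smooth_on_det S) (simp add: bmat_def smooth_on_add S smooth_on_const)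
  have sc: "smooth_on ?S (\<lambda>y. form_scale (?\<psi> y) x)" if "x \<noteq> 0" for x
  proof -
    have nz: "det (bmat (?\<psi> y x) + outer (x /\<^sub>R (x \<bullet> x)) (x /\<^sub>R (x \<bullet> x))) \<noteq> 0" if "y \<in> ?S" for y
      using sc_pos[OF that \<open>x \<noteq> 0\<close>] by (auto simp: form_scale_def)
    show ?thesis
      unfolding form_scale_def by (intro smooth_on_sqrt smooth_on_abs_nonzero S d) (use nz in auto)
  qed
  have ax: "axis i 1 \<noteq> (0::real^7)" for i by (simp add: axis_eq_0_iff)
  have ax2: "axis i 1 + axis j 1 \<noteq> (0::real^7)" for i j
  proof
    assume "axis i 1 + axis j 1 = (0::real^7)"
    then have "(axis i 1 + axis j 1) $ i = (0::real)" by simp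
    then show False by (simp add: axis_def split: if_splits)
  qed
  have gram: "smooth_on ?S (\<lambda>y. form_gram (?\<psi> y) $ i $ j)" for i j
    unfolding form_gram_def using sc[OF ax] sc[OF ax2]
    by (simp add: smooth_on_diff smooth_on_divide smooth_on_const S)
  have "smooth_on ?S (\<lambda>y. det (form_gram (?\<psi> y)) powr (- (1/9)) * form_gram (?\<psi> y) $ i $ j)"
    by (intro smooth_on_mult smooth_on_powr smooth_on_det gram gram_pos S)
  then show ?thesis by (simp add: form_metric_def)
qed

lemma metric_of_form_riemannian:
  assumes \<phi>: "\<phi> \<in> definite_forms A"
  shows "riemannian_metric A (metric_of_form \<phi>)"
  unfolding riemannian_metric_def
proof (intro conjI allI ballI impI)
  show "\<not> (v \<in> tangent_space A p \<and> w \<in> tangent_space A p) \<Longrightarrow> metric_of_form \<phi> p v w = undefined" for p v w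
    unfolding metric_of_form_def by (rule if_not_P)
  fix p v assume v: "v \<in> tangent_space A p"
  obtain u where u: "u \<in> G2_frames A \<phi> p" using \<phi> by (auto simp: definite_forms_def)
  note uf = G2_frameD(1)[OF u] and m = metric_of_form_frame[OF u]
  obtain x where x: "v = u x" using frame_surj[OF uf v] by blast
  show "tangent_functional A p (metric_of_form \<phi> p v)"
    unfolding tangent_functional_def
  proof (intro conjI ballI allI)
    fix w w' assume "w \<in> tangent_space A p" "w' \<in> tangent_space A p"
    then obtain y z where "w = u y" "w' = u z" using frame_surj[OF uf] by meson
    then show "metric_of_form \<phi> p v (tplus w w') = metric_of_form \<phi> p v w + metric_of_form \<phi> p v w'"
      by (simp add: x m frame_add[OF uf, symmetric] inner_add_right)
  next
    fix r w assume "w \<in> tangent_space A p"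
    then obtain y where "w = u y" using frame_surj[OF uf] by meson
    then show "metric_of_form \<phi> p v (tscale r w) = r * metric_of_form \<phi> p v w"
      by (simp add: x m frame_scale[OF uf, symmetric])
  qed
  show "metric_of_form \<phi> p v w = metric_of_form \<phi> p w v" if w: "w \<in> tangent_space A p" for w
  proof -
    obtain y where "w = u y" using frame_surj[OF uf w] by blast
    then show ?thesis by (simp add: x m inner_commute)
  qed
  show "0 < metric_of_form \<phi> p v v" if "v \<noteq> tzero"
    using that frame_zero[OF uf] by (cases "x = 0") (auto simp: x m)
next
  fix c i j assume c: "c \<in> A"
  show "smooth_on (chart_img c) (\<lambda>y. metric_of_form \<phi> (chart_inv c y)
      (coord_vector A c (chart_inv c y) (axis i 1)) (coord_vector A c (chart_inv c y) (axis j 1)))"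
  proof (rule smooth_on_cong[OF metric_of_form_smooth[OF \<phi> c] open_chart_img[OF c]])
    fix y assume y: "y \<in> chart_img c"
    have ch: "c \<in> charts_at A (chart_inv c y)"
      using coord_chart_inv[OF y] c by (simp add: charts_at_def)
    obtain u where u: "u \<in> G2_frames A \<phi> (chart_inv c y)" using \<phi> by (auto simp: definite_forms_def)
    show "form_metric (chart_form \<phi> c (chart_inv c y)) $ i $ j = metric_of_form \<phi> (chart_inv c y)
      (coord_vector A c (chart_inv c y) (axis i 1)) (coord_vector A c (chart_inv c y) (axis j 1))"
      unfolding metric_of_form_chart[OF u ch coord_vector_tangent[OF ch] coord_vector_tangent[OF ch]]
        coord_vector_same[OF ch]
      by (simp add: inner_axis' matrix_vector_mult_basis column_def)
  qed
qed

text \<open>A metric is determined at a point by its values on a single frame, so one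
  \<open>G2_frames\<close> member per point settles the definite description in
  \<open>assoc_metric\<close>.\<close>

lemma assoc_metric_eqI:
  assumes \<phi>: "\<phi> \<in> definite_forms A" and g: "riemannian_metric A g"
    and ex: "\<And>p. \<exists>u\<in>G2_frames A \<phi> p. \<forall>x y. g p (u x) (u y) = x \<bullet> y"
  shows "assoc_metric A \<phi> = g"
proof -
  have uniq: "h = metric_of_form \<phi>" if h: "riemannian_metric A h"
    and ex: "\<And>p. \<exists>u\<in>G2_frames A \<phi> p. \<forall>x y. h p (u x) (u y) = x \<bullet> y" for h
  proof (intro ext)
    fix p v w
    show "h p v w = metric_of_form \<phi> p v w"
    proof (cases "v \<in> tangent_space A p \<and> w \<in> tangent_space A p")
      case True
      obtain u where u: "u \<in> G2_frames A \<phi> p" "\<And>x y. h p (u x) (u y) = x \<bullet> y" using ex by blast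
      obtain x y where "v = u x" "w = u y" using frame_surj[OF G2_frameD(1)[OF u(1)]] True by meson
      then show ?thesis by (simp add: u(2) metric_of_form_frame[OF u(1)])
    next
      case False
      then have "h p v w = undefined" using h unfolding riemannian_metric_def by blast
      moreover have "metric_of_form \<phi> p v w = undefined"
        unfolding metric_of_form_def using False by (rule if_not_P)
      ultimately show ?thesis by simp
    qed
  qed
  have "assoc_metric A \<phi> = metric_of_form \<phi>"
    unfolding assoc_metric_def
  proof (rule the_equality)
    show "riemannian_metric A (metric_of_form \<phi>) \<and>
      (\<forall>p. \<forall>u\<in>G2_frames A \<phi> p. \<forall>x y. metric_of_form \<phi> p (u x) (u y) = x \<bullet> y)"
      using metric_of_form_riemannian[OF \<phi>] metric_of_form_frame by blast
    fix h assume h: "riemannian_metric A h \<and> (\<forall>p. \<forall>u\<in>G2_frames A \<phi> p. \<forall>x y. h p (u x) (u y) = x \<bullet> y)"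
    have "\<exists>u\<in>G2_frames A \<phi> p. \<forall>x y. h p (u x) (u y) = x \<bullet> y" for p
      using \<phi> h unfolding definite_forms_def by (metis (mono_tags, lifting) ex_in_conv mem_Collect_eq)
    then show "h = metric_of_form \<phi>" using uniq h by blast
  qed
  also have "\<dots> = g" using uniq[OF g ex] by simp
  finally show ?thesis .
qed

section \<open>Standard octonions and evaluation in frames\<close>

definition omult0 :: "real \<times> (real^7) \<Rightarrow> real \<times> (real^7) \<Rightarrow> real \<times> (real^7)" where
  "omult0 v w = (fst v * fst w - snd v \<bullet> snd w, fst v *\<^sub>R snd w + fst w *\<^sub>R snd v + cross0 (snd v) (snd w))"

text \<open>\<open>cross0 x y\<close> is orthogonal to \<open>x\<close> and \<open>y\<close>, the
  mixed terms in the inner product of \<open>x\<close> and \<open>y\<close> cancel against those of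
  the real part, and the rest is the Lagrange identity \<open>inner_cross0\<close>.\<close>

lemma omult0_norm:
  "(norm (omult0 v w))\<^sup>2 = (norm v)\<^sup>2 * (norm w)\<^sup>2"
proof -
  obtain a x b y where vw: "v = (a, x)" "w = (b, y)" by (metis surj_pair)
  have o: "x \<bullet> cross0 x y = 0" "y \<bullet> cross0 x y = 0" "cross0 x y \<bullet> x = 0" "cross0 x y \<bullet> y = 0"
    by (simp_all add: inner_7 cross0_nth algebra_simps)
  have "cross0 x y \<bullet> cross0 x y = (x \<bullet> x) * (y \<bullet> y) - (x \<bullet> y) * (x \<bullet> y)" by (rule inner_cross0)
  then show ?thesis
    unfolding power2_norm_eq_inner vw omult0_def fst_conv snd_conv inner_Pair
    by (simp add: inner_add o inner_commute[of y x] algebra_simps)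
qed

definition frame_eval :: "(real^7 \<Rightarrow> ('a, 7) tangent) \<Rightarrow> real \<times> (real^7) \<Rightarrow> real \<times> ('a, 7) tangent" where
  "frame_eval u v = (fst v, u (snd v))"

lemma eval_frame:
  assumes "u \<in> frames A p" "x \<in> osections A"
  obtains v where "eval_at p x = frame_eval u v"
proof -
  have "snd x p \<in> tangent_space A p" using assms(2) by (simp add: osections_iff vector_field_tangent)
  then obtain y where "snd x p = u y" using frame_surj[OF assms(1)] by blast
  then show ?thesis using that[of "(fst x p, y)"] by (simp add: eval_at_def frame_eval_def)
qed

lemma frame_eval_inj: "u \<in> frames A p \<Longrightarrow> frame_eval u v = frame_eval u w \<Longrightarrow> v = w"
  using frame_inj by (auto simp: frame_eval_def prod_eq_iff)

lemma eval_eqI: "(\<And>p. eval_at p x = eval_at p y) \<Longrightarrow> x = y"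
  by (rule prod_eqI; rule ext) (simp_all add: eval_at_def)

lemma eval_ops:
  assumes "u \<in> frames A p"
  shows "eval_at p x = frame_eval u v \<Longrightarrow> eval_at p y = frame_eval u w \<Longrightarrow>
      eval_at p (x \<oplus>\<^bsub>bundle_algebra A m g\<^esub> y) = frame_eval u (v + w)"
    "eval_at p x = frame_eval u v \<Longrightarrow> eval_at p (f \<odot>\<^bsub>bundle_algebra A m g\<^esub> x) = frame_eval u (f p *\<^sub>R v)"
  using frame_add[OF assms] frame_scale[OF assms] by (simp_all add: eval_at_def frame_eval_def)

lemma omult0_linear:
  "omult0 (v + v') w = omult0 v w + omult0 v' w" "omult0 v (w + w') = omult0 v w + omult0 v w'"
  "omult0 (r *\<^sub>R v) w = r *\<^sub>R omult0 v w" "omult0 v (r *\<^sub>R w) = r *\<^sub>R omult0 v w"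
  by (simp_all add: omult0_def prod_eq_iff algebra_simps inner_add bilinear_ladd[OF bilinear_cross0]
      bilinear_radd[OF bilinear_cross0] bilinear_lmul[OF bilinear_cross0] bilinear_rmul[OF bilinear_cross0])

lemma osections_ops:
  "x \<in> osections A \<Longrightarrow> y \<in> osections A \<Longrightarrow> x \<oplus>\<^bsub>bundle_algebra A m g\<^esub> y \<in> osections A"
  "f \<in> smooth_functions A \<Longrightarrow> x \<in> osections A \<Longrightarrow> f \<odot>\<^bsub>bundle_algebra A m g\<^esub> x \<in> osections A"
  by (simp_all add: osections_iff smooth_functions_add vector_fields_add smooth_functions_mult vector_fields_scale)

section \<open>The octonion algebra of a definite form\<close>

context
  fixes \<phi> assumes \<phi>: "\<phi> \<in> definite_forms A"
begin

lemma ex_G2_frame: "\<exists>u. u \<in> G2_frames A \<phi> p"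
  using \<phi> by (auto simp: definite_forms_def)

lemma definite_smooth: "smooth_form3 A \<phi>"
  using \<phi> by (simp add: definite_forms_def)

lemma assoc_metric_eq: "assoc_metric A \<phi> = metric_of_form \<phi>"
  by (rule assoc_metric_eqI[OF \<phi> metric_of_form_riemannian[OF \<phi>]]) (use ex_G2_frame metric_of_form_frame in blast)

lemma assoc_metric_riemannian: "riemannian_metric A (assoc_metric A \<phi>)"
  by (simp add: assoc_metric_eq metric_of_form_riemannian[OF \<phi>])

lemma assoc_metric_frame: "u \<in> G2_frames A \<phi> p \<Longrightarrow> assoc_metric A \<phi> p (u x) (u y) = x \<bullet> y"
  by (simp add: assoc_metric_eq metric_of_form_frame)

lemma cross_field_eqI:
  assumes W: "W \<in> vector_fields A"
    and eq: "\<And>Z. Z \<in> vector_fields A \<Longrightarrow> (\<lambda>p. assoc_metric A \<phi> p (W p) (Z p)) = (\<lambda>p. \<phi> p (X p) (Y p) (Z p))"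
  shows "cross_field A \<phi> X Y = W"
  unfolding cross_field_def
proof (rule the_equality)
  show "W \<in> vector_fields A \<and>
    (\<forall>Z\<in>vector_fields A. (\<lambda>p. assoc_metric A \<phi> p (W p) (Z p)) = (\<lambda>p. \<phi> p (X p) (Y p) (Z p)))"
    using W eq by blast
  fix W' assume W': "W' \<in> vector_fields A \<and>
    (\<forall>Z\<in>vector_fields A. (\<lambda>p. assoc_metric A \<phi> p (W' p) (Z p)) = (\<lambda>p. \<phi> p (X p) (Y p) (Z p)))"
  show "W' = W"
  proof
    fix p
    show "W' p = W p"
    proof (rule metric_eqI_fields[OF assoc_metric_riemannian])
      show "W' p \<in> tangent_space A p" "W p \<in> tangent_space A p" using W W' by (auto intro: vector_field_tangent)
      fix Z assume Z: "Z \<in> vector_fields A"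
      then have "(\<lambda>p. assoc_metric A \<phi> p (W' p) (Z p)) = (\<lambda>p. assoc_metric A \<phi> p (W p) (Z p))"
        using eq W' by simp
      then show "assoc_metric A \<phi> p (W' p) (Z p) = assoc_metric A \<phi> p (W p) (Z p)" by (rule fun_cong)
    qed
  qed
qed

text \<open>The field required by the definite description in \<open>cross_field\<close> is written
  down with a global frame: \<open>U\<close> is inserted in the last argument of the form and the
  values are coefficients of \<open>V\<close>. This makes smoothness evident, and in a
  \<open>G2_frames\<close> member the field becomes \<open>cross0\<close>.\<close>

lemma
  assumes X: "X \<in> vector_fields A" and Y: "Y \<in> vector_fields A"
  shows cross_field_in: "cross_field A \<phi> X Y \<in> vector_fields A"
    and cross_field_frame: "u \<in> G2_frames A \<phi> p \<Longrightarrow> X p = u x \<Longrightarrow> Y p = u y \<Longrightarrow>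
      cross_field A \<phi> X Y p = u (cross0 x y)"
proof -
  let ?g = "assoc_metric A \<phi>"
  obtain N U V where fr: "frame_pair ?g N U V" by (rule global_frame[OF assoc_metric_riemannian])
  note UV = frame_pairD[OF assoc_metric_riemannian fr]
  define W where "W = (\<lambda>p c. \<Sum>k<N. \<phi> p (X p) (Y p) (U k p) *\<^sub>R V k p c)"
  have WV: "W \<in> vector_fields A"
    unfolding W_def by (intro vector_fields_sum vector_fields_scale form_smooth[OF definite_smooth] X Y UV(1,2))
  have Wu: "W p = u (cross0 x y)" if u: "u \<in> G2_frames A \<phi> p" and xy: "X p = u x" "Y p = u y" for u p x y
  proof -
    note uf = G2_frameD(1)[OF u]
    have "\<phi> p (X p) (Y p) (U k p) = ?g p (U k p) (u (cross0 x y))" for k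
    proof -
      obtain z where z: "U k p = u z" using frame_surj[OF uf vector_field_tangent[OF UV(1)]] by blast
      show ?thesis by (simp add: xy z G2_frameD(2)[OF u] assoc_metric_frame[OF u] phi0_cross0 inner_commute)
    qed
    then have "W p = (\<lambda>c. \<Sum>k<N. ?g p (U k p) (u (cross0 x y)) *\<^sub>R V k p c)" by (simp add: W_def)
    also have "\<dots> = u (cross0 x y)" by (rule UV(3)[OF frame_tangent[OF uf], symmetric])
    finally show ?thesis .
  qed
  have W: "cross_field A \<phi> X Y = W"
  proof (rule cross_field_eqI[OF WV], rule ext)
    fix Z p assume Z: "Z \<in> vector_fields A"
    obtain u where u: "u \<in> G2_frames A \<phi> p" using ex_G2_frame by blast
    note uf = G2_frameD(1)[OF u]
    obtain x where x: "X p = u x" using frame_surj[OF uf vector_field_tangent[OF X]] by blast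
    obtain y where y: "Y p = u y" using frame_surj[OF uf vector_field_tangent[OF Y]] by blast
    obtain z where z: "Z p = u z" using frame_surj[OF uf vector_field_tangent[OF Z]] by blast
    show "?g p (W p) (Z p) = \<phi> p (X p) (Y p) (Z p)"
      by (simp add: Wu[OF u x y] x y z assoc_metric_frame[OF u] G2_frameD(2)[OF u] phi0_cross0)
  qed
  show "cross_field A \<phi> X Y \<in> vector_fields A" using W WV by simp
  show "u \<in> G2_frames A \<phi> p \<Longrightarrow> X p = u x \<Longrightarrow> Y p = u y \<Longrightarrow> cross_field A \<phi> X Y p = u (cross0 x y)"
    using W Wu by simp
qed

lemma cross_field_metric:
  assumes X: "X \<in> vector_fields A" and Y: "Y \<in> vector_fields A" and z: "z \<in> tangent_space A p"
  shows "assoc_metric A \<phi> p (cross_field A \<phi> X Y p) z = \<phi> p (X p) (Y p) z"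
proof -
  obtain u where u: "u \<in> G2_frames A \<phi> p" using ex_G2_frame by blast
  note uf = G2_frameD(1)[OF u]
  obtain x where x: "X p = u x" using frame_surj[OF uf vector_field_tangent[OF X]] by blast
  obtain y where y: "Y p = u y" using frame_surj[OF uf vector_field_tangent[OF Y]] by blast
  obtain w where w: "z = u w" using frame_surj[OF uf z] by blast
  show ?thesis
    by (simp add: cross_field_frame[OF X Y u x y] x y w assoc_metric_frame[OF u] G2_frameD(2)[OF u] phi0_cross0)
qed

lemma G2_mult_apply:
  "x \<in> osections A \<Longrightarrow> y \<in> osections A \<Longrightarrow> G2_mult A \<phi> x y =
     (\<lambda>p. fst x p * fst y p - assoc_metric A \<phi> p (snd x p) (snd y p),
      \<lambda>p. tplus (tplus (tscale (fst x p) (snd y p)) (tscale (fst y p) (snd x p)))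
                (cross_field A \<phi> (snd x) (snd y) p))"
  by (simp add: G2_mult_def)

lemma G2_mult_in: "x \<in> osections A \<Longrightarrow> y \<in> osections A \<Longrightarrow> G2_mult A \<phi> x y \<in> osections A"
  by (auto simp: G2_mult_apply osections_iff
      intro!: smooth_functions_diff smooth_functions_mult metric_smooth[OF assoc_metric_riemannian]
        vector_fields_add vector_fields_scale cross_field_in)

lemma G2_mult_frame:
  assumes u: "u \<in> G2_frames A \<phi> p" and x: "x \<in> osections A" "eval_at p x = frame_eval u v"
    and y: "y \<in> osections A" "eval_at p y = frame_eval u w"
  shows "eval_at p (G2_mult A \<phi> x y) = frame_eval u (omult0 v w)"
proof -
  have V: "snd x \<in> vector_fields A" "snd y \<in> vector_fields A" using x y by (auto simp: osections_iff)
  have s: "fst x p = fst v" "snd x p = u (snd v)" "fst y p = fst w" "snd y p = u (snd w)"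
    using x(2) y(2) by (auto simp: eval_at_def frame_eval_def)
  show ?thesis
    by (simp add: G2_mult_apply[OF x(1) y(1)] eval_at_def frame_eval_def omult0_def s assoc_metric_frame[OF u]
        cross_field_frame[OF V u s(2,4)] frame_add[OF G2_frameD(1)[OF u]] frame_scale[OF G2_frameD(1)[OF u]])
qed

text \<open>Both sides of each law are sections, so they may be compared point by point, in frames
  chosen without any continuity; there the product is the bilinear \<open>omult0\<close>.\<close>

lemma G2_mult_bilinear:
  "G2_mult A \<phi> \<in> bilinear_maps (smooth_ring A) (bundle_algebra A m g) (bundle_algebra A m g)"
proof -
  let ?C = "bundle_algebra A m g"
  have ops: "G2_mult A \<phi> (x \<oplus>\<^bsub>?C\<^esub> x') y = G2_mult A \<phi> x y \<oplus>\<^bsub>?C\<^esub> G2_mult A \<phi> x' y"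
    "G2_mult A \<phi> y (x \<oplus>\<^bsub>?C\<^esub> x') = G2_mult A \<phi> y x \<oplus>\<^bsub>?C\<^esub> G2_mult A \<phi> y x'"
    "f \<in> smooth_functions A \<Longrightarrow> G2_mult A \<phi> (f \<odot>\<^bsub>?C\<^esub> x) y = f \<odot>\<^bsub>?C\<^esub> G2_mult A \<phi> x y"
    "f \<in> smooth_functions A \<Longrightarrow> G2_mult A \<phi> y (f \<odot>\<^bsub>?C\<^esub> x) = f \<odot>\<^bsub>?C\<^esub> G2_mult A \<phi> y x"
    if x: "x \<in> osections A" and x': "x' \<in> osections A" and y: "y \<in> osections A" for x x' y f
  proof -
    have "\<exists>u v v' w. u \<in> G2_frames A \<phi> p \<and> eval_at p x = frame_eval u v \<and> eval_at p x' = frame_eval u v' \<and>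
        eval_at p y = frame_eval u w" for p
    proof -
      obtain u where u: "u \<in> G2_frames A \<phi> p" using ex_G2_frame by blast
      note uf = G2_frameD(1)[OF u]
      show ?thesis
        using u eval_frame[OF uf x] eval_frame[OF uf x'] eval_frame[OF uf y] by metis
    qed
    then obtain u v v' w where uv: "\<And>p. u p \<in> G2_frames A \<phi> p" "\<And>p. eval_at p x = frame_eval (u p) (v p)"
      "\<And>p. eval_at p x' = frame_eval (u p) (v' p)" "\<And>p. eval_at p y = frame_eval (u p) (w p)" by metis
    note uf = G2_frameD(1)[OF uv(1)]
    note a = osections_ops(1)[OF x x', of m g] eval_ops(1)[OF uf uv(2,3), of _ m g]
    note M = G2_mult_frame[OF uv(1)]
    show "G2_mult A \<phi> (x \<oplus>\<^bsub>?C\<^esub> x') y = G2_mult A \<phi> x y \<oplus>\<^bsub>?C\<^esub> G2_mult A \<phi> x' y"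
      by (rule eval_eqI) (simp only: M[OF a y uv(4)] eval_ops(1)[OF uf M[OF x uv(2) y uv(4)] M[OF x' uv(3) y uv(4)]] omult0_linear)
    show "G2_mult A \<phi> y (x \<oplus>\<^bsub>?C\<^esub> x') = G2_mult A \<phi> y x \<oplus>\<^bsub>?C\<^esub> G2_mult A \<phi> y x'"
      by (rule eval_eqI) (simp only: M[OF y uv(4) a] eval_ops(1)[OF uf M[OF y uv(4) x uv(2)] M[OF y uv(4) x' uv(3)]] omult0_linear)
    assume f: "f \<in> smooth_functions A"
    note b = osections_ops(2)[OF f x, of m g] eval_ops(2)[OF uf uv(2), of _ m g f]
    show "G2_mult A \<phi> (f \<odot>\<^bsub>?C\<^esub> x) y = f \<odot>\<^bsub>?C\<^esub> G2_mult A \<phi> x y"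
      by (rule eval_eqI) (simp only: M[OF b y uv(4)] eval_ops(2)[OF uf M[OF x uv(2) y uv(4)]] omult0_linear)
    show "G2_mult A \<phi> y (f \<odot>\<^bsub>?C\<^esub> x) = f \<odot>\<^bsub>?C\<^esub> G2_mult A \<phi> y x"
      by (rule eval_eqI) (simp only: M[OF y uv(4) b] eval_ops(2)[OF uf M[OF y uv(4) x uv(2)]] omult0_linear)
  qed
  have car: "carrier ?C = osections A" by simp
  have ext: "G2_mult A \<phi> x \<in> extensional (osections A)" if "x \<in> osections A" for x
    using that by (simp add: G2_mult_def)
  show ?thesis
    unfolding bilinear_maps_def linear_maps_def car
  proof (intro CollectI conjI ballI)
    show "G2_mult A \<phi> \<in> extensional (osections A)" by (simp add: G2_mult_def)
    fix x assume x: "x \<in> osections A"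
    show "G2_mult A \<phi> x \<in> osections A \<rightarrow>\<^sub>E osections A"
      using G2_mult_in[OF x] ext[OF x] by (auto simp: PiE_def)
    show "(\<lambda>z\<in>osections A. G2_mult A \<phi> z x) \<in> osections A \<rightarrow>\<^sub>E osections A"
      using G2_mult_in[OF _ x] by auto
    { fix y z assume yz: "y \<in> osections A" "z \<in> osections A"
      show "G2_mult A \<phi> x (y \<oplus>\<^bsub>?C\<^esub> z) = G2_mult A \<phi> x y \<oplus>\<^bsub>?C\<^esub> G2_mult A \<phi> x z" by (rule ops(2)[OF yz x])
      show "(\<lambda>z\<in>osections A. G2_mult A \<phi> z x) (y \<oplus>\<^bsub>?C\<^esub> z) =
          (\<lambda>z\<in>osections A. G2_mult A \<phi> z x) y \<oplus>\<^bsub>?C\<^esub> (\<lambda>z\<in>osections A. G2_mult A \<phi> z x) z"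
        unfolding restrict_apply'[OF yz(1)] restrict_apply'[OF yz(2)] restrict_apply'[OF osections_ops(1)[OF yz]]
        by (rule ops(1)[OF yz x]) }
    { fix f y assume "f \<in> carrier (smooth_ring A)" and y: "y \<in> osections A"
      then have f: "f \<in> smooth_functions A" by simp
      show "G2_mult A \<phi> x (f \<odot>\<^bsub>?C\<^esub> y) = f \<odot>\<^bsub>?C\<^esub> G2_mult A \<phi> x y" by (rule ops(4)[OF y y x f])
      show "(\<lambda>z\<in>osections A. G2_mult A \<phi> z x) (f \<odot>\<^bsub>?C\<^esub> y) = f \<odot>\<^bsub>?C\<^esub> (\<lambda>z\<in>osections A. G2_mult A \<phi> z x) y"
        unfolding restrict_apply'[OF y] restrict_apply'[OF osections_ops(2)[OF f y]]
        by (rule ops(3)[OF y y x f]) }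
  qed
qed

lemma G2_octonion_algebra: "octonion_algebra (smooth_ring A) (G2_algebra A \<phi>)"
  unfolding G2_algebra_def octonion_algebra_bundle_iff[OF assoc_metric_riemannian]
proof (intro conjI ballI G2_mult_bilinear)
  let ?one = "(\<lambda>p. 1, \<lambda>p. tzero) :: ('a, 7) osection"
  let ?q = "norm_form (smooth_ring A) (bundle_algebra A (G2_mult A \<phi>) (assoc_metric A \<phi>))"
  have one: "?one \<in> osections A" by (simp add: osections_iff smooth_functions_const vector_fields_zero)
  fix x assume x: "x \<in> osections A"
  have 1: "eval_at p (G2_mult A \<phi> ?one x) = eval_at p x \<and> eval_at p (G2_mult A \<phi> x ?one) = eval_at p x" for p
  proof -
    obtain u where u: "u \<in> G2_frames A \<phi> p" using ex_G2_frame by blast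
    note uf = G2_frameD(1)[OF u]
    obtain v where v: "eval_at p x = frame_eval u v" using eval_frame[OF uf x] by blast
    have e1: "eval_at p ?one = frame_eval u (1, 0)" by (simp add: eval_at_def frame_eval_def frame_zero[OF uf])
    show ?thesis
      unfolding G2_mult_frame[OF u one e1 x v] G2_mult_frame[OF u x v one e1]
      by (simp add: v omult0_def bilinear_lzero[OF bilinear_cross0] bilinear_rzero[OF bilinear_cross0])
  qed
  show "G2_mult A \<phi> ?one x = x" by (rule eval_eqI) (simp only: 1)
  show "G2_mult A \<phi> x ?one = x" by (rule eval_eqI) (simp only: 1)
  fix y assume y: "y \<in> osections A"
  have q: "?q z p = (norm v)\<^sup>2" if "z \<in> osections A" "u \<in> G2_frames A \<phi> p" "eval_at p z = frame_eval u v" for z p u v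
    using that(3) unfolding bundle_norm_form[OF assoc_metric_riemannian that(1)]
    by (cases v) (auto simp: eval_at_def frame_eval_def assoc_metric_frame[OF that(2)] power2_norm_eq_inner inner_Pair)
  show "?q (G2_mult A \<phi> x y) = (\<lambda>p. ?q x p * ?q y p)"
  proof
    fix p
    obtain u where u: "u \<in> G2_frames A \<phi> p" using ex_G2_frame by blast
    note uf = G2_frameD(1)[OF u]
    obtain v where v: "eval_at p x = frame_eval u v" using eval_frame[OF uf x] by blast
    obtain w where w: "eval_at p y = frame_eval u w" using eval_frame[OF uf y] by blast
    show "?q (G2_mult A \<phi> x y) p = ?q x p * ?q y p"
      by (simp only: q[OF x u v] q[OF y u w] q[OF G2_mult_in[OF x y] u G2_mult_frame[OF u x v y w]] omult0_norm)
  qed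
qed

text \<open>In a frame the fibre product is \<open>omult0\<close>. Its Euclidean norm is
  multiplicative and definite, so a zero product has a zero factor.\<close>

lemma G2_non_split: "non_split_at A (G2_mult A \<phi>) p"
  unfolding non_split_at_def
proof (intro ballI impI)
  fix v w :: "real \<times> ('a, 7) tangent"
  assume v: "v \<in> UNIV \<times> tangent_space A p" and w: "w \<in> UNIV \<times> tangent_space A p"
    and 0: "fibre_mult A (G2_mult A \<phi>) p v w = (0, tzero)"
  obtain u where u: "u \<in> G2_frames A \<phi> p" using ex_G2_frame by blast
  note uf = G2_frameD(1)[OF u]
  have lift: "\<exists>x\<in>osections A. eval_at p x = z" if "z \<in> UNIV \<times> tangent_space A p" for z :: "real \<times> ('a, 7) tangent"
  proof -
    have "snd z \<in> tangent_space A p" using that by auto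
    then obtain X where "X \<in> vector_fields A" "X p = snd z"
      using ex_field_through[OF assoc_metric_riemannian] by blast
    then show ?thesis
      by (intro bexI[of _ "(\<lambda>p. fst z, X)"]) (simp_all add: eval_at_def osections_iff smooth_functions_const)
  qed
  have coords: "\<exists>a. z = frame_eval u a" if "z \<in> UNIV \<times> tangent_space A p" for z
  proof -
    have "snd z \<in> tangent_space A p" using that by auto
    then obtain b where "snd z = u b" using frame_surj[OF uf] by blast
    then show ?thesis by (intro exI[of _ "(fst z, b)"]) (simp add: frame_eval_def prod_eq_iff)
  qed
  obtain a b where ab: "v = frame_eval u a" "w = frame_eval u b" using coords[OF v] coords[OF w] by blast
  have "fibre_mult A (G2_mult A \<phi>) p v w = frame_eval u (omult0 a b)"
    unfolding fibre_mult_def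
  proof (rule the_equality)
    obtain x y where xy: "x \<in> osections A" "y \<in> osections A" "eval_at p x = v" "eval_at p y = w"
      using lift[OF v] lift[OF w] by blast
    show "\<exists>x\<in>osections A. \<exists>y\<in>osections A. eval_at p x = v \<and> eval_at p y = w \<and>
        eval_at p (G2_mult A \<phi> x y) = frame_eval u (omult0 a b)"
      using xy G2_mult_frame[OF u xy(1) _ xy(2)] ab by blast
    fix z assume "\<exists>x\<in>osections A. \<exists>y\<in>osections A. eval_at p x = v \<and> eval_at p y = w \<and> eval_at p (G2_mult A \<phi> x y) = z"
    then show "z = frame_eval u (omult0 a b)" using G2_mult_frame[OF u] ab by blast
  qed
  then have "frame_eval u (omult0 a b) = frame_eval u 0"
    using 0 by (simp add: frame_eval_def frame_zero[OF uf])
  then have "omult0 a b = 0" by (rule frame_eval_inj[OF uf])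
  then have "(norm a)\<^sup>2 * (norm b)\<^sup>2 = 0" using omult0_norm[of a b] by simp
  then have "a = 0 \<or> b = 0" by simp
  then show "v = (0, tzero) \<or> w = (0, tzero)"
    using ab by (auto simp: frame_eval_def frame_zero[OF uf])
qed

end

end

section \<open>From octonion bundles to definite forms\<close>

context manifold
begin

text \<open>The coordinate vectors of a chart are not global fields. Near a point they are cut-off
  fields divided by the bump function \<beta>, so multilinearity expresses a component as a smooth
  function divided by the cube of \<beta>.\<close>

lemma form_components_smooth:
  assumes f: "\<And>p v w. v \<in> tangent_space A p \<Longrightarrow> w \<in> tangent_space A p \<Longrightarrow>
      tangent_functional A p (\<lambda>u. \<phi> p u v w) \<and> tangent_functional A p (\<lambda>u. \<phi> p v u w) \<and>
      tangent_functional A p (\<phi> p v w)"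
    and s: "\<And>X Y Z. X \<in> vector_fields A \<Longrightarrow> Y \<in> vector_fields A \<Longrightarrow> Z \<in> vector_fields A \<Longrightarrow>
      (\<lambda>p. \<phi> p (X p) (Y p) (Z p)) \<in> smooth_functions A"
    and c: "c \<in> A"
  shows "smooth_on (chart_img c)
        (\<lambda>y. \<phi> (chart_inv c y) (coord_vector A c (chart_inv c y) x1)
               (coord_vector A c (chart_inv c y) x2) (coord_vector A c (chart_inv c y) x3))"
    (is "smooth_on _ (\<lambda>y. ?h (chart_inv c y))")
proof -
  have "smooth_in c (chart_dom c) ?h"
  proof (rule smooth_in_local[OF c open_chart_dom[OF c] subset_refl])
    fix p assume "p \<in> chart_dom c"
    from bump_function[OF open_chart_dom[OF c] this] obtain \<beta> K where \<beta>: "\<beta> \<in> smooth_functions A" "compact K"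
      "K \<subseteq> chart_dom c" "\<And>q. q \<notin> K \<Longrightarrow> \<beta> q = 0" "\<beta> p > 0" by metis
    let ?U = "{q. 0 < \<beta> q}"
    have U: "open ?U"
      by (rule open_Collect_less[OF continuous_on_const smooth_functions_continuous[OF \<beta>(1)]])
    have Uc: "?U \<subseteq> chart_dom c" using \<beta>(3,4) by force
    let ?E = "cutoff_field \<beta> c"
    have E: "?E x \<in> vector_fields A" for x by (rule cutoff_field[OF \<beta>(1-4) c])
    have "(\<lambda>q. \<phi> q (?E x1 q) (?E x2 q) (?E x3 q)) \<in> smooth_functions A" by (rule s[OF E E E])
    then have 1: "smooth_in c ?U (\<lambda>q. \<phi> q (?E x1 q) (?E x2 q) (?E x3 q))"
      using Uc c by (auto simp: smooth_functions_iff intro: smooth_in_subset)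
    have 2: "smooth_in c ?U \<beta>" using \<beta>(1) Uc c by (auto simp: smooth_functions_iff intro: smooth_in_subset)
    have "smooth_in c ?U (\<lambda>q. \<phi> q (?E x1 q) (?E x2 q) (?E x3 q) / (\<beta> q * (\<beta> q * \<beta> q)))"
      using 1 2 Uc c chart_inv_coord[OF c] unfolding smooth_in_def
      by (intro smooth_on_divide smooth_on_mult open_coord_image U) (auto simp: subset_eq)
    then have "smooth_in c ?U ?h"
    proof (rule smooth_in_cong[OF _ c U Uc])
      fix q assume q: "q \<in> ?U"
      then have qc: "q \<in> chart_dom c" using Uc by blast
      then have cq: "c \<in> charts_at A q" using c by (simp add: charts_at_def)
      note cv = coord_vector_tangent[OF cq]
      have Eq: "?E x q = tscale (\<beta> q) (coord_vector A c q x)" for x using qc by (simp add: cutoff_field_def)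
      have "\<phi> q (?E x1 q) (?E x2 q) (?E x3 q) = \<beta> q * (\<beta> q * (\<beta> q * ?h q))"
        unfolding Eq
        using tangent_functional_scale[OF f[THEN conjunct1], OF tangent_scale[OF cv] tangent_scale[OF cv] cv]
          tangent_functional_scale[OF f[THEN conjunct2, THEN conjunct1], OF cv tangent_scale[OF cv] cv]
          tangent_functional_scale[OF f[THEN conjunct2, THEN conjunct2], OF cv cv cv]
        by (simp only:)
      then show "\<phi> q (?E x1 q) (?E x2 q) (?E x3 q) / (\<beta> q * (\<beta> q * \<beta> q)) = ?h q"
        using q by simp
    qed
    then show "\<exists>U. open U \<and> p \<in> U \<and> U \<subseteq> chart_dom c \<and> smooth_in c U ?h"
      using U Uc \<beta>(5) by (intro exI[of _ ?U]) simp
  qed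
  then show ?thesis by (simp add: smooth_in_def)
qed

end

lemma bilinear_mapsD:
  assumes "B \<in> bilinear_maps R M N"
  shows "x \<in> carrier M \<Longrightarrow> y \<in> carrier M \<Longrightarrow> B x y \<in> carrier N"
    "x \<in> carrier M \<Longrightarrow> y \<in> carrier M \<Longrightarrow> z \<in> carrier M \<Longrightarrow> B x (y \<oplus>\<^bsub>M\<^esub> z) = B x y \<oplus>\<^bsub>N\<^esub> B x z"
    "r \<in> carrier R \<Longrightarrow> x \<in> carrier M \<Longrightarrow> y \<in> carrier M \<Longrightarrow> B x (r \<odot>\<^bsub>M\<^esub> y) = r \<odot>\<^bsub>N\<^esub> B x y"
    "x \<in> carrier M \<Longrightarrow> y \<in> carrier M \<Longrightarrow> z \<in> carrier M \<Longrightarrow> y \<oplus>\<^bsub>M\<^esub> z \<in> carrier M \<Longrightarrow>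
      B (y \<oplus>\<^bsub>M\<^esub> z) x = B y x \<oplus>\<^bsub>N\<^esub> B z x"
    "r \<in> carrier R \<Longrightarrow> x \<in> carrier M \<Longrightarrow> y \<in> carrier M \<Longrightarrow> r \<odot>\<^bsub>M\<^esub> y \<in> carrier M \<Longrightarrow>
      B (r \<odot>\<^bsub>M\<^esub> y) x = r \<odot>\<^bsub>N\<^esub> B y x"
    "B \<in> extensional (carrier M)" "x \<in> carrier M \<Longrightarrow> B x \<in> extensional (carrier M)"
proof -
  have l: "B x \<in> linear_maps R M N" if "x \<in> carrier M" for x using assms that by (simp add: bilinear_maps_def)
  have r: "(\<lambda>x\<in>carrier M. B x y) \<in> linear_maps R M N" if "y \<in> carrier M" for y
    using assms that by (simp add: bilinear_maps_def)
  show "x \<in> carrier M \<Longrightarrow> y \<in> carrier M \<Longrightarrow> B x y \<in> carrier N" using l[of x] by (auto simp: linear_maps_def)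
  show "x \<in> carrier M \<Longrightarrow> y \<in> carrier M \<Longrightarrow> z \<in> carrier M \<Longrightarrow> B x (y \<oplus>\<^bsub>M\<^esub> z) = B x y \<oplus>\<^bsub>N\<^esub> B x z"
    using l[of x] by (simp add: linear_maps_def)
  show "r \<in> carrier R \<Longrightarrow> x \<in> carrier M \<Longrightarrow> y \<in> carrier M \<Longrightarrow> B x (r \<odot>\<^bsub>M\<^esub> y) = r \<odot>\<^bsub>N\<^esub> B x y"
    using l[of x] by (simp add: linear_maps_def)
  show "B (y \<oplus>\<^bsub>M\<^esub> z) x = B y x \<oplus>\<^bsub>N\<^esub> B z x"
    if "x \<in> carrier M" "y \<in> carrier M" "z \<in> carrier M" "y \<oplus>\<^bsub>M\<^esub> z \<in> carrier M"
  proof -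
    have "(\<lambda>t\<in>carrier M. B t x) (y \<oplus>\<^bsub>M\<^esub> z) = (\<lambda>t\<in>carrier M. B t x) y \<oplus>\<^bsub>N\<^esub> (\<lambda>t\<in>carrier M. B t x) z"
      using r[OF that(1)] that(2,3) unfolding linear_maps_def by blast
    then show ?thesis using that by simp
  qed
  show "B (r \<odot>\<^bsub>M\<^esub> y) x = r \<odot>\<^bsub>N\<^esub> B y x"
    if "r \<in> carrier R" "x \<in> carrier M" "y \<in> carrier M" "r \<odot>\<^bsub>M\<^esub> y \<in> carrier M"
  proof -
    have "(\<lambda>t\<in>carrier M. B t x) (r \<odot>\<^bsub>M\<^esub> y) = r \<odot>\<^bsub>N\<^esub> (\<lambda>t\<in>carrier M. B t x) y"
      using r[OF that(2)] that(1,3) unfolding linear_maps_def by blast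
    then show ?thesis using that by simp
  qed
  show "B \<in> extensional (carrier M)" using assms by (simp add: bilinear_maps_def)
  show "x \<in> carrier M \<Longrightarrow> B x \<in> extensional (carrier M)" using l[of x] by (simp add: linear_maps_def PiE_def)
qed

section \<open>The composition law and the cross product of a bundle\<close>

locale octonion_bundle = manifold7 A for A :: "('a::{t2_space, second_countable_topology}, 7) chart set" +
  fixes m g
  assumes g: "riemannian_metric A g" and oct: "octonion_algebra (smooth_ring A) (bundle_algebra A m g)"
begin

abbreviation (input) C where "C \<equiv> bundle_algebra A m g"

text \<open>Half of \<open>bundle_form\<close>, so that \<open>ip x x\<close> is the norm form
  without factors of 2.\<close>

definition ip :: "('a, 7) osection \<Rightarrow> ('a, 7) osection \<Rightarrow> 'a \<Rightarrow> real" where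
  "ip x y p = fst x p * fst y p + g p (snd x p) (snd y p)"

definition unit :: "('a, 7) osection" where "unit = (\<lambda>p. 1, \<lambda>p. tzero)"

definition im :: "('a \<Rightarrow> ('a, 7) tangent) \<Rightarrow> ('a, 7) osection" where "im X = (\<lambda>p. 0, X)"

lemma mult_bilinear: "m \<in> bilinear_maps (smooth_ring A) C C"
  and mult_unit: "x \<in> osections A \<Longrightarrow> m unit x = x" "x \<in> osections A \<Longrightarrow> m x unit = x"
  using oct unfolding octonion_algebra_bundle_iff[OF g] unit_def by blast+

lemma mult_in: "x \<in> osections A \<Longrightarrow> y \<in> osections A \<Longrightarrow> m x y \<in> osections A"
  using bilinear_mapsD(1)[OF mult_bilinear] by simp

lemma mult_add:
  assumes "x \<in> osections A" "y \<in> osections A" "z \<in> osections A"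
  shows "m x (y \<oplus>\<^bsub>C\<^esub> z) = m x y \<oplus>\<^bsub>C\<^esub> m x z" "m (x \<oplus>\<^bsub>C\<^esub> y) z = m x z \<oplus>\<^bsub>C\<^esub> m y z"
  using bilinear_mapsD(2)[OF mult_bilinear, of x y z] bilinear_mapsD(4)[OF mult_bilinear, of z x y]
    osections_ops(1)[OF assms(1,2), of m g] assms
  by (simp_all only: bundle_simps(1))

lemma mult_smult:
  assumes "f \<in> smooth_functions A" "x \<in> osections A" "y \<in> osections A"
  shows "m x (f \<odot>\<^bsub>C\<^esub> y) = f \<odot>\<^bsub>C\<^esub> m x y" "m (f \<odot>\<^bsub>C\<^esub> x) y = f \<odot>\<^bsub>C\<^esub> m x y"
  using bilinear_mapsD(3)[OF mult_bilinear, of f x y] bilinear_mapsD(5)[OF mult_bilinear, of f y x]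
    osections_ops(2)[OF assms(1,2), of m g] assms
  by (simp_all only: bundle_simps(1) smooth_ring_simps(1))

lemma unit_in: "unit \<in> osections A"
  by (simp add: unit_def osections_iff smooth_functions_const vector_fields_zero)

lemma im_in: "X \<in> vector_fields A \<Longrightarrow> im X \<in> osections A"
  by (simp add: im_def osections_iff smooth_functions_const)

lemma snd_tangent: "x \<in> osections A \<Longrightarrow> snd x p \<in> tangent_space A p"
  by (simp add: osections_iff vector_field_tangent)

lemma ip_add:
  assumes "x \<in> osections A" "y \<in> osections A" "z \<in> osections A"
  shows "ip (x \<oplus>\<^bsub>C\<^esub> y) z p = ip x z p + ip y z p" "ip z (x \<oplus>\<^bsub>C\<^esub> y) p = ip z x p + ip z y p"
  using tangent_functional_add[OF metric_functional_left[OF g snd_tangent[OF assms(3)]] snd_tangent[OF assms(1)] snd_tangent[OF assms(2)]]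
    tangent_functional_add[OF metric_functional[OF g snd_tangent[OF assms(3)]] snd_tangent[OF assms(1)] snd_tangent[OF assms(2)]]
  by (simp_all add: ip_def algebra_simps)

lemma ip_sym: "x \<in> osections A \<Longrightarrow> y \<in> osections A \<Longrightarrow> ip x y p = ip y x p"
  using metric_sym[OF g snd_tangent snd_tangent] by (simp add: ip_def mult.commute)

lemma ip_mult:
  assumes "x \<in> osections A" "y \<in> osections A"
  shows "ip (m x y) (m x y) p = ip x x p * ip y y p"
proof -
  have "norm_form (smooth_ring A) C (m x y) = (\<lambda>p. norm_form (smooth_ring A) C x p * norm_form (smooth_ring A) C y p)"
    using oct assms unfolding octonion_algebra_bundle_iff[OF g] by blast
  from fun_cong[OF this, of p] show ?thesis
    by (simp add: bundle_norm_form[OF g] assms mult_in ip_def)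
qed

lemma ip_mult_right:
  assumes x: "x \<in> osections A" and y: "y \<in> osections A" and z: "z \<in> osections A"
  shows "ip (m x z) (m y z) p = ip x y p * ip z z p"
proof -
  have xy: "x \<oplus>\<^bsub>C\<^esub> y \<in> osections A" by (rule osections_ops(1)[OF x y])
  note M = mult_in[OF x z] mult_in[OF y z]
  have "ip (m x z \<oplus>\<^bsub>C\<^esub> m y z) (m x z \<oplus>\<^bsub>C\<^esub> m y z) p = ip (x \<oplus>\<^bsub>C\<^esub> y) (x \<oplus>\<^bsub>C\<^esub> y) p * ip z z p"
    using ip_mult[OF xy z, of p] by (simp only: mult_add(2)[OF x y z])
  then show ?thesis
    unfolding ip_add(1)[OF M osections_ops(1)[OF M]] ip_add(2)[OF M M(1)] ip_add(2)[OF M M(2)]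
      ip_add(1)[OF x y xy] ip_add(2)[OF x y x] ip_add(2)[OF x y y]
    using ip_mult[OF x z, of p] ip_mult[OF y z, of p] ip_sym[OF M, of p] ip_sym[OF x y, of p]
    by (simp add: algebra_simps)
qed

text \<open>The norm law is now polarized in both factors. Taking \<open>unit\<close> for
  \<open>y\<close> and \<open>w\<close> and imaginary sections for \<open>x\<close> and
  \<open>z\<close> yields the real part of a product of imaginary sections in
  \<open>im_mult\<close>.\<close>

lemma ip_mult_polar:
  assumes x: "x \<in> osections A" and y: "y \<in> osections A" and z: "z \<in> osections A" and w: "w \<in> osections A"
  shows "ip (m x z) (m y w) p + ip (m x w) (m y z) p = 2 * ip x y p * ip z w p"
proof -
  have zw: "z \<oplus>\<^bsub>C\<^esub> w \<in> osections A" by (rule osections_ops(1)[OF z w])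
  note M = mult_in[OF x z] mult_in[OF x w] and M' = mult_in[OF y z] mult_in[OF y w]
  have "ip (m x z \<oplus>\<^bsub>C\<^esub> m x w) (m y z \<oplus>\<^bsub>C\<^esub> m y w) p = ip x y p * ip (z \<oplus>\<^bsub>C\<^esub> w) (z \<oplus>\<^bsub>C\<^esub> w) p"
    using ip_mult_right[OF x y zw, of p] by (simp only: mult_add(1)[OF x z w] mult_add(1)[OF y z w])
  then show ?thesis
    unfolding ip_add(1)[OF M osections_ops(1)[OF M']] ip_add(2)[OF M' M(1)] ip_add(2)[OF M' M(2)]
      ip_add(1)[OF z w zw] ip_add(2)[OF z w z] ip_add(2)[OF z w w]
    using ip_mult_right[OF x y z, of p] ip_mult_right[OF x y w, of p] ip_sym[OF z w, of p]
    by (simp add: algebra_simps)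
qed

definition cr :: "('a \<Rightarrow> ('a, 7) tangent) \<Rightarrow> ('a \<Rightarrow> ('a, 7) tangent) \<Rightarrow> 'a \<Rightarrow> ('a, 7) tangent" where
  "cr X Y = snd (m (im X) (im Y))"

lemma cr_in: "X \<in> vector_fields A \<Longrightarrow> Y \<in> vector_fields A \<Longrightarrow> cr X Y \<in> vector_fields A"
  using mult_in[OF im_in im_in] by (simp add: cr_def osections_iff)

lemma metric_zero: "v \<in> tangent_space A p \<Longrightarrow> g p v tzero = 0" "v \<in> tangent_space A p \<Longrightarrow> g p tzero v = 0"
  using tangent_functional_zero[OF metric_functional[OF g]] tangent_functional_zero[OF metric_functional_left[OF g]]
  by blast+

lemma im_mult:
  assumes X: "X \<in> vector_fields A" and Y: "Y \<in> vector_fields A"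
  shows "m (im X) (im Y) = (\<lambda>p. - g p (X p) (Y p), cr X Y)"
proof -
  have "fst (m (im X) (im Y)) p = - g p (X p) (Y p)" for p
    using ip_mult_polar[OF im_in[OF X] unit_in im_in[OF Y] unit_in, of p]
      vector_field_tangent[OF X, of p] vector_field_tangent[OF Y, of p] vector_field_tangent[OF cr_in[OF X Y], of p]
    by (simp add: mult_unit im_in X Y unit_in) (simp add: ip_def im_def unit_def metric_zero cr_def)
  then show ?thesis by (intro prod_eqI ext) (simp_all add: cr_def)
qed

lemma cr_norm:
  assumes X: "X \<in> vector_fields A" and Y: "Y \<in> vector_fields A"
  shows "g p (cr X Y p) (cr X Y p) = g p (X p) (X p) * g p (Y p) (Y p) - (g p (X p) (Y p))\<^sup>2"
  using ip_mult[OF im_in[OF X] im_in[OF Y], of p]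
  by (simp add: im_mult[OF X Y]) (simp add: ip_def im_def power2_eq_square)

lemma cr_orth:
  assumes X: "X \<in> vector_fields A" and Y: "Y \<in> vector_fields A"
  shows "g p (cr X Y p) (Y p) = 0"
  using ip_mult_right[OF im_in[OF X] unit_in im_in[OF Y], of p] vector_field_tangent[OF X, of p]
  by (simp add: mult_unit im_in Y im_mult[OF X Y]) (simp add: ip_def im_def unit_def metric_zero)

lemma cr_self:
  assumes X: "X \<in> vector_fields A"
  shows "cr X X p = tzero"
  using cr_norm[OF X X, of p] metric_pos[OF g vector_field_tangent[OF cr_in[OF X X]], of p]
  by (force simp: power2_eq_square)

lemma cr_add:
  assumes X: "X \<in> vector_fields A" and Y: "Y \<in> vector_fields A" and Z: "Z \<in> vector_fields A"
  shows "cr (\<lambda>p. tplus (X p) (Y p)) Z = (\<lambda>p. tplus (cr X Z p) (cr Y Z p))"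
    "cr Z (\<lambda>p. tplus (X p) (Y p)) = (\<lambda>p. tplus (cr Z X p) (cr Z Y p))"
proof -
  have "im (\<lambda>p. tplus (X p) (Y p)) = im X \<oplus>\<^bsub>C\<^esub> im Y" by (simp add: im_def)
  then show "cr (\<lambda>p. tplus (X p) (Y p)) Z = (\<lambda>p. tplus (cr X Z p) (cr Y Z p))"
    "cr Z (\<lambda>p. tplus (X p) (Y p)) = (\<lambda>p. tplus (cr Z X p) (cr Z Y p))"
    using mult_add[OF im_in[OF X] im_in[OF Y] im_in[OF Z]] mult_add[OF im_in[OF Z] im_in[OF X] im_in[OF Y]]
    by (simp_all add: cr_def)
qed

lemma cr_scale:
  assumes X: "X \<in> vector_fields A" and Z: "Z \<in> vector_fields A"
  shows "cr (\<lambda>p. tscale r (X p)) Z = (\<lambda>p. tscale r (cr X Z p))"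
    "cr Z (\<lambda>p. tscale r (X p)) = (\<lambda>p. tscale r (cr Z X p))"
proof -
  have "im (\<lambda>p. tscale r (X p)) = (\<lambda>p. r) \<odot>\<^bsub>C\<^esub> im X" by (simp add: im_def)
  then show "cr (\<lambda>p. tscale r (X p)) Z = (\<lambda>p. tscale r (cr X Z p))"
    "cr Z (\<lambda>p. tscale r (X p)) = (\<lambda>p. tscale r (cr Z X p))"
    using mult_smult[OF smooth_functions_const im_in[OF X] im_in[OF Z], of r] mult_smult[OF smooth_functions_const im_in[OF Z] im_in[OF X], of r]
    by (simp_all add: cr_def)
qed

text \<open>Multiplicativity of the norm makes the product of two sections at \<open>p\<close> vanish if one of them
  vanishes at \<open>p\<close>; together with additivity this is tensoriality.\<close>

lemma cr_tensorial:
  assumes X: "X \<in> vector_fields A" "X' \<in> vector_fields A" "X p = X' p"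
    and Y: "Y \<in> vector_fields A" "Y' \<in> vector_fields A" "Y p = Y' p"
  shows "cr X Y p = cr X' Y' p"
proof -
  have vanish: "cr D Z p = tzero \<and> cr Z D p = tzero"
    if D: "D \<in> vector_fields A" "D p = tzero" and Z: "Z \<in> vector_fields A" for D Z
  proof -
    have "g p (cr D Z p) (cr D Z p) = 0" "g p (cr Z D p) (cr Z D p) = 0"
      using cr_norm[OF D(1) Z, of p] cr_norm[OF Z D(1), of p] D(2) vector_field_tangent[OF Z, of p]
      by (simp_all add: metric_zero tangent_zero)
    then show ?thesis
      using metric_pos[OF g vector_field_tangent[OF cr_in[OF D(1) Z]], of p]
        metric_pos[OF g vector_field_tangent[OF cr_in[OF Z D(1)]], of p] by force
  qed
  have diff: "(\<lambda>p. tplus (Z p) (tscale (-1) (Z' p))) \<in> vector_fields A" if "Z \<in> vector_fields A" "Z' \<in> vector_fields A" for Z Z'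
    using that vector_fields_scale[OF smooth_functions_const, of Z' "-1"] by (intro vector_fields_add)
  have "cr X Y p = cr X' Y p"
  proof -
    let ?D = "\<lambda>p. tplus (X p) (tscale (-1) (X' p))"
    have "X = (\<lambda>p. tplus (?D p) (X' p))" by (intro ext) simp
    then have "cr X Y p = cr (\<lambda>p. tplus (?D p) (X' p)) Y p" by (rule arg_cong[where f = "\<lambda>X. cr X Y p"])
    also have "\<dots> = tplus (cr ?D Y p) (cr X' Y p)" by (simp only: cr_add(1)[OF diff[OF X(1,2)] X(2) Y(1)])
    finally have "cr X Y p = tplus (cr ?D Y p) (cr X' Y p)" .
    moreover have "cr ?D Y p = tzero" using vanish[OF diff[OF X(1,2)] _ Y(1)] X(3) by simp
    ultimately show ?thesis by simp
  qed
  also have "\<dots> = cr X' Y' p"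
  proof -
    let ?D = "\<lambda>p. tplus (Y p) (tscale (-1) (Y' p))"
    have "Y = (\<lambda>p. tplus (?D p) (Y' p))" by (intro ext) simp
    then have "cr X' Y p = cr X' (\<lambda>p. tplus (?D p) (Y' p)) p" by (rule arg_cong[where f = "\<lambda>Y. cr X' Y p"])
    also have "\<dots> = tplus (cr X' ?D p) (cr X' Y' p)" by (simp only: cr_add(2)[OF diff[OF Y(1,2)] Y(2) X(2)])
    finally have "cr X' Y p = tplus (cr X' ?D p) (cr X' Y' p)" .
    moreover have "cr X' ?D p = tzero" using vanish[OF diff[OF Y(1,2)] _ X(2)] Y(3) by simp
    ultimately show ?thesis by simp
  qed
  finally show ?thesis .
qed

lemma mult_eq:
  assumes x: "x \<in> osections A" and y: "y \<in> osections A"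
  shows "m x y = (\<lambda>p. fst x p * fst y p - g p (snd x p) (snd y p),
      \<lambda>p. tplus (tplus (tscale (fst x p) (snd y p)) (tscale (fst y p) (snd x p))) (cr (snd x) (snd y) p))"
proof -
  have x': "fst x \<in> smooth_functions A" "snd x \<in> vector_fields A" and y': "fst y \<in> smooth_functions A" "snd y \<in> vector_fields A"
    using x y by (auto simp: osections_iff)
  have ux: "fst x \<odot>\<^bsub>C\<^esub> unit \<in> osections A" and uy: "fst y \<odot>\<^bsub>C\<^esub> unit \<in> osections A"
    using osections_ops(2)[OF _ unit_in] x' y' by blast+
  have xs: "x = fst x \<odot>\<^bsub>C\<^esub> unit \<oplus>\<^bsub>C\<^esub> im (snd x)" and ys: "y = fst y \<odot>\<^bsub>C\<^esub> unit \<oplus>\<^bsub>C\<^esub> im (snd y)"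
    by (simp_all add: im_def unit_def)
  have "m x y = m (fst x \<odot>\<^bsub>C\<^esub> unit) y \<oplus>\<^bsub>C\<^esub> m (im (snd x)) y"
    by (subst xs) (rule mult_add(2)[OF ux im_in[OF x'(2)] y])
  also have "m (fst x \<odot>\<^bsub>C\<^esub> unit) y = fst x \<odot>\<^bsub>C\<^esub> y"
    using mult_smult(2)[OF x'(1) unit_in y] mult_unit(1)[OF y] by (simp only:)
  also have "m (im (snd x)) y = m (im (snd x)) (fst y \<odot>\<^bsub>C\<^esub> unit) \<oplus>\<^bsub>C\<^esub> m (im (snd x)) (im (snd y))"
    by (rule trans[OF arg_cong[where f = "m (im (snd x))", OF ys] mult_add(1)[OF im_in[OF x'(2)] uy im_in[OF y'(2)]]])
  also have "m (im (snd x)) (fst y \<odot>\<^bsub>C\<^esub> unit) = fst y \<odot>\<^bsub>C\<^esub> im (snd x)"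
    using mult_smult(1)[OF y'(1) im_in[OF x'(2)] unit_in] mult_unit(2)[OF im_in[OF x'(2)]] by (simp only:)
  finally show ?thesis
    by (simp add: im_mult[OF x'(2) y'(2)]) (simp add: im_def add.assoc)
qed

text \<open>\<open>cr\<close> takes fields, whereas a frame lives on one fibre. Linear extensions of
  the coordinate vectors turn \<open>cr\<close> into a bilinear map on \<open>real^7\<close> that
  satisfies the axioms of \<open>cross_product\<close>; its standard basis gives the frame, and
  \<open>cr_tensorial\<close> returns from the chosen extensions to arbitrary fields.\<close>

lemma ex_adapted_frame:
  obtains u where "u \<in> frames A p" "\<And>x y. g p (u x) (u y) = x \<bullet> y"
    "\<And>X Y x y. X \<in> vector_fields A \<Longrightarrow> Y \<in> vector_fields A \<Longrightarrow> X p = u x \<Longrightarrow> Y p = u y \<Longrightarrow>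
      cr X Y p = u (cross0 x y)"
proof (rule linear_extension[OF g])
  fix E :: "'a \<Rightarrow> ('a, 7) tangent \<Rightarrow> 'a \<Rightarrow> ('a, 7) tangent"
  assume E: "\<And>p v. E p v \<in> vector_fields A" "\<And>p v. v \<in> tangent_space A p \<Longrightarrow> E p v p = v"
    "\<And>p v w. v \<in> tangent_space A p \<Longrightarrow> w \<in> tangent_space A p \<Longrightarrow>
      E p (tplus v w) = (\<lambda>q. tplus (E p v q) (E p w q))"
    "\<And>p r v. v \<in> tangent_space A p \<Longrightarrow> E p (tscale r v) = (\<lambda>q. tscale r (E p v q))"
  obtain c where c: "c \<in> charts_at A p" using ex_chart by metis
  note cv = coord_vector_tangent[OF c]
  define e where "e x = E p (coord_vector A c p x)" for x
  have e: "e x \<in> vector_fields A" "e x p = coord_vector A c p x" for x using E(1) E(2)[OF cv] by (simp_all add: e_def)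
  have e_add: "e (x + y) = (\<lambda>q. tplus (e x q) (e y q))" and e_scale: "e (r *\<^sub>R x) = (\<lambda>q. tscale r (e x q))" for x y r
    by (simp_all only: e_def coord_vector_add[OF c] coord_vector_scale[OF c] E(3)[OF cv cv] E(4)[OF cv])
  define gc where "gc x y = g p (coord_vector A c p x) (coord_vector A c p y)" for x y
  define cc where "cc x y = cr (e x) (e y) p c" for x y
  have cc_coord: "coord_vector A c p (cc x y) = cr (e x) (e y) p" for x y
    unfolding cc_def by (rule coord_vector_coord[OF c vector_field_tangent[OF cr_in[OF e(1) e(1)]]])
  interpret cross_product gc cc
  proof
    show "bilinear gc" unfolding gc_def by (rule metric_bilinear[OF g c])
    show "gc x y = gc y x" for x y unfolding gc_def by (rule metric_sym[OF g cv cv])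
    show "gc x x > 0" if "x \<noteq> 0" for x
      unfolding gc_def using that coord_vector_same[OF c, of x] by (intro metric_pos[OF g cv]) auto
    show "bilinear cc"
      unfolding bilinear_def
      by (intro conjI allI linearI) (simp_all add: cc_def e_add e_scale cr_add cr_scale e(1))
    show "cc x x = 0" for x by (simp add: cc_def cr_self[OF e(1)])
    show "gc (cc x y) y = 0" for x y
      using cr_orth[OF e(1) e(1), of p x y] by (simp add: gc_def cc_coord e(2))
    show "gc (cc x y) (cc x y) = gc x x * gc y y - (gc x y)\<^sup>2" for x y
      using cr_norm[OF e(1) e(1), of p x y] by (simp add: gc_def cc_coord e(2))
  qed
  obtain U where U: "linear U" "\<And>x y. gc (U x) (U y) = x \<bullet> y" "\<And>x y. cc (U x) (U y) = U (cross0 x y)"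
    by (rule standard_basis) (rule that, simp_all)
  have "x = 0" if "U x = 0" for x using U(2)[of x x] that by (simp add: g_simps)
  then have "(\<lambda>x. coord_vector A c p (U x)) \<in> frames A p" by (rule frame_in_chart[OF c U(1)])
  then show ?thesis
  proof (rule that)
    show "g p (coord_vector A c p (U x)) (coord_vector A c p (U y)) = x \<bullet> y" for x y using U(2) by (simp add: gc_def)
    show "cr X Y p = coord_vector A c p (U (cross0 x y))"
      if "X \<in> vector_fields A" "Y \<in> vector_fields A" "X p = coord_vector A c p (U x)" "Y p = coord_vector A c p (U y)" for X Y x y
      using cr_tensorial[of X "e (U x)" p Y "e (U y)"] that e cc_coord[of "U x" "U y"] U(3)[of x y] by simp
  qed
qed

text \<open>A form has to accept tangent vectors, so the first two arguments are extended to fields;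
  by \<open>cr_tensorial\<close> the choice of the extensions does not affect the value.\<close>

definition bundle_to_form :: "('a, 7) form3" where
  "bundle_to_form p u v w = (if u \<in> tangent_space A p \<and> v \<in> tangent_space A p \<and> w \<in> tangent_space A p
     then g p (cr (SOME X. X \<in> vector_fields A \<and> X p = u) (SOME Y. Y \<in> vector_fields A \<and> Y p = v) p) w else undefined)"

lemma bundle_to_form_fields:
  assumes X: "X \<in> vector_fields A" and Y: "Y \<in> vector_fields A" and w: "w \<in> tangent_space A p"
  shows "bundle_to_form p (X p) (Y p) w = g p (cr X Y p) w"
proof -
  let ?X = "SOME X'. X' \<in> vector_fields A \<and> X' p = X p" and ?Y = "SOME Y'. Y' \<in> vector_fields A \<and> Y' p = Y p"
  have "?X \<in> vector_fields A \<and> ?X p = X p" by (rule someI[of _ X]) (simp add: X)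
  moreover have "?Y \<in> vector_fields A \<and> ?Y p = Y p" by (rule someI[of _ Y]) (simp add: Y)
  ultimately have "cr ?X ?Y p = cr X Y p" using X Y by (intro cr_tensorial) auto
  then show ?thesis using w X Y by (simp add: bundle_to_form_def vector_field_tangent)
qed

lemma ex_G2_frame_bundle:
  obtains u where "u \<in> G2_frames A bundle_to_form p" "\<And>x y. g p (u x) (u y) = x \<bullet> y"
proof -
  obtain u where u: "u \<in> frames A p" "\<And>x y. g p (u x) (u y) = x \<bullet> y"
    "\<And>X Y x y. X \<in> vector_fields A \<Longrightarrow> Y \<in> vector_fields A \<Longrightarrow> X p = u x \<Longrightarrow> Y p = u y \<Longrightarrow>
      cr X Y p = u (cross0 x y)"
    by (rule ex_adapted_frame) (rule that, simp_all)
  have "bundle_to_form p (u x) (u y) (u z) = phi0 x y z" for x y z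
  proof -
    obtain X where X: "X \<in> vector_fields A" "X p = u x" using ex_field_through[OF g frame_tangent[OF u(1)]] by blast
    obtain Y where Y: "Y \<in> vector_fields A" "Y p = u y" using ex_field_through[OF g frame_tangent[OF u(1)]] by blast
    show ?thesis
      using bundle_to_form_fields[OF X(1) Y(1) frame_tangent[OF u(1)], of z] u(3)[OF X(1) Y(1) X(2) Y(2)] u(2)
      by (simp add: X Y phi0_cross0)
  qed
  then have "u \<in> G2_frames A bundle_to_form p" using u(1) by (simp add: G2_frames_def)
  then show ?thesis using that u(2) by blast
qed

text \<open>Multilinearity and the alternating property are read off in a frame, where the form is
  \<open>phi0\<close>. Smoothness is known first on global fields, through the metric and
  \<open>cr\<close>, and passes to components by \<open>form_components_smooth\<close>.\<close>

lemma bundle_to_form_definite: "bundle_to_form \<in> definite_forms A"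
proof -
  have f: "(tangent_functional A p (\<lambda>u. bundle_to_form p u v w) \<and> tangent_functional A p (\<lambda>u. bundle_to_form p v u w) \<and>
      tangent_functional A p (bundle_to_form p v w)) \<and>
      bundle_to_form p v v w = 0 \<and> bundle_to_form p v w v = 0 \<and> bundle_to_form p w v v = 0"
    if v: "v \<in> tangent_space A p" and w: "w \<in> tangent_space A p" for p v w
  proof -
    obtain u where u: "u \<in> G2_frames A bundle_to_form p" using ex_G2_frame_bundle by blast
    note uf = G2_frameD(1)[OF u]
    obtain x where x: "v = u x" using frame_surj[OF uf v] by blast
    obtain y where y: "w = u y" using frame_surj[OF uf w] by blast
    have tf: "tangent_functional A p h" if "linear l" "\<And>z. h (u z) = l z" for h :: "('a, 7) tangent \<Rightarrow> real" and l
      unfolding tangent_functional_def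
    proof (intro conjI ballI allI)
      fix a b assume "a \<in> tangent_space A p" "b \<in> tangent_space A p"
      then obtain a' b' where "a = u a'" "b = u b'" using frame_surj[OF uf] by meson
      then show "h (tplus a b) = h a + h b" by (simp add: frame_add[OF uf, symmetric] that linear_add)
    next
      fix r a assume "a \<in> tangent_space A p"
      then obtain a' where "a = u a'" using frame_surj[OF uf] by meson
      then show "h (tscale r a) = r * h a" by (simp add: frame_scale[OF uf, symmetric] that linear_scale)
    qed
    have lin: "linear (\<lambda>z. phi0 z x y)" "linear (\<lambda>z. phi0 x z y)" "linear (\<lambda>z. phi0 x y z)" for x y
      by (intro linearI; simp add: phi0_expand algebra_simps)+
    have "phi0 x x y = 0" "phi0 x y x = 0" "phi0 y x x = 0" for x y
      by (simp_all add: phi0_expand algebra_simps)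
    then show ?thesis
      unfolding x y G2_frameD(2)[OF u]
      using tf[OF lin(1)[of x y], of "\<lambda>t. bundle_to_form p t (u x) (u y)"]
        tf[OF lin(2)[of x y], of "\<lambda>t. bundle_to_form p (u x) t (u y)"] tf[OF lin(3)[of x y], of "bundle_to_form p (u x) (u y)"]
      by (simp add: G2_frameD(2)[OF u])
  qed
  have s: "(\<lambda>p. bundle_to_form p (X p) (Y p) (Z p)) \<in> smooth_functions A"
    if "X \<in> vector_fields A" "Y \<in> vector_fields A" "Z \<in> vector_fields A" for X Y Z
    using metric_smooth[OF g cr_in[OF that(1,2)] that(3)] bundle_to_form_fields[OF that(1,2) vector_field_tangent[OF that(3)]]
    by simp
  have "smooth_form3 A bundle_to_form"
    unfolding smooth_form3_def
  proof (intro conjI allI ballI impI)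
    show "bundle_to_form p u v w = undefined"
      if "\<not> (u \<in> tangent_space A p \<and> v \<in> tangent_space A p \<and> w \<in> tangent_space A p)" for p u v w
      unfolding bundle_to_form_def using that by (rule if_not_P)
    fix c i j k assume c: "c \<in> A"
    show "smooth_on (chart_img c) (\<lambda>y. bundle_to_form (chart_inv c y) (coord_vector A c (chart_inv c y) (axis i 1))
        (coord_vector A c (chart_inv c y) (axis j 1)) (coord_vector A c (chart_inv c y) (axis k 1)))"
      by (rule form_components_smooth[OF _ s c]) (use f in blast)
  qed (use f in \<open>simp_all add: eta_contract_eq\<close>)
  then show ?thesis
    unfolding definite_forms_def using ex_G2_frame_bundle by blast
qed

text \<open>By \<open>mult_eq\<close> the product is fixed by the metric and \<open>cr\<close>. The
  form returns both: the metric through the adapted frames, and \<open>cr\<close> as the field dual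
  to the form.\<close>

theorem G2_algebra_bundle_to_form: "G2_algebra A bundle_to_form = bundle_algebra A m g"
proof -
  have gm: "assoc_metric A bundle_to_form = g"
    by (rule assoc_metric_eqI[OF bundle_to_form_definite g]) (use ex_G2_frame_bundle in metis)
  have cr: "cross_field A bundle_to_form X Y = cr X Y" if "X \<in> vector_fields A" "Y \<in> vector_fields A" for X Y
    by (rule cross_field_eqI[OF bundle_to_form_definite cr_in[OF that]])
      (simp add: gm bundle_to_form_fields[OF that vector_field_tangent])
  have "G2_mult A bundle_to_form = m"
  proof (rule extensionalityI)
    show "G2_mult A bundle_to_form \<in> extensional (osections A)" by (simp add: G2_mult_def)
    show "m \<in> extensional (osections A)" using bilinear_mapsD(6)[OF mult_bilinear] by simp
    fix x assume x: "x \<in> osections A"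
    show "G2_mult A bundle_to_form x = m x"
    proof (rule extensionalityI)
      show "G2_mult A bundle_to_form x \<in> extensional (osections A)" using x by (simp add: G2_mult_def)
      show "m x \<in> extensional (osections A)" using bilinear_mapsD(7)[OF mult_bilinear, of x] x by simp
      fix y assume y: "y \<in> osections A"
      show "G2_mult A bundle_to_form x y = m x y"
        using x y by (simp add: G2_mult_apply[OF bundle_to_form_definite x y] mult_eq[OF x y] gm cr osections_iff)
    qed
  qed
  then show ?thesis by (simp add: G2_algebra_def gm)
qed

end

section \<open>Categories of algebras and of definite forms\<close>

text \<open>Hom-sets may overlap, so the arrow map is inverted on each Hom-set separately.
  Functoriality of the inverse then follows from injectivity there, since both sides of each law
  have the same image under the functor.\<close>

lemma isomorphism_of_categoriesI:
  assumes F: "is_functor C D Fo Fm" and o: "bij_betw Fo (Obj C) (Obj D)"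
    and h: "\<And>a b. a \<in> Obj C \<Longrightarrow> b \<in> Obj C \<Longrightarrow> bij_betw (Fm a b) (Hom C a b) (Hom D (Fo a) (Fo b))"
  shows "isomorphism_of_categories C D Fo Fm"
proof -
  define Go where "Go = inv_into (Obj C) Fo"
  define Gm where "Gm x y = inv_into (Hom C (Go x) (Go y)) (Fm (Go x) (Go y))" for x y
  have GF: "Go (Fo a) = a" if "a \<in> Obj C" for a
    unfolding Go_def using o that by (simp add: bij_betw_def)
  have FG: "Fo (Go x) = x" and Gx: "Go x \<in> Obj C" if "x \<in> Obj D" for x
    unfolding Go_def using o that by (auto simp: bij_betw_def f_inv_into_f inv_into_into)
  have Gm1: "Gm x y k \<in> Hom C (Go x) (Go y)" "Fm (Go x) (Go y) (Gm x y k) = k"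
    if "x \<in> Obj D" "y \<in> Obj D" "k \<in> Hom D x y" for x y k
    unfolding Gm_def using h[OF Gx[OF that(1)] Gx[OF that(2)]] that
    by (auto simp: FG bij_betw_def f_inv_into_f inv_into_into)
  have Gm2: "Gm x y k = f" if "x \<in> Obj D" "y \<in> Obj D" "f \<in> Hom C (Go x) (Go y)" "k = Fm (Go x) (Go y) f" for x y k f
    unfolding Gm_def using h[OF Gx[OF that(1)] Gx[OF that(2)]] that(3,4) by (simp add: bij_betw_def)
  have C: "is_category C" and D: "is_category D" using F by (auto simp: is_functor_def)
  have Cide: "Ide C a \<in> Hom C a a" if "a \<in> Obj C" for a using C that by (simp add: is_category_def)
  have Ccmp: "Cmp C a b c g f \<in> Hom C a c"
    if "a \<in> Obj C" "b \<in> Obj C" "c \<in> Obj C" "f \<in> Hom C a b" "g \<in> Hom C b c" for a b c f g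
    using C that unfolding is_category_def by blast
  have Fide: "Fm a a (Ide C a) = Ide D (Fo a)" if "a \<in> Obj C" for a
    using F that unfolding is_functor_def by blast
  have Fcmp: "Fm a c (Cmp C a b c g f) = Cmp D (Fo a) (Fo b) (Fo c) (Fm b c g) (Fm a b f)"
    if "a \<in> Obj C" "b \<in> Obj C" "c \<in> Obj C" "f \<in> Hom C a b" "g \<in> Hom C b c" for a b c f g
    using F that unfolding is_functor_def by blast
  have G: "is_functor D C Go Gm"
    unfolding is_functor_def
  proof (intro conjI ballI C D)
    show "Go a \<in> Obj C" if "a \<in> Obj D" for a by (rule Gx[OF that])
    show "Gm a b f \<in> Hom C (Go a) (Go b)" if "a \<in> Obj D" "b \<in> Obj D" "f \<in> Hom D a b" for a b f
      by (rule Gm1(1)[OF that])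
    show "Gm a a (Ide D a) = Ide C (Go a)" if "a \<in> Obj D" for a
      by (rule Gm2[OF that that Cide[OF Gx[OF that]]]) (simp add: Fide Gx FG that)
    show "Gm a c (Cmp D a b c g f) = Cmp C (Go a) (Go b) (Go c) (Gm b c g) (Gm a b f)"
      if a: "a \<in> Obj D" and b: "b \<in> Obj D" and c: "c \<in> Obj D" and f: "f \<in> Hom D a b" and g: "g \<in> Hom D b c" for a b c f g
    proof (rule Gm2[OF a c Ccmp[OF Gx[OF a] Gx[OF b] Gx[OF c] Gm1(1)[OF a b f] Gm1(1)[OF b c g]]])
      show "Cmp D a b c g f = Fm (Go a) (Go c) (Cmp C (Go a) (Go b) (Go c) (Gm b c g) (Gm a b f))"
        unfolding Fcmp[OF Gx[OF a] Gx[OF b] Gx[OF c] Gm1(1)[OF a b f] Gm1(1)[OF b c g]]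
        by (simp only: FG a b c Gm1(2)[OF a b f] Gm1(2)[OF b c g])
    qed
  qed
  have Fo: "Fo a \<in> Obj D" if "a \<in> Obj C" for a using F that by (simp add: is_functor_def)
  have GmF: "Gm (Fo a) (Fo b) (Fm a b f) = f" if "a \<in> Obj C" "b \<in> Obj C" "f \<in> Hom C a b" for a b f
    by (rule Gm2[OF Fo Fo]) (use that in \<open>simp_all add: GF\<close>)
  show ?thesis
    unfolding isomorphism_of_categories_def
    using F G GF FG GmF Gm1(2) by blast
qed

lemma full_subcategory_is_category: "is_category C \<Longrightarrow> is_category (full_subcategory C S)"
  unfolding is_category_def full_subcategory_def by simp

section \<open>Morphisms of octonion algebras\<close>

lemma linear_isosI:
  assumes "\<And>x. x \<in> carrier M \<Longrightarrow> f x \<in> carrier N" "f \<in> extensional (carrier M)"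
    "\<And>x y. x \<in> carrier M \<Longrightarrow> y \<in> carrier M \<Longrightarrow> f (x \<oplus>\<^bsub>M\<^esub> y) = f x \<oplus>\<^bsub>N\<^esub> f y"
    "\<And>r x. r \<in> carrier R \<Longrightarrow> x \<in> carrier M \<Longrightarrow> f (r \<odot>\<^bsub>M\<^esub> x) = r \<odot>\<^bsub>N\<^esub> f x"
    "inj_on f (carrier M)" "\<And>y. y \<in> carrier N \<Longrightarrow> \<exists>x\<in>carrier M. f x = y"
  shows "f \<in> linear_isos R M N"
  using assms by (force simp: linear_isos_def linear_maps_def PiE_def bij_betw_def)

lemma linear_isosD:
  assumes "f \<in> linear_isos R M N"
  shows "x \<in> carrier M \<Longrightarrow> f x \<in> carrier N" "f \<in> extensional (carrier M)"
    "x \<in> carrier M \<Longrightarrow> y \<in> carrier M \<Longrightarrow> f (x \<oplus>\<^bsub>M\<^esub> y) = f x \<oplus>\<^bsub>N\<^esub> f y"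
    "r \<in> carrier R \<Longrightarrow> x \<in> carrier M \<Longrightarrow> f (r \<odot>\<^bsub>M\<^esub> x) = r \<odot>\<^bsub>N\<^esub> f x"
    "inj_on f (carrier M)" "z \<in> carrier N \<Longrightarrow> \<exists>x\<in>carrier M. f x = z"
    "f \<in> carrier M \<rightarrow> carrier N"
proof -
  show "\<exists>x\<in>carrier M. f x = z" if "z \<in> carrier N"
  proof -
    have "z \<in> f ` carrier M" using assms that by (simp add: linear_isos_def bij_betw_def)
    then show ?thesis by auto
  qed
qed (use assms in \<open>auto simp: linear_isos_def linear_maps_def PiE_def bij_betw_def\<close>)

lemma linear_isos_compose:
  assumes f: "f \<in> linear_isos R M N" and g: "g \<in> linear_isos R N P"
    and cl: "\<And>x y. x \<in> carrier M \<Longrightarrow> y \<in> carrier M \<Longrightarrow> x \<oplus>\<^bsub>M\<^esub> y \<in> carrier M"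
      "\<And>r x. r \<in> carrier R \<Longrightarrow> x \<in> carrier M \<Longrightarrow> r \<odot>\<^bsub>M\<^esub> x \<in> carrier M"
  shows "compose (carrier M) g f \<in> linear_isos R M P"
proof (rule linear_isosI)
  show "inj_on (compose (carrier M) g f) (carrier M)"
    by (rule inj_onI) (metis compose_eq linear_isosD(1,5)[OF f] linear_isosD(5)[OF g] inj_onD)
  show "\<exists>x\<in>carrier M. compose (carrier M) g f x = y" if y: "y \<in> carrier P" for y
  proof -
    obtain z where z: "z \<in> carrier N" "g z = y" using linear_isosD(6)[OF g y] by blast
    obtain x where "x \<in> carrier M" "f x = z" using linear_isosD(6)[OF f z(1)] by blast
    then show ?thesis using z(2) by (intro bexI[of _ x]) (simp_all add: compose_eq)
  qed
qed (use linear_isosD[OF f] linear_isosD[OF g] cl in \<open>simp_all add: compose_eq\<close>)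

lemma linear_isos_id:
  assumes "\<And>x y. x \<in> carrier M \<Longrightarrow> y \<in> carrier M \<Longrightarrow> x \<oplus>\<^bsub>M\<^esub> y \<in> carrier M"
    "\<And>r x. r \<in> carrier R \<Longrightarrow> x \<in> carrier M \<Longrightarrow> r \<odot>\<^bsub>M\<^esub> x \<in> carrier M"
  shows "(\<lambda>x\<in>carrier M. x) \<in> linear_isos R M M"
  by (rule linear_isosI) (use assms in \<open>auto simp: inj_on_def\<close>)

text \<open>For a bijection, substituting \<open>f x\<close> for \<open>x\<close> trades the inverse
  in the definition for preservation equations. These compose directly, which is the form that the
  category axioms use.\<close>

lemma octonion_morphisms_iff:
  assumes C: "octonion_algebra R C"
  shows "f \<in> octonion_morphisms R C C' \<longleftrightarrow> f \<in> linear_isos R C C' \<and>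
    (\<forall>x\<in>carrier C. \<forall>y\<in>carrier C. f (x \<otimes>\<^bsub>C\<^esub> y) = f x \<otimes>\<^bsub>C'\<^esub> f y) \<and> f \<one>\<^bsub>C\<^esub> = \<one>\<^bsub>C'\<^esub> \<and>
    (\<forall>x\<in>carrier C. \<forall>y\<in>carrier C. bform C' (f x) (f y) = bform C x y)"
proof (cases "f \<in> linear_isos R C C'")
  case True
  then have b: "bij_betw f (carrier C) (carrier C')" by (simp add: linear_isos_def)
  let ?i = "inv_into (carrier C) f"
  have i: "?i x \<in> carrier C" "f (?i x) = x" if "x \<in> carrier C'" for x
    using b that by (auto simp: bij_betw_def f_inv_into_f inv_into_into)
  have fi: "?i (f x) = x" "f x \<in> carrier C'" if "x \<in> carrier C" for x
    using b that by (auto simp: bij_betw_def)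
  have eq: "(\<forall>x\<in>carrier C'. \<forall>y\<in>carrier C'. P x y (?i x) (?i y)) \<longleftrightarrow>
      (\<forall>x\<in>carrier C. \<forall>y\<in>carrier C. P (f x) (f y) x y)" for P
  proof (intro iffI ballI)
    fix x y assume "\<forall>x\<in>carrier C'. \<forall>y\<in>carrier C'. P x y (?i x) (?i y)" "x \<in> carrier C" "y \<in> carrier C"
    then show "P (f x) (f y) x y" using fi[of x] fi[of y] by metis
  next
    fix x y assume "\<forall>x\<in>carrier C. \<forall>y\<in>carrier C. P (f x) (f y) x y" "x \<in> carrier C'" "y \<in> carrier C'"
    then show "P x y (?i x) (?i y)" using i[of x] i[of y] by metis
  qed
  show ?thesis
    using True eq[of "\<lambda>x y x' y'. x \<otimes>\<^bsub>C'\<^esub> y = f (x' \<otimes>\<^bsub>C\<^esub> y')"] eq[of "\<lambda>x y x' y'. bform C' x y = bform C x' y'"]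
    unfolding octonion_morphisms_def by (auto simp: eq_commute[of "f (_ \<otimes>\<^bsub>C\<^esub> _)"] eq_commute[of "f \<one>\<^bsub>C\<^esub>"])
next
  case False
  then show ?thesis by (simp add: octonion_morphisms_def)
qed

lemma octonion_algebra_closed:
  assumes "octonion_algebra R C"
  shows "x \<in> carrier C \<Longrightarrow> y \<in> carrier C \<Longrightarrow> x \<oplus>\<^bsub>C\<^esub> y \<in> carrier C"
    "r \<in> carrier R \<Longrightarrow> x \<in> carrier C \<Longrightarrow> r \<odot>\<^bsub>C\<^esub> x \<in> carrier C"
    "x \<in> carrier C \<Longrightarrow> y \<in> carrier C \<Longrightarrow> x \<otimes>\<^bsub>C\<^esub> y \<in> carrier C" "\<one>\<^bsub>C\<^esub> \<in> carrier C"
proof -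
  have "Module.module R C" using assms by (simp add: octonion_algebra_def)
  then interpret Module.module R C .
  show "x \<in> carrier C \<Longrightarrow> y \<in> carrier C \<Longrightarrow> x \<oplus>\<^bsub>C\<^esub> y \<in> carrier C"
    "r \<in> carrier R \<Longrightarrow> x \<in> carrier C \<Longrightarrow> r \<odot>\<^bsub>C\<^esub> x \<in> carrier C" by simp_all
  show "x \<in> carrier C \<Longrightarrow> y \<in> carrier C \<Longrightarrow> x \<otimes>\<^bsub>C\<^esub> y \<in> carrier C" "\<one>\<^bsub>C\<^esub> \<in> carrier C"
    using assms bilinear_mapsD(1)[of "mult C" R C C] by (simp_all add: octonion_algebra_def)
qed

lemma octonion_category: "is_category (octonion_category R)"
proof -
  have id: "(\<lambda>x\<in>carrier C. x) \<in> octonion_morphisms R C C" if "octonion_algebra R C" for C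
    unfolding octonion_morphisms_iff[OF that]
    using octonion_algebra_closed[OF that] by (auto intro!: linear_isos_id)
  have comp: "compose (carrier C) g f \<in> octonion_morphisms R C E"
    if C: "octonion_algebra R C" and D: "octonion_algebra R D"
      and f: "f \<in> octonion_morphisms R C D" and g: "g \<in> octonion_morphisms R D E" for C D E f g
  proof -
    note cl = octonion_algebra_closed[OF C]
    have f': "f \<in> linear_isos R C D" and g': "g \<in> linear_isos R D E"
      using f g by (auto simp: octonion_morphisms_def)
    have "compose (carrier C) g f \<in> linear_isos R C E"
      by (rule linear_isos_compose[OF f' g' cl(1,2)])
    then show ?thesis
      using f g linear_isosD(1)[OF f'] cl
      unfolding octonion_morphisms_iff[OF C] octonion_morphisms_iff[OF D]
      by (simp add: compose_eq)
  qed
  have ext: "f \<in> carrier C \<rightarrow> carrier D" "f \<in> extensional (carrier C)" if "f \<in> octonion_morphisms R C D" for C D f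
    using that linear_isosD[of f R C D] by (auto simp: octonion_morphisms_def)
  show ?thesis
    unfolding is_category_def octonion_category_def
    by (auto simp: id comp compose_Id[OF ext] Id_compose[OF ext] compose_assoc[OF ext(1)])
qed

context manifold
begin

lemma vector_field_module_simps [simp]:
  "carrier (vector_field_module A) = vector_fields A"
  "X \<oplus>\<^bsub>vector_field_module A\<^esub> Y = (\<lambda>p. tplus (X p) (Y p))"
  "f \<odot>\<^bsub>vector_field_module A\<^esub> X = (\<lambda>p. tscale (f p) (X p))"
  by (simp_all add: vector_field_module_def)

end

section \<open>The two categories and the comparison functor\<close>

context manifold7
begin

lemma G2str_morphisms_iff:
  "f \<in> G2str_morphisms A \<phi> \<phi>' \<longleftrightarrow> f \<in> linear_isos (smooth_ring A) (vector_field_module A) (vector_field_module A) \<and>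
    (\<forall>X\<in>vector_fields A. \<forall>Y\<in>vector_fields A. \<forall>Z\<in>vector_fields A.
      (\<lambda>p. \<phi>' p (f X p) (f Y p) (f Z p)) = (\<lambda>p. \<phi> p (X p) (Y p) (Z p)))"
proof (cases "f \<in> linear_isos (smooth_ring A) (vector_field_module A) (vector_field_module A)")
  case True
  then have b: "bij_betw f (vector_fields A) (vector_fields A)" by (simp add: linear_isos_def)
  let ?i = "inv_into (vector_fields A) f"
  have i: "?i x \<in> vector_fields A" "f (?i x) = x" if "x \<in> vector_fields A" for x
    using b that by (auto simp: bij_betw_def f_inv_into_f inv_into_into)
  have fi: "?i (f x) = x" "f x \<in> vector_fields A" if "x \<in> vector_fields A" for x
    using b that by (auto simp: bij_betw_def)
  have "(\<forall>X\<in>vector_fields A. \<forall>Y\<in>vector_fields A. \<forall>Z\<in>vector_fields A.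
          (\<lambda>p. \<phi>' p (X p) (Y p) (Z p)) = (\<lambda>p. \<phi> p (?i X p) (?i Y p) (?i Z p))) \<longleftrightarrow>
    (\<forall>X\<in>vector_fields A. \<forall>Y\<in>vector_fields A. \<forall>Z\<in>vector_fields A.
      (\<lambda>p. \<phi>' p (f X p) (f Y p) (f Z p)) = (\<lambda>p. \<phi> p (X p) (Y p) (Z p)))" (is "?L \<longleftrightarrow> ?R")
  proof
    assume L: ?L
    show ?R
    proof (intro ballI)
      fix X Y Z assume "X \<in> vector_fields A" "Y \<in> vector_fields A" "Z \<in> vector_fields A"
      then show "(\<lambda>p. \<phi>' p (f X p) (f Y p) (f Z p)) = (\<lambda>p. \<phi> p (X p) (Y p) (Z p))"
        using L[rule_format, of "f X" "f Y" "f Z"] by (simp add: fi)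
    qed
  next
    assume R: ?R
    show ?L
    proof (intro ballI)
      fix X Y Z assume "X \<in> vector_fields A" "Y \<in> vector_fields A" "Z \<in> vector_fields A"
      then show "(\<lambda>p. \<phi>' p (X p) (Y p) (Z p)) = (\<lambda>p. \<phi> p (?i X p) (?i Y p) (?i Z p))"
        using R[rule_format, of "?i X" "?i Y" "?i Z"] by (simp add: i)
    qed
  qed
  then show ?thesis using True unfolding G2str_morphisms_def by simp
next
  case False
  then show ?thesis by (simp add: G2str_morphisms_def)
qed

lemma G2str_category: "is_category (G2str A)"
proof -
  let ?V = "vector_field_module A" and ?R = "smooth_ring A"
  have cl: "\<And>x y. x \<in> carrier ?V \<Longrightarrow> y \<in> carrier ?V \<Longrightarrow> x \<oplus>\<^bsub>?V\<^esub> y \<in> carrier ?V"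
    "\<And>r x. r \<in> carrier ?R \<Longrightarrow> x \<in> carrier ?V \<Longrightarrow> r \<odot>\<^bsub>?V\<^esub> x \<in> carrier ?V"
    by (simp_all add: vector_fields_add vector_fields_scale)
  have id: "(\<lambda>X\<in>vector_fields A. X) \<in> G2str_morphisms A \<phi> \<phi>" for \<phi>
    unfolding G2str_morphisms_iff using linear_isos_id[where M = ?V and R = ?R, OF cl] by simp
  have comp: "compose (vector_fields A) g f \<in> G2str_morphisms A \<phi> \<phi>''"
    if f: "f \<in> G2str_morphisms A \<phi> \<phi>'" and g: "g \<in> G2str_morphisms A \<phi>' \<phi>''" for \<phi> \<phi>' \<phi>'' f g
  proof -
    have f': "f \<in> linear_isos ?R ?V ?V" and g': "g \<in> linear_isos ?R ?V ?V"
      using f g by (auto simp: G2str_morphisms_def)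
    have "compose (vector_fields A) g f \<in> linear_isos ?R ?V ?V"
      using linear_isos_compose[OF f' g' cl] by simp
    moreover have "f X \<in> vector_fields A" if "X \<in> vector_fields A" for X
      using linear_isosD(1)[OF f', of X] that by simp
    ultimately show ?thesis
      using f g unfolding G2str_morphisms_iff by (simp add: compose_eq)
  qed
  have ext: "f \<in> vector_fields A \<rightarrow> vector_fields A" "f \<in> extensional (vector_fields A)"
    if "f \<in> G2str_morphisms A \<phi> \<phi>'" for \<phi> \<phi>' f
    using that linear_isosD(2,7)[of f ?R ?V ?V] by (auto simp: G2str_morphisms_def)
  show ?thesis
    unfolding is_category_def G2str_def
    by (auto simp: id comp compose_Id[OF ext] Id_compose[OF ext] compose_assoc[OF ext(1)])
qed

lemma octbun_category: "is_category (octbun A)"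
  unfolding octbun_def by (rule full_subcategory_is_category[OF octonion_category])

lemma octbun_simps:
  "Obj (octbun A) = {C. octonion_algebra (smooth_ring A) C} \<inter>
     {bundle_algebra A m g | m g. riemannian_metric A g \<and> (\<forall>p. non_split_at A m p)}"
  "Hom (octbun A) = octonion_morphisms (smooth_ring A)"
  "Ide (octbun A) C = (\<lambda>x\<in>carrier C. x)" "Cmp (octbun A) C D E h f = compose (carrier C) h f"
  by (simp_all add: octbun_def full_subcategory_def octonion_category_def)

lemma G2str_simps:
  "Obj (G2str A) = definite_forms A" "Hom (G2str A) = G2str_morphisms A"
  "Ide (G2str A) \<phi> = (\<lambda>X\<in>vector_fields A. X)" "Cmp (G2str A) \<phi> \<phi>' \<phi>'' h f = compose (vector_fields A) h f"
  by (simp_all add: G2str_def)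

lemma G2_algebra_simps [simp]:
  "carrier (G2_algebra A \<phi>) = osections A" "mult (G2_algebra A \<phi>) = G2_mult A \<phi>"
  "one (G2_algebra A \<phi>) = (\<lambda>p. 1, \<lambda>p. tzero)" "bform (G2_algebra A \<phi>) = bundle_form A (assoc_metric A \<phi>)"
  "add (G2_algebra A \<phi>) x y = (\<lambda>p. fst x p + fst y p, \<lambda>p. tplus (snd x p) (snd y p))"
  "smult (G2_algebra A \<phi>) f x = (\<lambda>p. f p * fst x p, \<lambda>p. tscale (f p) (snd x p))"
  by (simp_all add: G2_algebra_def)

lemma G2_algebra_in_octbun: "\<phi> \<in> definite_forms A \<Longrightarrow> G2_algebra A \<phi> \<in> Obj (octbun A)"
  using G2_octonion_algebra[of \<phi>] G2_non_split[of \<phi>] assoc_metric_riemannian[of \<phi>]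
  unfolding octbun_simps G2_algebra_def by blast

lemma G2_algebra_surj:
  assumes "C \<in> Obj (octbun A)"
  shows "\<exists>\<phi>\<in>definite_forms A. G2_algebra A \<phi> = C"
proof -
  obtain m g where mg: "C = bundle_algebra A m g" "riemannian_metric A g" "octonion_algebra (smooth_ring A) C"
    using assms by (auto simp: octbun_simps)
  interpret octonion_bundle A m g
    by unfold_locales (use mg in simp_all)
  show ?thesis using bundle_to_form_definite G2_algebra_bundle_to_form mg(1) by blast
qed

lemma im_osection: "X \<in> vector_fields A \<Longrightarrow> (\<lambda>p. 0, X) \<in> osections A"
  by (simp add: osections_iff smooth_functions_const)

lemma unit_osection: "(\<lambda>p. 1, \<lambda>p. tzero) \<in> osections A"
  by (simp add: osections_iff smooth_functions_const vector_fields_zero)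

text \<open>Pairing with an imaginary section ignores the real part of the product, so the algebra
  alone returns the form, with the factor 2 of \<open>bundle_form\<close>. Injectivity on objects
  and surjectivity on Hom-sets rest on this.\<close>

lemma form_from_algebra:
  assumes \<phi>: "\<phi> \<in> definite_forms A" and X: "X \<in> vector_fields A" and Y: "Y \<in> vector_fields A" and Z: "Z \<in> vector_fields A"
  shows "bundle_form A (assoc_metric A \<phi>) (G2_mult A \<phi> (\<lambda>p. 0, X) (\<lambda>p. 0, Y)) (\<lambda>p. 0, Z) = (\<lambda>p. 2 * \<phi> p (X p) (Y p) (Z p))"
  using G2_mult_in[OF \<phi> im_osection[OF X] im_osection[OF Y]]
  by (simp add: bundle_form_apply[OF assoc_metric_riemannian[OF \<phi>]] im_osection X Y Z G2_mult_apply[OF \<phi>] cross_field_metric[OF \<phi> X Y vector_field_tangent[OF Z]])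

text \<open>Global fields pass through any three tangent vectors at a point, so the values on fields
  supplied by \<open>form_from_algebra\<close> determine the form.\<close>

lemma G2_algebra_inj: "inj_on (G2_algebra A) (definite_forms A)"
proof (rule inj_onI)
  fix \<phi> \<phi>' assume \<phi>: "\<phi> \<in> definite_forms A" and \<phi>': "\<phi>' \<in> definite_forms A" and eq: "G2_algebra A \<phi> = G2_algebra A \<phi>'"
  have b: "bundle_form A (assoc_metric A \<phi>) = bundle_form A (assoc_metric A \<phi>')" and m: "G2_mult A \<phi> = G2_mult A \<phi>'"
    using arg_cong[OF eq, of bform] arg_cong[OF eq, of mult] by simp_all
  show "\<phi> = \<phi>'"
  proof (intro ext)
    fix p u v w
    show "\<phi> p u v w = \<phi>' p u v w"
    proof (cases "u \<in> tangent_space A p \<and> v \<in> tangent_space A p \<and> w \<in> tangent_space A p")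
      case True
      obtain X where X: "X \<in> vector_fields A" "X p = u" using ex_field_through[OF assoc_metric_riemannian[OF \<phi>]] True by blast
      obtain Y where Y: "Y \<in> vector_fields A" "Y p = v" using ex_field_through[OF assoc_metric_riemannian[OF \<phi>]] True by blast
      obtain Z where Z: "Z \<in> vector_fields A" "Z p = w" using ex_field_through[OF assoc_metric_riemannian[OF \<phi>]] True by blast
      have "(\<lambda>p. 2 * \<phi> p (X p) (Y p) (Z p)) = (\<lambda>p. 2 * \<phi>' p (X p) (Y p) (Z p))"
        using form_from_algebra[OF \<phi> X(1) Y(1) Z(1)] form_from_algebra[OF \<phi>' X(1) Y(1) Z(1)] by (simp only: b m)
      from fun_cong[OF this, of p] show ?thesis using X Y Z by simp
    next
      case False
      have und: "\<psi> p u v w = undefined" if "\<psi> \<in> definite_forms A" for \<psi>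
        using definite_smooth[OF that] False unfolding smooth_form3_def by blast
      show ?thesis using und[OF \<phi>] und[OF \<phi>'] by simp
    qed
  qed
qed

text \<open>Each coordinate of \<open>a\<close> is a single value of \<open>phi0 a\<close>; the
  pairs of basis vectors are read off from the terms e123, e145 and e167.\<close>

lemma phi0_nondegenerate:
  assumes "\<And>y z. phi0 a y z = phi0 x y z"
  shows "a = x"
  using assms[of "axis 2 1" "axis 3 1"] assms[of "axis 3 1" "axis 1 1"] assms[of "axis 1 1" "axis 2 1"]
    assms[of "axis 5 1" "axis 1 1"] assms[of "axis 1 1" "axis 4 1"] assms[of "axis 7 1" "axis 1 1"]
    assms[of "axis 1 1" "axis 6 1"]
  by (simp add: phi0_expand axis_def vec_eq_iff forall_7)

text \<open>A morphism of definite forms acts fibrewise because the form is nondegenerate, and it therefore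
  carries \<open>G\<^sub>2\<close>-frames to \<open>G\<^sub>2\<close>-frames.\<close>

lemma G2_morphism_frame:
  assumes \<phi>: "\<phi> \<in> definite_forms A" and \<phi>': "\<phi>' \<in> definite_forms A" and f: "f \<in> G2str_morphisms A \<phi> \<phi>'"
    and u: "u \<in> G2_frames A \<phi> p"
  shows "\<exists>u'\<in>G2_frames A \<phi>' p. \<forall>X\<in>vector_fields A. \<forall>x. X p = u x \<longrightarrow> f X p = u' x"
proof (rule linear_extension[OF assoc_metric_riemannian[OF \<phi>]])
  fix E :: "'a \<Rightarrow> ('a, 7) tangent \<Rightarrow> 'a \<Rightarrow> ('a, 7) tangent"
  assume E: "\<And>p v. E p v \<in> vector_fields A" "\<And>p v. v \<in> tangent_space A p \<Longrightarrow> E p v p = v"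
    "\<And>p v w. v \<in> tangent_space A p \<Longrightarrow> w \<in> tangent_space A p \<Longrightarrow>
      E p (tplus v w) = (\<lambda>q. tplus (E p v q) (E p w q))"
    "\<And>p r v. v \<in> tangent_space A p \<Longrightarrow> E p (tscale r v) = (\<lambda>q. tscale r (E p v q))"
  note uf = G2_frameD(1)[OF u]
  have lin: "f \<in> linear_isos (smooth_ring A) (vector_field_module A) (vector_field_module A)"
    using f by (simp add: G2str_morphisms_def)
  have fin: "f X \<in> vector_fields A" if "X \<in> vector_fields A" for X using linear_isosD(1)[OF lin] that by simp
  have fadd: "f (\<lambda>q. tplus (X q) (Y q)) = (\<lambda>q. tplus (f X q) (f Y q))"
    if "X \<in> vector_fields A" "Y \<in> vector_fields A" for X Y
    using linear_isosD(3)[OF lin, of X Y] that by simp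
  have fscale: "f (\<lambda>q. tscale r (X q)) = (\<lambda>q. tscale r (f X q))" if "X \<in> vector_fields A" for X r
    using linear_isosD(4)[OF lin, of "\<lambda>q. r" X] that by (simp add: smooth_functions_const)
  have form: "\<phi>' p (f X p) (f Y p) (f Z p) = \<phi> p (X p) (Y p) (Z p)"
    if "X \<in> vector_fields A" "Y \<in> vector_fields A" "Z \<in> vector_fields A" for X Y Z
  proof -
    have "(\<lambda>p. \<phi>' p (f X p) (f Y p) (f Z p)) = (\<lambda>p. \<phi> p (X p) (Y p) (Z p))"
      using f that unfolding G2str_morphisms_iff by blast
    then show ?thesis by (rule fun_cong)
  qed
  define e where "e x = E p (u x)" for x
  have e: "e x \<in> vector_fields A" "e x p = u x" for x using E(1) E(2)[OF frame_tangent[OF uf]] by (simp_all add: e_def)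
  have e_add: "e (x + y) = (\<lambda>q. tplus (e x q) (e y q))" and e_scale: "e (r *\<^sub>R x) = (\<lambda>q. tscale r (e x q))" for x y r
    by (simp_all only: e_def frame_add[OF uf] frame_scale[OF uf] E(3)[OF frame_tangent[OF uf] frame_tangent[OF uf]]
        E(4)[OF frame_tangent[OF uf]])
  define u' where "u' x = f (e x) p" for x
  have u'T: "u' x \<in> tangent_space A p" for x unfolding u'_def by (rule vector_field_tangent[OF fin[OF e(1)]])
  have u'form: "\<phi>' p (u' x) (u' y) (u' z) = phi0 x y z" for x y z
    unfolding u'_def form[OF e(1) e(1) e(1)] e(2) by (rule G2_frameD(2)[OF u])
  have u'f: "u' \<in> frames A p"
  proof (rule linear_injective_frame[OF u'T])
    show "u' (x + y) = tplus (u' x) (u' y)" for x y by (simp add: u'_def e_add fadd e(1))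
    show "u' (r *\<^sub>R x) = tscale r (u' x)" for r x by (simp add: u'_def e_scale fscale e(1))
    fix x assume "u' x = tzero"
    then have "phi0 x y z = phi0 0 y z" for y z
      using tangent_functional_zero[OF form_functional(1)[OF definite_smooth[OF \<phi>'] u'T u'T], of y z] u'form[of x y z]
      by (simp add: phi0_expand)
    then show "x = 0" by (rule phi0_nondegenerate)
  qed
  \<comment> \<open>A field through \<open>u x\<close> may differ from the linear extension
    \<open>e x\<close> away from \<open>p\<close>. Testing its image against the images of all
    \<open>e y\<close> and \<open>e z\<close> shows that only the value at \<open>p\<close>
    matters.\<close>
  have "f X p = u' x" if X: "X \<in> vector_fields A" "X p = u x" for X x
  proof -
    obtain a where a: "f X p = u' a" using frame_surj[OF u'f vector_field_tangent[OF fin[OF X(1)]]] by blast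
    have "phi0 a y z = phi0 x y z" for y z
    proof -
      have "phi0 a y z = \<phi>' p (f X p) (f (e y) p) (f (e z) p)" unfolding a using u'form[of a y z] by (simp add: u'_def)
      also have "\<dots> = phi0 x y z" unfolding form[OF X(1) e(1) e(1)] X(2) e(2) by (rule G2_frameD(2)[OF u])
      finally show ?thesis .
    qed
    then have "a = x" by (rule phi0_nondegenerate)
    then show ?thesis using a by simp
  qed
  moreover have "u' \<in> G2_frames A \<phi>' p" using u'f u'form by (simp add: G2_frames_def)
  ultimately show ?thesis by blast
qed

lemma bundle_form_frame:
  assumes \<phi>: "\<phi> \<in> definite_forms A" and u: "u \<in> G2_frames A \<phi> p"
    and x: "x \<in> osections A" "eval_at p x = frame_eval u v" and y: "y \<in> osections A" "eval_at p y = frame_eval u w"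
  shows "bundle_form A (assoc_metric A \<phi>) x y p = 2 * (v \<bullet> w)"
  using x(2) y(2) assoc_metric_frame[OF \<phi> u, of "snd v" "snd w"]
  by (simp add: bundle_form_apply[OF assoc_metric_riemannian[OF \<phi>] x(1) y(1)] eval_at_def frame_eval_def inner_prod_def)

text \<open>The frames at \<open>p\<close> come in pairs, related by \<open>f\<close>. A section in
  the first frame and its image in the second have equal coordinates, so products and forms on both
  sides are the same expressions in the standard octonions.\<close>

lemma id_oplus_morphism:
  assumes \<phi>: "\<phi> \<in> definite_forms A" and \<phi>': "\<phi>' \<in> definite_forms A" and f: "f \<in> G2str_morphisms A \<phi> \<phi>'"
  shows "id_oplus A f \<in> octonion_morphisms (smooth_ring A) (G2_algebra A \<phi>) (G2_algebra A \<phi>')"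
  unfolding octonion_morphisms_iff[OF G2_octonion_algebra[OF \<phi>]]
proof (intro conjI ballI)
  have lin: "f \<in> linear_isos (smooth_ring A) (vector_field_module A) (vector_field_module A)"
    using f by (simp add: G2str_morphisms_def)
  have fin: "f X \<in> vector_fields A" if "X \<in> vector_fields A" for X using linear_isosD(1)[OF lin] that by simp
  have os: "snd x \<in> vector_fields A" if "x \<in> osections A" for x using that by (simp add: osections_iff)
  have app: "id_oplus A f x = (fst x, f (snd x))" if "x \<in> osections A" for x using that by (simp add: id_oplus_def)
  have in_os: "id_oplus A f x \<in> osections A" if "x \<in> osections A" for x
    using that fin by (simp add: app osections_iff)
  show "id_oplus A f \<in> linear_isos (smooth_ring A) (G2_algebra A \<phi>) (G2_algebra A \<phi>')"
  proof (rule linear_isosI)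
    show "id_oplus A f x \<in> carrier (G2_algebra A \<phi>')" if "x \<in> carrier (G2_algebra A \<phi>)" for x
      using in_os that by simp
    show "id_oplus A f \<in> extensional (carrier (G2_algebra A \<phi>))" by (simp add: id_oplus_def)
    show "id_oplus A f (x \<oplus>\<^bsub>G2_algebra A \<phi>\<^esub> y) = id_oplus A f x \<oplus>\<^bsub>G2_algebra A \<phi>'\<^esub> id_oplus A f y"
      if "x \<in> carrier (G2_algebra A \<phi>)" "y \<in> carrier (G2_algebra A \<phi>)" for x y
    proof -
      have xy: "x \<in> osections A" "y \<in> osections A" using that by simp_all
      have "x \<oplus>\<^bsub>G2_algebra A \<phi>\<^esub> y \<in> osections A"
        using osections_ops(1)[OF xy] by (simp add: G2_algebra_def)
      then show ?thesis using linear_isosD(3)[OF lin, of "snd x" "snd y"] xy os by (simp add: app)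
    qed
    show "id_oplus A f (r \<odot>\<^bsub>G2_algebra A \<phi>\<^esub> x) = r \<odot>\<^bsub>G2_algebra A \<phi>'\<^esub> id_oplus A f x"
      if "r \<in> carrier (smooth_ring A)" "x \<in> carrier (G2_algebra A \<phi>)" for r x
    proof -
      have rx: "r \<in> smooth_functions A" "x \<in> osections A" using that by simp_all
      have "r \<odot>\<^bsub>G2_algebra A \<phi>\<^esub> x \<in> osections A"
        using osections_ops(2)[OF rx] by (simp add: G2_algebra_def)
      then show ?thesis using linear_isosD(4)[OF lin, of r "snd x"] rx os by (simp add: app)
    qed
    show "inj_on (id_oplus A f) (carrier (G2_algebra A \<phi>))"
    proof (rule inj_onI)
      fix x y assume "x \<in> carrier (G2_algebra A \<phi>)" "y \<in> carrier (G2_algebra A \<phi>)" "id_oplus A f x = id_oplus A f y"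
      then show "x = y" using inj_onD[OF linear_isosD(5)[OF lin], of "snd x" "snd y"] os by (simp add: app prod_eq_iff)
    qed
    show "\<exists>x\<in>carrier (G2_algebra A \<phi>). id_oplus A f x = y" if y: "y \<in> carrier (G2_algebra A \<phi>')" for y
    proof -
      obtain X where X: "X \<in> vector_fields A" "f X = snd y"
        using linear_isosD(6)[OF lin, of "snd y"] y os by auto
      have "(fst y, X) \<in> osections A" using y X by (simp add: osections_iff)
      then show ?thesis using X by (intro bexI[of _ "(fst y, X)"]) (simp_all add: app)
    qed
  qed
  have "f (\<lambda>p. tscale 0 tzero) = (\<lambda>p. tscale 0 (f (\<lambda>p. tzero) p))"
    using linear_isosD(4)[OF lin, of "\<lambda>p. 0" "\<lambda>p. tzero"] by (simp add: smooth_functions_const vector_fields_zero)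
  then have "f (\<lambda>p. tzero) = (\<lambda>p. tzero)" by simp
  then show "id_oplus A f \<one>\<^bsub>G2_algebra A \<phi>\<^esub> = \<one>\<^bsub>G2_algebra A \<phi>'\<^esub>" by (simp add: app unit_osection)
  fix x y assume "x \<in> carrier (G2_algebra A \<phi>)" "y \<in> carrier (G2_algebra A \<phi>)"
  then have x: "x \<in> osections A" and y: "y \<in> osections A" by simp_all
  have fr: "\<exists>u u' v w. u \<in> G2_frames A \<phi> p \<and> u' \<in> G2_frames A \<phi>' p \<and> eval_at p x = frame_eval u v \<and> eval_at p y = frame_eval u w \<and>
      (\<forall>z\<in>osections A. \<forall>a. eval_at p z = frame_eval u a \<longrightarrow> eval_at p (id_oplus A f z) = frame_eval u' a)" for p
  proof -
    obtain u where u: "u \<in> G2_frames A \<phi> p" using ex_G2_frame[OF \<phi>] by blast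
    obtain u' where u': "u' \<in> G2_frames A \<phi>' p" "\<And>X x. X \<in> vector_fields A \<Longrightarrow> X p = u x \<Longrightarrow> f X p = u' x"
      using G2_morphism_frame[OF \<phi> \<phi>' f u] by blast
    obtain v where v: "eval_at p x = frame_eval u v" using eval_frame[OF G2_frameD(1)[OF u] x] by blast
    obtain w where w: "eval_at p y = frame_eval u w" using eval_frame[OF G2_frameD(1)[OF u] y] by blast
    have "eval_at p (id_oplus A f z) = frame_eval u' a" if "z \<in> osections A" "eval_at p z = frame_eval u a" for z a
      using that u'(2)[OF os[OF that(1)], of "snd a"] by (simp add: app eval_at_def frame_eval_def)
    then show ?thesis using u u'(1) v w by blast
  qed
  show "id_oplus A f (x \<otimes>\<^bsub>G2_algebra A \<phi>\<^esub> y) = id_oplus A f x \<otimes>\<^bsub>G2_algebra A \<phi>'\<^esub> id_oplus A f y"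
  proof (rule eval_eqI)
    fix p
    obtain u u' v w where u: "u \<in> G2_frames A \<phi> p" "u' \<in> G2_frames A \<phi>' p" "eval_at p x = frame_eval u v" "eval_at p y = frame_eval u w"
      and ev: "\<And>z a. z \<in> osections A \<Longrightarrow> eval_at p z = frame_eval u a \<Longrightarrow> eval_at p (id_oplus A f z) = frame_eval u' a"
      using fr by blast
    show "eval_at p (id_oplus A f (x \<otimes>\<^bsub>G2_algebra A \<phi>\<^esub> y)) = eval_at p (id_oplus A f x \<otimes>\<^bsub>G2_algebra A \<phi>'\<^esub> id_oplus A f y)"
      using ev[OF G2_mult_in[OF \<phi> x y] G2_mult_frame[OF \<phi> u(1) x u(3) y u(4)]]
        G2_mult_frame[OF \<phi>' u(2) in_os[OF x] ev[OF x u(3)] in_os[OF y] ev[OF y u(4)]]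
      by simp
  qed
  show "bform (G2_algebra A \<phi>') (id_oplus A f x) (id_oplus A f y) = bform (G2_algebra A \<phi>) x y"
  proof
    fix p
    obtain u u' v w where u: "u \<in> G2_frames A \<phi> p" "u' \<in> G2_frames A \<phi>' p" "eval_at p x = frame_eval u v" "eval_at p y = frame_eval u w"
      and ev: "\<And>z a. z \<in> osections A \<Longrightarrow> eval_at p z = frame_eval u a \<Longrightarrow> eval_at p (id_oplus A f z) = frame_eval u' a"
      using fr by blast
    show "bform (G2_algebra A \<phi>') (id_oplus A f x) (id_oplus A f y) p = bform (G2_algebra A \<phi>) x y p"
      using bundle_form_frame[OF \<phi> u(1) x u(3) y u(4)]
        bundle_form_frame[OF \<phi>' u(2) in_os[OF x] ev[OF x u(3)] in_os[OF y] ev[OF y u(4)]]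
      by simp
  qed
qed

lemma id_oplus_inj: "inj_on (id_oplus A) (G2str_morphisms A \<phi> \<phi>')"
proof (rule inj_onI)
  fix f h assume f: "f \<in> G2str_morphisms A \<phi> \<phi>'" and h: "h \<in> G2str_morphisms A \<phi> \<phi>'" and eq: "id_oplus A f = id_oplus A h"
  show "f = h"
  proof (rule extensionalityI)
    show "f \<in> extensional (vector_fields A)" "h \<in> extensional (vector_fields A)"
      using f h linear_isosD(2)[of _ "smooth_ring A" "vector_field_module A" "vector_field_module A"]
      by (auto simp: G2str_morphisms_def)
    fix X assume "X \<in> vector_fields A"
    then show "f X = h X" using fun_cong[OF eq, of "(\<lambda>p. 0, X)"] by (simp add: id_oplus_def im_osection)
  qed
qed

text \<open>An octonion morphism fixes the unit and preserves the bilinear form, hence preserves the orthogonal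
  complement \<open>\<Gamma>(TM)\<close> of the unit, on which the form is recovered from the product.\<close>

lemma id_oplus_surj:
  assumes \<phi>: "\<phi> \<in> definite_forms A" and \<phi>': "\<phi>' \<in> definite_forms A"
    and F: "F \<in> octonion_morphisms (smooth_ring A) (G2_algebra A \<phi>) (G2_algebra A \<phi>')"
  shows "\<exists>f\<in>G2str_morphisms A \<phi> \<phi>'. id_oplus A f = F"
proof -
  note F' = F[unfolded octonion_morphisms_iff[OF G2_octonion_algebra[OF \<phi>]]]
  have lin: "F \<in> linear_isos (smooth_ring A) (G2_algebra A \<phi>) (G2_algebra A \<phi>')" using F' by blast
  have mult: "F (G2_mult A \<phi> x y) = G2_mult A \<phi>' (F x) (F y)" if "x \<in> osections A" "y \<in> osections A" for x y
    using F' that by simp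
  have one: "F (\<lambda>p. 1, \<lambda>p. tzero) = (\<lambda>p. 1, \<lambda>p. tzero)" using F' by simp
  have form: "bundle_form A (assoc_metric A \<phi>') (F x) (F y) = bundle_form A (assoc_metric A \<phi>) x y"
    if "x \<in> osections A" "y \<in> osections A" for x y using F' that by simp
  have Fin: "F x \<in> osections A" if "x \<in> osections A" for x using linear_isosD(1)[OF lin, of x] that by simp
  have Fadd: "F (\<lambda>p. fst x p + fst y p, \<lambda>p. tplus (snd x p) (snd y p))
      = (\<lambda>p. fst (F x) p + fst (F y) p, \<lambda>p. tplus (snd (F x) p) (snd (F y) p))"
    if "x \<in> osections A" "y \<in> osections A" for x y using linear_isosD(3)[OF lin, of x y] that by simp
  have Fscale: "F (\<lambda>p. r p * fst x p, \<lambda>p. tscale (r p) (snd x p)) = (\<lambda>p. r p * fst (F x) p, \<lambda>p. tscale (r p) (snd (F x) p))"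
    if "r \<in> smooth_functions A" "x \<in> osections A" for r x using linear_isosD(4)[OF lin, of r x] that by simp
  define f where "f = (\<lambda>X\<in>vector_fields A. snd (F (\<lambda>p. 0, X)))"
  have F0: "F (\<lambda>p. 0, X) = (\<lambda>p. 0, f X)" if X: "X \<in> vector_fields A" for X
  proof -
    note i = im_osection[OF X]
    have z: "assoc_metric A \<psi> p v tzero = 0" if "\<psi> \<in> definite_forms A" "v \<in> tangent_space A p" for \<psi> p v
      by (rule tangent_functional_zero[OF metric_functional[OF assoc_metric_riemannian[OF that(1)] that(2)]])
    have "snd (F (\<lambda>p. 0, X)) p \<in> tangent_space A p" for p
      using Fin[OF i] by (simp add: osections_iff vector_field_tangent)
    then have "fst (F (\<lambda>p. 0, X)) p = 0" for p
      using fun_cong[OF form[OF i unit_osection], of p]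
      by (simp add: one bundle_form_apply[OF assoc_metric_riemannian[OF \<phi>]] bundle_form_apply[OF assoc_metric_riemannian[OF \<phi>']]
          i Fin unit_osection z \<phi> \<phi>' vector_field_tangent[OF X])
    then show ?thesis using X by (intro prod_eqI) (auto simp: f_def)
  qed
  have f_in: "f X \<in> vector_fields A" if "X \<in> vector_fields A" for X
    using Fin[OF im_osection[OF that]] F0[OF that] by (simp add: osections_iff)
  have split: "F x = (fst x, f (snd x))" if x: "x \<in> osections A" for x
  proof -
    have x': "fst x \<in> smooth_functions A" "snd x \<in> vector_fields A" using x by (auto simp: osections_iff)
    have 1: "F (fst x, \<lambda>p. tzero) = (fst x, \<lambda>p. tzero)"
      using Fscale[OF x'(1) unit_osection] by (simp add: one)
    have "(fst x, \<lambda>p. tzero) \<in> osections A" using x' by (simp add: osections_iff vector_fields_zero)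
    from Fadd[OF this im_osection[OF x'(2)]] show ?thesis by (simp add: 1 F0[OF x'(2)])
  qed
  have "f \<in> linear_isos (smooth_ring A) (vector_field_module A) (vector_field_module A)"
  proof (rule linear_isosI)
    show "f \<in> extensional (carrier (vector_field_module A))" by (simp add: f_def)
    show "f X \<in> carrier (vector_field_module A)" if "X \<in> carrier (vector_field_module A)" for X
      using f_in that by simp
    show "f (X \<oplus>\<^bsub>vector_field_module A\<^esub> Y) = f X \<oplus>\<^bsub>vector_field_module A\<^esub> f Y"
      if "X \<in> carrier (vector_field_module A)" "Y \<in> carrier (vector_field_module A)" for X Y
    proof -
      have XY: "X \<in> vector_fields A" "Y \<in> vector_fields A" using that by simp_all
      show ?thesis
        using Fadd[OF im_osection[OF XY(1)] im_osection[OF XY(2)]] F0[OF XY(1)] F0[OF XY(2)] F0[OF vector_fields_add[OF XY]]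
        by simp
    qed
    show "f (r \<odot>\<^bsub>vector_field_module A\<^esub> X) = r \<odot>\<^bsub>vector_field_module A\<^esub> f X"
      if "r \<in> carrier (smooth_ring A)" "X \<in> carrier (vector_field_module A)" for r X
    proof -
      have rX: "r \<in> smooth_functions A" "X \<in> vector_fields A" using that by simp_all
      show ?thesis
        using Fscale[OF rX(1) im_osection[OF rX(2)]] F0[OF rX(2)] F0[OF vector_fields_scale[OF rX]] by simp
    qed
    show "inj_on f (carrier (vector_field_module A))"
    proof (rule inj_onI)
      fix X Y assume "X \<in> carrier (vector_field_module A)" "Y \<in> carrier (vector_field_module A)" and eq: "f X = f Y"
      then have XY: "X \<in> vector_fields A" "Y \<in> vector_fields A" by simp_all
      have "F (\<lambda>p. 0, X) = F (\<lambda>p. 0, Y)" using F0 XY eq by simp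
      then have "(\<lambda>p :: 'a. 0 :: real, X) = (\<lambda>p. 0, Y)"
        by (rule inj_onD[OF linear_isosD(5)[OF lin]]) (simp_all add: im_osection XY)
      then show "X = Y" by simp
    qed
    show "\<exists>X\<in>carrier (vector_field_module A). f X = Y" if Y: "Y \<in> carrier (vector_field_module A)" for Y
    proof -
      obtain x where x: "x \<in> osections A" "F x = (\<lambda>p. 0, Y)"
        using linear_isosD(6)[OF lin, of "(\<lambda>p. 0, Y)"] im_osection[of Y] Y by auto
      then show ?thesis using split[OF x(1)] by (intro bexI[of _ "snd x"]) (auto simp: osections_iff)
    qed
  qed
  moreover have "(\<lambda>p. \<phi>' p (f X p) (f Y p) (f Z p)) = (\<lambda>p. \<phi> p (X p) (Y p) (Z p))"
    if X: "X \<in> vector_fields A" and Y: "Y \<in> vector_fields A" and Z: "Z \<in> vector_fields A" for X Y Z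
  proof -
    note i = im_osection[OF X] im_osection[OF Y] im_osection[OF Z]
    have "(\<lambda>p. 2 * \<phi>' p (f X p) (f Y p) (f Z p)) = (\<lambda>p. 2 * \<phi> p (X p) (Y p) (Z p))"
      using form[OF G2_mult_in[OF \<phi> i(1,2)] i(3)] mult[OF i(1,2)]
        form_from_algebra[OF \<phi> X Y Z] form_from_algebra[OF \<phi>' f_in[OF X] f_in[OF Y] f_in[OF Z]]
      by (simp add: F0 X Y Z)
    then show ?thesis by (simp add: fun_eq_iff)
  qed
  ultimately have "f \<in> G2str_morphisms A \<phi> \<phi>'" unfolding G2str_morphisms_iff by blast
  moreover have "id_oplus A f = F"
  proof (rule extensionalityI)
    show "id_oplus A f \<in> extensional (osections A)" by (simp add: id_oplus_def)
    show "F \<in> extensional (osections A)" using linear_isosD(2)[OF lin] by simp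
  qed (simp add: id_oplus_def split)
  ultimately show ?thesis by blast
qed

theorem G2_algebra_isomorphism:
  "isomorphism_of_categories (G2str A) (octbun A) (G2_algebra A) (\<lambda>\<phi> \<phi>' f. id_oplus A f)"
proof (rule isomorphism_of_categoriesI)
  show "is_functor (G2str A) (octbun A) (G2_algebra A) (\<lambda>\<phi> \<phi>' f. id_oplus A f)"
    unfolding is_functor_def G2str_simps octbun_simps(2-4)
  proof (intro conjI ballI G2str_category octbun_category G2_algebra_in_octbun id_oplus_morphism)
    show "id_oplus A (\<lambda>X\<in>vector_fields A. X) = (\<lambda>x\<in>carrier (G2_algebra A \<phi>). x)" for \<phi>
      by (rule extensionalityI[of _ "osections A"]) (auto simp: id_oplus_def osections_iff)
    show "id_oplus A (compose (vector_fields A) h f) = compose (carrier (G2_algebra A \<phi>)) (id_oplus A h) (id_oplus A f)"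
      if f: "f \<in> G2str_morphisms A \<phi> \<phi>'" for \<phi> \<phi>' f h
    proof (rule extensionalityI[of _ "osections A"])
      fix x assume x: "x \<in> osections A"
      have "f (snd x) \<in> vector_fields A"
        using f x linear_isosD(1)[of f "smooth_ring A" "vector_field_module A" "vector_field_module A" "snd x"]
        by (simp add: G2str_morphisms_def osections_iff)
      then show "id_oplus A (compose (vector_fields A) h f) x = compose (carrier (G2_algebra A \<phi>)) (id_oplus A h) (id_oplus A f) x"
        using x by (simp add: id_oplus_def compose_def osections_iff)
    qed (simp_all add: id_oplus_def compose_def)
  qed
  show "bij_betw (G2_algebra A) (Obj (G2str A)) (Obj (octbun A))"
    unfolding bij_betw_def G2str_simps using G2_algebra_inj G2_algebra_in_octbun G2_algebra_surj by blast
  show "bij_betw (id_oplus A) (Hom (G2str A) \<phi> \<phi>') (Hom (octbun A) (G2_algebra A \<phi>) (G2_algebra A \<phi>'))"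
    if "\<phi> \<in> Obj (G2str A)" "\<phi>' \<in> Obj (G2str A)" for \<phi> \<phi>'
    using that id_oplus_inj id_oplus_morphism id_oplus_surj
    unfolding bij_betw_def G2str_simps octbun_simps(2) by blast
qed

end

theorem proposition4p46:
  fixes A :: "('a::{t2_space, second_countable_topology}, 7) chart set"
    and g\<^sub>M :: "'a \<Rightarrow> ('a, 7) tangent \<Rightarrow> ('a, 7) tangent \<Rightarrow> real"
  assumes "smooth_atlas A"
    and "connected (UNIV :: 'a set)"
    and "riemannian_metric A g\<^sub>M"
  shows "isomorphism_of_categories (G2str A) (octbun A)
           (G2_algebra A) (\<lambda>\<phi> \<phi>' f. id_oplus A f)"
proof -
  interpret manifold7 A by unfold_locales (rule assms(1))
  show ?thesis by (rule G2_algebra_isomorphism)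
qed

end
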